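(* Let $d\in\mathbb{N}$ and let $\mathcal{T}$ be an (unparametrized) tree of level $d$ without leaves. Then there exist $n\in\mathbb{N}$ and a definable set $X\subset\mathbb{Q}_p^n$ of dimension $\le d$ such that $\mathrm{T}(X)\cong\mathcal{T}$ as trees.
   Context: Fix a prime $p$. $\Gamma=\mathbb{Z}$ is the value group of $\mathbb{Q}_p$ with $v(p)=1$; $\mathbb{N}=\{0,1,2,\dots\}$. "Definable" means first-order definable with parameters in the two-sorted structure with sorts $\mathbb{Q}_p$ (ring language) and $\Gamma$ (ordered group language) and the valuation $v\colon\mathbb{Q}_p\to\Gamma\cup\{\infty\}$; on $\mathbb{Q}_p^n$ this is the same as definable in the field language, and a subset of $\Gamma^m$ is definable iff it is definable in $(\Gamma,0,+,<)$. For $M\subset\Gamma^m$, a function $\ell\colon M\to\Gamma\cup\{\infty\}$ is linear if it is constant $\infty$, or takes values in $\Gamma$ and is of the form $\kappa\mapsto a_1\kappa_1+\dots+a_m\kappa_m+b$ with $a_i,b\in\mathbb{Q}$. Dimension: the dimension of a definable $X\subset\mathbb{Q}_p^n$ is the algebraic dimension of its Zariski closure in $\tilde{\mathbb{Q}}_p^n$, $\tilde{\mathbb{Q}}_p$ the algebraic closure of $\mathbb{Q}_p$ (the empty set counts as having dimension $\le d$ for every $d$). Trees: a tree is a rooted tree (a set of nodes with an is-child-of relation), possibly infinite, possibly empty; a leaf is a node without children; $\mathrm{depth}(v)$ is the distance of $v$ from the root; an edge is a pair (node, child). The product $\mathcal{T}_1\times\mathcal{T}_2$ is layerwise: its nodes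 of depth $\lambda$ are pairs of nodes of depth $\lambda$, with componentwise child relation. Attaching a non-empty tree $\mathcal{T}'$ to a node $v$ of $\mathcal{T}$ means taking the disjoint union and identifying the root of $\mathcal{T}'$ with $v$. For $X\subset\mathbb{Q}_p^n$, $\mathrm{T}(X)$ is the tree whose nodes are the balls $x+p^\lambda\mathbb{Z}_p^n\subset\mathbb{Z}_p^n$ ($\lambda\ge0$) meeting $X$, ordered by inclusion; equivalently, its nodes of depth $\lambda$ are the elements of the image of $X\cap\mathbb{Z}_p^n$ in $(\mathbb{Z}/p^\lambda\mathbb{Z})^n$. $\mathrm{T}(\mathbb{Z}_p)$ is the infinite tree in which each node has exactly $p$ children. Trees of level $d$. A parametrized tree is a map $\mathcal{T}\colon M\to\{\text{trees}\}$, $M\subset\Gamma^m$ definable. It is of level $d$ if it is (pointwise in $\kappa\in M$) isomorphic to one constructed from a level $d$ datum on $M$, as follows. Level $0$ datum on $M$: a finite, possibly empty, tree $\mathcal{S}$ (its nodes are called joints, its edges bones) and for each bone $e=(w,w')$ a linear function $\ell_e\colon M\to\Gamma_{>0}\cup\{\infty\}$ (the length), where $\infty$ is allowed only if $w'$ is a leaf of $\mathcal{S}$. A joint at the lower end of a bone of length $\infty$ is virtual, all others are real. The tree $\mathcal{T}(\kappa)$: take a copy of $\mathcal{S}$ without virtual joints, writing $w(\kappa)$ for the copy of $w$; for each bone $e=(w,w')$ insert $\ell_e(\kappa)-1$ nodes between $w(\kappa)$ and $w'(\kappa)$ (so as to get a path of length $\ell_e(\kappa)$) if $w'$ is real, and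 add an infinite path below $w(\kappa)$ if $w'$ is virtual; $e(\kappa)$ denotes the set of these new nodes. The depth of a joint $w$ is the function $\mathrm{depth}(w)\colon\kappa\mapsto\mathrm{depth}(w(\kappa))$ if $w$ is real, and constant $\infty$ if $w$ is virtual. Side branch datum of level $d$ on $M$: a non-empty finite tree $\mathcal{F}$ and for each leaf $w$ of $\mathcal{F}$ a level $d$ tree $\mathcal{T}_w\colon M\to\{\text{trees}\}$ with all $\mathcal{T}_w(\kappa)$ non-empty. The side branch $\mathcal{B}(\kappa)$ is $\mathcal{F}$ with $\mathrm{T}(\mathbb{Z}_p)\times\mathcal{T}_w(\kappa)$ attached to each leaf $w$. Level $d+1$ datum on $M$: an element $\rho\in\Gamma_{>0}$; a level $0$ datum $(\mathcal{S},(\ell_e))$ on $M$ such that for each bone $e$, $\ell_e(\kappa)\bmod\rho$ does not depend on $\kappa$, with corresponding tree $\mathcal{T}_0$ (the skeleton); for each real joint $w$ a side branch $\mathcal{B}_w$ of level $d$ on $M$ (given by a datum); for each bone $e=(w,w')$ and each class $\Xi\in\Gamma/\rho\Gamma$ a side branch $\mathcal{B}_{e,\Xi}$ of level $d$ on $N_{e,\Xi}=\{(\kappa,\lambda)\in M\times\Xi\mid\mathrm{depth}(w)(\kappa)<\lambda<\mathrm{depth}(w')(\kappa)\}$. The tree $\mathcal{T}(\kappa)$ is $\mathcal{T}_0(\kappa)$ with $\mathcal{B}_w(\kappa)$ attached to $w(\kappa)$ for each real joint $w$, and $\mathcal{B}_{e,\Xi}(\kappa,\mathrm{depth}(v))$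 attached to each $v\in e(\kappa)$ with $\mathrm{depth}(v)\in\Xi$. An unparametrized tree of level $d$ is the case where $M=\Gamma^0$ is a one-point set. *)

theory Defs
  imports
    "HOL-Library.Extended"
    "HOL-Computational_Algebra.Computational_Algebra"
    "HOL-Algebra.Algebraic_Closure_Type"
    "Berlekamp_Zassenhaus.Finite_Field"
begin

(* HOL-Algebra uses the letter X for the variable of a polynomial ring. *)
no_notation var (\<open>X\<index>\<close>)

section \<open>The field of p-adic numbers\<close>

text \<open>
  The prime is \<open>CARD('p)\<close> for a type \<open>'p\<close> of class \<open>prime_card\<close>; the p-adic integers are the
  inverse limit of the rings Z/p^n, a residue class mod p^n being represented by its
  least non-negative element.
\<close>

typedef (overloaded) 'p :: prime_card padic_int =
  "{f :: nat \<Rightarrow> int. \<forall>n. f n \<in> {0..<int CARD('p) ^ n} \<and> f (Suc n) mod int CARD('p) ^ n = f n}"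
  morphisms residue_of Abs_padic_int
proof -
  have "0 < CARD('p)"
    using prime_card[where 'a = 'p] by (simp add: prime_gt_0_nat)
  then show ?thesis
    by (intro exI[of _ "\<lambda>_. 0"]) simp
qed

setup_lifting type_definition_padic_int

lemma card_prime_pos: "0 < CARD('p :: prime_card)"
  using prime_card[where 'a = 'p] by (rule prime_gt_0_nat)

lemma padic_int_compat:
  fixes g :: "nat \<Rightarrow> int"
  assumes "\<And>n. g (Suc n) mod int CARD('p :: prime_card) ^ n = g n mod int CARD('p) ^ n"
  shows "g n mod int CARD('p) ^ n \<in> {0..<int CARD('p) ^ n} \<and>
    (g (Suc n) mod int CARD('p) ^ Suc n) mod int CARD('p) ^ n = g n mod int CARD('p) ^ n"
proof -
  have "(g (Suc n) mod int CARD('p) ^ Suc n) mod int CARD('p) ^ n = g (Suc n) mod int CARD('p) ^ n"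
    by (rule mod_mod_cancel) simp
  then show ?thesis
    using assms card_prime_pos[where 'p = 'p] by simp
qed

instantiation padic_int :: (prime_card) comm_ring_1
begin

lift_definition zero_padic_int :: "'a padic_int" is "\<lambda>_. 0"
  using card_prime_pos[where 'p = 'a] by simp

lift_definition one_padic_int :: "'a padic_int" is "\<lambda>n. 1 mod int CARD('a) ^ n"
  by (intro allI padic_int_compat) simp

lift_definition plus_padic_int :: "'a padic_int \<Rightarrow> 'a padic_int \<Rightarrow> 'a padic_int"
  is "\<lambda>f g n. (f n + g n) mod int CARD('a) ^ n"
  by (intro allI padic_int_compat, rule mod_add_cong) auto

lift_definition minus_padic_int :: "'a padic_int \<Rightarrow> 'a padic_int \<Rightarrow> 'a padic_int"
  is "\<lambda>f g n. (f n - g n) mod int CARD('a) ^ n"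
  by (intro allI padic_int_compat, rule mod_diff_cong) auto

lift_definition uminus_padic_int :: "'a padic_int \<Rightarrow> 'a padic_int"
  is "\<lambda>f n. (- f n) mod int CARD('a) ^ n"
  by (intro allI padic_int_compat, rule mod_minus_cong) auto

lift_definition times_padic_int :: "'a padic_int \<Rightarrow> 'a padic_int \<Rightarrow> 'a padic_int"
  is "\<lambda>f g n. (f n * g n) mod int CARD('a) ^ n"
  by (intro allI padic_int_compat, rule mod_mult_cong) auto

instance
proof
  fix a b c :: "'a padic_int"
  show "a * b * c = a * (b * c)"
    by transfer (auto simp: fun_eq_iff mod_simps mult.assoc)
  show "a * b = b * a"
    by transfer (auto simp: mult.commute)
  show "1 * a = a"
    by transfer (auto simp: fun_eq_iff mod_simps)
  show "a + b + c = a + (b + c)"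
    by transfer (auto simp: fun_eq_iff mod_simps add.assoc)
  show "a + b = b + a"
    by transfer (auto simp: add.commute)
  show "0 + a = a"
    by transfer (auto simp: fun_eq_iff)
  show "- a + a = 0"
    by transfer (auto simp: fun_eq_iff mod_simps)
  show "a - b = a + - b"
    by transfer (auto simp: fun_eq_iff mod_simps)
  show "(a + b) * c = a * c + b * c"
    by transfer (auto simp: fun_eq_iff mod_simps distrib_right)
  show "(0 :: 'a padic_int) \<noteq> 1"
  proof transfer
    have "1 < int CARD('a)"
      using prime_gt_1_nat[OF prime_card[where 'a = 'a]] by simp
    then show "(\<lambda>_. 0) \<noteq> (\<lambda>n. 1 mod int CARD('a) ^ n)"
      by (auto simp: fun_eq_iff intro!: exI[of _ 1])
  qed
qed

end

lemma residue_of_mod: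
  fixes a :: "'p :: prime_card padic_int"
  assumes "m \<le> n"
  shows "residue_of a n mod int CARD('p) ^ m = residue_of a m"
  using assms
proof (induction n rule: dec_induct)
  case base
  then show ?case using residue_of[of a] by auto
next
  case (step n)
  have "residue_of a (Suc n) mod int CARD('p) ^ m
      = (residue_of a (Suc n) mod int CARD('p) ^ n) mod int CARD('p) ^ m"
    using step.hyps by (simp add: mod_mod_cancel le_imp_power_dvd)
  also have "\<dots> = residue_of a m"
    using residue_of[of a] step.IH by auto
  finally show ?case .
qed

lemma prime_power_dvd_mult_int:
  fixes a b q :: int
  assumes "prime q" "q ^ (m + k) dvd a * b"
  shows "q ^ m dvd a \<or> q ^ k dvd b"
proof (rule ccontr)
  assume *: "\<not> (q ^ m dvd a \<or> q ^ k dvd b)"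
  then have nz: "a \<noteq> 0" "b \<noteq> 0" by auto
  have pe: "prime_elem q" using assms(1) by (rule prime_imp_prime_elem)
  have nu: "\<not> is_unit q" using pe by (rule prime_elem_not_unit)
  have "multiplicity q a < m" "multiplicity q b < k"
    using * nz nu by (auto simp: power_dvd_iff_le_multiplicity)
  moreover have "m + k \<le> multiplicity q (a * b)"
    using assms(2) nz nu by (simp add: power_dvd_iff_le_multiplicity)
  ultimately show False
    using nz pe by (simp add: prime_elem_multiplicity_mult_distrib)
qed

instance padic_int :: (prime_card) idom
proof
  fix a b :: "'a padic_int"
  assume nz: "a \<noteq> 0" "b \<noteq> 0"
  have ex: "\<exists>m. residue_of c m \<noteq> 0" if "c \<noteq> 0" for c :: "'a padic_int"
  proof (rule ccontr)
    assume "\<not> (\<exists>m. residue_of c m \<noteq> 0)"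
    then have "residue_of c = residue_of (0 :: 'a padic_int)"
      by (auto simp: zero_padic_int.rep_eq fun_eq_iff)
    then have "c = 0" by (simp only: residue_of_inject)
    with that show False by simp
  qed
  obtain m k where mk: "residue_of a m \<noteq> 0" "residue_of b k \<noteq> 0"
    using nz ex by metis
  have "\<not> int CARD('a) ^ m dvd residue_of a (m + k)"
    using residue_of_mod[of m "m + k" a] mk(1) by (simp add: dvd_eq_mod_eq_0)
  moreover have "\<not> int CARD('a) ^ k dvd residue_of b (m + k)"
    using residue_of_mod[of k "m + k" b] mk(2) by (simp add: dvd_eq_mod_eq_0)
  ultimately have "\<not> int CARD('a) ^ (m + k) dvd residue_of a (m + k) * residue_of b (m + k)"
    using prime_power_dvd_mult_int prime_card_int[where 'a = 'a] by blast
  then have "residue_of (a * b) (m + k) \<noteq> 0"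
    by (simp add: times_padic_int.rep_eq dvd_eq_mod_eq_0)
  then show "a * b \<noteq> 0"
    by (auto simp: zero_padic_int.rep_eq)
qed

type_synonym 'p padic = "'p padic_int fract"

definition padic_integers :: "'p :: prime_card padic set" where
  "padic_integers = range to_fract"

definition padic_val :: "'p :: prime_card padic \<Rightarrow> int extended" where
  "padic_val x = (if x = 0 then \<infinity> else
     Fin (THE k. \<exists>u. u dvd 1 \<and> x = of_nat CARD('p) powi k * to_fract u))"


section \<open>Definable sets\<close>

text \<open>
  Formulas of the two-sorted language. The valuation makes terms of the value group sort
  take values in \<open>\<Gamma> \<union> {\<infinity>}\<close>, but variables of that sort (free or bound) range over
  \<open>\<Gamma>\<close> only. The constructor \<open>Minf\<close> of \<^typ>\<open>int extended\<close> never occurs as a value.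
\<close>

datatype field_term =
    FVar nat
  | FZero
  | FOne
  | FAdd field_term field_term
  | FNeg field_term
  | FMult field_term field_term

datatype group_term =
    GVar nat
  | GZero
  | GAdd group_term group_term
  | GVal field_term

datatype form =
    FEq field_term field_term
  | GEq group_term group_term
  | GLess group_term group_term
  | Neg form
  | Conj form form
  | FEx nat form
  | GEx nat form

primrec eval_field :: "(nat \<Rightarrow> 'p :: prime_card padic) \<Rightarrow> field_term \<Rightarrow> 'p padic" where
  "eval_field a (FVar i) = a i"
| "eval_field a FZero = 0"
| "eval_field a FOne = 1"
| "eval_field a (FAdd s t) = eval_field a s + eval_field a t"
| "eval_field a (FNeg t) = - eval_field a t"
| "eval_field a (FMult s t) = eval_field a s * eval_field a t"

primrec eval_group ::
  "(nat \<Rightarrow> 'p :: prime_card padic) \<Rightarrow> (nat \<Rightarrow> int) \<Rightarrow> group_term \<Rightarrow> int extended" where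
  "eval_group a g (GVar i) = Fin (g i)"
| "eval_group a g GZero = 0"
| "eval_group a g (GAdd s t) = eval_group a g s + eval_group a g t"
| "eval_group a g (GVal t) = padic_val (eval_field a t)"

primrec sat :: "(nat \<Rightarrow> 'p :: prime_card padic) \<Rightarrow> (nat \<Rightarrow> int) \<Rightarrow> form \<Rightarrow> bool" where
  "sat a g (FEq s t) \<longleftrightarrow> eval_field a s = eval_field a t"
| "sat a g (GEq s t) \<longleftrightarrow> eval_group a g s = eval_group a g t"
| "sat a g (GLess s t) \<longleftrightarrow> eval_group a g s < eval_group a g t"
| "sat a g (Neg \<phi>) \<longleftrightarrow> \<not> sat a g \<phi>"
| "sat a g (Conj \<phi> \<psi>) \<longleftrightarrow> sat a g \<phi> \<and> sat a g \<psi>"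
| "sat a g (FEx i \<phi>) \<longleftrightarrow> (\<exists>x. sat (a(i := x)) g \<phi>)"
| "sat a g (GEx i \<phi>) \<longleftrightarrow> (\<exists>k. sat a (g(i := k)) \<phi>)"

text \<open>
  Points of Q_p^n and of \<open>\<Gamma>\<close>^m are lists of length n and m. In the next definition the free
  variables with index at least n resp. m are the parameters, with values \<open>a\<close> and \<open>g\<close>.
\<close>

definition definable :: "nat \<Rightarrow> nat \<Rightarrow> ('p :: prime_card padic list \<times> int list) set \<Rightarrow> bool" where
  "definable n m A \<longleftrightarrow> (\<exists>\<phi> a g. A = {(x, \<kappa>). length x = n \<and> length \<kappa> = m \<and>
     sat (\<lambda>i. if i < n then x ! i else a i) (\<lambda>i. if i < m then \<kappa> ! i else g i) \<phi>})"

definition definable_field :: "nat \<Rightarrow> 'p :: prime_card padic list set \<Rightarrow> bool" where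
  "definable_field n X \<longleftrightarrow> definable n 0 (X \<times> {[]})"

definition definable_group :: "'p :: prime_card itself \<Rightarrow> nat \<Rightarrow> int list set \<Rightarrow> bool" where
  "definable_group _ m M \<longleftrightarrow> definable 0 m ({[] :: 'p padic list} \<times> M)"


section \<open>Dimension\<close>

inductive_set polynomial_functions :: "nat \<Rightarrow> ('k :: comm_ring_1 list \<Rightarrow> 'k) set" for n where
  const: "(\<lambda>_. c) \<in> polynomial_functions n"
| coord: "i < n \<Longrightarrow> (\<lambda>x. x ! i) \<in> polynomial_functions n"
| add: "f \<in> polynomial_functions n \<Longrightarrow> g \<in> polynomial_functions n \<Longrightarrow>
    (\<lambda>x. f x + g x) \<in> polynomial_functions n"
| mult: "f \<in> polynomial_functions n \<Longrightarrow> g \<in> polynomial_functions n \<Longrightarrow>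
    (\<lambda>x. f x * g x) \<in> polynomial_functions n"

definition zariski_closed :: "nat \<Rightarrow> 'k :: field list set \<Rightarrow> bool" where
  "zariski_closed n V \<longleftrightarrow>
     (\<exists>P \<subseteq> polynomial_functions n. V = {x. length x = n \<and> (\<forall>f\<in>P. f x = 0)})"

definition zariski_irreducible :: "nat \<Rightarrow> 'k :: field list set \<Rightarrow> bool" where
  "zariski_irreducible n V \<longleftrightarrow> zariski_closed n V \<and> V \<noteq> {} \<and>
     (\<forall>A B. zariski_closed n A \<and> zariski_closed n B \<and> V = A \<union> B \<longrightarrow> V = A \<or> V = B)"

text \<open>The dimension of a closed set, as the supremum of the lengths of chains of irreducible closed
  subsets; the empty set contains no such chain.\<close>

definition alg_dim_le :: "nat \<Rightarrow> 'k :: field list set \<Rightarrow> nat \<Rightarrow> bool" where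
  "alg_dim_le n V d \<longleftrightarrow> (\<forall>k Z. (\<forall>i\<le>k. zariski_irreducible n (Z i) \<and> Z i \<subseteq> V) \<and>
     (\<forall>i<k. Z i \<subset> Z (Suc i)) \<longrightarrow> k \<le> d)"

definition dim_le :: "nat \<Rightarrow> 'p :: prime_card padic list set \<Rightarrow> nat \<Rightarrow> bool" where
  "dim_le n X d \<longleftrightarrow> alg_dim_le n (zariski_closed n hull (map to_ac ` X)) d"


section \<open>Trees\<close>

record 'a rtree =
  nodes :: "'a set"
  child_rel :: "('a \<times> 'a) set"

definition rooted_tree :: "'a rtree \<Rightarrow> bool" where
  "rooted_tree T \<longleftrightarrow> child_rel T \<subseteq> nodes T \<times> nodes T \<and>
     (nodes T = {} \<or>
      (\<exists>r\<in>nodes T. (\<forall>u. (u, r) \<notin> child_rel T) \<and>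
         (\<forall>v\<in>nodes T - {r}. \<exists>!u. (u, v) \<in> child_rel T) \<and>
         (\<forall>v\<in>nodes T. (r, v) \<in> (child_rel T)\<^sup>*)))"

definition tree_root :: "'a rtree \<Rightarrow> 'a" where
  "tree_root T = (THE r. r \<in> nodes T \<and> (\<forall>u. (u, r) \<notin> child_rel T))"

definition depth :: "'a rtree \<Rightarrow> 'a \<Rightarrow> nat" where
  "depth T v = (LEAST k. (tree_root T, v) \<in> child_rel T ^^ k)"

definition leaves :: "'a rtree \<Rightarrow> 'a set" where
  "leaves T = {v \<in> nodes T. \<forall>u. (v, u) \<notin> child_rel T}"

definition tree_iso :: "'a rtree \<Rightarrow> 'b rtree \<Rightarrow> bool"  (infix \<open>\<cong>\<^sub>T\<close> 50) where
  "T \<cong>\<^sub>T T' \<longleftrightarrow> (\<exists>f. bij_betw f (nodes T) (nodes T') \<and>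
     (\<forall>u\<in>nodes T. \<forall>v\<in>nodes T. (u, v) \<in> child_rel T \<longleftrightarrow> (f u, f v) \<in> child_rel T'))"

definition tree_prod :: "'a rtree \<Rightarrow> 'b rtree \<Rightarrow> ('a \<times> 'b) rtree" where
  "tree_prod T T' =
     \<lparr>nodes = {(u, u') \<in> nodes T \<times> nodes T'. depth T u = depth T' u'},
      child_rel = {((u, u'), (v, v')). u \<in> nodes T \<and> u' \<in> nodes T' \<and> depth T u = depth T' u' \<and>
        (u, v) \<in> child_rel T \<and> (u', v') \<in> child_rel T'}\<rparr>"

text \<open>Attach the non-empty tree \<open>A v\<close> to each node \<open>v \<in> W\<close> of \<open>T\<close>. The root of \<open>A v\<close> is identified
  with \<open>v\<close>, so only its other nodes are added.\<close>

definition attach :: "'a rtree \<Rightarrow> 'a set \<Rightarrow> ('a \<Rightarrow> 'b rtree) \<Rightarrow> ('a + 'a \<times> 'b) rtree" where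
  "attach T W A =
     (let pos = (\<lambda>v u. if u = tree_root (A v) then Inl v else Inr (v, u)) in
      \<lparr>nodes = Inl ` nodes T \<union> {pos v u | v u. v \<in> W \<and> u \<in> nodes (A v)},
       child_rel = {(Inl u, Inl v) | u v. (u, v) \<in> child_rel T} \<union>
         {(pos v u, pos v u') | v u u'. v \<in> W \<and> (u, u') \<in> child_rel (A v)}\<rparr>)"

text \<open>
  The tree T(X). A node is a ball together with its depth; the depth is determined by the ball
  except when n = 0.
\<close>

definition padic_ball :: "nat \<Rightarrow> 'p :: prime_card padic list \<Rightarrow> nat \<Rightarrow> 'p padic list set" where
  "padic_ball n x k = {y. length y = n \<and>
     (\<forall>i<n. \<exists>z\<in>padic_integers. y ! i = x ! i + of_nat CARD('p) ^ k * z)}"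

definition ball_tree ::
  "nat \<Rightarrow> 'p :: prime_card padic list set \<Rightarrow> (nat \<times> 'p padic list set) rtree" where
  "ball_tree n X =
     (let N = {(k, padic_ball n x k) | k x. length x = n \<and>
                padic_ball n x k \<subseteq> lists padic_integers \<and> padic_ball n x k \<inter> X \<noteq> {}} in
      \<lparr>nodes = N,
       child_rel = {((k, B), (k', B')). (k, B) \<in> N \<and> (k', B') \<in> N \<and> k' = Suc k \<and> B' \<subseteq> B}\<rparr>)"

definition zp_tree :: "'p :: prime_card itself \<Rightarrow> (nat \<times> 'p padic list set) rtree" where
  "zp_tree _ = ball_tree 1 {[x] | x. x \<in> padic_integers}"


section \<open>Trees of level d\<close>

definition linear_on :: "nat \<Rightarrow> int list set \<Rightarrow> (int list \<Rightarrow> int extended) \<Rightarrow> bool" where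
  "linear_on m M l \<longleftrightarrow> (\<forall>\<kappa>\<in>M. l \<kappa> = \<infinity>) \<or>
     (\<exists>(a :: nat \<Rightarrow> rat) b. \<forall>\<kappa>\<in>M. \<exists>k.
        l \<kappa> = Fin k \<and> of_int k = (\<Sum>i<m. a i * of_int (\<kappa> ! i)) + b)"

text \<open>The finite trees in the data have natural numbers as nodes, which is no loss up to
  isomorphism.\<close>

definition level0_datum ::
  "nat \<Rightarrow> int list set \<Rightarrow> nat rtree \<Rightarrow> (nat \<times> nat \<Rightarrow> int list \<Rightarrow> int extended) \<Rightarrow> bool" where
  "level0_datum m M S l \<longleftrightarrow> rooted_tree S \<and> finite (nodes S) \<and>
     (\<forall>e\<in>child_rel S. linear_on m M (l e) \<and> (\<forall>\<kappa>\<in>M. 0 < l e \<kappa>) \<and>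
        ((\<exists>\<kappa>\<in>M. l e \<kappa> = \<infinity>) \<longrightarrow> snd e \<in> leaves S))"

text \<open>In the following three definitions \<open>L\<close> gives the lengths of the bones at a fixed parameter.
  \<open>Inner e i\<close> is the node of \<open>e(\<kappa>)\<close> at distance i below the upper end of \<open>e\<close>.\<close>

datatype skel_node = Joint nat | Inner "nat \<times> nat" nat

definition real_joints :: "nat rtree \<Rightarrow> (nat \<times> nat \<Rightarrow> int extended) \<Rightarrow> nat set" where
  "real_joints S L = {w \<in> nodes S. \<forall>u. (u, w) \<in> child_rel S \<longrightarrow> L (u, w) \<noteq> \<infinity>}"

definition skeleton :: "nat rtree \<Rightarrow> (nat \<times> nat \<Rightarrow> int extended) \<Rightarrow> skel_node rtree" where
  "skeleton S L =
     (let pos = (\<lambda>e i. if i = 0 then Joint (fst e)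
                       else if Fin (int i) = L e then Joint (snd e) else Inner e i) in
      \<lparr>nodes = Joint ` real_joints S L \<union>
         {Inner e i | e i. e \<in> child_rel S \<and> 0 < i \<and> Fin (int i) < L e},
       child_rel = {(pos e i, pos e (Suc i)) | e i. e \<in> child_rel S \<and> Fin (int i) < L e}\<rparr>)"

definition joint_depth :: "nat rtree \<Rightarrow> (nat \<times> nat \<Rightarrow> int extended) \<Rightarrow> nat \<Rightarrow> int extended" where
  "joint_depth S L w =
     (if w \<in> real_joints S L then Fin (int (depth (skeleton S L) (Joint w))) else \<infinity>)"

text \<open>The set \<open>N\<^bsub>e,\<Xi>\<^esub>\<close> for the bone \<open>e = (w, w')\<close> and the class \<open>\<Xi>\<close> of \<open>\<xi>\<close>; the pair
  \<open>(\<kappa>, \<mu>)\<close> becomes \<open>\<kappa> @ [\<mu>]\<close>.\<close>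

definition bone_params :: "int list set \<Rightarrow> int \<Rightarrow> nat rtree \<Rightarrow>
    (nat \<times> nat \<Rightarrow> int list \<Rightarrow> int extended) \<Rightarrow> nat \<times> nat \<Rightarrow> int \<Rightarrow> int list set" where
  "bone_params M \<rho> S l e \<xi> = {\<kappa> @ [\<mu>] | \<kappa> \<mu>. \<kappa> \<in> M \<and> \<mu> mod \<rho> = \<xi> \<and>
     joint_depth S (\<lambda>e. l e \<kappa>) (fst e) < Fin \<mu> \<and> Fin \<mu> < joint_depth S (\<lambda>e. l e \<kappa>) (snd e)}"

text \<open>A side branch datum on \<open>M\<close> consists of \<open>F\<close> and the family \<open>U\<close> of trees at its leaves.
  \<open>Lev\<close> stands for ``is a tree of level d on \<open>M\<close>''.\<close>

definition side_branch_datum :: "int list set \<Rightarrow> ((int list \<Rightarrow> nat rtree) \<Rightarrow> bool) \<Rightarrow>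
    nat rtree \<Rightarrow> (nat \<Rightarrow> int list \<Rightarrow> nat rtree) \<Rightarrow> bool" where
  "side_branch_datum M Lev F U \<longleftrightarrow> rooted_tree F \<and> finite (nodes F) \<and> nodes F \<noteq> {} \<and>
     (\<forall>w\<in>leaves F. Lev (U w) \<and> (\<forall>\<kappa>\<in>M. nodes (U w \<kappa>) \<noteq> {}))"

type_synonym 'p branch_node = "nat + nat \<times> ((nat \<times> 'p padic list set) \<times> nat)"

definition side_branch :: "'p :: prime_card itself \<Rightarrow> nat rtree \<Rightarrow>
    (nat \<Rightarrow> int list \<Rightarrow> nat rtree) \<Rightarrow> int list \<Rightarrow> 'p branch_node rtree" where
  "side_branch P F U \<kappa> = attach F (leaves F) (\<lambda>w. tree_prod (zp_tree P) (U w \<kappa>))"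

text \<open>The tree of a datum of level d + 1 at \<open>\<kappa>\<close>: \<open>B w\<close> is the side branch at the real joint \<open>w\<close> and
  \<open>C e \<xi>\<close> the one at the bone \<open>e\<close> and the class of \<open>\<xi>\<close>.\<close>

definition branched_tree :: "int \<Rightarrow> nat rtree \<Rightarrow> (nat \<times> nat \<Rightarrow> int list \<Rightarrow> int extended) \<Rightarrow>
    (nat \<Rightarrow> int list \<Rightarrow> 'b rtree) \<Rightarrow> (nat \<times> nat \<Rightarrow> int \<Rightarrow> int list \<Rightarrow> 'b rtree) \<Rightarrow> int list \<Rightarrow>
    (skel_node + skel_node \<times> 'b) rtree" where
  "branched_tree \<rho> S l B C \<kappa> =
     (let T0 = skeleton S (\<lambda>e. l e \<kappa>) in
      attach T0 (nodes T0) (\<lambda>v. case v of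
         Joint w \<Rightarrow> B w \<kappa>
       | Inner e i \<Rightarrow> (let \<mu> = int (depth T0 v) in C e (\<mu> mod \<rho>) (\<kappa> @ [\<mu>]))))"

text \<open>
  \<open>level_on P d m M T\<close>: the parametrized tree \<open>T\<close> on \<open>M \<subseteq> \<Gamma>\<close>^m is of level d. All trees built from
  data are countable, so natural numbers suffice as nodes. Which joints are real does not depend
  on \<open>\<kappa> \<in> M\<close>.
\<close>

primrec level_on :: "'p :: prime_card itself \<Rightarrow> nat \<Rightarrow> nat \<Rightarrow> int list set \<Rightarrow>
    (int list \<Rightarrow> nat rtree) \<Rightarrow> bool" where
  "level_on P 0 m M T \<longleftrightarrow>
     definable_group P m M \<and> (\<forall>\<kappa>\<in>M. rooted_tree (T \<kappa>)) \<and>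
     (\<exists>S l. level0_datum m M S l \<and> (\<forall>\<kappa>\<in>M. T \<kappa> \<cong>\<^sub>T skeleton S (\<lambda>e. l e \<kappa>)))"
| "level_on P (Suc d) m M T \<longleftrightarrow>
     definable_group P m M \<and> (\<forall>\<kappa>\<in>M. rooted_tree (T \<kappa>)) \<and>
     (\<exists>\<rho> S l F U G V.
        \<rho> > 0 \<and> level0_datum m M S l \<and>
        (\<forall>e\<in>child_rel S. \<forall>\<kappa>\<in>M. \<forall>\<kappa>'\<in>M. \<forall>k k'.
           l e \<kappa> = Fin k \<and> l e \<kappa>' = Fin k' \<longrightarrow> k mod \<rho> = k' mod \<rho>) \<and>
        (\<forall>w\<in>(\<Union>\<kappa>\<in>M. real_joints S (\<lambda>e. l e \<kappa>)).
           side_branch_datum M (level_on P d m M) (F w) (U w)) \<and>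
        (\<forall>e\<in>child_rel S. \<forall>\<xi>\<in>{0..<\<rho>}.
           side_branch_datum (bone_params M \<rho> S l e \<xi>)
             (level_on P d (Suc m) (bone_params M \<rho> S l e \<xi>)) (G e \<xi>) (V e \<xi>)) \<and>
        (\<forall>\<kappa>\<in>M. T \<kappa> \<cong>\<^sub>T branched_tree \<rho> S l
           (\<lambda>w. side_branch P (F w) (U w)) (\<lambda>e \<xi>. side_branch P (G e \<xi>) (V e \<xi>)) \<kappa>))"

text \<open>Unparametrized trees: \<open>M = \<Gamma>\<close>^0 is the one-point set containing the empty tuple.\<close>

definition tree_of_level :: "'p :: prime_card itself \<Rightarrow> nat \<Rightarrow> 'a rtree \<Rightarrow> bool" where
  "tree_of_level P d T \<longleftrightarrow> rooted_tree T \<and> (\<exists>T'. level_on P d 0 {[]} T' \<and> T \<cong>\<^sub>T T' [])"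

end

theory Submission
  imports Defs "HOL-Number_Theory.Residues" "HOL-Number_Theory.Modular_Inverse"
begin

text \<open>
  A tree without leaves is determined by its rays. If each ray is approximated by rays attached to
  points of \<open>X\<close>, and two points of \<open>X\<close> agree mod \<open>p ^ j\<close> iff their rays agree up to depth \<open>j\<close>, then
  \<open>T(X)\<close> is the tree. Such sets are built by induction on the level. The choice of a joint or a
  bone of the skeleton is recorded by finitely many coordinates, namely elements whose valuations
  are the depths where the choices are made. The depth \<open>\<lambda>\<close> at which a ray leaves the skeleton is
  carried by one field element \<open>s\<close>, whose valuation gives \<open>\<lambda>\<close>. The points of the side branch are
  scaled by a monomial in \<open>s\<close> of valuation \<open>\<lambda>\<close>. At the same time the unit part of \<open>s\<close> provides the
  position in the factor \<open>T(Z_p)\<close> of the side branch, so a level costs one parameter only.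

  Linear functions of the parameters have to be valuations of monomials with integral exponents in
  the elements that carry them. Therefore the residues of \<open>\<lambda>\<close> modulo a multiple of \<open>q\<close> are treated
  separately, where \<open>q\<close> is a common multiple of all denominators and moduli that occur in the datum.
  In the end \<open>X\<close> is a finite union of images of definable subsets of \<open>Q_p\<close>^d under piecewise
  rational maps. Hence it is definable, and no chain of irreducible closed subsets of its Zariski
  closure has length more than \<open>d\<close>: such a chain yields as many algebraically independent
  polynomial functions, which pull back to rational functions of \<open>d\<close> variables.
\<close>

section \<open>The p-adic valuation\<close>

text \<open>A length may involve \<kappa> / q, which is no integral multiple of the valuation of an
  element of valuation \<kappa>. Hence \<kappa> is carried by an element s of valuation \<phi> *
  (\<kappa> div h), where h = q * \<phi>: then p^(\<kappa> mod h) * s^q has valuation \<kappa>, and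
  monomials in s reach the fractional lengths up to a power of p that depends only on the class mod
  h. The price is the q-th power map: on 1 + p^q Z_p it shifts distances by exactly v(q), and its
  values lie in 1 + p^K Z_p with K = q + v(q). So nearness of carriers is measured on q-th powers,
  and a digit c with finitely many values supplies the part of a position that the unit part of s^q
  cannot reach. The number \<phi> is the order of the unit group mod p^q: an element that is a
  \<phi>-th power up to 1 + p^q Z_p has a prescribed unit part mod p^q, and this condition is
  definable. As \<kappa> has many carriers, the inductive claim must compare points over two close
  carriers. The dimension bound is a count: (N + 1)^(d+1) monomials in d + 1 polynomial functions
  against O(N^d) linear conditions coming from d parameters.\<close>

lemma padic_int_eqI: "(\<And>n. residue_of a n = residue_of b n) \<Longrightarrow> a = b"
  by (metis ext residue_of_inject)

lemma residue_of_range: "0 \<le> residue_of a n" "residue_of (a :: 'p :: prime_card padic_int) n < int CARD('p) ^ n"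
  using residue_of[of a] by auto

lemma residue_of_0 [simp]: "residue_of (a :: 'p :: prime_card padic_int) 0 = 0"
  using residue_of[of a] by (auto dest!: spec[of _ 0])

lemma residue_of_nat:
  "residue_of (of_nat k :: 'p :: prime_card padic_int) n = int k mod int CARD('p) ^ n"
  by (induction k) (simp_all add: zero_padic_int.rep_eq one_padic_int.rep_eq plus_padic_int.rep_eq mod_simps)

lemma residue_of_diff:
  "residue_of (a - b :: 'p :: prime_card padic_int) n = (residue_of a n - residue_of b n) mod int CARD('p) ^ n"
  by (simp add: minus_padic_int.rep_eq)

text \<open>Compatibility is only required mod p^n, so residues computed level by level, such as
  inverses or quotients, glue without being normalised first.\<close>

lemma padic_int_ex:
  fixes g :: "nat \<Rightarrow> int"
  assumes "\<And>n. [g (Suc n) = g n] (mod int CARD('p) ^ n)"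
  obtains a :: "'p :: prime_card padic_int" where "\<And>n. residue_of a n = g n mod int CARD('p) ^ n"
proof
  fix n
  have "residue_of (Abs_padic_int (\<lambda>n. g n mod int CARD('p) ^ n) :: 'p padic_int) = (\<lambda>n. g n mod int CARD('p) ^ n)"
    by (rule Abs_padic_int_inverse, rule CollectI, intro allI padic_int_compat)
       (use assms in \<open>simp add: Cong.cong_def\<close>)
  then show "residue_of (Abs_padic_int (\<lambda>n. g n mod int CARD('p) ^ n) :: 'p padic_int) n = g n mod int CARD('p) ^ n"
    by simp
qed

lemma residue_of_cong:
  assumes "m \<le> n"
  shows "[residue_of (a :: 'p :: prime_card padic_int) n = residue_of a m] (mod int CARD('p) ^ m)"
  using residue_of_mod[OF assms, of a] residue_of_range[of a m] by (simp add: Cong.cong_def)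

text \<open>With nonzero first residue the element is coprime to p at every level; inverses mod p^n
  are unique, hence coherent, and glue to an inverse.\<close>

lemma padic_int_unit:
  fixes a :: "'p :: prime_card padic_int"
  assumes "residue_of a 1 \<noteq> 0"
  shows "a dvd 1"
proof -
  let ?q = "int CARD('p)"
  have cop: "coprime (residue_of a n) (?q ^ n)" for n
  proof (cases "n = 0")
    case False
    have "\<not> ?q dvd residue_of a n"
      using residue_of_mod[of 1 n a] assms False by (auto simp: dvd_eq_mod_eq_0)
    then have "coprime (residue_of a n) ?q"
      using prime_card_int[where 'a = 'p] by (metis coprime_commute prime_imp_coprime)
    then show ?thesis by simp
  qed simp
  define g where "g n = modular_inverse (?q ^ n) (residue_of a n)" for n
  have g: "[residue_of a n * g n = 1] (mod ?q ^ n)" for n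
    unfolding g_def by (rule cong_modular_inverse1[OF cop])
  have "[g (Suc n) = g n] (mod ?q ^ n)" for n
  proof -
    have "[residue_of a (Suc n) * g (Suc n) = 1] (mod ?q ^ n)"
      using g[of "Suc n"] by (rule cong_dvd_modulus) simp
    moreover have "[residue_of a (Suc n) * g (Suc n) = residue_of a n * g (Suc n)] (mod ?q ^ n)"
      by (rule cong_scalar_right, rule residue_of_cong) simp
    ultimately have "[residue_of a n * g (Suc n) = residue_of a n * g n] (mod ?q ^ n)"
      using g[of n] by (metis cong_sym cong_trans)
    then show ?thesis
      using cop[of n] by (simp add: cong_mult_lcancel)
  qed
  then obtain b :: "'p padic_int" where b: "\<And>n. residue_of b n = g n mod ?q ^ n"
    using padic_int_ex by blast
  have "a * b = 1"
    using g by (intro padic_int_eqI) (simp add: times_padic_int.rep_eq one_padic_int.rep_eq b mod_simps Cong.cong_def)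
  then show ?thesis by (metis dvd_triv_left)
qed

lemma padic_int_dvd_power:
  fixes a :: "'p :: prime_card padic_int"
  assumes "residue_of a k = 0"
  shows "of_nat CARD('p) ^ k dvd a"
proof -
  let ?q = "int CARD('p)"
  have q0: "?q > 0" using card_prime_pos[where 'p='p] by simp
  have dv: "?q ^ k dvd residue_of a (n + k)" for n
    using residue_of_mod[of k "n + k" a] assms by (simp add: dvd_eq_mod_eq_0)
  \<comment> \<open>Dividing by p^k costs k digits, so the n-th residue of the quotient is read off
    at level n + k.\<close>
  define g where "g n = residue_of a (n + k) div ?q ^ k" for n
  have g: "residue_of a (n + k) = ?q ^ k * g n" for n
    using dv[of n] by (simp add: g_def)
  have "[g (Suc n) = g n] (mod ?q ^ n)" for n
  proof -
    have "[?q ^ k * g (Suc n) = ?q ^ k * g n] (mod ?q ^ (n + k))"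
      unfolding g[symmetric] by (rule residue_of_cong) simp
    then have "?q ^ k * ?q ^ n dvd ?q ^ k * (g (Suc n) - g n)"
      by (simp add: cong_iff_dvd_diff power_add algebra_simps)
    then show ?thesis using q0 by (simp add: cong_iff_dvd_diff)
  qed
  then obtain b :: "'p padic_int" where b: "\<And>n. residue_of b n = g n mod ?q ^ n"
    using padic_int_ex by blast
  have "a = of_nat CARD('p) ^ k * b"
  proof (rule padic_int_eqI)
    fix n
    have "residue_of a n = residue_of a (n + k) mod ?q ^ n"
      using residue_of_mod[of n "n + k" a] by simp
    also have "\<dots> = ?q ^ k * g n mod ?q ^ n" by (simp add: g)
    also have "\<dots> = residue_of (of_nat CARD('p) ^ k * b) n"
      using residue_of_nat[of "CARD('p) ^ k" n, where 'p='p]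
      by (simp add: times_padic_int.rep_eq b mod_simps)
    finally show "residue_of a n = residue_of (of_nat CARD('p) ^ k * b) n" .
  qed
  then show ?thesis by simp
qed

lemma padic_int_unit_residue:
  fixes u :: "'p :: prime_card padic_int"
  assumes "u dvd 1"
  shows "residue_of u 1 \<noteq> 0"
proof
  assume 0: "residue_of u 1 = 0"
  obtain v where v: "1 = u * v" using assms by (rule dvdE)
  have "residue_of (1 :: 'p padic_int) 1 = 0"
    unfolding v times_padic_int.rep_eq 0 by simp
  then show False
    using prime_gt_1_nat[OF prime_card[where 'a = 'p]] by (simp add: one_padic_int.rep_eq)
qed

lemma padic_int_decomp:
  fixes a :: "'p :: prime_card padic_int"
  assumes "a \<noteq> 0"
  obtains k u where "u dvd 1" "a = of_nat CARD('p) ^ k * u"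
proof -
  have "\<exists>n. residue_of a n \<noteq> 0"
    using assms padic_int_eqI[of a 0] by (auto simp: zero_padic_int.rep_eq)
  \<comment> \<open>The residue at level 0 is always 0, so n = k + 1, and k is the valuation; a
    cofactor divisible by p would make the residue at n vanish too.\<close>
  define n where "n = (LEAST n. residue_of a n \<noteq> 0)"
  have n: "residue_of a n \<noteq> 0" "\<And>m. m < n \<Longrightarrow> residue_of a m = 0"
    unfolding n_def using LeastI_ex[OF \<open>\<exists>n. _\<close>] not_less_Least by auto
  then obtain k where k: "n = Suc k" by (cases n) auto
  obtain u where u: "a = of_nat CARD('p) ^ k * u"
    using padic_int_dvd_power[of a k] n(2) k by auto
  have "u dvd 1"
  proof (rule padic_int_unit, rule notI)
    assume "residue_of u 1 = 0"
    then have "of_nat CARD('p) ^ 1 dvd u" by (rule padic_int_dvd_power)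
    then obtain w where "u = of_nat CARD('p) * w" by auto
    then have "a = of_nat (CARD('p) ^ n) * w" using u k by simp
    then have "residue_of a n = 0"
      by (simp only: times_padic_int.rep_eq residue_of_nat) simp
    with n(1) show False by simp
  qed
  with u that show ?thesis by blast
qed

section \<open>The valuation on the fraction field\<close>

lemma p_padic_nonzero [simp]: "(of_nat CARD('p) :: 'p :: prime_card padic) \<noteq> 0"
proof -
  have "to_fract (of_nat n) = (of_nat n :: 'p padic)" for n
    by (induction n) auto
  moreover have "(of_nat CARD('p) :: 'p padic_int) \<noteq> 0"
  proof
    \<comment> \<open>Level 2 is the first at which the residue of p is nonzero.\<close>
    assume "(of_nat CARD('p) :: 'p padic_int) = 0"
    then have "residue_of (of_nat CARD('p) :: 'p padic_int) 2 = 0"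
      by (simp add: zero_padic_int.rep_eq)
    then have "int CARD('p) * int CARD('p) dvd int CARD('p) * 1"
      by (simp add: residue_of_nat dvd_eq_mod_eq_0 power2_eq_square)
    then have "int CARD('p) dvd 1"
      using card_prime_pos[where 'p = 'p] by (subst (asm) dvd_mult_cancel_left) auto
    then show False
      using prime_gt_1_nat[OF prime_card[where 'a = 'p]] by simp
  qed
  ultimately show ?thesis by (metis to_fract_eq_0_iff)
qed

lemma to_fract_of_nat: "to_fract (of_nat n :: 'a :: idom) = of_nat n"
  by (induction n) auto

lemma to_fract_power: "to_fract (x ^ n) = to_fract x ^ n"
  by (induction n) auto

lemma padic_decomp:
  fixes x :: "'p :: prime_card padic"
  assumes "x \<noteq> 0"
  obtains k u where "u dvd 1" "x = of_nat CARD('p) powi k * to_fract u"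
proof -
  obtain a b where ab: "x = to_fract a / to_fract b" "b \<noteq> 0"
    by (cases x) (auto simp: Fract_conv_to_fract)
  with assms have "a \<noteq> 0" by auto
  obtain k u where u: "u dvd 1" "a = of_nat CARD('p) ^ k * u" by (rule padic_int_decomp[OF \<open>a \<noteq> 0\<close>])
  obtain l v where v: "v dvd 1" "b = of_nat CARD('p) ^ l * v" by (rule padic_int_decomp[OF \<open>b \<noteq> 0\<close>])
  obtain v' where v': "1 = v * v'" using v(1) by auto
  then have v1: "to_fract v * to_fract v' = 1"
    by (metis to_fract_1 to_fract_mult)
  have "x = of_nat CARD('p) powi (int k - int l) * to_fract (u * v')"
    using v1 \<open>b \<noteq> 0\<close> unfolding ab(1) u(2) v(2)
    by (simp add: to_fract_power to_fract_of_nat power_int_diff field_simps)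
  moreover have "u * v' dvd 1"
    using u(1) v' by (metis dvd_triv_right is_unit_mult_iff)
  ultimately show ?thesis using that by blast
qed

text \<open>Needed because \<open>padic_val\<close> is a definite description: two exponents k < l
  would give u = p^m v with m > 0, against the nonzero first residue of a unit.\<close>

lemma padic_val_eqI:
  assumes "u dvd 1" "x = of_nat CARD('p :: prime_card) powi k * to_fract u"
  shows "padic_val (x :: 'p padic) = Fin k"
proof -
  have unit_nz: "to_fract u \<noteq> 0" if "u dvd 1" for u :: "'p padic_int"
    using that by auto
  have le: False if "u dvd 1" "v dvd 1" "k < l"
    "of_nat CARD('p) powi k * to_fract u = of_nat CARD('p) powi l * (to_fract v :: 'p padic)" for k l u v
  proof -
    define m where "m = nat (l - k)"
    have l: "l = k + int m" and "m \<noteq> 0" using that(3) by (auto simp: m_def)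
    have "to_fract u = of_nat CARD('p) ^ m * (to_fract v :: 'p padic)"
      using that(4) unfolding l by (simp add: power_int_add)
    then have "u = of_nat CARD('p) ^ m * v"
      by (metis to_fract_eq_iff to_fract_mult to_fract_of_nat to_fract_power)
    moreover have "residue_of (of_nat CARD('p) ^ m :: 'p padic_int) 1 = 0"
      using residue_of_nat[of "CARD('p) ^ m" 1, where 'p='p] \<open>m \<noteq> 0\<close> by (cases m) auto
    ultimately have "residue_of u 1 = 0"
      by (simp add: times_padic_int.rep_eq)
    with padic_int_unit_residue[OF that(1)] show False by simp
  qed
  have "x \<noteq> 0" using assms unit_nz by simp
  moreover have "(THE k. \<exists>u. u dvd 1 \<and> x = of_nat CARD('p) powi k * to_fract u) = k"
  proof (rule the_equality)
    show "\<exists>u. u dvd 1 \<and> x = of_nat CARD('p) powi k * to_fract u" using assms by blast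
    fix l assume "\<exists>u. u dvd 1 \<and> x = of_nat CARD('p) powi l * to_fract u"
    then show "l = k" using le assms by (metis linorder_neqE)
  qed
  ultimately show ?thesis by (simp add: padic_val_def)
qed

text \<open>The integer-valued form of the valuation, with the default \<open>pval 0 = 0\<close>;
  hence 0 is split off wherever valuations are compared.\<close>

definition pval :: "'p :: prime_card padic \<Rightarrow> int" where
  "pval x = (case padic_val x of Fin k \<Rightarrow> k | _ \<Rightarrow> 0)"

text \<open>The fractional ideal p^k Z_p, also for negative k. Membership of a difference serves as
  congruence mod p^k throughout.\<close>

definition pball :: "int \<Rightarrow> 'p :: prime_card padic set" where
  "pball k = {of_nat CARD('p) powi k * z | z. z \<in> padic_integers}"

lemma padic_val_0 [simp]: "padic_val 0 = \<infinity>"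
  by (simp add: padic_val_def)

lemma padic_val_nonzero:
  fixes x :: "'p :: prime_card padic"
  assumes "x \<noteq> 0"
  shows "padic_val x = Fin (pval x)"
proof -
  obtain k u where "u dvd 1" "x = of_nat CARD('p) powi k * to_fract u" by (rule padic_decomp[OF assms])
  then have "padic_val x = Fin k" by (rule padic_val_eqI)
  then show ?thesis by (simp add: pval_def)
qed

lemma pval_decomp:
  fixes x :: "'p :: prime_card padic"
  assumes "x \<noteq> 0"
  obtains u where "u dvd 1" "x = of_nat CARD('p) powi pval x * to_fract u"
proof -
  obtain k u where ku: "u dvd 1" "x = of_nat CARD('p) powi k * to_fract u" by (rule padic_decomp[OF assms])
  then have "padic_val x = Fin k" by (rule padic_val_eqI)
  then have "pval x = k" by (simp add: pval_def)
  with ku that show ?thesis by simp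
qed

lemma pval_eqI:
  assumes "u dvd 1" "x = of_nat CARD('p :: prime_card) powi k * to_fract u"
  shows "pval (x :: 'p padic) = k"
  using padic_val_eqI[OF assms] by (simp add: pval_def)

lemma padic_integers_closed:
  "x \<in> padic_integers \<Longrightarrow> y \<in> padic_integers \<Longrightarrow> x + y \<in> padic_integers"
  "x \<in> padic_integers \<Longrightarrow> y \<in> padic_integers \<Longrightarrow> x * y \<in> padic_integers"
  "x \<in> padic_integers \<Longrightarrow> - x \<in> padic_integers"
  unfolding padic_integers_def
  by (auto simp flip: to_fract_add to_fract_mult to_fract_uminus)

lemma of_nat_in_padic_integers: "of_nat n \<in> padic_integers"
  unfolding padic_integers_def by (metis rangeI to_fract_of_nat)

lemma pball_0: "pball 0 = padic_integers"
  by (auto simp: pball_def)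

lemma zero_in_pball [simp]: "0 \<in> pball k"
  unfolding pball_def using of_nat_in_padic_integers[of 0] by force

lemma pball_add: "x \<in> pball k \<Longrightarrow> y \<in> pball k \<Longrightarrow> x + y \<in> pball k"
  unfolding pball_def using padic_integers_closed(1) by (auto simp flip: distrib_left)

lemma pball_uminus: "x \<in> pball k \<Longrightarrow> - x \<in> pball k"
  unfolding pball_def using padic_integers_closed(3) by (auto simp flip: mult_minus_right)

lemma pball_uminus_iff [simp]: "- x \<in> pball k \<longleftrightarrow> x \<in> pball k"
  using pball_uminus[of x k] pball_uminus[of "- x" k] by auto

lemma pball_diff: "x \<in> pball k \<Longrightarrow> y \<in> pball k \<Longrightarrow> x - y \<in> pball k"
  using pball_add[of x k "- y"] by simp

lemma pball_diff_commute: "x - y \<in> pball k \<longleftrightarrow> y - x \<in> pball k"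
  using pball_uminus_iff[of "x - y" k] by simp

lemma pball_mult:
  assumes "x \<in> pball j" "y \<in> pball k"
  shows "x * y \<in> pball (j + k)"
proof -
  obtain a b where "x = of_nat CARD('a) powi j * a" "y = of_nat CARD('a) powi k * b"
    "a \<in> padic_integers" "b \<in> padic_integers"
    using assms unfolding pball_def by blast
  then have "x * y = of_nat CARD('a) powi (j + k) * (a * b)" "a * b \<in> padic_integers"
    by (auto simp: power_int_add padic_integers_closed)
  then show ?thesis unfolding pball_def by blast
qed

lemma pval_uniformizer [simp]: "pval (of_nat CARD('p) powi k :: 'p :: prime_card padic) = k"
  by (rule pval_eqI[of 1]) auto

lemma mem_pball_iff: "x \<in> pball k \<longleftrightarrow> x = 0 \<or> k \<le> pval x"
  for x :: "'p :: prime_card padic"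
proof
  assume "x \<in> pball k"
  then obtain a where a: "x = of_nat CARD('p) powi k * to_fract a"
    unfolding pball_def padic_integers_def by blast
  show "x = 0 \<or> k \<le> pval x"
  proof (cases "a = 0")
    case False
    then obtain l u where u: "u dvd 1" "a = of_nat CARD('p) ^ l * u" by (rule padic_int_decomp)
    have "x = of_nat CARD('p) powi (k + int l) * to_fract u"
      unfolding a u(2) by (simp add: power_int_add to_fract_power to_fract_of_nat)
    then show ?thesis using pval_eqI[OF u(1)] by auto
  qed (simp add: a)
next
  assume *: "x = 0 \<or> k \<le> pval x"
  show "x \<in> pball k"
  proof (cases "x = 0")
    case False
    obtain u where u: "u dvd 1" "x = of_nat CARD('p) powi pval x * to_fract u"
      by (rule pval_decomp[OF False])
    have "pval x = k + int (nat (pval x - k))" using * False by simp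
    then have "of_nat CARD('p) powi pval x = of_nat CARD('p) powi k * (of_nat CARD('p) :: 'p padic) ^ nat (pval x - k)"
      by (metis p_padic_nonzero power_int_add power_int_of_nat)
    then have "x = of_nat CARD('p) powi k * to_fract (of_nat CARD('p) ^ nat (pval x - k) * u)"
      using u(2) by (simp add: to_fract_power to_fract_of_nat mult.assoc)
    then show ?thesis unfolding pball_def padic_integers_def by blast
  qed simp
qed

lemma pball_antimono: "x \<in> pball k \<Longrightarrow> j \<le> k \<Longrightarrow> x \<in> pball j"
  by (auto simp: mem_pball_iff)

lemma pval_mult: "x \<noteq> 0 \<Longrightarrow> y \<noteq> 0 \<Longrightarrow> pval (x * y) = pval x + pval y"
  for x y :: "'p :: prime_card padic"
proof -
  assume nz: "x \<noteq> 0" "y \<noteq> 0"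
  obtain u v where "u dvd 1" "v dvd 1" and xy: "x = of_nat CARD('p) powi pval x * to_fract u"
     "y = of_nat CARD('p) powi pval y * to_fract v"
    using pval_decomp[OF nz(1)] pval_decomp[OF nz(2)] by metis
  then have "u * v dvd 1" by simp
  moreover have "x * y = of_nat CARD('p) powi (pval x + pval y) * to_fract (u * v)"
    by (subst xy(1), subst xy(2)) (simp add: power_int_add)
  ultimately show ?thesis by (rule pval_eqI)
qed

lemma pval_1 [simp]: "pval (1 :: 'p :: prime_card padic) = 0"
  by (rule pval_eqI[of 1]) auto

lemma pval_uminus [simp]: "pval (- x) = pval x"
proof (cases "x = 0")
  case False
  have "pball k = pball k" for k ..
  have "k \<le> pval x \<longleftrightarrow> k \<le> pval (- x)" for k
    using False mem_pball_iff[of x k] mem_pball_iff[of "- x" k] by simp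
  then show ?thesis by (metis order.antisym order.refl)
qed simp

lemma pval_inverse: "x \<noteq> 0 \<Longrightarrow> pval (inverse x) = - pval x"
  using pval_mult[of x "inverse x"] by simp

lemma pval_divide: "x \<noteq> 0 \<Longrightarrow> y \<noteq> 0 \<Longrightarrow> pval (x / y) = pval x - pval y"
  by (simp add: divide_inverse pval_mult pval_inverse)

lemma pval_power: "x \<noteq> 0 \<Longrightarrow> pval (x ^ n) = int n * pval x"
  by (induction n) (auto simp: pval_mult algebra_simps)

lemma pval_powi: "x \<noteq> 0 \<Longrightarrow> pval (x powi k) = k * pval x"
  by (cases k rule: int_cases2) (auto simp: power_int_minus pval_inverse pval_power)

lemma pval_prod: "finite A \<Longrightarrow> (\<And>i. i \<in> A \<Longrightarrow> f i \<noteq> 0) \<Longrightarrow> pval (prod f A) = (\<Sum>i\<in>A. pval (f i))"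
  by (induction A rule: finite_induct) (auto simp: pval_mult)

lemma pball_mult_cancel:
  assumes "c \<noteq> 0"
  shows "c * x \<in> pball k \<longleftrightarrow> x \<in> pball (k - pval c)"
  using assms by (cases "x = 0") (auto simp: mem_pball_iff pval_mult)

lemma pball_mult0: "x \<in> pball 0 \<Longrightarrow> y \<in> pball k \<Longrightarrow> x * y \<in> pball k"
  using pball_mult[of x 0 y k] by simp

lemma pball_mult0': "x \<in> pball k \<Longrightarrow> y \<in> pball 0 \<Longrightarrow> x * y \<in> pball k"
  using pball_mult[of x k y 0] by simp

lemma of_nat_in_pball_0 [simp]: "of_nat n \<in> pball 0"
  unfolding pball_0 by (rule of_nat_in_padic_integers)

lemma one_in_pball_0 [simp]: "1 \<in> pball 0"
  using of_nat_in_pball_0[of 1] by simp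

lemma pball_power: "x \<in> pball 0 \<Longrightarrow> x ^ n \<in> pball 0"
  by (induction n) (auto intro: pball_mult0)

lemma pball_trans: "x - y \<in> pball k \<Longrightarrow> y - z \<in> pball k \<Longrightarrow> x - z \<in> pball k"
  using pball_add[of "x - y" k "y - z"] by simp

lemma pball_uniformizer [simp]: "of_nat CARD('p) powi k \<in> (pball k :: 'p :: prime_card padic set)"
  by (simp add: mem_pball_iff)

text \<open>The ultrametric inequality: an error of valuation above v(x) cannot touch the leading
  term.\<close>

lemma pval_close:
  assumes "x \<noteq> 0" "x - y \<in> pball (pval x + 1)"
  shows "y \<noteq> 0" "pval y = pval x"
proof -
  show y: "y \<noteq> 0" using assms by (auto simp: mem_pball_iff)
  have "y \<in> pball (pval x)"
    using pball_diff[of x "pval x" "x - y"] assms pball_antimono[OF assms(2), of "pval x"] by (simp add: mem_pball_iff)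
  moreover have "y \<notin> pball (pval x + 1)"
  proof
    assume "y \<in> pball (pval x + 1)"
    with assms(2) have "x - y + y \<in> pball (pval x + 1)" by (rule pball_add)
    then have "x \<in> pball (pval x + 1)" by simp
    then show False using assms(1) by (simp add: mem_pball_iff)
  qed
  ultimately show "pval y = pval x" using y by (simp add: mem_pball_iff)
qed

lemma one_plus_pball:
  assumes "w - 1 \<in> pball k" "k \<ge> 1"
  shows "w \<noteq> 0" "pval w = 0"
  using pval_close[of 1 w] assms pball_antimono[of "w - 1" k 1] by (auto simp: pball_diff_commute[of 1])

lemma padic_residue:
  fixes x :: "'p :: prime_card padic"
  assumes "x \<in> pball 0"
  obtains n where "n < CARD('p) ^ k" "x - of_nat n \<in> pball (int k)"
proof -
  obtain a where a: "x = to_fract a" using assms by (auto simp: pball_0 padic_integers_def)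
  define n where "n = nat (residue_of a k)"
  have n: "int n = residue_of a k" using residue_of_range[of a k] by (simp add: n_def)
  have "int n < int (CARD('p) ^ k)" using residue_of_range(2)[of a k] n by simp
  then have "n < CARD('p) ^ k" by (simp only: of_nat_less_iff)
  moreover have "residue_of (a - of_nat n) k = 0"
    using residue_of_range[of a k] by (simp add: residue_of_diff residue_of_nat n)
  then obtain b where "a - of_nat n = of_nat CARD('p) ^ k * b"
    using padic_int_dvd_power by (metis dvdE)
  then have "x - of_nat n = of_nat CARD('p) powi int k * to_fract b"
    unfolding a by (metis power_int_of_nat to_fract_diff to_fract_mult to_fract_of_nat to_fract_power)
  then have "x - of_nat n \<in> pball (int k)" unfolding pball_def padic_integers_def by blast
  ultimately show ?thesis using that by blast
qed

lemma of_nat_diff_in_pball: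
  "of_nat m - (of_nat n :: 'p :: prime_card padic) \<in> pball (int k) \<longleftrightarrow> [m = n] (mod CARD('p) ^ k)"
proof -
  have to: "to_fract (of_nat m - of_nat n) = of_nat m - (of_nat n :: 'p padic)"
    by (simp add: to_fract_of_nat)
  have "of_nat m - (of_nat n :: 'p padic) \<in> pball (int k) \<longleftrightarrow>
      of_nat CARD('p) ^ k dvd (of_nat m - of_nat n :: 'p padic_int)"
  proof
    assume "of_nat m - (of_nat n :: 'p padic) \<in> pball (int k)"
    then obtain z where "to_fract (of_nat m - of_nat n) = of_nat CARD('p) ^ k * (to_fract z :: 'p padic)"
      unfolding pball_def padic_integers_def to by auto
    then have "of_nat m - of_nat n = of_nat CARD('p) ^ k * z"
      by (metis to_fract_eq_iff to_fract_mult to_fract_of_nat to_fract_power)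
    then show "of_nat CARD('p) ^ k dvd (of_nat m - of_nat n :: 'p padic_int)" by simp
  next
    assume "of_nat CARD('p) ^ k dvd (of_nat m - of_nat n :: 'p padic_int)"
    then obtain z :: "'p padic_int" where "of_nat m - of_nat n = of_nat CARD('p) ^ k * z" by (rule dvdE)
    then have "of_nat m - (of_nat n :: 'p padic) = of_nat CARD('p) powi int k * to_fract z"
      unfolding to[symmetric] by (simp add: to_fract_power to_fract_of_nat)
    then show "of_nat m - (of_nat n :: 'p padic) \<in> pball (int k)"
      unfolding pball_def padic_integers_def by blast
  qed
  also have "\<dots> \<longleftrightarrow> residue_of (of_nat m - of_nat n :: 'p padic_int) k = 0"
  proof
    assume "of_nat CARD('p) ^ k dvd (of_nat m - of_nat n :: 'p padic_int)"
    then obtain z :: "'p padic_int" where "of_nat m - of_nat n = of_nat (CARD('p) ^ k) * z" by auto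
    then show "residue_of (of_nat m - of_nat n :: 'p padic_int) k = 0"
      by (simp only: times_padic_int.rep_eq residue_of_nat) simp
  qed (rule padic_int_dvd_power)
  also have "\<dots> \<longleftrightarrow> [int m = int n] (mod int CARD('p) ^ k)"
    by (simp add: residue_of_diff residue_of_nat mod_simps cong_iff_dvd_diff dvd_eq_mod_eq_0)
  also have "\<dots> \<longleftrightarrow> [m = n] (mod CARD('p) ^ k)"
    by (metis cong_int_iff of_nat_power)
  finally show ?thesis .
qed

text \<open>Euler's theorem for an integer that approximates the unit mod p^k, since powers preserve
  congruences of integral elements. It makes a \<phi>-th power forget its unit part in the set
  \<open>H\<close> below.\<close>

lemma padic_euler:
  fixes x :: "'p :: prime_card padic"
  assumes "x \<noteq> 0" "pval x = 0" "k \<ge> 1"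
  shows "x ^ totient (CARD('p) ^ k) - 1 \<in> pball (int k)"
proof -
  let ?f = "totient (CARD('p) ^ k)"
  have "x \<in> pball 0" using assms by (simp add: mem_pball_iff)
  then obtain n where n: "x - of_nat n \<in> pball (int k)" using padic_residue by metis
  have "\<not> CARD('p) dvd n"
  proof
    assume "CARD('p) dvd n"
    then have "(of_nat n - of_nat 0 :: 'p padic) \<in> pball (int 1)"
      unfolding of_nat_diff_in_pball by (simp add: cong_0_iff)
    then have "(x - of_nat n) + of_nat n \<in> pball 1"
      using pball_antimono[OF n, of 1] assms(3) by (intro pball_add) auto
    then show False using assms by (simp add: mem_pball_iff)
  qed
  then have "coprime CARD('p) n"
    using prime_card[where 'a='p] by (simp add: prime_imp_coprime)
  then have "coprime n (CARD('p) ^ k)"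
    by (simp add: coprime_commute)
  then have "[n ^ ?f = 1] (mod CARD('p) ^ k)" by (rule euler_theorem)
  then have 1: "of_nat n ^ ?f - (1 :: 'p padic) \<in> pball (int k)"
    using of_nat_diff_in_pball[of "n ^ ?f" 1 k, where 'p='p] by simp
  have "x ^ m - of_nat n ^ m \<in> pball (int k)" for m
  proof (induction m)
    case (Suc m)
    have "x ^ Suc m - of_nat n ^ Suc m = x * (x ^ m - of_nat n ^ m) + (x - of_nat n) * of_nat n ^ m"
      by (simp add: algebra_simps)
    then show ?case
      using pball_add[OF pball_mult0[OF \<open>x \<in> pball 0\<close> Suc] pball_mult0'[OF n pball_power]] by simp
  qed simp
  from this[of ?f] 1 show ?thesis by (rule pball_trans)
qed

text \<open>First-order expansion with quadratic error, the linearisation behind the Newton step for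
  q-th roots.\<close>

lemma power_one_plus:
  assumes "x \<in> pball i" "i \<ge> 0"
  shows "(1 + x) ^ n - 1 - of_nat n * x \<in> pball (2 * i)"
proof (induction n)
  case (Suc n)
  have 0: "x \<in> pball 0" using assms pball_antimono by blast
  have "(1 + x) ^ Suc n - 1 - of_nat (Suc n) * x =
     (1 + x) * ((1 + x) ^ n - 1 - of_nat n * x) + of_nat n * (x * x)"
    by (simp add: algebra_simps)
  also have "\<dots> \<in> pball (2 * i)"
    using pball_add[OF pball_mult0[OF pball_add[OF one_in_pball_0 0] Suc]
      pball_mult0[OF of_nat_in_pball_0 pball_mult[OF assms(1,1), folded mult_2], of n]] by simp
  finally show ?case .
qed simp

section \<open>Definable predicates and piecewise rational functions\<close>

type_synonym 'p assignment = "nat \<Rightarrow> 'p padic"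

text \<open>Truth must be independent of \<open>g\<close>: sets are described by field variables
  alone, and the value group enters only through comparisons of valuations.\<close>

definition dfn :: "('p :: prime_card assignment \<Rightarrow> bool) \<Rightarrow> bool" where
  "dfn D \<longleftrightarrow> (\<exists>\<phi>. \<forall>a g. sat a g \<phi> \<longleftrightarrow> D a)"

lemma dfnI: "(\<And>a g. sat a g \<phi> \<longleftrightarrow> D a) \<Longrightarrow> dfn D"
  unfolding dfn_def by blast

lemma dfnE:
  assumes "dfn D"
  obtains \<phi> where "\<And>a g. sat a g \<phi> \<longleftrightarrow> D a"
  using assms unfolding dfn_def by auto

lemma dfn_neg: "dfn D \<Longrightarrow> dfn (\<lambda>a. \<not> D a)"
  by (erule dfnE, rule dfnI[of "Neg _"]) simp

lemma dfn_conj: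
  assumes "dfn D" "dfn E"
  shows "dfn (\<lambda>a. D a \<and> E a)"
proof -
  obtain s where s: "\<And>a g. sat a g s \<longleftrightarrow> D a" using assms(1) by (rule dfnE) blast
  obtain t where t: "\<And>a g. sat a g t \<longleftrightarrow> E a" using assms(2) by (rule dfnE) blast
  show ?thesis by (rule dfnI[of "Conj s t"]) (simp add: s t)
qed

lemma dfn_disj: "dfn D \<Longrightarrow> dfn E \<Longrightarrow> dfn (\<lambda>a. D a \<or> E a)"
  using dfn_neg[OF dfn_conj[OF dfn_neg[of D] dfn_neg[of E]]] by simp

lemma dfn_ex:
  assumes "dfn D"
  shows "dfn (\<lambda>a. \<exists>x. D (a(i := x)))"
proof -
  obtain s where s: "\<And>a g. sat a g s \<longleftrightarrow> D a" using assms(1) by (rule dfnE) blast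
  show ?thesis by (rule dfnI[of "FEx i s"]) (simp add: s)
qed

lemma dfn_const: "dfn (\<lambda>a. c)"
proof -
  have "dfn (\<lambda>a. True)" by (rule dfnI[of "FEq FZero FZero"]) simp
  then show ?thesis using dfn_neg[of "\<lambda>_. True"] by (cases c) auto
qed

lemma dfn_finite_disj: "finite I \<Longrightarrow> (\<And>i. i \<in> I \<Longrightarrow> dfn (D i)) \<Longrightarrow> dfn (\<lambda>a. \<exists>i\<in>I. D i a)"
  by (induction I rule: finite_induct) (auto intro: dfn_const dfn_disj)

lemma dfn_finite_conj: "finite I \<Longrightarrow> (\<And>i. i \<in> I \<Longrightarrow> dfn (D i)) \<Longrightarrow> dfn (\<lambda>a. \<forall>i\<in>I. D i a)"
  by (induction I rule: finite_induct) (auto intro: dfn_const dfn_conj)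

section \<open>Renaming of variables\<close>

primrec rename_field :: "(nat \<Rightarrow> nat) \<Rightarrow> field_term \<Rightarrow> field_term" where
  "rename_field f (FVar i) = FVar (f i)"
| "rename_field f FZero = FZero"
| "rename_field f FOne = FOne"
| "rename_field f (FAdd s t) = FAdd (rename_field f s) (rename_field f t)"
| "rename_field f (FNeg t) = FNeg (rename_field f t)"
| "rename_field f (FMult s t) = FMult (rename_field f s) (rename_field f t)"

primrec rename_group :: "(nat \<Rightarrow> nat) \<Rightarrow> group_term \<Rightarrow> group_term" where
  "rename_group f (GVar i) = GVar i"
| "rename_group f GZero = GZero"
| "rename_group f (GAdd s t) = GAdd (rename_group f s) (rename_group f t)"
| "rename_group f (GVal t) = GVal (rename_field f t)"

primrec rename_form :: "(nat \<Rightarrow> nat) \<Rightarrow> form \<Rightarrow> form" where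
  "rename_form f (FEq s t) = FEq (rename_field f s) (rename_field f t)"
| "rename_form f (GEq s t) = GEq (rename_group f s) (rename_group f t)"
| "rename_form f (GLess s t) = GLess (rename_group f s) (rename_group f t)"
| "rename_form f (Neg \<phi>) = Neg (rename_form f \<phi>)"
| "rename_form f (Conj \<phi> \<psi>) = Conj (rename_form f \<phi>) (rename_form f \<psi>)"
| "rename_form f (FEx i \<phi>) = FEx (f i) (rename_form f \<phi>)"
| "rename_form f (GEx i \<phi>) = GEx i (rename_form f \<phi>)"

lemma eval_rename_field: "eval_field a (rename_field f t) = eval_field (a \<circ> f) t"
  by (induction t) auto

lemma eval_rename_group: "eval_group a g (rename_group f t) = eval_group (a \<circ> f) g t"
  by (induction t) (simp_all add: eval_rename_field o_def)

text \<open>Injectivity prevents capture: an update at the bound variable \<open>f i\<close> must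
  change no other renamed variable.\<close>

lemma sat_rename_form: "inj f \<Longrightarrow> sat a g (rename_form f \<phi>) \<longleftrightarrow> sat (a \<circ> f) g \<phi>"
  by (induction \<phi> arbitrary: a g)
     (auto simp: eval_rename_field eval_rename_group fun_upd_comp inj_eq o_def fun_upd_def)

lemma dfn_rename:
  assumes "dfn D" "inj f"
  shows "dfn (\<lambda>a. D (\<lambda>i. a (f i)))"
proof -
  obtain \<phi> where "\<forall>a g. sat a g \<phi> \<longleftrightarrow> D a" using assms(1) unfolding dfn_def by blast
  then have "sat a g (rename_form f \<phi>) \<longleftrightarrow> D (\<lambda>i. a (f i))" for a g
    by (simp add: sat_rename_form[OF assms(2)] o_def)
  then show ?thesis unfolding dfn_def by blast
qed

section \<open>Polynomial and piecewise rational functions of an assignment\<close>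

definition trm :: "('p :: prime_card assignment \<Rightarrow> 'p padic) \<Rightarrow> bool" where
  "trm f \<longleftrightarrow> (\<exists>t. \<forall>a. eval_field a t = f a)"

lemma trmI: "(\<And>a. eval_field a t = f a) \<Longrightarrow> trm f"
  unfolding trm_def by blast

lemma trmE:
  assumes "trm f"
  obtains t where "\<And>a. eval_field a t = f a"
  using assms unfolding trm_def by auto

lemma trm_var: "trm (\<lambda>a. a i)"
  by (rule trmI[of "FVar i"]) simp

lemma trm_0: "trm (\<lambda>a. 0)"
  by (rule trmI[of FZero]) simp

lemma trm_1: "trm (\<lambda>a. 1)"
  by (rule trmI[of FOne]) simp

lemma trm_add:
  assumes "trm f" "trm g"
  shows "trm (\<lambda>a. f a + g a)"
proof -
  obtain s where s: "\<And>a. eval_field a s = f a" using assms(1) by (rule trmE) blast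
  obtain t where t: "\<And>a. eval_field a t = g a" using assms(2) by (rule trmE) blast
  show ?thesis by (rule trmI[of "FAdd s t"]) (simp add: s t)
qed

lemma trm_uminus: "trm f \<Longrightarrow> trm (\<lambda>a. - f a)"
  by (erule trmE, rule trmI[of "FNeg _"]) simp

lemma trm_mult:
  assumes "trm f" "trm g"
  shows "trm (\<lambda>a. f a * g a)"
proof -
  obtain s where s: "\<And>a. eval_field a s = f a" using assms(1) by (rule trmE) blast
  obtain t where t: "\<And>a. eval_field a t = g a" using assms(2) by (rule trmE) blast
  show ?thesis by (rule trmI[of "FMult s t"]) (simp add: s t)
qed

lemma trm_of_nat: "trm (\<lambda>a. of_nat n)"
  by (induction n) (auto intro: trm_0 trm_1 trm_add)

lemma trm_rename:
  assumes "trm t"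
  shows "trm (\<lambda>a. t (\<lambda>i. a (f i)))"
proof -
  obtain s where "\<forall>a. eval_field a s = t a" using assms unfolding trm_def by blast
  then have "eval_field a (rename_field f s) = t (\<lambda>i. a (f i))" for a
    by (simp add: eval_rename_field o_def)
  then show ?thesis unfolding trm_def by blast
qed

lemma dfn_trm_eq:
  assumes "trm f" "trm g"
  shows "dfn (\<lambda>a. f a = g a)"
proof -
  obtain s where s: "\<And>a. eval_field a s = f a" using assms(1) by (rule trmE) blast
  obtain t where t: "\<And>a. eval_field a t = g a" using assms(2) by (rule trmE) blast
  show ?thesis by (rule dfnI[of "FEq s t"]) (simp add: s t)
qed

lemma dfn_trm_val_less:
  assumes "trm f" "trm g"
  shows "dfn (\<lambda>a. padic_val (f a) < padic_val (g a))"
proof -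
  obtain s where s: "\<And>a. eval_field a s = f a" using assms(1) by (rule trmE) blast
  obtain t where t: "\<And>a. eval_field a t = g a" using assms(2) by (rule trmE) blast
  show ?thesis by (rule dfnI[of "GLess (GVal s) (GVal t)"]) (simp add: s t)
qed

text \<open>Case distinctions are built in since division by 0 yields 0, so that even a sum of two
  quotients need not be a single quotient everywhere.\<close>

inductive pw :: "('p :: prime_card assignment \<Rightarrow> 'p padic) \<Rightarrow> bool" where
  rat: "trm n \<Longrightarrow> trm d \<Longrightarrow> pw (\<lambda>a. n a / d a)"
| ite: "dfn D \<Longrightarrow> pw f \<Longrightarrow> pw g \<Longrightarrow> pw (\<lambda>a. if D a then f a else g a)"

text \<open>Operations are pushed to the leaves of the case tree, so closure has to be checked on
  quotients only.\<close>

lemma pw_unary: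
  assumes "\<And>n d. trm n \<Longrightarrow> trm d \<Longrightarrow> pw (\<lambda>a. u (n a / d a))" "pw f"
  shows "pw (\<lambda>a. u (f a))"
  using assms(2)
proof (induction rule: pw.induct)
  case (ite D f g)
  from pw.ite[OF this(1,4,5)] show ?case by (simp add: if_distrib)
qed (rule assms(1))

lemma pw_binary:
  assumes "\<And>n d n' d'. trm n \<Longrightarrow> trm d \<Longrightarrow> trm n' \<Longrightarrow> trm d' \<Longrightarrow> pw (\<lambda>a. u (n a / d a) (n' a / d' a))"
    "pw f" "pw g"
  shows "pw (\<lambda>a. u (f a) (g a))"
  using assms(2)
proof (induction rule: pw.induct)
  case (rat n d)
  show ?case using assms(3)
  proof (induction rule: pw.induct)
    case (ite D f g)
    from pw.ite[OF this(1,4,5)] show ?case by (simp add: if_distrib)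
  qed (rule assms(1)[OF rat])
next
  case (ite D f h)
  have "(\<lambda>a. u (if D a then f a else h a) (g a)) = (\<lambda>a. if D a then u (f a) (g a) else u (h a) (g a))"
    by auto
  with pw.ite[OF ite(1,4,5)] show ?case by simp
qed

lemma dfn_binary:
  assumes "\<And>n d n' d'. trm n \<Longrightarrow> trm d \<Longrightarrow> trm n' \<Longrightarrow> trm d' \<Longrightarrow> dfn (\<lambda>a. P (n a / d a) (n' a / d' a))"
    "pw f" "pw g"
  shows "dfn (\<lambda>a. P (f a) (g a))"
  using assms(2)
proof (induction rule: pw.induct)
  case (rat n d)
  show ?case using assms(3)
  proof (induction rule: pw.induct)
    case (ite D f g)
    have "(\<lambda>a. P (n a / d a) (if D a then f a else g a)) =
        (\<lambda>a. (D a \<and> P (n a / d a) (f a)) \<or> (\<not> D a \<and> P (n a / d a) (g a)))"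
      by auto
    with ite show ?case by (simp add: dfn_disj dfn_conj dfn_neg)
  qed (rule assms(1)[OF rat])
next
  case (ite D f h)
  have "(\<lambda>a. P (if D a then f a else h a) (g a)) =
      (\<lambda>a. (D a \<and> P (f a) (g a)) \<or> (\<not> D a \<and> P (h a) (g a)))"
    by auto
  with ite show ?case by (simp add: dfn_disj dfn_conj dfn_neg)
qed

lemma pw_trm: "trm f \<Longrightarrow> pw f"
  using pw.rat[OF _ trm_1, of f] by simp

lemma pw_mult: "pw f \<Longrightarrow> pw g \<Longrightarrow> pw (\<lambda>a. f a * g a)"
proof (rule pw_binary[where u = "(*)"])
  fix n d n' d' :: "'a assignment \<Rightarrow> 'a padic"
  assume "trm n" "trm d" "trm n'" "trm d'"
  then show "pw (\<lambda>a. n a / d a * (n' a / d' a))"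
    using pw.rat[OF trm_mult[of n n'] trm_mult[of d d']] by simp
qed

lemma pw_add: "pw f \<Longrightarrow> pw g \<Longrightarrow> pw (\<lambda>a. f a + g a)"
proof (rule pw_binary[where u = "(+)"])
  fix n d n' d' :: "'a assignment \<Rightarrow> 'a padic"
  assume t: "trm n" "trm d" "trm n'" "trm d'"
  \<comment> \<open>With x / 0 = 0 the common denominator gives a wrong value where one denominator
    vanishes; those points are split off.\<close>
  have "(\<lambda>a. n a / d a + n' a / d' a) = (\<lambda>a. if d a = 0 then n' a / d' a else if d' a = 0 then n a / d a
      else (n a * d' a + n' a * d a) / (d a * d' a))"
    by (auto simp: field_simps)
  moreover have "pw (\<lambda>a. if d a = 0 then n' a / d' a else if d' a = 0 then n a / d a
      else (n a * d' a + n' a * d a) / (d a * d' a))"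
    using t by (intro pw.ite pw.rat dfn_trm_eq trm_add trm_mult trm_0)
  ultimately show "pw (\<lambda>a. n a / d a + n' a / d' a)" by simp
qed

lemma pw_uminus: "pw f \<Longrightarrow> pw (\<lambda>a. - f a)"
proof (rule pw_unary[where u = uminus])
  fix n d :: "'a assignment \<Rightarrow> 'a padic"
  assume "trm n" "trm d"
  then show "pw (\<lambda>a. - (n a / d a))"
    using pw.rat[OF trm_uminus[of n]] by simp
qed

lemma pw_diff: "pw f \<Longrightarrow> pw g \<Longrightarrow> pw (\<lambda>a. f a - g a)"
  using pw_add[OF _ pw_uminus, of f g] by simp

lemma pw_inverse: "pw f \<Longrightarrow> pw (\<lambda>a. inverse (f a))"
proof (rule pw_unary[where u = inverse])
  fix n d :: "'a assignment \<Rightarrow> 'a padic"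
  assume "trm n" "trm d"
  then show "pw (\<lambda>a. inverse (n a / d a))"
    using pw.rat[of d n] by simp
qed

lemma pw_of_nat: "pw (\<lambda>a. of_nat n)"
  by (rule pw_trm trm_of_nat)+

lemma pw_0: "pw (\<lambda>a. 0)"
  by (rule pw_trm trm_0)+

lemma pw_1: "pw (\<lambda>a. 1)"
  by (rule pw_trm trm_1)+

lemma pw_var: "pw (\<lambda>a. a i)"
  by (rule pw_trm trm_var)+

lemma pw_power: "pw f \<Longrightarrow> pw (\<lambda>a. f a ^ n)"
  by (induction n) (auto intro: pw_1 pw_mult)

lemma pw_powi: "pw f \<Longrightarrow> pw (\<lambda>a. f a powi n)"
  by (cases n rule: int_cases2) (auto simp: power_int_minus intro: pw_power pw_inverse)

lemma pw_prod: "(\<And>i. i \<in> I \<Longrightarrow> pw (f i)) \<Longrightarrow> pw (\<lambda>a. \<Prod>i\<in>I. f i a)"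
  by (induction I rule: infinite_finite_induct) (auto intro: pw_1 pw_mult)

lemma dfn_eq: "pw f \<Longrightarrow> pw g \<Longrightarrow> dfn (\<lambda>a. f a = g a)"
proof (rule dfn_binary[where P = "(=)"])
  fix n d n' d' :: "'a assignment \<Rightarrow> 'a padic"
  assume t: "trm n" "trm d" "trm n'" "trm d'"
  have "(\<lambda>a. n a / d a = n' a / d' a) = (\<lambda>a. ((d a = 0 \<or> n a = 0) \<and> (d' a = 0 \<or> n' a = 0)) \<or>
      (\<not> d a = 0 \<and> \<not> d' a = 0 \<and> n a * d' a = n' a * d a))"
  proof
    fix a show "(n a / d a = n' a / d' a) = (((d a = 0 \<or> n a = 0) \<and> (d' a = 0 \<or> n' a = 0)) \<or>
      (\<not> d a = 0 \<and> \<not> d' a = 0 \<and> n a * d' a = n' a * d a))"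
      by (cases "d a = 0"; cases "d' a = 0") (auto simp: frac_eq_eq)
  qed
  moreover have "dfn (\<lambda>a. ((d a = 0 \<or> n a = 0) \<and> (d' a = 0 \<or> n' a = 0)) \<or>
      (\<not> d a = 0 \<and> \<not> d' a = 0 \<and> n a * d' a = n' a * d a))"
    using t by (intro dfn_disj dfn_conj dfn_neg dfn_trm_eq trm_0 trm_mult)
  ultimately show "dfn (\<lambda>a. n a / d a = n' a / d' a)" by simp
qed

lemma padic_val_less_iff: "padic_val x < padic_val y \<longleftrightarrow> x \<noteq> 0 \<and> (y = 0 \<or> pval x < pval y)"
  by (cases "x = 0"; cases "y = 0") (auto simp: padic_val_nonzero)

text \<open>This is v(f) < v(g) with v(0) = \<infinity>. Cross-multiplication reduces it to
  valuations of polynomial terms, that is to an atomic formula.\<close>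

lemma dfn_val_less: "pw f \<Longrightarrow> pw g \<Longrightarrow> dfn (\<lambda>a. f a \<noteq> 0 \<and> (g a = 0 \<or> pval (f a) < pval (g a)))"
proof (rule dfn_binary[where P = "\<lambda>x y. x \<noteq> 0 \<and> (y = 0 \<or> pval x < pval y)"])
  fix n d n' d' :: "'a assignment \<Rightarrow> 'a padic"
  assume t: "trm n" "trm d" "trm n'" "trm d'"
  have "(\<lambda>a. n a / d a \<noteq> 0 \<and> (n' a / d' a = 0 \<or> pval (n a / d a) < pval (n' a / d' a))) =
    (\<lambda>a. (\<not> n a = 0 \<and> \<not> d a = 0) \<and> (d' a = 0 \<or> padic_val (n a * d' a) < padic_val (n' a * d a)))"
    by (rule ext) (auto simp: padic_val_less_iff pval_divide pval_mult)
  moreover have "dfn (\<lambda>a. (\<not> n a = 0 \<and> \<not> d a = 0) \<and> (d' a = 0 \<or> padic_val (n a * d' a) < padic_val (n' a * d a)))"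
    using t by (intro dfn_disj dfn_conj dfn_neg dfn_trm_eq dfn_trm_val_less trm_0 trm_mult)
  ultimately show "dfn (\<lambda>a. n a / d a \<noteq> 0 \<and> (n' a / d' a = 0 \<or> pval (n a / d a) < pval (n' a / d' a)))"
    by simp
qed

lemma dfn_pball:
  assumes "pw f"
  shows "dfn (\<lambda>a. f a \<in> pball k)"
proof -
  have "(\<lambda>a. f a \<in> pball k) = (\<lambda>a. \<not> (f a \<noteq> 0 \<and> ((of_nat CARD('a) powi k :: 'a padic) = 0 \<or>
     pval (f a) < pval (of_nat CARD('a) powi k :: 'a padic))))"
    by (auto simp: mem_pball_iff)
  then show ?thesis
    by (simp only: dfn_neg[OF dfn_val_less[OF assms pw_powi[OF pw_of_nat]]])
qed

lemma dfn_pval_eq: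
  assumes "pw f"
  shows "dfn (\<lambda>a. f a \<noteq> 0 \<and> pval (f a) = k)"
proof -
  have "(\<lambda>a. f a \<noteq> 0 \<and> pval (f a) = k) = (\<lambda>a. \<not> f a = 0 \<and> f a \<in> pball k \<and> \<not> f a \<in> pball (k + 1))"
    by (auto simp: mem_pball_iff)
  moreover have "dfn (\<lambda>a. \<not> f a = 0 \<and> f a \<in> pball k \<and> \<not> f a \<in> pball (k + 1))"
    by (intro dfn_conj dfn_neg dfn_eq dfn_pball assms pw_0)
  ultimately show ?thesis by simp
qed

lemma pw_rename:
  assumes "pw h" "inj f"
  shows "pw (\<lambda>a. h (\<lambda>i. a (f i)))"
  using assms(1)
proof (induction rule: pw.induct)
  case (rat n d)
  then show ?case by (intro pw.rat[OF trm_rename[OF rat(1)] trm_rename[OF rat(2)]])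
next
  case (ite D g h)
  then show ?case using pw.ite[OF dfn_rename[OF ite(1) assms(2)]] by simp
qed

text \<open>Forgets the domains of the pieces, which is enough for a bound on the dimension.\<close>

lemma pw_rational_cases:
  assumes "pw f"
  shows "\<exists>R. finite R \<and> (\<forall>(n, d)\<in>R. trm n \<and> trm d) \<and> (\<forall>a. \<exists>(n, d)\<in>R. d a \<noteq> 0 \<and> f a = n a / d a)"
  using assms
proof (induction rule: pw.induct)
  case (rat n d)
  \<comment> \<open>The quotient 0 / 1 takes over at the zeros of \<open>d\<close>.\<close>
  show ?case
    by (rule exI[of _ "{(n, d), (\<lambda>_. 0, \<lambda>_. 1)}"]) (use rat trm_0 trm_1 in auto)
next
  case (ite D f g)
  from ite.IH obtain R R' where R: "finite R" "\<forall>(n, d)\<in>R. trm n \<and> trm d"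
    "\<forall>a. \<exists>(n, d)\<in>R. d a \<noteq> 0 \<and> f a = n a / d a" and R': "finite R'" "\<forall>(n, d)\<in>R'. trm n \<and> trm d"
    "\<forall>a. \<exists>(n, d)\<in>R'. d a \<noteq> 0 \<and> g a = n a / d a" by (elim exE conjE)
  show ?case
  proof (intro exI[of _ "R \<union> R'"] conjI allI)
    show "finite (R \<union> R')" using R(1) R'(1) by simp
    show "\<forall>(n, d)\<in>R \<union> R'. trm n \<and> trm d" using R(2) R'(2) by (simp add: ball_Un)
    show "\<exists>(n, d)\<in>R \<union> R'. d a \<noteq> 0 \<and> (if D a then f a else g a) = n a / d a" for a
      using R(3)[rule_format, of a] R'(3)[rule_format, of a] by (cases "D a") (simp_all add: bex_Un)
  qed
qed

section \<open>Definability of images\<close>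

lemma dfn_ex_interval:
  assumes "dfn D"
  shows "dfn (\<lambda>a. \<exists>b. D (\<lambda>i. if n \<le> i \<and> i < n + d then b i else a i))"
proof (induction d)
  case 0
  have "(\<lambda>i. if n \<le> i \<and> i < n + 0 then b i else a i) = a" for a b :: "'a assignment"
    by (rule ext) auto
  then show ?case using assms by (simp only: simp_thms)
next
  case (Suc d)
  from dfn_ex[OF Suc, of "n + d"]
  have "dfn (\<lambda>a. \<exists>x b. D (\<lambda>i. if n \<le> i \<and> i < n + d then b i else (a(n + d := x)) i))" .
  also have "(\<lambda>a. \<exists>x b. D (\<lambda>i. if n \<le> i \<and> i < n + d then b i else (a(n + d := x)) i)) =
     (\<lambda>a. \<exists>b. D (\<lambda>i. if n \<le> i \<and> i < n + Suc d then b i else a i))"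
  proof (intro ext iffI)
    fix a assume "\<exists>x b. D (\<lambda>i. if n \<le> i \<and> i < n + d then b i else (a(n + d := x)) i)"
    then obtain x b where *: "D (\<lambda>i. if n \<le> i \<and> i < n + d then b i else (a(n + d := x)) i)" by blast
    have eq: "(\<lambda>i. if n \<le> i \<and> i < n + d then b i else (a(n + d := x)) i) =
       (\<lambda>i. if n \<le> i \<and> i < n + Suc d then (b(n + d := x)) i else a i)"
      by (rule ext) auto
    show "\<exists>b. D (\<lambda>i. if n \<le> i \<and> i < n + Suc d then b i else a i)"
      by (rule exI[of _ "b(n + d := x)"]) (rule *[unfolded eq])
  next
    fix a assume "\<exists>b. D (\<lambda>i. if n \<le> i \<and> i < n + Suc d then b i else a i)"
    then obtain b where *: "D (\<lambda>i. if n \<le> i \<and> i < n + Suc d then b i else a i)" by blast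
    have eq: "(\<lambda>i. if n \<le> i \<and> i < n + Suc d then b i else a i) =
       (\<lambda>i. if n \<le> i \<and> i < n + d then b i else (a(n + d := b (n + d))) i)"
      by (rule ext) auto
    show "\<exists>x b. D (\<lambda>i. if n \<le> i \<and> i < n + d then b i else (a(n + d := x)) i)"
      by (rule exI[of _ "b (n + d)"], rule exI[of _ b]) (rule *[unfolded eq])
  qed
  finally show ?case .
qed

text \<open>Variables 0, ..., n - 1 hold the point and n, ..., n + d - 1 its parameters, which are
  quantified away. The condition that \<open>a\<close> vanishes from d on matches the later
  variables of the formula, which are all assigned 0.\<close>

lemma definable_field_image:
  fixes D :: "'i \<Rightarrow> 'p :: prime_card assignment \<Rightarrow> bool" and F :: "'i \<Rightarrow> 'p assignment \<Rightarrow> nat \<Rightarrow> 'p padic"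
  assumes "finite I" "\<And>i. i \<in> I \<Longrightarrow> dfn (D i)" "\<And>i j. i \<in> I \<Longrightarrow> j < n \<Longrightarrow> pw (\<lambda>a. F i a j)"
  shows "definable_field n {map (F i a) [0..<n] | i a. i \<in> I \<and> (\<forall>k\<ge>d. a k = 0) \<and> D i a}"
proof -
  let ?sh = "\<lambda>A j. A (n + j)"
  let ?E = "\<lambda>A. \<exists>i\<in>I. D i (?sh A) \<and> (\<forall>j\<in>{..<n}. A j = F i (?sh A) j)"
  have "dfn ?E"
  proof (intro dfn_finite_disj dfn_conj dfn_finite_conj dfn_eq pw_var assms)
    show "dfn (\<lambda>A. D i (?sh A))" if "i \<in> I" for i
      by (rule dfn_rename[OF assms(2)[OF that]]) (auto simp: inj_def)
    show "pw (\<lambda>A. F i (?sh A) j)" if "i \<in> I" "j \<in> {..<n}" for i j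
      by (rule pw_rename[OF assms(3)[OF that(1)]]) (use that in \<open>auto simp: inj_def\<close>)
  qed auto
  from dfn_ex_interval[OF this, of n d] obtain \<phi> where \<phi>:
    "\<And>a g. sat a g \<phi> \<longleftrightarrow> (\<exists>b. ?E (\<lambda>i. if n \<le> i \<and> i < n + d then b i else a i))"
    unfolding dfn_def by blast
  let ?X = "{map (F i a) [0..<n] | i a. i \<in> I \<and> (\<forall>k\<ge>d. a k = 0) \<and> D i a}"
  have iff: "x \<in> ?X \<longleftrightarrow> length x = n \<and> sat (\<lambda>i. if i < n then x ! i else 0) g \<phi>" for x g
  proof
    assume "x \<in> ?X"
    then obtain i a where x: "x = map (F i a) [0..<n]" "i \<in> I" "\<forall>k\<ge>d. a k = 0" "D i a" by blast
    let ?A = "\<lambda>i. if n \<le> i \<and> i < n + d then a (i - n) else if i < n then x ! i else 0"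
    have "?sh ?A = a" using x(3) by auto
    then have "?E ?A" using x by (intro bexI[of _ i]) auto
    then show "length x = n \<and> sat (\<lambda>i. if i < n then x ! i else 0) g \<phi>"
      unfolding \<phi> using x(1) by (intro conjI exI[of _ "\<lambda>i. a (i - n)"]) auto
  next
    assume *: "length x = n \<and> sat (\<lambda>i. if i < n then x ! i else 0) g \<phi>"
    then obtain b where E: "?E (\<lambda>i. if n \<le> i \<and> i < n + d then b i else if i < n then x ! i else 0)"
      unfolding \<phi> by blast
    let ?A = "\<lambda>i. if n \<le> i \<and> i < n + d then b i else if i < n then x ! i else 0"
    from E obtain i where i: "i \<in> I" "D i (?sh ?A)" "\<forall>j\<in>{..<n}. ?A j = F i (?sh ?A) j" by blast
    have "x = map (F i (?sh ?A)) [0..<n]"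
      using * i(3) by (intro nth_equalityI) auto
    then show "x \<in> ?X" using i(1,2) by (auto intro!: exI[of _ i] exI[of _ "?sh ?A"])
  qed
  have "?X \<times> {[]} = {(x, \<kappa>). length x = n \<and> length \<kappa> = 0 \<and>
     sat (\<lambda>i. if i < n then x ! i else 0) (\<lambda>i. if i < 0 then \<kappa> ! i else 0) \<phi>}" (is "_ = ?R")
  proof (rule Set.set_eqI)
    fix y :: "'p padic list \<times> int list"
    obtain x \<kappa> where y: "y = (x, \<kappa>)" by (cases y)
    have "y \<in> ?X \<times> {[]} \<longleftrightarrow> x \<in> ?X \<and> \<kappa> = []" by (simp only: y mem_Times_iff fst_conv snd_conv singleton_iff)
    also have "\<dots> \<longleftrightarrow> y \<in> ?R" unfolding iff[of x "\<lambda>_. 0"] y by auto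
    finally show "y \<in> ?X \<times> {[]} \<longleftrightarrow> y \<in> ?R" .
  qed
  then show ?thesis
    unfolding definable_field_def definable_def by (intro exI[of _ \<phi>] exI[of _ "\<lambda>_. 0"])
qed

section \<open>Trees and rays\<close>

text \<open>Root and depth function are made explicit. A depth that grows by one along edges
  replaces the reachability condition: passing to parents lowers it until only the root is
  left.\<close>

definition tree_at :: "'a rtree \<Rightarrow> 'a \<Rightarrow> ('a \<Rightarrow> nat) \<Rightarrow> bool" where
  "tree_at T r D \<longleftrightarrow> r \<in> nodes T \<and> child_rel T \<subseteq> nodes T \<times> nodes T \<and> D r = 0 \<and>
     (\<forall>u v. (u, v) \<in> child_rel T \<longrightarrow> D v = Suc (D u)) \<and>
     (\<forall>v\<in>nodes T - {r}. \<exists>!u. (u, v) \<in> child_rel T)"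

text \<open>Only the entries up to n matter; working with sequences on all of \<open>nat\<close>
  makes a ray a path of every length.\<close>

definition path :: "'a rtree \<Rightarrow> (nat \<Rightarrow> 'a) \<Rightarrow> nat \<Rightarrow> bool" where
  "path T \<alpha> n \<longleftrightarrow> \<alpha> 0 \<in> nodes T \<and> \<alpha> 0 = tree_root T \<and> (\<forall>i<n. (\<alpha> i, \<alpha> (Suc i)) \<in> child_rel T)"

definition ray :: "'a rtree \<Rightarrow> (nat \<Rightarrow> 'a) \<Rightarrow> bool" where
  "ray T \<alpha> \<longleftrightarrow> (\<forall>n. path T \<alpha> n)"

lemma ray_path: "ray T \<alpha> \<Longrightarrow> path T \<alpha> n"
  by (simp add: ray_def)

lemma tree_atD:
  assumes "tree_at T r D"
  shows "r \<in> nodes T" "D r = 0" "(u, v) \<in> child_rel T \<Longrightarrow> u \<in> nodes T"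
    "(u, v) \<in> child_rel T \<Longrightarrow> v \<in> nodes T" "(u, v) \<in> child_rel T \<Longrightarrow> D v = Suc (D u)"
    "(u, r) \<notin> child_rel T" "(u, v) \<in> child_rel T \<Longrightarrow> (u', v) \<in> child_rel T \<Longrightarrow> u = u'"
    "v \<in> nodes T \<Longrightarrow> v \<noteq> r \<Longrightarrow> \<exists>u. (u, v) \<in> child_rel T"
    "v \<in> nodes T \<Longrightarrow> D v = 0 \<Longrightarrow> v = r"
proof -
  show 1: "r \<in> nodes T" "D r = 0" "(u, v) \<in> child_rel T \<Longrightarrow> u \<in> nodes T"
    "(u, v) \<in> child_rel T \<Longrightarrow> v \<in> nodes T" "\<And>u v. (u, v) \<in> child_rel T \<Longrightarrow> D v = Suc (D u)"
    and ex: "\<And>v. v \<in> nodes T \<Longrightarrow> v \<noteq> r \<Longrightarrow> \<exists>u. (u, v) \<in> child_rel T"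
    using assms unfolding tree_at_def by blast+
  show 2: "\<And>u. (u, r) \<notin> child_rel T" using 1(2,5) by fastforce
  show "(u, v) \<in> child_rel T \<Longrightarrow> (u', v) \<in> child_rel T \<Longrightarrow> u = u'"
    using assms 1(4) 2 unfolding tree_at_def by blast
  show "v \<in> nodes T \<Longrightarrow> D v = 0 \<Longrightarrow> v = r"
    using ex[of v] 1(5) by fastforce
qed

lemma tree_at_root:
  assumes "tree_at T r D"
  shows "tree_root T = r"
  unfolding tree_root_def
proof (rule the_equality)
  show "r \<in> nodes T \<and> (\<forall>u. (u, r) \<notin> child_rel T)"
    using tree_atD[OF assms] by blast
  show "x = r" if "x \<in> nodes T \<and> (\<forall>u. (u, x) \<notin> child_rel T)" for x
    using tree_atD[OF assms] that by blast
qed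

lemma tree_at_depth:
  assumes "tree_at T r D" "v \<in> nodes T"
  shows "depth T v = D v"
proof -
  note t = tree_atD[OF assms(1)]
  have 1: "(r, v) \<in> child_rel T ^^ D v" if "v \<in> nodes T" for v
    using that
  proof (induction "D v" arbitrary: v)
    case 0
    then show ?case using t(9)[of v] by simp
  next
    case (Suc n)
    then have "v \<noteq> r" using t(2) by auto
    then obtain u where u: "(u, v) \<in> child_rel T" using t(8) Suc by blast
    then have "D v = Suc (D u)" "u \<in> nodes T" using t(3,5) by auto
    then show ?case using Suc(1)[of u] Suc(2) u by auto
  qed
  have 2: "D v = k + D u" if "(u, v) \<in> child_rel T ^^ k" for k u v
    using that
  proof (induction k arbitrary: v)
    case (Suc k)
    then obtain w where "(u, w) \<in> child_rel T ^^ k" "(w, v) \<in> child_rel T" by auto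
    then show ?case using Suc.IH[of w] t(5)[of w v] by simp
  qed simp
  show ?thesis unfolding depth_def tree_at_root[OF assms(1)]
  proof (rule Least_equality)
    show "D v \<le> k" if "(r, v) \<in> child_rel T ^^ k" for k
      using 2[OF that] t(2) by simp
  qed (rule 1[OF assms(2)])
qed

lemma rooted_tree_at:
  assumes "rooted_tree T" "nodes T \<noteq> {}"
  shows "tree_at T (tree_root T) (depth T)"
proof -
  have sub: "child_rel T \<subseteq> nodes T \<times> nodes T"
    using assms unfolding rooted_tree_def by (elim conjE)
  obtain r where r': "r \<in> nodes T" "\<forall>u. (u, r) \<notin> child_rel T"
    "\<forall>v\<in>nodes T - {r}. \<exists>!u. (u, v) \<in> child_rel T"
    "\<forall>v\<in>nodes T. (r, v) \<in> (child_rel T)\<^sup>*"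
    using assms unfolding rooted_tree_def by (elim conjE disjE bexE) simp_all
  have r: "r \<in> nodes T" "\<And>u. (u, r) \<notin> child_rel T"
    "\<And>v. v \<in> nodes T - {r} \<Longrightarrow> \<exists>!u. (u, v) \<in> child_rel T"
    "\<And>v. v \<in> nodes T \<Longrightarrow> (r, v) \<in> (child_rel T)\<^sup>*"
    using r' by simp_all
  have root: "tree_root T = r"
    unfolding tree_root_def
  proof (rule the_equality)
    show "v = r" if "v \<in> nodes T \<and> (\<forall>u. (u, v) \<notin> child_rel T)" for v
      using r(3)[of v] that by auto
  qed (use r in auto)
  \<comment> \<open>Parents are unique, so all paths from the root to a node have the same length
    and the least length in \<open>depth\<close> is the only one.\<close>
  have uniq: "j = k" if "(r, v) \<in> child_rel T ^^ j" "(r, v) \<in> child_rel T ^^ k" for v j k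
    using that
  proof (induction j arbitrary: k v)
    case 0
    then show ?case using r(2) by (cases k) auto
  next
    case (Suc j)
    from Suc(2) obtain u where u: "(r, u) \<in> child_rel T ^^ j" "(u, v) \<in> child_rel T" by auto
    then have "v \<noteq> r" using r(2) by auto
    with Suc(3) obtain k' where k: "k = Suc k'" by (cases k) auto
    with Suc(3) obtain u' where u': "(r, u') \<in> child_rel T ^^ k'" "(u', v) \<in> child_rel T" by auto
    have "v \<in> nodes T" using u(2) sub by auto
    then have "u = u'" using r(3)[of v] \<open>v \<noteq> r\<close> u(2) u'(2) by auto
    then show ?case using Suc(1)[OF u(1), of k'] u' k by simp
  qed
  have dep: "depth T v = k" if "(r, v) \<in> child_rel T ^^ k" for v k
    unfolding depth_def root
  proof (rule Least_equality)
    show "k \<le> j" if "(r, v) \<in> child_rel T ^^ j" for j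
      using uniq[OF that \<open>(r, v) \<in> child_rel T ^^ k\<close>] by simp
  qed (rule that)
  show ?thesis unfolding tree_at_def root
  proof (intro conjI allI impI)
    show "depth T r = 0" by (rule dep) simp
    show "depth T v = Suc (depth T u)" if "(u, v) \<in> child_rel T" for u v
    proof -
      have "u \<in> nodes T" using sub \<open>(u, v) \<in> child_rel T\<close> by auto
      then obtain k where "(r, u) \<in> child_rel T ^^ k"
        using r(4)[of u] by (auto simp: rtrancl_power)
      then show ?thesis using dep[of u k] dep[of v "Suc k"] that by auto
    qed
  qed (use r sub in simp_all)
qed

lemma path_mono: "path T \<alpha> n \<Longrightarrow> m \<le> n \<Longrightarrow> path T \<alpha> m"
  by (auto simp: path_def)

lemma path_node:
  assumes "tree_at T r D" "path T \<alpha> n" "i \<le> n"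
  shows "\<alpha> i \<in> nodes T" "D (\<alpha> i) = i"
proof -
  have "\<alpha> i \<in> nodes T \<and> D (\<alpha> i) = i"
    using assms(3)
  proof (induction i)
    case 0
    then show ?case using assms(2) tree_atD(1,2)[OF assms(1)] tree_at_root[OF assms(1)] by (simp add: path_def)
  next
    case (Suc i)
    then have "(\<alpha> i, \<alpha> (Suc i)) \<in> child_rel T" using assms(2) by (simp add: path_def)
    then show ?case using tree_atD(4,5)[OF assms(1)] Suc by fastforce
  qed
  then show "\<alpha> i \<in> nodes T" "D (\<alpha> i) = i" by auto
qed

lemma path_unique:
  assumes "tree_at T r D" "path T \<alpha> i" "path T \<beta> i" "\<alpha> i = \<beta> i" "j \<le> i"
  shows "\<alpha> j = \<beta> j"
  using assms(5,4,2,3)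
proof (induction j rule: inc_induct)
  case (step n)
  then have "\<alpha> (Suc n) = \<beta> (Suc n)" by blast
  moreover have "(\<alpha> n, \<alpha> (Suc n)) \<in> child_rel T" "(\<beta> n, \<beta> (Suc n)) \<in> child_rel T"
    using step by (auto simp: path_def)
  ultimately show ?case using tree_atD(7)[OF assms(1)] by metis
qed

lemma path_ex:
  assumes "tree_at T r D" "v \<in> nodes T"
  obtains \<alpha> where "path T \<alpha> (D v)" "\<alpha> (D v) = v"
  using assms(2)
proof (induction "D v" arbitrary: v thesis)
  case 0
  then show ?case
    using tree_atD(9)[OF assms(1), of v] tree_at_root[OF assms(1)] by (intro 0(2)[of "\<lambda>_. v"]) (auto simp: path_def)
next
  case (Suc n)
  then have "v \<noteq> r" using tree_atD(2)[OF assms(1)] by auto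
  then obtain u where u: "(u, v) \<in> child_rel T" using tree_atD(8)[OF assms(1)] Suc by blast
  then have u': "D v = Suc (D u)" "u \<in> nodes T" using tree_atD(3,5)[OF assms(1)] by auto
  with Suc(1)[of u] Suc(2) obtain \<alpha> where \<alpha>: "path T \<alpha> (D u)" "\<alpha> (D u) = u" by auto
  show ?case
  proof (rule Suc(3))
    show "path T (\<alpha>(D v := v)) (D v)"
      using \<alpha> u u'(1) by (auto simp: path_def less_Suc_eq)
  qed simp
qed

text \<open>Recursion from parent to child, run as recursion on the depth: the k-th iterate is
  correct on nodes of depth k.\<close>

lemma tree_recursion:
  assumes "tree_at T r D"
  obtains f where "f r = c" "\<And>u v. (u, v) \<in> child_rel T \<Longrightarrow> f v = g u v (f u)"
proof -
  define par where "par v = (THE u. (u, v) \<in> child_rel T)" for v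
  have par: "par v = u" if "(u, v) \<in> child_rel T" for u v
    unfolding par_def using that tree_atD(7)[OF assms] by blast
  define F where "F = rec_nat (\<lambda>v. c) (\<lambda>_ G v. g (par v) v (G (par v)))"
  show ?thesis
  proof (rule that[of "\<lambda>v. F (D v) v"])
    show "F (D r) r = c" using tree_atD(2)[OF assms] by (simp add: F_def)
    show "F (D v) v = g u v (F (D u) u)" if "(u, v) \<in> child_rel T" for u v
      using tree_atD(5)[OF assms that] par[OF that] by (simp add: F_def)
  qed
qed

text \<open>This is where leaflessness enters: every node of a tree T(X) lies on the ray of a point,
  so the given tree must be covered by rays as well.\<close>

lemma leafless_ray:
  assumes "tree_at T r D" "leaves T = {}" "v \<in> nodes T"
  obtains \<beta> where "ray T \<beta>" "\<beta> (D v) = v"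
proof -
  obtain \<alpha> where \<alpha>: "path T \<alpha> (D v)" "\<alpha> (D v) = v" by (rule path_ex[OF assms(1,3)])
  define nx where "nx u = (SOME w. (u, w) \<in> child_rel T)" for u
  have nx: "(u, nx u) \<in> child_rel T" if "u \<in> nodes T" for u
    unfolding nx_def using assms(2) that by (rule_tac someI_ex) (auto simp: leaves_def)
  define \<beta> where "\<beta> i = (if i \<le> D v then \<alpha> i else (nx ^^ (i - D v)) v)" for i
  have in_nodes: "(nx ^^ k) v \<in> nodes T" for k
    by (induction k) (use assms(3) nx tree_atD(4)[OF assms(1)] in auto)
  have "(\<beta> i, \<beta> (Suc i)) \<in> child_rel T" for i
  proof (cases "i < D v")
    case True
    then show ?thesis using \<alpha> by (auto simp: \<beta>_def path_def)
  next
    case False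
    then have "\<beta> i = (nx ^^ (i - D v)) v" "\<beta> (Suc i) = nx ((nx ^^ (i - D v)) v)"
      using \<alpha>(2) by (auto simp: \<beta>_def Suc_diff_le)
    then show ?thesis using nx in_nodes by simp
  qed
  then have "ray T \<beta>" using \<alpha>(1) by (auto simp: ray_def path_def \<beta>_def)
  moreover have "\<beta> (D v) = v" using \<alpha>(2) by (simp add: \<beta>_def)
  ultimately show ?thesis using that by blast
qed

subsection \<open>Attached trees\<close>

text \<open>Follows \<alpha> to depth n, then \<gamma> inside the tree attached at \<alpha> n. The
  root of that tree is identified with \<alpha> n, so position n still belongs to \<alpha>.\<close>

definition join_ray :: "(nat \<Rightarrow> 'a) \<Rightarrow> nat \<Rightarrow> (nat \<Rightarrow> 'b) \<Rightarrow> nat \<Rightarrow> 'a + 'a \<times> 'b" where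
  "join_ray \<alpha> n \<gamma> i = (if i \<le> n then Inl (\<alpha> i) else Inr (\<alpha> n, \<gamma> (i - n)))"

lemma attach_simps:
  assumes "tree_at T r D" "W \<subseteq> nodes T" "\<And>v. v \<in> W \<Longrightarrow> tree_at (A v) (\<rho> v) (E v)"
  shows "Inl v \<in> nodes (attach T W A) \<longleftrightarrow> v \<in> nodes T"
    "Inr (v, u) \<in> nodes (attach T W A) \<longleftrightarrow> v \<in> W \<and> u \<in> nodes (A v) \<and> u \<noteq> \<rho> v"
    "(Inl v, Inl w) \<in> child_rel (attach T W A) \<longleftrightarrow> (v, w) \<in> child_rel T"
    "(Inl v, Inr (w, u)) \<in> child_rel (attach T W A) \<longleftrightarrow> v = w \<and> v \<in> W \<and> (\<rho> v, u) \<in> child_rel (A v)"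
    "(Inr (v, u), Inr (w, u')) \<in> child_rel (attach T W A) \<longleftrightarrow>
       v = w \<and> v \<in> W \<and> u \<noteq> \<rho> v \<and> (u, u') \<in> child_rel (A v)"
    "(Inr (v, u), Inl w) \<notin> child_rel (attach T W A)"
proof -
  have root: "tree_root (A v) = \<rho> v" if "v \<in> W" for v
    using tree_at_root[OF assms(3)[OF that]] .
  have nr: "u' \<noteq> \<rho> v" if "v \<in> W" "(u, u') \<in> child_rel (A v)" for u u' v
    using tree_atD(6)[OF assms(3)[OF that(1)]] that(2) by auto
  have c: "(x, y) \<in> child_rel (attach T W A) \<longleftrightarrow>
      (\<exists>u v. x = Inl u \<and> y = Inl v \<and> (u, v) \<in> child_rel T) \<or>
      (\<exists>v u u'. v \<in> W \<and> (u, u') \<in> child_rel (A v) \<and> u' \<noteq> \<rho> v \<and>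
         x = (if u = \<rho> v then Inl v else Inr (v, u)) \<and> y = Inr (v, u'))" (is "?l \<longleftrightarrow> ?a \<or> ?b") for x y
  proof -
    have "?l \<longleftrightarrow> ?a \<or> (\<exists>v u u'. v \<in> W \<and> (u, u') \<in> child_rel (A v) \<and>
         x = (if u = tree_root (A v) then Inl v else Inr (v, u)) \<and>
         y = (if u' = tree_root (A v) then Inl v else Inr (v, u')))"
      unfolding attach_def Let_def by (simp, blast)
    also have "(\<exists>v u u'. v \<in> W \<and> (u, u') \<in> child_rel (A v) \<and>
         x = (if u = tree_root (A v) then Inl v else Inr (v, u)) \<and>
         y = (if u' = tree_root (A v) then Inl v else Inr (v, u'))) \<longleftrightarrow> ?b"
      by ((rule ex_cong1)+) (use nr in \<open>auto simp: root\<close>)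
    finally show ?thesis .
  qed
  have n: "x \<in> nodes (attach T W A) \<longleftrightarrow> (\<exists>v\<in>nodes T. x = Inl v) \<or>
      (\<exists>v u. v \<in> W \<and> u \<in> nodes (A v) \<and> x = (if u = \<rho> v then Inl v else Inr (v, u)))" for x
  proof -
    have "x \<in> nodes (attach T W A) \<longleftrightarrow> (\<exists>v\<in>nodes T. x = Inl v) \<or>
      (\<exists>v u. v \<in> W \<and> u \<in> nodes (A v) \<and> x = (if u = tree_root (A v) then Inl v else Inr (v, u)))"
      unfolding attach_def Let_def by (simp add: image_iff, blast)
    also have "(\<exists>v u. v \<in> W \<and> u \<in> nodes (A v) \<and> x = (if u = tree_root (A v) then Inl v else Inr (v, u))) \<longleftrightarrow>
      (\<exists>v u. v \<in> W \<and> u \<in> nodes (A v) \<and> x = (if u = \<rho> v then Inl v else Inr (v, u)))"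
      by ((rule ex_cong1)+) (auto simp: root)
    finally show ?thesis .
  qed
  show "Inl v \<in> nodes (attach T W A) \<longleftrightarrow> v \<in> nodes T"
    using assms(2) by (auto simp: n split: if_splits)
  show "Inr (v, u) \<in> nodes (attach T W A) \<longleftrightarrow> v \<in> W \<and> u \<in> nodes (A v) \<and> u \<noteq> \<rho> v"
    by (auto simp: n split: if_splits)
  show "(Inl v, Inl w) \<in> child_rel (attach T W A) \<longleftrightarrow> (v, w) \<in> child_rel T"
    by (auto simp: c)
  show "(Inl v, Inr (w, u)) \<in> child_rel (attach T W A) \<longleftrightarrow> v = w \<and> v \<in> W \<and> (\<rho> v, u) \<in> child_rel (A v)"
    using nr by (auto simp: c split: if_splits)
  show "(Inr (v, u), Inr (w, u')) \<in> child_rel (attach T W A) \<longleftrightarrow>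
       v = w \<and> v \<in> W \<and> u \<noteq> \<rho> v \<and> (u, u') \<in> child_rel (A v)"
  proof
    assume "v = w \<and> v \<in> W \<and> u \<noteq> \<rho> v \<and> (u, u') \<in> child_rel (A v)"
    then show "(Inr (v, u), Inr (w, u')) \<in> child_rel (attach T W A)"
      unfolding c using nr by (intro disjI2 exI[of _ v] exI[of _ u] exI[of _ u']) auto
  qed (auto simp: c split: if_splits)
  show "(Inr (v, u), Inl w) \<notin> child_rel (attach T W A)"
    by (auto simp: c)
qed

lemma tree_at_attach:
  assumes "tree_at T r D" "W \<subseteq> nodes T" "\<And>v. v \<in> W \<Longrightarrow> tree_at (A v) (\<rho> v) (E v)"
  shows "tree_at (attach T W A) (Inl r) (case_sum D (\<lambda>(v, u). D v + E v u))"
  unfolding tree_at_def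
proof (intro conjI allI impI ballI)
  note s = attach_simps[OF assms]
  note t = tree_atD[OF assms(1)]
  note a = tree_atD[OF assms(3)]
  show "Inl r \<in> nodes (attach T W A)" using s(1) t(1) by simp
  show "child_rel (attach T W A) \<subseteq> nodes (attach T W A) \<times> nodes (attach T W A)"
  proof (rule subrelI)
    fix x y assume xy: "(x, y) \<in> child_rel (attach T W A)"
    show "(x, y) \<in> nodes (attach T W A) \<times> nodes (attach T W A)"
      using xy t(3,4) a(3,4,6) assms(2)
      by (cases x; cases y) (auto simp: s)
  qed
  show "case_sum D (\<lambda>(v, u). D v + E v u) (Inl r) = 0" using t(2) by simp
  show "case_sum D (\<lambda>(v, u). D v + E v u) y = Suc (case_sum D (\<lambda>(v, u). D v + E v u) x)"
    if "(x, y) \<in> child_rel (attach T W A)" for x y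
    using that t(5) a(5) a(2)
    by (cases x; cases y) (auto simp: s)
  show "\<exists>!u. (u, v) \<in> child_rel (attach T W A)" if v: "v \<in> nodes (attach T W A) - {Inl r}" for v
  proof (cases v)
    case (Inl w)
    then obtain u where u: "(u, w) \<in> child_rel T" using v t(8)[of w] s(1) by auto
    show ?thesis
    proof (rule ex1I[of _ "Inl u"])
      show "x = Inl u" if "(x, v) \<in> child_rel (attach T W A)" for x
        using that t(7)[OF u] Inl by (cases x) (auto simp: s)
    qed (use u Inl in \<open>simp add: s\<close>)
  next
    case (Inr wu)
    then obtain w u where wu: "v = Inr (w, u)" by (cases wu) auto
    then have w: "w \<in> W" "u \<in> nodes (A w)" "u \<noteq> \<rho> w" using v s(2) by auto
    then obtain u' where u': "(u', u) \<in> child_rel (A w)" using a(8) by blast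
    show ?thesis
    proof (rule ex1I[of _ "if u' = \<rho> w then Inl w else Inr (w, u')"])
      show "x = (if u' = \<rho> w then Inl w else Inr (w, u'))" if "(x, v) \<in> child_rel (attach T W A)" for x
        using that a(7)[OF w(1) u'] wu by (cases x) (auto simp: s)
    qed (use u' wu w in \<open>auto simp: s\<close>)
  qed
qed

lemma ray_join:
  assumes "tree_at T r D" "W \<subseteq> nodes T" "\<And>v. v \<in> W \<Longrightarrow> tree_at (A v) (\<rho> v) (E v)"
    "path T \<alpha> n" "\<alpha> n \<in> W" "ray (A (\<alpha> n)) \<gamma>"
  shows "ray (attach T W A) (join_ray \<alpha> n \<gamma>)"
proof -
  note s = attach_simps[OF assms(1-3)]
  have root: "tree_root (attach T W A) = Inl r"
    by (rule tree_at_root[OF tree_at_attach[OF assms(1-3)]])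
  have g: "\<gamma> 0 = \<rho> (\<alpha> n)" "\<And>i. (\<gamma> i, \<gamma> (Suc i)) \<in> child_rel (A (\<alpha> n))"
    using assms(6) tree_at_root[OF assms(3)[OF assms(5)]] by (auto simp: ray_def path_def)
  have g0: "\<gamma> i \<noteq> \<rho> (\<alpha> n)" if "i > 0" for i
    using path_node(2)[OF assms(3)[OF assms(5)] ray_path[OF assms(6)], of i i] that
      tree_atD(2)[OF assms(3)[OF assms(5)]] by (metis order.refl less_numeral_extra(3))
  have "(join_ray \<alpha> n \<gamma> i, join_ray \<alpha> n \<gamma> (Suc i)) \<in> child_rel (attach T W A)" for i
  proof (cases "Suc i \<le> n")
    case True
    then show ?thesis using assms(4) by (simp add: join_ray_def s path_def)
  next
    case False
    then consider "i = n" | "i > n" by linarith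
    then show ?thesis
    proof cases
      case 1
      then show ?thesis using g(2)[of 0] assms(5) by (simp add: join_ray_def s g(1))
    next
      case 2
      then show ?thesis using g(2)[of "i - n"] g0[of "i - n"] assms(5) by (simp add: join_ray_def s Suc_diff_le)
    qed
  qed
  moreover have "join_ray \<alpha> n \<gamma> 0 = Inl r"
    using assms(4) tree_at_root[OF assms(1)] by (simp add: join_ray_def path_def)
  ultimately show ?thesis
    unfolding ray_def path_def root using tree_atD(1)[OF assms(1)] by (simp add: s)
qed

lemma ray_Inl:
  assumes "tree_at T r D" "W \<subseteq> nodes T" "\<And>v. v \<in> W \<Longrightarrow> tree_at (A v) (\<rho> v) (E v)" "ray T \<alpha>"
  shows "ray (attach T W A) (Inl \<circ> \<alpha>)"
  using assms(4) tree_at_root[OF tree_at_attach[OF assms(1-3)]] tree_at_root[OF assms(1)]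
  by (auto simp: ray_def path_def attach_simps[OF assms(1-3)])

text \<open>No edge leads from an attached tree back to T or into another attached tree, so a ray
  stays in T forever or leaves it once, at a definite node.\<close>

lemma ray_attach_cases:
  assumes "tree_at T r D" "W \<subseteq> nodes T" "\<And>v. v \<in> W \<Longrightarrow> tree_at (A v) (\<rho> v) (E v)"
    "ray (attach T W A) \<beta>"
  obtains \<alpha> where "ray T \<alpha>" "\<beta> = Inl \<circ> \<alpha>"
  | \<alpha> n \<gamma> where "path T \<alpha> n" "\<alpha> n \<in> W" "ray (A (\<alpha> n)) \<gamma>" "\<beta> = join_ray \<alpha> n \<gamma>"
proof -
  note s = attach_simps[OF assms(1-3)]
  have b0: "\<beta> 0 = Inl r"
    using assms(4) tree_at_root[OF tree_at_attach[OF assms(1-3)]] by (simp add: ray_def path_def)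
  have b: "(\<beta> i, \<beta> (Suc i)) \<in> child_rel (attach T W A)" for i
    using assms(4) by (auto simp: ray_def path_def)
  define \<alpha> where "\<alpha> i = projl (\<beta> i)" for i
  show ?thesis
  proof (cases "\<forall>i. isl (\<beta> i)")
    case True
    then have "\<beta> = Inl \<circ> \<alpha>" by (auto simp: \<alpha>_def)
    moreover have "ray T \<alpha>"
      using b b0 tree_atD(1)[OF assms(1)] tree_at_root[OF assms(1)] unfolding ray_def path_def calculation by (simp add: s)
    ultimately show ?thesis using that(1) by blast
  next
    case False
    define m where "m = (LEAST i. \<not> isl (\<beta> i))"
    have m1: "\<not> isl (\<beta> m)"
      unfolding m_def by (rule LeastI_ex) (use False in simp)
    have m2: "isl (\<beta> i)" if "i < m" for i
      using not_less_Least[of i "\<lambda>i. \<not> isl (\<beta> i)"] that unfolding m_def by simp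
    obtain n where n: "m = Suc n" using b0 m1 by (cases m) auto
    have \<alpha>: "\<beta> i = Inl (\<alpha> i)" if "i \<le> n" for i
      using m2[of i] that n by (auto simp: \<alpha>_def)
    obtain v u where vu: "\<beta> (Suc n) = Inr (v, u)" using m1 n by (cases "\<beta> m") auto
    have v: "v = \<alpha> n" "\<alpha> n \<in> W" "(\<rho> v, u) \<in> child_rel (A v)"
      using b[of n] unfolding vu \<alpha>[OF order.refl] by (auto simp: s)
    have pa: "path T \<alpha> n"
      unfolding path_def
    proof (intro conjI allI impI)
      show "\<alpha> 0 \<in> nodes T" "\<alpha> 0 = tree_root T"
        using b0 tree_atD(1)[OF assms(1)] tree_at_root[OF assms(1)] by (auto simp: \<alpha>_def)
      show "(\<alpha> i, \<alpha> (Suc i)) \<in> child_rel T" if "i < n" for i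
        using b[of i] \<alpha>[of i] \<alpha>[of "Suc i"] that by (simp add: s)
    qed
    have ex: "\<exists>u. \<beta> (Suc n + k) = Inr (\<alpha> n, u)" for k
    proof (induction k)
      case (Suc k)
      then obtain u where u: "\<beta> (Suc n + k) = Inr (\<alpha> n, u)" by blast
      show ?case using b[of "Suc n + k"] unfolding u by (cases "\<beta> (Suc n + Suc k)") (auto simp: s)
    qed (use vu v in auto)
    define \<gamma> where "\<gamma> i = (if i = 0 then \<rho> (\<alpha> n) else snd (projr (\<beta> (n + i))))" for i
    have \<gamma>: "\<beta> (n + i) = Inr (\<alpha> n, \<gamma> i)" if "i > 0" for i
      using ex[of "i - 1"] that by (auto simp: \<gamma>_def)
    have "\<beta> = join_ray \<alpha> n \<gamma>"
    proof
      fix i show "\<beta> i = join_ray \<alpha> n \<gamma> i"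
        using \<alpha>[of i] \<gamma>[of "i - n"] by (auto simp: join_ray_def)
    qed
    moreover have "ray (A (\<alpha> n)) \<gamma>"
      unfolding ray_def path_def
    proof (intro conjI allI impI)
      note a = assms(3)[OF v(2)]
      show "\<gamma> 0 \<in> nodes (A (\<alpha> n))" "\<gamma> 0 = tree_root (A (\<alpha> n))"
        using tree_atD(1)[OF a] tree_at_root[OF a] by (auto simp: \<gamma>_def)
      show "(\<gamma> i, \<gamma> (Suc i)) \<in> child_rel (A (\<alpha> n))" for i
      proof (cases "i = 0")
        case True
        then show ?thesis using v vu \<gamma>[of 1] by (simp add: \<gamma>_def)
      next
        case False
        then show ?thesis using b[of "n + i"] \<gamma>[of i] \<gamma>[of "Suc i"] by (simp add: s)
      qed
    qed
    ultimately show ?thesis using that(2) pa v(2) by blast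
  qed
qed

text \<open>A node determines its depth, so rays that leave T at different depths agree only as long
  as both are still in T.\<close>

lemma join_ray_eq_iff:
  assumes "tree_at T r D" "path T \<alpha> n" "path T \<alpha>' n'"
  shows "join_ray \<alpha> n \<gamma> j = join_ray \<alpha>' n' \<gamma>' j \<longleftrightarrow>
    (if j \<le> n \<and> j \<le> n' then \<alpha> j = \<alpha>' j else n = n' \<and> \<alpha> n = \<alpha>' n \<and> \<gamma> (j - n) = \<gamma>' (j - n))"
proof -
  have "n = n'" if "\<alpha> n = \<alpha>' n'"
    using path_node(2)[OF assms(1,2), of n] path_node(2)[OF assms(1,3), of n'] that by simp
  then show ?thesis by (auto simp: join_ray_def)
qed

subsection \<open>Products\<close>

lemma tree_prod_simps:
  assumes "tree_at T r D" "tree_at T' r' D'"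
  shows "nodes (tree_prod T T') = {(u, u'). u \<in> nodes T \<and> u' \<in> nodes T' \<and> D u = D' u'}"
    "((u, u'), (v, v')) \<in> child_rel (tree_prod T T') \<longleftrightarrow>
       D u = D' u' \<and> (u, v) \<in> child_rel T \<and> (u', v') \<in> child_rel T'"
  using tree_at_depth[OF assms(1)] tree_at_depth[OF assms(2)] tree_atD(3)[OF assms(1)] tree_atD(3)[OF assms(2)]
  by (auto simp: tree_prod_def)

lemma tree_at_prod:
  assumes "tree_at T r D" "tree_at T' r' D'"
  shows "tree_at (tree_prod T T') (r, r') (D \<circ> fst)"
  unfolding tree_at_def
proof (intro conjI allI impI ballI)
  note s = tree_prod_simps[OF assms]
  note t = tree_atD[OF assms(1)]
  note t' = tree_atD[OF assms(2)]
  show "(r, r') \<in> nodes (tree_prod T T')" using t(1,2) t'(1,2) by (simp add: s)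
  show "child_rel (tree_prod T T') \<subseteq> nodes (tree_prod T T') \<times> nodes (tree_prod T T')"
  proof (rule subrelI)
    fix x y assume xy: "(x, y) \<in> child_rel (tree_prod T T')"
    obtain u u' v v' where e: "x = (u, u')" "y = (v, v')" by (cases x; cases y)
    have 1: "D u = D' u'" "(u, v) \<in> child_rel T" "(u', v') \<in> child_rel T'"
      using xy unfolding e s(2) by auto
    show "(x, y) \<in> nodes (tree_prod T T') \<times> nodes (tree_prod T T')"
      using 1(1) t(3,4,5)[OF 1(2)] t'(3,4,5)[OF 1(3)] by (simp add: e s(1))
  qed
  show "(D \<circ> fst) (r, r') = 0" using t(2) by simp
  show "(D \<circ> fst) y = Suc ((D \<circ> fst) x)" if "(x, y) \<in> child_rel (tree_prod T T')" for x y
    using that t(5) by (cases x; cases y) (auto simp: s)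
  show "\<exists>!u. (u, v) \<in> child_rel (tree_prod T T')" if vin: "v \<in> nodes (tree_prod T T') - {(r, r')}" for v
  proof -
    obtain w w' where v: "v = (w, w')" "w \<in> nodes T" "w' \<in> nodes T'" "D w = D' w'"
      using vin by (cases v) (auto simp: s)
    have "w \<noteq> r" "w' \<noteq> r'"
      using vin v t(2) t'(2) t(9)[of w] t'(9)[of w'] by auto
    then obtain u u' where u: "(u, w) \<in> child_rel T" "(u', w') \<in> child_rel T'"
      using t(8) t'(8) v by blast
    show ?thesis
    proof (rule ex1I[of _ "(u, u')"])
      show "((u, u'), v) \<in> child_rel (tree_prod T T')"
        using u t(5)[OF u(1)] t'(5)[OF u(2)] v by (simp add: s)
      show "x = (u, u')" if "(x, v) \<in> child_rel (tree_prod T T')" for x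
        using that t(7)[OF u(1)] t'(7)[OF u(2)] v by (cases x) (auto simp: s)
    qed
  qed
qed

text \<open>Position i of a ray has depth i in both components, so the layer condition holds by
  itself.\<close>

lemma ray_prod:
  assumes "tree_at T r D" "tree_at T' r' D'"
  shows "ray (tree_prod T T') \<beta> \<longleftrightarrow> ray T (fst \<circ> \<beta>) \<and> ray T' (snd \<circ> \<beta>)"
proof -
  note s = tree_prod_simps[OF assms]
  have root: "tree_root (tree_prod T T') = (r, r')" by (rule tree_at_root[OF tree_at_prod[OF assms]])
  show ?thesis
  proof
    assume b: "ray (tree_prod T T') \<beta>"
    then have "\<beta> 0 = (r, r')" "\<And>i. (\<beta> i, \<beta> (Suc i)) \<in> child_rel (tree_prod T T')"
      unfolding ray_def path_def root by auto
    moreover from this(2) have "(fst (\<beta> i), fst (\<beta> (Suc i))) \<in> child_rel T \<and> (snd (\<beta> i), snd (\<beta> (Suc i))) \<in> child_rel T'" for i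
      by (metis s(2) prod.collapse)
    ultimately show "ray T (fst \<circ> \<beta>) \<and> ray T' (snd \<circ> \<beta>)"
      using tree_at_root[OF assms(1)] tree_at_root[OF assms(2)] tree_atD(1)[OF assms(1)] tree_atD(1)[OF assms(2)]
      by (simp add: ray_def path_def)
  next
    assume b: "ray T (fst \<circ> \<beta>) \<and> ray T' (snd \<circ> \<beta>)"
    have "D (fst (\<beta> i)) = D' (snd (\<beta> i))" for i
      using path_node(2)[OF assms(1) ray_path, of "fst \<circ> \<beta>" i i] path_node(2)[OF assms(2) ray_path, of "snd \<circ> \<beta>" i i] b by simp
    then have "(\<beta> i, \<beta> (Suc i)) \<in> child_rel (tree_prod T T')" for i
      using b s(2)[of "fst (\<beta> i)" "snd (\<beta> i)" "fst (\<beta> (Suc i))" "snd (\<beta> (Suc i))"]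
      by (auto simp: ray_def path_def)
    moreover have "\<beta> 0 = (r, r')"
      using b tree_at_root[OF assms(1)] tree_at_root[OF assms(2)] by (auto simp: ray_def path_def prod_eq_iff)
    ultimately show "ray (tree_prod T T') \<beta>"
      using tree_atD(1,2)[OF assms(1)] tree_atD(1,2)[OF assms(2)] unfolding ray_def path_def root by (simp add: s(1))
  qed
qed

subsection \<open>Labelled trees\<close>

text \<open>
  The labels \<open>E v\<close> of a node record the choices made on the way from the root to \<open>v\<close>; a label
  \<open>c\<close> is acquired at depth \<open>h c\<close>. A coordinate for each label, of valuation \<open>h c\<close>, embeds the
  tree isometrically.
\<close>

definition labelled :: "'a rtree \<Rightarrow> 'a \<Rightarrow> ('a \<Rightarrow> nat) \<Rightarrow> ('a \<Rightarrow> 'c set) \<Rightarrow> ('c \<Rightarrow> nat) \<Rightarrow> bool" where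
  "labelled T r D E h \<longleftrightarrow> tree_at T r D \<and> E r = {} \<and>
     (\<forall>u v. (u, v) \<in> child_rel T \<longrightarrow> E v = E u \<or> (\<exists>c. c \<notin> E u \<and> E v = insert c (E u) \<and> h c = D u)) \<and>
     (\<forall>u\<in>nodes T. \<forall>v\<in>nodes T. D u = D v \<and> E u = E v \<longrightarrow> u = v)"

lemma labelled_tree_at: "labelled T r D E h \<Longrightarrow> tree_at T r D"
  by (simp add: labelled_def)

text \<open>A label acquired at depth i is present from depth i + 1 on and is never lost; filtering
  the labels of a deep node by acquisition depth thus recovers those of each ancestor.\<close>

lemma labels_below:
  assumes "labelled T r D E h" "path T \<alpha> n" "j \<le> n"
  shows "{c \<in> E (\<alpha> n). h c < j} = E (\<alpha> j)"
proof -
  have tr: "tree_at T r D" using assms(1) by (rule labelled_tree_at)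
  have acq: "E (\<alpha> (Suc i)) = E (\<alpha> i) \<or> (\<exists>c. c \<notin> E (\<alpha> i) \<and> E (\<alpha> (Suc i)) = insert c (E (\<alpha> i)) \<and> h c = i)"
    if "i < n" for i
  proof -
    have "(\<alpha> i, \<alpha> (Suc i)) \<in> child_rel T" using assms(2) that by (simp add: path_def)
    then have "E (\<alpha> (Suc i)) = E (\<alpha> i) \<or> (\<exists>c. c \<notin> E (\<alpha> i) \<and> E (\<alpha> (Suc i)) = insert c (E (\<alpha> i)) \<and> h c = D (\<alpha> i))"
      using assms(1) unfolding labelled_def by blast
    then show ?thesis using path_node(2)[OF tr assms(2), of i] that by simp
  qed
  have less: "\<forall>c\<in>E (\<alpha> i). h c < i" if "i \<le> n" for i
    using that
  proof (induction i)
    case 0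
    then show ?case
      using assms(1,2) tree_at_root[OF tr] by (auto simp: labelled_def path_def)
  next
    case (Suc i)
    then have "\<forall>c\<in>E (\<alpha> i). h c < i" by simp
    then show ?case using acq[of i] Suc.prems by (auto simp: less_Suc_eq)
  qed
  have "{c \<in> E (\<alpha> i). h c < j} = E (\<alpha> j)" if "j \<le> i" "i \<le> n" for i
    using that
  proof (induction i rule: dec_induct)
    case base
    then show ?case using less[of j] by auto
  next
    case (step i)
    then show ?case using acq[of i] by auto
  qed
  then show ?thesis using assms(3) by blast
qed

lemma labels_eq_iff:
  assumes "labelled T r D E h" "path T \<alpha> j" "path T \<beta> j"
  shows "E (\<alpha> j) = E (\<beta> j) \<longleftrightarrow> \<alpha> j = \<beta> j"
proof -
  have tr: "tree_at T r D" using assms(1) by (rule labelled_tree_at)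
  show ?thesis
    using assms(1) path_node[OF tr assms(2), of j] path_node[OF tr assms(3), of j] unfolding labelled_def by auto
qed

text \<open>The labels of a node are its ancestors, itself included and the root excluded, because
  reaching the root involves no choice.\<close>

lemma ancestor_labels:
  assumes "tree_at T r D"
  obtains E where "E r = {}" "\<And>u v. (u, v) \<in> child_rel T \<Longrightarrow> E v = insert v (E u)"
    "\<And>v. v \<in> nodes T \<Longrightarrow> E v \<subseteq> {u \<in> nodes T. D u \<le> D v}"
    "\<And>v u. v \<in> nodes T \<Longrightarrow> u \<in> E v \<Longrightarrow> D u = D v \<Longrightarrow> u = v"
    "\<And>v. v \<in> nodes T \<Longrightarrow> v \<noteq> r \<Longrightarrow> v \<in> E v" "\<And>v. v \<in> nodes T \<Longrightarrow> r \<notin> E v"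
proof -
  obtain E where E: "E r = {}" "\<And>u v. (u, v) \<in> child_rel T \<Longrightarrow> E v = insert v (E u)"
    by (rule tree_recursion[OF assms, of "{}" "\<lambda>u v A. insert v A"]) blast
  have 1: "E v \<subseteq> {u \<in> nodes T. D u \<le> D v} \<and> (\<forall>u\<in>E v. D u = D v \<longrightarrow> u = v) \<and> r \<notin> E v" if "v \<in> nodes T" for v
    using that
  proof (induction "D v" arbitrary: v)
    case 0
    then show ?case using tree_atD(9)[OF assms, of v] E(1) by auto
  next
    case (Suc n)
    then have "v \<noteq> r" using tree_atD(2)[OF assms] by auto
    then obtain u where u: "(u, v) \<in> child_rel T" using tree_atD(8)[OF assms] Suc by blast
    then have u': "D v = Suc (D u)" "u \<in> nodes T" using tree_atD(3,5)[OF assms] by auto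
    have IH: "E u \<subseteq> {w \<in> nodes T. D w \<le> D u}" "r \<notin> E u" using Suc(1)[of u] Suc(2) u' by auto
    show ?case unfolding E(2)[OF u] using IH u' Suc(3) \<open>v \<noteq> r\<close> by fastforce
  qed
  have "v \<in> E v" if "v \<in> nodes T" "v \<noteq> r" for v
    using tree_atD(8)[OF assms that] E(2) by blast
  with that[of E] E 1 show ?thesis by blast
qed

lemma labelled_self:
  assumes "tree_at T r D"
  obtains E where "labelled T r D E (\<lambda>c. D c - 1)" "\<And>v. v \<in> nodes T \<Longrightarrow> E v \<subseteq> nodes T"
proof -
  obtain E where E: "E r = {}" "\<And>u v. (u, v) \<in> child_rel T \<Longrightarrow> E v = insert v (E u)"
    "\<And>v. v \<in> nodes T \<Longrightarrow> E v \<subseteq> {u \<in> nodes T. D u \<le> D v}"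
    "\<And>v u. v \<in> nodes T \<Longrightarrow> u \<in> E v \<Longrightarrow> D u = D v \<Longrightarrow> u = v"
    "\<And>v. v \<in> nodes T \<Longrightarrow> v \<noteq> r \<Longrightarrow> v \<in> E v" "\<And>v. v \<in> nodes T \<Longrightarrow> r \<notin> E v"
    by (rule ancestor_labels[OF assms]) blast
  \<comment> \<open>The child c is chosen at its parent, hence at depth \<open>D c - 1\<close>; the
    subtraction is never truncated on labels, as the root is not among them.\<close>
  have "labelled T r D E (\<lambda>c. D c - 1)"
    unfolding labelled_def
  proof (intro conjI allI impI ballI)
    fix u v assume uv: "(u, v) \<in> child_rel T"
    have "v \<notin> E u" using E(3)[of u] tree_atD(3,5)[OF assms uv] by auto
    then show "E v = E u \<or> (\<exists>c. c \<notin> E u \<and> E v = insert c (E u) \<and> D c - 1 = D u)"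
      using E(2)[OF uv] tree_atD(5)[OF assms uv] by auto
  next
    fix u v assume "u \<in> nodes T" "v \<in> nodes T" and uv: "D u = D v \<and> E u = E v"
    then show "u = v" using E(1,4,5) by (metis empty_iff)
  qed (use assms E(1) in auto)
  with that[of E] E(3) show ?thesis by blast
qed

subsection \<open>Skeletons\<close>

definition admissible_lengths :: "nat rtree \<Rightarrow> (nat \<times> nat \<Rightarrow> int extended) \<Rightarrow> bool" where
  "admissible_lengths S L \<longleftrightarrow> (\<forall>u v. (u, v) \<in> child_rel S \<longrightarrow>
     L (u, v) = \<infinity> \<and> v \<in> leaves S \<or> (\<exists>k>0. L (u, v) = Fin (int k)))"

text \<open>The position map that is local to \<open>skeleton\<close>, made available by
  name.\<close>

definition skel_pos :: "(nat \<times> nat \<Rightarrow> int extended) \<Rightarrow> nat \<times> nat \<Rightarrow> nat \<Rightarrow> skel_node" where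
  "skel_pos L e i = (if i = 0 then Joint (fst e) else if Fin (int i) = L e then Joint (snd e) else Inner e i)"

text \<open>Only finite bones are constrained, so the value at a virtual joint is arbitrary.\<close>

definition joint_depths :: "nat rtree \<Rightarrow> nat \<Rightarrow> (nat \<times> nat \<Rightarrow> int extended) \<Rightarrow> (nat \<Rightarrow> nat) \<Rightarrow> bool" where
  "joint_depths S r L jd \<longleftrightarrow> jd r = 0 \<and>
     (\<forall>u v k. (u, v) \<in> child_rel S \<and> L (u, v) = Fin (int k) \<longrightarrow> jd v = jd u + k)"

definition skel_depth :: "(nat \<Rightarrow> nat) \<Rightarrow> skel_node \<Rightarrow> nat" where
  "skel_depth jd v = (case v of Joint w \<Rightarrow> jd w | Inner e i \<Rightarrow> jd (fst e) + i)"

text \<open>An inner node bears the labels of the lower end of its bone: the choice is made on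
  entering the bone, at the depth of its upper end, and not on reaching the next joint.\<close>

definition skel_labels :: "(nat \<Rightarrow> nat set) \<Rightarrow> skel_node \<Rightarrow> nat set" where
  "skel_labels E v = (case v of Joint w \<Rightarrow> E w | Inner e i \<Rightarrow> E (snd e))"

lemma joint_depths_ex:
  assumes "tree_at S r D"
  obtains jd where "joint_depths S r L jd"
proof -
  obtain jd where j: "jd r = 0" "\<And>u v. (u, v) \<in> child_rel S \<Longrightarrow>
      jd v = jd u + (case L (u, v) of Fin k \<Rightarrow> nat k | _ \<Rightarrow> 0)"
    by (rule tree_recursion[OF assms, of 0 "\<lambda>u v n. n + (case L (u, v) of Fin k \<Rightarrow> nat k | _ \<Rightarrow> 0)"]) blast
  have "jd v = jd u + k" if "(u, v) \<in> child_rel S" "L (u, v) = Fin (int k)" for u v k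
    using j(2)[OF that(1)] that(2) by simp
  then have "joint_depths S r L jd" using j(1) by (simp add: joint_depths_def)
  then show ?thesis by (rule that)
qed

lemma skeleton_simps:
  "nodes (skeleton S L) = Joint ` real_joints S L \<union> {Inner e i | e i. e \<in> child_rel S \<and> 0 < i \<and> Fin (int i) < L e}"
  "child_rel (skeleton S L) =
     {(skel_pos L e i, skel_pos L e (Suc i)) | e i. e \<in> child_rel S \<and> Fin (int i) < L e}"
  by (simp_all add: skeleton_def Let_def skel_pos_def)

locale skel =
  fixes S :: "nat rtree" and r D L jd
  assumes S: "tree_at S r D" and L: "admissible_lengths S L" and jd: "joint_depths S r L jd"
begin

lemma jd_root: "jd r = 0"
  using jd by (simp add: joint_depths_def)

lemma jd_bone: "e \<in> child_rel S \<Longrightarrow> L e = Fin (int k) \<Longrightarrow> jd (snd e) = jd (fst e) + k"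
  using jd unfolding joint_depths_def by (cases e) auto

lemma length_cases:
  assumes "e \<in> child_rel S"
  obtains "L e = \<infinity>" "snd e \<in> leaves S" | k where "k > 0" "L e = Fin (int k)"
  using L assms unfolding admissible_lengths_def by (cases e) auto

lemma real_upper:
  assumes "e \<in> child_rel S"
  shows "fst e \<in> real_joints S L"
  unfolding real_joints_def
proof (intro CollectI conjI allI impI)
  show "fst e \<in> nodes S" using assms tree_atD(3)[OF S] by (cases e) auto
  fix u assume u: "(u, fst e) \<in> child_rel S"
  have "fst e \<notin> leaves S" using assms by (cases e) (auto simp: leaves_def)
  with u show "L (u, fst e) \<noteq> \<infinity>" by (auto elim!: length_cases)
qed

lemma real_lower:
  assumes "e \<in> child_rel S" "L e \<noteq> \<infinity>"
  shows "snd e \<in> real_joints S L"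
  unfolding real_joints_def
proof (intro CollectI conjI allI impI)
  show "snd e \<in> nodes S" using assms tree_atD(4)[OF S] by (cases e) auto
  fix u assume u: "(u, snd e) \<in> child_rel S"
  then have "u = fst e" using tree_atD(7)[OF S u, of "fst e"] assms(1) by simp
  then show "L (u, snd e) \<noteq> \<infinity>" using assms(2) by simp
qed

lemma real_root: "r \<in> real_joints S L"
  using tree_atD(1,6)[OF S] by (simp add: real_joints_def)

lemma pos_0 [simp]: "skel_pos L e 0 = Joint (fst e)"
  by (simp add: skel_pos_def)

lemma pos_node:
  assumes "e \<in> child_rel S" "Fin (int i) \<le> L e"
  shows "skel_pos L e i \<in> nodes (skeleton S L)"
proof -
  consider "i = 0" | "i \<noteq> 0" "Fin (int i) = L e" | "i \<noteq> 0" "Fin (int i) < L e"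
    using assms(2) by fastforce
  then show ?thesis
  proof cases
    case 1
    then show ?thesis using real_upper[OF assms(1)] by (simp add: skeleton_simps)
  next
    case 2
    then have "snd e \<in> real_joints S L" by (intro real_lower assms(1)) (metis extended.distinct(1))
    then show ?thesis using 2 by (simp add: skeleton_simps skel_pos_def)
  next
    case 3
    then have "skel_pos L e i = Inner e i" by (auto simp: skel_pos_def)
    then show ?thesis using 3 assms(1) by (cases e) (auto simp: skeleton_simps)
  qed
qed

lemma pos_depth:
  assumes "e \<in> child_rel S" "Fin (int i) \<le> L e"
  shows "skel_depth jd (skel_pos L e i) = jd (fst e) + i"
  using jd_bone[OF assms(1), of i] by (auto simp: skel_depth_def skel_pos_def)

lemma pos_labels: "i > 0 \<Longrightarrow> skel_labels E (skel_pos L e i) = E (snd e)"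
  "skel_labels E (skel_pos L e 0) = E (fst e)"
  by (auto simp: skel_labels_def skel_pos_def)

text \<open>A joint other than the root is the last position on the finite bone above it, so the
  positions with positive index on bones exhaust all nodes but the root.\<close>

lemma node_cases:
  assumes "v \<in> nodes (skeleton S L)"
  obtains "v = Joint r" | e i where "e \<in> child_rel S" "0 < i" "Fin (int i) \<le> L e" "v = skel_pos L e i"
proof (cases v)
  case (Joint w)
  then have w: "w \<in> real_joints S L" using assms by (auto simp: skeleton_simps)
  show ?thesis
  proof (cases "w = r")
    case False
    then obtain u where u: "(u, w) \<in> child_rel S"
      using tree_atD(8)[OF S, of w] w by (auto simp: real_joints_def)
    then have fin: "L (u, w) \<noteq> \<infinity>" using w by (auto simp: real_joints_def)
    from u show ?thesis
    proof (cases rule: length_cases)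
      case (2 k)
      then show ?thesis using that(2)[of "(u, w)" k] u Joint by (simp add: skel_pos_def)
    qed (use fin in simp)
  qed (use that Joint in simp)
next
  case (Inner e i)
  then have "e \<in> child_rel S" "0 < i" "Fin (int i) < L e" using assms by (auto simp: skeleton_simps)
  then show ?thesis using that(2)[of e i] Inner by (auto simp: skel_pos_def)
qed

lemma bone_eqI:
  assumes "e \<in> child_rel S" "e' \<in> child_rel S" "snd e = snd e'"
  shows "e = e'"
proof -
  obtain u v u' v' where e: "e = (u, v)" "e' = (u', v')" by (cases e; cases e')
  then have "(u, v) \<in> child_rel S" "(u', v) \<in> child_rel S" "v = v'" using assms by auto
  then show ?thesis using tree_atD(7)[OF S] e by blast
qed

lemma pos_inj:
  assumes "e \<in> child_rel S" "e' \<in> child_rel S" "0 < i" "0 < i'"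
    "skel_pos L e i = skel_pos L e' i'"
  shows "e = e'" "i = i'"
proof -
  have "e = e'" if "snd e = snd e'"
    using bone_eqI[OF assms(1,2) that] .
  then have "e = e' \<and> i = i'"
    using assms(3-5) unfolding skel_pos_def by (auto split: if_splits) (metis extended.inject of_nat_eq_iff)
  then show "e = e'" "i = i'" by auto
qed

lemma edge_iff:
  "(x, y) \<in> child_rel (skeleton S L) \<longleftrightarrow>
    (\<exists>e i. e \<in> child_rel S \<and> Fin (int i) < L e \<and> x = skel_pos L e i \<and> y = skel_pos L e (Suc i))"
  unfolding skeleton_simps by auto

lemma Suc_le_length: "e \<in> child_rel S \<Longrightarrow> Fin (int i) < L e \<Longrightarrow> Fin (int (Suc i)) \<le> L e"
  by (cases "L e") auto

lemma tree_at_skeleton: "tree_at (skeleton S L) (Joint r) (skel_depth jd)"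
  unfolding tree_at_def
proof (intro conjI allI impI ballI)
  show "Joint r \<in> nodes (skeleton S L)" using real_root by (simp add: skeleton_simps)
  show "child_rel (skeleton S L) \<subseteq> nodes (skeleton S L) \<times> nodes (skeleton S L)"
  proof (rule subrelI)
    fix x y assume "(x, y) \<in> child_rel (skeleton S L)"
    then obtain e i where e: "e \<in> child_rel S" "Fin (int i) < L e" "x = skel_pos L e i" "y = skel_pos L e (Suc i)"
      unfolding edge_iff by auto
    then show "(x, y) \<in> nodes (skeleton S L) \<times> nodes (skeleton S L)"
      using pos_node[OF e(1), of i] pos_node[OF e(1) Suc_le_length[OF e(1,2)]] by simp
  qed
  show "skel_depth jd (Joint r) = 0" by (simp add: skel_depth_def jd_root)
  show "skel_depth jd y = Suc (skel_depth jd x)" if xy: "(x, y) \<in> child_rel (skeleton S L)" for x y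
  proof -
    obtain e i where e: "e \<in> child_rel S" "Fin (int i) < L e" "x = skel_pos L e i" "y = skel_pos L e (Suc i)"
      using xy unfolding edge_iff by auto
    then show ?thesis
      using pos_depth[OF e(1), of i] pos_depth[OF e(1) Suc_le_length[OF e(1,2)]] by simp
  qed
  show "\<exists>!u. (u, v) \<in> child_rel (skeleton S L)" if v: "v \<in> nodes (skeleton S L) - {Joint r}" for v
  proof -
    have "v \<in> nodes (skeleton S L)" "v \<noteq> Joint r" using v by auto
    then obtain e i where e: "e \<in> child_rel S" "0 < i" "Fin (int i) \<le> L e" "v = skel_pos L e i"
      by (elim node_cases) simp_all
    then obtain j where j: "i = Suc j" by (cases i) auto
    show ?thesis
    proof (rule ex1I[of _ "skel_pos L e j"])
      show "(skel_pos L e j, v) \<in> child_rel (skeleton S L)"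
        unfolding edge_iff using e j by (intro exI[of _ e] exI[of _ j]) (cases "L e"; auto)
      fix u assume "(u, v) \<in> child_rel (skeleton S L)"
      then obtain e' i' where "e' \<in> child_rel S" "u = skel_pos L e' i'" "v = skel_pos L e' (Suc i')"
        unfolding edge_iff by auto
      then show "u = skel_pos L e j"
        using pos_inj[of e e' i "Suc i'"] e j by auto
    qed
  qed
qed

lemma joint_depth_eq: "joint_depth S L w = (if w \<in> real_joints S L then Fin (int (jd w)) else \<infinity>)"
  using tree_at_depth[OF tree_at_skeleton, of "Joint w"]
  by (auto simp: joint_depth_def skeleton_simps skel_depth_def)

lemma labelled_skeleton:
  assumes E: "E r = {}" "\<And>u v. (u, v) \<in> child_rel S \<Longrightarrow> E v = insert v (E u)"
    "\<And>v. v \<in> nodes S \<Longrightarrow> E v \<subseteq> {u \<in> nodes S. D u \<le> D v}"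
    "\<And>v u. v \<in> nodes S \<Longrightarrow> u \<in> E v \<Longrightarrow> D u = D v \<Longrightarrow> u = v"
    "\<And>v. v \<in> nodes S \<Longrightarrow> v \<noteq> r \<Longrightarrow> v \<in> E v"
    and h: "\<And>u v. (u, v) \<in> child_rel S \<Longrightarrow> h v = jd u"
  shows "labelled (skeleton S L) (Joint r) (skel_depth jd) (skel_labels E) h"
  unfolding labelled_def
proof (intro conjI allI impI ballI)
  show "tree_at (skeleton S L) (Joint r) (skel_depth jd)" by (rule tree_at_skeleton)
  show "skel_labels E (Joint r) = {}" using E(1) by (simp add: skel_labels_def)
next
  fix x y assume "(x, y) \<in> child_rel (skeleton S L)"
  then obtain e i where e: "e \<in> child_rel S" "Fin (int i) < L e" "x = skel_pos L e i" "y = skel_pos L e (Suc i)"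
    unfolding edge_iff by auto
  show "skel_labels E y = skel_labels E x \<or>
     (\<exists>c. c \<notin> skel_labels E x \<and> skel_labels E y = insert c (skel_labels E x) \<and> h c = skel_depth jd x)"
  proof (cases "i = 0")
    case True
    have e': "(fst e, snd e) \<in> child_rel S" using e(1) by simp
    have "snd e \<notin> E (fst e)"
      using E(3)[of "fst e"] tree_atD(3,5)[OF S e'] by auto
    then show ?thesis
      using E(2)[OF e'] h[OF e'] True e(3,4) pos_labels(1)[of 1] by (auto simp: skel_labels_def skel_depth_def)
  next
    case False
    then show ?thesis using e(3,4) pos_labels(1) by simp
  qed
next
  fix x y assume x: "x \<in> nodes (skeleton S L)" and y: "y \<in> nodes (skeleton S L)"
    and xy: "skel_depth jd x = skel_depth jd y \<and> skel_labels E x = skel_labels E y"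
  have ne: "snd e \<in> E (snd e)" "snd e \<in> nodes S" if "e \<in> child_rel S" for e
    using E(2)[of "fst e" "snd e"] tree_atD(4)[OF S, of "fst e" "snd e"] that by auto
  from x show "x = y"
  proof (cases rule: node_cases)
    case 1
    from y show ?thesis
    proof (cases rule: node_cases)
      case (2 e i)
      then show ?thesis using xy 1 E(1) pos_labels(1)[of i E e] ne(1)[of e] by (auto simp: skel_labels_def)
    qed (use 1 in simp)
  next
    case x': (2 e i)
    from y show ?thesis
    proof (cases rule: node_cases)
      case 1
      then show ?thesis using xy x' E(1) pos_labels(1)[of i E e] ne(1)[of e] by (auto simp: skel_labels_def)
    next
      case y': (2 e' i')
      \<comment> \<open>The lower end of its bone is the deepest label of a node. Equal label sets
        therefore give the same bone, and the depth then fixes the position on it.\<close>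
      have eq: "E (snd e) = E (snd e')" using xy x' y' pos_labels(1) by simp
      have "D (snd e) \<le> D (snd e')" "D (snd e') \<le> D (snd e)"
        using E(3)[OF ne(2)[OF y'(1)]] E(3)[OF ne(2)[OF x'(1)]] ne(1)[OF x'(1)] ne(1)[OF y'(1)] eq by auto
      then have "snd e = snd e'"
        using E(4)[OF ne(2)[OF y'(1)], of "snd e"] ne(1)[OF x'(1)] eq by simp
      then have "e = e'" by (rule bone_eqI[OF x'(1) y'(1)])
      moreover have "i = i'"
        using xy x' y' pos_depth[OF x'(1,3)] pos_depth[OF y'(1,3)] \<open>e = e'\<close> by simp
      ultimately show ?thesis using x'(4) y'(4) by simp
    qed
  qed
qed

lemma infinite_bone_ray:
  assumes "e \<in> child_rel S" "L e = \<infinity>"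
  obtains \<alpha> where "ray (skeleton S L) \<alpha>" "\<And>i. \<alpha> (jd (fst e) + i) = skel_pos L e i"
proof -
  have "Joint (fst e) \<in> nodes (skeleton S L)" using real_upper[OF assms(1)] by (simp add: skeleton_simps)
  then obtain \<beta> where \<beta>: "path (skeleton S L) \<beta> (jd (fst e))" "\<beta> (jd (fst e)) = Joint (fst e)"
    using path_ex[OF tree_at_skeleton, of "Joint (fst e)"] by (auto simp: skel_depth_def)
  define \<alpha> where "\<alpha> i = (if i \<le> jd (fst e) then \<beta> i else skel_pos L e (i - jd (fst e)))" for i
  have a: "\<alpha> (jd (fst e) + i) = skel_pos L e i" for i
    using \<beta>(2) by (auto simp: \<alpha>_def)
  have "(\<alpha> i, \<alpha> (Suc i)) \<in> child_rel (skeleton S L)" for i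
  proof (cases "i < jd (fst e)")
    case True
    then show ?thesis using \<beta>(1) by (simp add: \<alpha>_def path_def)
  next
    case False
    then obtain k where "i = jd (fst e) + k" using le_Suc_ex not_less by metis
    then show ?thesis using a[of k] a[of "Suc k"] assms unfolding edge_iff by (intro exI[of _ e] exI[of _ k]) auto
  qed
  moreover have "\<alpha> 0 = \<beta> 0" by (simp add: \<alpha>_def)
  ultimately have "ray (skeleton S L) \<alpha>" using \<beta>(1) unfolding ray_def path_def by auto
  then show ?thesis using a that by blast
qed

text \<open>S is finite, so beyond some depth there are no real joints and a ray can only run down
  an infinite bone.\<close>

lemma ray_in_infinite_bone:
  assumes "finite (nodes S)" "ray (skeleton S L) \<beta>"
  obtains e i where "e \<in> child_rel S" "L e = \<infinity>" "jd (fst e) + i \<ge> j" "\<beta> (jd (fst e) + i) = skel_pos L e i"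
proof -
  define J where "J = Suc (j + Max (jd ` nodes S))"
  have J: "jd w < J" if "w \<in> nodes S" for w
  proof -
    have "jd w \<le> Max (jd ` nodes S)" using assms(1) that by (intro Max_ge) auto
    then show ?thesis by (simp add: J_def)
  qed
  have b: "\<beta> J \<in> nodes (skeleton S L)" "skel_depth jd (\<beta> J) = J"
    using path_node[OF tree_at_skeleton ray_path[OF assms(2)], of J J] by auto
  from b(1) show ?thesis
  proof (cases rule: node_cases)
    case 1
    then show ?thesis using b(2) J[OF tree_atD(1)[OF S]] by (simp add: skel_depth_def)
  next
    case (2 e i)
    have d: "jd (fst e) + i = J" using b(2) pos_depth[OF 2(1,3)] 2(4) by simp
    from 2(1) show ?thesis
    proof (cases rule: length_cases)
      case 1
      then show ?thesis using that[OF 2(1), of i] d 2(4) by (simp add: J_def)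
    next
      case (2 k)
      then have "jd (snd e) < J" using J[of "snd e"] tree_atD(4)[OF S, of "fst e" "snd e"] \<open>e \<in> child_rel S\<close> by simp
      then show ?thesis using jd_bone[OF \<open>e \<in> child_rel S\<close> 2(2)] d \<open>Fin (int i) \<le> L e\<close> 2(2) by simp
    qed
  qed
qed

end

subsection \<open>Trees of balls\<close>

lemma mem_padic_ball:
  "z \<in> padic_ball n x k \<longleftrightarrow> length z = n \<and> (\<forall>i<n. z ! i - x ! i \<in> pball (int k))"
proof -
  have "(\<exists>z\<in>padic_integers. y = x + of_nat CARD('a) ^ k * z) \<longleftrightarrow> y - x \<in> pball (int k)" for x y :: "'a padic"
    unfolding pball_def by (auto simp: algebra_simps)
  then show ?thesis by (simp add: padic_ball_def)
qed

lemma padic_ball_eq_iff: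
  assumes "length x = n" "length y = n"
  shows "padic_ball n x k = padic_ball n y k \<longleftrightarrow> (\<forall>i<n. x ! i - y ! i \<in> pball (int k))"
proof
  assume "padic_ball n x k = padic_ball n y k"
  moreover have "x \<in> padic_ball n x k" using assms by (simp add: mem_padic_ball)
  ultimately show "\<forall>i<n. x ! i - y ! i \<in> pball (int k)" using mem_padic_ball by blast
next
  assume *: "\<forall>i<n. x ! i - y ! i \<in> pball (int k)"
  have "z ! i - x ! i \<in> pball (int k) \<longleftrightarrow> z ! i - y ! i \<in> pball (int k)" if "i < n" for z i
    using * that pball_trans[of "z ! i" "x ! i" "int k" "y ! i"] pball_trans[of "z ! i" "y ! i" "int k" "x ! i"]
    by (auto simp: pball_diff_commute[of "y ! i"])
  then show "padic_ball n x k = padic_ball n y k" by (auto simp: mem_padic_ball)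
qed

text \<open>Balls of equal depth coincide once they share a point, so each ball meeting X may be
  centred in X; for X inside Z_p^n integrality of the ball is then automatic.\<close>

lemma ball_tree_simps:
  assumes "\<And>x. x \<in> X \<Longrightarrow> length x = n \<and> set x \<subseteq> padic_integers"
  shows "nodes (ball_tree n X) = {(k, padic_ball n x k) | k x. x \<in> X}"
    "child_rel (ball_tree n X) = {((k, padic_ball n x k), (Suc k, padic_ball n x (Suc k))) | k x. x \<in> X}"
proof -
  have self: "x \<in> padic_ball n x k" if "x \<in> X" for x k
    using assms[OF that] by (simp add: mem_padic_ball)
  have int: "padic_ball n x k \<subseteq> lists padic_integers" if "x \<in> X" for x k
  proof
    fix z assume z: "z \<in> padic_ball n x k"
    have "z ! i \<in> padic_integers" if "i < length z" for i
    proof -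
      have "i < n" "z ! i - x ! i \<in> pball 0"
        using z that pball_antimono[of "z ! i - x ! i" "int k" 0] by (auto simp: mem_padic_ball)
      moreover have "x ! i \<in> pball 0" using assms[OF \<open>x \<in> X\<close>] \<open>i < n\<close> by (auto simp: pball_0)
      ultimately show ?thesis using pball_add[of "z ! i - x ! i" 0 "x ! i"] by (simp add: pball_0)
    qed
    then show "z \<in> lists padic_integers" by (auto simp: in_set_conv_nth)
  qed
  have eq: "padic_ball n x k = padic_ball n y k" if "y \<in> padic_ball n x k" "length x = n" for x y k
    using that by (subst padic_ball_eq_iff) (auto simp: mem_padic_ball pball_diff_commute)
  have N: "{(k, padic_ball n x k) | k x. length x = n \<and> padic_ball n x k \<subseteq> lists padic_integers \<and>
      padic_ball n x k \<inter> X \<noteq> {}} = {(k, padic_ball n x k) | k x. x \<in> X}" (is "?N = ?N'")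
  proof (intro subset_antisym subsetI)
    fix z assume "z \<in> ?N"
    then obtain k x y where "z = (k, padic_ball n x k)" "length x = n" "y \<in> padic_ball n x k" "y \<in> X" by blast
    then show "z \<in> ?N'" using eq[of y x k] by auto
  next
    fix z assume "z \<in> ?N'"
    then obtain k x where "z = (k, padic_ball n x k)" "x \<in> X" by blast
    then show "z \<in> ?N" using self[of x k] int[of x k] assms[of x] by blast
  qed
  then show "nodes (ball_tree n X) = ?N'" by (simp add: ball_tree_def Let_def)
  have "child_rel (ball_tree n X) = {((k, B), (k', B')). (k, B) \<in> ?N' \<and> (k', B') \<in> ?N' \<and> k' = Suc k \<and> B' \<subseteq> B}"
    unfolding ball_tree_def Let_def N by simp
  also have "\<dots> = {((k, padic_ball n x k), (Suc k, padic_ball n x (Suc k))) | k x. x \<in> X}" (is "?C = ?C'")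
  proof (intro subset_antisym subsetI)
    fix z assume "z \<in> ?C"
    then obtain k x y where z: "z = ((k, padic_ball n x k), (Suc k, padic_ball n y (Suc k)))" "x \<in> X" "y \<in> X"
      "padic_ball n y (Suc k) \<subseteq> padic_ball n x k" by blast
    then have "padic_ball n x k = padic_ball n y k" using self[of y "Suc k"] assms[of x] by (intro eq) auto
    then show "z \<in> ?C'" using z by auto
  next
    fix z assume "z \<in> ?C'"
    then obtain k x where z: "z = ((k, padic_ball n x k), (Suc k, padic_ball n x (Suc k)))" "x \<in> X" by blast
    moreover have "padic_ball n x (Suc k) \<subseteq> padic_ball n x k"
    proof
      fix y assume "y \<in> padic_ball n x (Suc k)"
      then show "y \<in> padic_ball n x k"
        using pball_antimono[of "y ! i - x ! i" "int (Suc k)" "int k" for i] by (simp add: mem_padic_ball)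
    qed
    ultimately show "z \<in> ?C" by blast
  qed
  finally show "child_rel (ball_tree n X) = ?C'" .
qed

lemma zp_ball_eq_iff: "padic_ball 1 [x] k = padic_ball 1 [y] k \<longleftrightarrow> x - y \<in> pball (int k)"
  by (subst padic_ball_eq_iff) auto

lemma zp_tree_simps:
  fixes P :: "'p :: prime_card itself"
  shows "u \<in> nodes (zp_tree P) \<longleftrightarrow> (\<exists>k. \<exists>x\<in>pball 0. u = (k, padic_ball 1 [x] k))"
    "(u, v) \<in> child_rel (zp_tree P) \<longleftrightarrow>
      (\<exists>k. \<exists>x\<in>pball 0. u = (k, padic_ball 1 [x] k) \<and> v = (Suc k, padic_ball 1 [x] (Suc k)))"
proof -
  let ?X = "{[x] | x. x \<in> (padic_integers :: 'p padic set)}"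
  have "nodes (ball_tree 1 ?X) = {(k, padic_ball 1 x k) | k x. x \<in> ?X}"
    by (rule ball_tree_simps(1)) auto
  then show "u \<in> nodes (zp_tree P) \<longleftrightarrow> (\<exists>k. \<exists>x\<in>pball 0. u = (k, padic_ball 1 [x] k))"
    unfolding zp_tree_def pball_0 by auto
  have "child_rel (ball_tree 1 ?X) = {((k, padic_ball 1 x k), (Suc k, padic_ball 1 x (Suc k))) | k x. x \<in> ?X}"
    by (rule ball_tree_simps(2)) auto
  then show "(u, v) \<in> child_rel (zp_tree P) \<longleftrightarrow>
      (\<exists>k. \<exists>x\<in>pball 0. u = (k, padic_ball 1 [x] k) \<and> v = (Suc k, padic_ball 1 [x] (Suc k)))"
    unfolding zp_tree_def pball_0 by auto
qed

lemma tree_at_zp: "tree_at (zp_tree (P :: 'p :: prime_card itself)) (0, padic_ball 1 [0] 0) fst"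
  unfolding tree_at_def
proof (intro conjI allI impI ballI)
  show "(0, padic_ball 1 [0] 0) \<in> nodes (zp_tree P)"
    unfolding zp_tree_simps using zero_in_pball[of 0] by blast
  show "child_rel (zp_tree P) \<subseteq> nodes (zp_tree P) \<times> nodes (zp_tree P)"
  proof (rule subrelI)
    fix u v assume "(u, v) \<in> child_rel (zp_tree P)"
    then show "(u, v) \<in> nodes (zp_tree P) \<times> nodes (zp_tree P)"
      unfolding mem_Times_iff fst_conv snd_conv zp_tree_simps by blast
  qed
  show "fst (0 :: nat, padic_ball 1 [0 :: 'p padic] 0) = 0" by simp
  show "fst v = Suc (fst u)" if "(u, v) \<in> child_rel (zp_tree P)" for u v
    using that unfolding zp_tree_simps by auto
  fix v assume v: "v \<in> nodes (zp_tree P) - {(0, padic_ball 1 [0] 0)}"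
  then obtain k x where x: "v = (k, padic_ball 1 [x] k)" "x \<in> pball 0"
    unfolding Diff_iff zp_tree_simps by blast
  have "k \<noteq> 0"
  proof
    assume "k = 0"
    then have "v = (0, padic_ball 1 [0] 0)" using x zp_ball_eq_iff[of x 0 0] by simp
    with v show False by blast
  qed
  then obtain j where j: "k = Suc j" by (cases k) auto
  show "\<exists>!u. (u, v) \<in> child_rel (zp_tree P)"
  proof (rule ex1I[of _ "(j, padic_ball 1 [x] j)"])
    show "((j, padic_ball 1 [x] j), v) \<in> child_rel (zp_tree P)"
      unfolding zp_tree_simps using x j by blast
    fix u assume "(u, v) \<in> child_rel (zp_tree P)"
    then obtain y where "u = (j, padic_ball 1 [y] j)" "padic_ball 1 [x] (Suc j) = padic_ball 1 [y] (Suc j)"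
      unfolding zp_tree_simps x j by auto
    then show "u = (j, padic_ball 1 [x] j)"
      using zp_ball_eq_iff[of x "Suc j" y] zp_ball_eq_iff[of x j y] pball_antimono[of "x - y" "int (Suc j)" "int j"]
      by simp
  qed
qed

lemma ray_zp:
  assumes "t \<in> pball 0"
  shows "ray (zp_tree P) (\<lambda>k. (k, padic_ball 1 [t] k))"
proof -
  have "((k, padic_ball 1 [t] k), (Suc k, padic_ball 1 [t] (Suc k))) \<in> child_rel (zp_tree P)" for k
    unfolding zp_tree_simps using assms by blast
  moreover have "padic_ball 1 [t] 0 = padic_ball 1 [0] 0"
    using zp_ball_eq_iff[of t 0 0] assms by simp
  ultimately show ?thesis
    using tree_atD(1)[OF tree_at_zp[of P]] tree_at_root[OF tree_at_zp[of P]] by (simp add: ray_def path_def)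
qed

text \<open>The ball of depth k around x is sent to the k-th node of the ray of x. The condition
  \<open>iso\<close> makes this well defined and injective, \<open>dense\<close> makes it
  surjective.\<close>

lemma ball_tree_iso:
  fixes Y :: "('p :: prime_card padic list \<times> (nat \<Rightarrow> 'a)) set"
  assumes T: "rooted_tree T"
    and Y: "\<And>x \<beta>. (x, \<beta>) \<in> Y \<Longrightarrow> length x = n \<and> set x \<subseteq> padic_integers \<and> ray T \<beta>"
    and iso: "\<And>x \<beta> x' \<beta>' j. (x, \<beta>) \<in> Y \<Longrightarrow> (x', \<beta>') \<in> Y \<Longrightarrow>
       (\<forall>i<n. x ! i - x' ! i \<in> pball (int j)) \<longleftrightarrow> \<beta> j = \<beta>' j"
    and dense: "\<And>v. v \<in> nodes T \<Longrightarrow> \<exists>(x, \<beta>)\<in>Y. \<exists>j. \<beta> j = v"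
  shows "ball_tree n (fst ` Y) \<cong>\<^sub>T T"
proof -
  have X: "length x = n \<and> set x \<subseteq> padic_integers" if x: "x \<in> fst ` Y" for x
  proof -
    obtain \<beta> where "(x, \<beta>) \<in> Y" using x by auto
    then show ?thesis using Y by simp
  qed
  have fY: "x \<in> fst ` Y \<longleftrightarrow> (\<exists>\<beta>. (x, \<beta>) \<in> Y)" for x
    by (auto simp: image_iff Bex_def)
  have "nodes (ball_tree n (fst ` Y)) = {(k, padic_ball n x k) | k x. x \<in> fst ` Y}"
    by (rule ball_tree_simps(1)) (rule X)
  then have s: "nodes (ball_tree n (fst ` Y)) = {(k, padic_ball n x k) | k x \<beta>. (x, \<beta>) \<in> Y}"
    unfolding fY by blast
  have "child_rel (ball_tree n (fst ` Y)) =
      {((k, padic_ball n x k), (Suc k, padic_ball n x (Suc k))) | k x. x \<in> fst ` Y}"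
    by (rule ball_tree_simps(2)) (rule X)
  then have c: "child_rel (ball_tree n (fst ` Y)) =
      {((k, padic_ball n x k), (Suc k, padic_ball n x (Suc k))) | k x \<beta>. (x, \<beta>) \<in> Y}"
    unfolding fY by blast
  define f where "f = (\<lambda>(k, B). SOME b. \<exists>x \<beta>. (x, \<beta>) \<in> Y \<and> B = padic_ball n x k \<and> b = \<beta> k)"
  have beq: "padic_ball n x k = padic_ball n x' k \<longleftrightarrow> \<beta> k = \<beta>' k" if "(x, \<beta>) \<in> Y" "(x', \<beta>') \<in> Y" for x \<beta> x' \<beta>' k
    using iso[OF that, of k] Y[OF that(1)] Y[OF that(2)] by (subst padic_ball_eq_iff) auto
  have f: "f (k, padic_ball n x k) = \<beta> k" if "(x, \<beta>) \<in> Y" for x \<beta> k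
  proof -
    have "(SOME b. \<exists>x' \<beta>'. (x', \<beta>') \<in> Y \<and> padic_ball n x k = padic_ball n x' k \<and> b = \<beta>' k) = \<beta> k"
    proof (rule some_equality)
      show "\<exists>x' \<beta>'. (x', \<beta>') \<in> Y \<and> padic_ball n x k = padic_ball n x' k \<and> \<beta> k = \<beta>' k" using that by blast
      fix b assume "\<exists>x' \<beta>'. (x', \<beta>') \<in> Y \<and> padic_ball n x k = padic_ball n x' k \<and> b = \<beta>' k"
      then obtain x' \<beta>' where "(x', \<beta>') \<in> Y" "padic_ball n x k = padic_ball n x' k" "b = \<beta>' k" by blast
      then show "b = \<beta> k" using beq[OF that, of x' \<beta>' k] by simp
    qed
    then show ?thesis by (simp add: f_def)
  qed
  have T': "tree_at T (tree_root T) (depth T)" if "(x, \<beta>) \<in> Y" for x \<beta>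
    using Y[OF that] rooted_tree_at[OF T] by (auto simp: ray_def path_def)
  have node: "\<beta> k \<in> nodes T" "depth T (\<beta> k) = k" if "(x, \<beta>) \<in> Y" for x \<beta> k
    using path_node[OF T'[OF that] ray_path, of \<beta> k k] Y[OF that] by auto
  show ?thesis unfolding tree_iso_def
  proof (intro exI[of _ f] conjI ballI)
    show "bij_betw f (nodes (ball_tree n (fst ` Y))) (nodes T)"
      unfolding bij_betw_def
    proof
      show "inj_on f (nodes (ball_tree n (fst ` Y)))"
      proof (rule inj_onI)
        fix u v assume "u \<in> nodes (ball_tree n (fst ` Y))" "v \<in> nodes (ball_tree n (fst ` Y))" and eq: "f u = f v"
        then obtain k x \<beta> k' x' \<beta>' where u: "u = (k, padic_ball n x k)" "(x, \<beta>) \<in> Y"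
          and v: "v = (k', padic_ball n x' k')" "(x', \<beta>') \<in> Y" unfolding s by blast
        have e: "\<beta> k = \<beta>' k'" using eq f[OF u(2)] f[OF v(2)] unfolding u v by simp
        then have "k = k'" using node(2)[OF u(2), of k] node(2)[OF v(2), of k'] by simp
        then show "u = v" using beq[OF u(2) v(2), of k] e unfolding u v by simp
      qed
      show "f ` nodes (ball_tree n (fst ` Y)) = nodes T"
      proof (intro subset_antisym subsetI)
        fix y assume "y \<in> f ` nodes (ball_tree n (fst ` Y))"
        then obtain k x \<beta> where "(x, \<beta>) \<in> Y" "y = f (k, padic_ball n x k)" unfolding s by blast
        then show "y \<in> nodes T" using f node(1) by auto
      next
        fix y assume "y \<in> nodes T"
        then obtain x \<beta> j where y: "(x, \<beta>) \<in> Y" "\<beta> j = y" using dense by fastforce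
        have "(j, padic_ball n x j) \<in> nodes (ball_tree n (fst ` Y))" unfolding s using y(1) by blast
        then show "y \<in> f ` nodes (ball_tree n (fst ` Y))" using f[OF y(1), of j] y(2) by force
      qed
    qed
    fix u v assume "u \<in> nodes (ball_tree n (fst ` Y))" "v \<in> nodes (ball_tree n (fst ` Y))"
    then obtain k x \<beta> k' x' \<beta>' where u: "u = (k, padic_ball n x k)" "(x, \<beta>) \<in> Y"
      and v: "v = (k', padic_ball n x' k')" "(x', \<beta>') \<in> Y" unfolding s by blast
    have fu: "f u = \<beta> k" "f v = \<beta>' k'" using f u v by auto
    have edge: "(\<beta> i, \<beta> (Suc i)) \<in> child_rel T" if "(x, \<beta>) \<in> Y" for x \<beta> i
      using Y[OF that] by (auto simp: ray_def path_def)
    show "(u, v) \<in> child_rel (ball_tree n (fst ` Y)) \<longleftrightarrow> (f u, f v) \<in> child_rel T"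
    proof
      assume "(u, v) \<in> child_rel (ball_tree n (fst ` Y))"
      then obtain i y \<gamma> where "u = (i, padic_ball n y i)" "v = (Suc i, padic_ball n y (Suc i))" "(y, \<gamma>) \<in> Y"
        unfolding c by blast
      then show "(f u, f v) \<in> child_rel T" using f[of y \<gamma>] edge[of y \<gamma> i] by simp
    next
      assume e: "(f u, f v) \<in> child_rel T"
      \<comment> \<open>Edges are reflected because parents are unique: the ray through
        \<open>f v\<close> passes through \<open>f u\<close> at depth k, so both balls can be
        centred at x'.\<close>
      have "k' = Suc k"
        using tree_atD(5)[OF T'[OF u(2)] e] unfolding fu node(2)[OF u(2)] node(2)[OF v(2)] .
      then have "\<beta>' k = \<beta> k"
        using tree_atD(7)[OF T'[OF u(2)] e, of "\<beta>' k"] edge[OF v(2), of k] unfolding fu by simp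
      then have "padic_ball n x k = padic_ball n x' k" using beq[OF u(2) v(2), of k] by simp
      then have uv: "u = (k, padic_ball n x' k)" "v = (Suc k, padic_ball n x' (Suc k))" using u v \<open>k' = Suc k\<close> by auto
      show "(u, v) \<in> child_rel (ball_tree n (fst ` Y))" unfolding c uv using v(2) by blast
    qed
  qed
qed

section \<open>Carrying parameters by field elements\<close>

lemma one_unit_mult: "x - 1 \<in> pball k \<Longrightarrow> y - 1 \<in> pball k \<Longrightarrow> x \<in> pball 0 \<Longrightarrow> x * y - 1 \<in> pball k"
  using pball_add[of "x * (y - 1)" k "x - 1"] pball_mult0[of x "y - 1" k] by (simp add: algebra_simps)

lemma one_unit_inverse:
  assumes "x - 1 \<in> pball k" "x \<noteq> 0" "pval x = 0"
  shows "inverse x - 1 \<in> pball k"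
proof -
  have "inverse x \<in> pball 0" using assms by (simp add: mem_pball_iff pval_inverse)
  then have "inverse x * (1 - x) \<in> pball k"
    using assms(1) by (intro pball_mult0) (simp_all add: pball_diff_commute[of 1])
  then show ?thesis using assms(2) by (simp add: algebra_simps)
qed

lemma one_unit_power:
  assumes "x - 1 \<in> pball k" "x \<noteq> 0" "pval x = 0"
  shows "x ^ n - 1 \<in> pball k"
proof (induction n)
  case (Suc n)
  then show ?case using one_unit_mult[OF assms(1) Suc] assms by (simp add: mem_pball_iff)
qed simp

lemma one_unit_powi:
  assumes "x - 1 \<in> pball k" "x \<noteq> 0" "pval x = 0"
  shows "x powi n - 1 \<in> pball k"
proof (cases n rule: int_cases2)
  case (nonneg m)
  then show ?thesis using one_unit_power[OF assms] by simp
next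
  case (nonpos m)
  have "inverse (x ^ m) - 1 \<in> pball k"
    using assms by (intro one_unit_inverse one_unit_power) (auto simp: pval_power)
  then show ?thesis using nonpos by (simp add: power_int_minus)
qed

lemma one_unit_prod:
  assumes "finite A" "\<And>i. i \<in> A \<Longrightarrow> f i - 1 \<in> pball k \<and> f i \<noteq> 0 \<and> pval (f i) = 0"
  shows "prod f A - 1 \<in> pball k"
  using assms
proof (induction A rule: finite_induct)
  case (insert i A)
  then show ?case using one_unit_mult[of "f i" k "prod f A"] by (simp add: mem_pball_iff)
qed simp

section \<open>Constants attached to q, and the q-th power map on 1 + p^q Z_p\<close>

locale modulus =
  fixes P :: "'p :: prime_card itself" and q :: nat
  assumes q_pos: "q > 0"
begin

abbreviation p :: "'p padic" where "p \<equiv> of_nat CARD('p)"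

text \<open>The valuation of q, which is the precision lost in passing from q-th powers to their
  roots.\<close>

definition ev :: int where "ev = pval (of_nat q :: 'p padic)"

text \<open>The order of the unit group mod p^q, so the \<phi>-th power of any unit is 1 mod
  p^q.\<close>

definition \<phi> :: nat where "\<phi> = totient (CARD('p) ^ q)"

text \<open>The period of the construction: parameters are treated class by class mod h.\<close>

definition h :: int where "h = int q * int \<phi>"

text \<open>Raising to the power q maps 1 + p^q Z_p into 1 + p^K Z_p; digits before the K-th must
  come from elsewhere.\<close>

definition K :: int where "K = int q + ev"

text \<open>v(q) < q because p^q > q. This inequality keeps every quadratic error below the linear
  term in what follows.\<close>

lemma q_valuation: "(of_nat q :: 'p padic) \<noteq> 0" "ev \<ge> 0" "ev < int q"
proof -
  have 1: "Suc 0 < CARD('p)" using prime_gt_1_nat[OF prime_card[where 'a='p]] by simp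
  have "\<not> CARD('p) ^ q dvd q"
    using power_gt_expt[OF 1, of q] q_pos by (auto dest: dvd_imp_le)
  then have "(of_nat q :: 'p padic) - of_nat 0 \<notin> pball (int q)"
    unfolding of_nat_diff_in_pball by (simp add: cong_0_iff)
  then show nz: "(of_nat q :: 'p padic) \<noteq> 0" "ev < int q"
    by (auto simp: mem_pball_iff ev_def)
  show "ev \<ge> 0" using of_nat_in_pball_0[of q, where 'a='p] nz by (simp add: mem_pball_iff ev_def)
qed

lemma \<phi>_pos: "\<phi> > 0"
  unfolding \<phi>_def using card_prime_pos[where 'p='p] by simp

lemma h_pos: "h > 0"
  unfolding h_def using \<phi>_pos q_pos by simp

text \<open>With i = v(w - 1) >= q the linear term q (w - 1) has valuation i + v(q) < 2 i. It
  dominates, so distances from 1 are shifted by exactly v(q).\<close>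

lemma power_q:
  assumes w: "(w :: 'p padic) - 1 \<in> pball (int q)"
  shows "w ^ q - 1 \<in> pball K" "w ^ q - 1 \<in> pball j \<Longrightarrow> w - 1 \<in> pball (j - ev)"
proof -
  define x where "x = w - 1"
  have "w ^ q - 1 \<in> pball K \<and> (w ^ q - 1 \<in> pball j \<longrightarrow> w - 1 \<in> pball (j - ev))"
  proof (cases "x = 0")
    case False
    define i where "i = pval x"
    have i: "i \<ge> int q" using w False by (auto simp: x_def i_def mem_pball_iff)
    define z where "z = (1 + x) ^ q - 1 - of_nat q * x"
    have z: "z \<in> pball (2 * i)"
      unfolding z_def by (rule power_one_plus) (use i in \<open>auto simp: mem_pball_iff i_def\<close>)
    have w: "w ^ q - 1 = of_nat q * x + z" by (simp add: z_def x_def)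
    have qx: "pval (of_nat q * x) = ev + i" "of_nat q * x \<noteq> 0"
      using False q_valuation(1) by (auto simp: pval_mult ev_def i_def)
    have "of_nat q * x + z \<in> pball K"
      using qx i q_valuation z by (intro pball_add) (auto simp: mem_pball_iff K_def)
    moreover have "j \<le> ev + i" if "w ^ q - 1 \<in> pball j"
    proof (rule ccontr)
      assume "\<not> j \<le> ev + i"
      then have "w ^ q - 1 \<in> pball (ev + i + 1)" using pball_antimono[OF that] by simp
      moreover have "z \<in> pball (ev + i + 1)" using pball_antimono[OF z] i q_valuation by simp
      ultimately have "of_nat q * x \<in> pball (ev + i + 1)" using pball_diff[of "w ^ q - 1" _ z] w by simp
      then show False using qx by (simp add: mem_pball_iff)
    qed
    ultimately show ?thesis using False by (auto simp: w mem_pball_iff[of "w - 1"] x_def i_def)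
  qed (simp add: x_def)
  then show "w ^ q - 1 \<in> pball K" "w ^ q - 1 \<in> pball j \<Longrightarrow> w - 1 \<in> pball (j - ev)" by auto
qed

text \<open>Newton iteration for a q-th root of 1 + y. Approximate roots suffice, because rays have
  to be met only up to a given depth.\<close>

lemma power_q_dense:
  assumes y: "(y :: 'p padic) \<in> pball K"
  shows "\<exists>w. w - 1 \<in> pball (int q) \<and> w ^ q - 1 - y \<in> pball (K + int j)"
proof (induction j)
  case 0
  show ?case using y by (intro exI[of _ 1]) (auto intro: pball_uminus)
next
  case (Suc j)
  then obtain w where w: "w - 1 \<in> pball (int q)" "w ^ q - 1 - y \<in> pball (K + int j)" by blast
  have w0: "w \<noteq> 0" "pval w = 0" using one_plus_pball[OF w(1)] q_pos by auto
  define \<delta> where "\<delta> = y - (w ^ q - 1)"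
  have \<delta>: "\<delta> \<in> pball (K + int j)" using w(2) by (simp add: \<delta>_def pball_diff_commute)
  define x where "x = \<delta> / of_nat q"
  have x: "x \<in> pball (int q + int j)"
    using \<delta> q_valuation(1) by (cases "\<delta> = 0") (auto simp: x_def mem_pball_iff pval_divide K_def ev_def)
  \<comment> \<open>The factor 1 + x' is chosen with q x' w^q = \<delta>, which cancels the error to
    first order; the remainder w^q z has valuation at least 2 (q + j) >= K + j + 1.\<close>
  define x' where "x' = x / w ^ q"
  have x': "x' \<in> pball (int q + int j)"
    using x w0 by (cases "x = 0") (auto simp: x'_def mem_pball_iff pval_divide pval_power)
  define z where "z = (1 + x') ^ q - 1 - of_nat q * x'"
  have z: "z \<in> pball (2 * (int q + int j))" unfolding z_def by (rule power_one_plus[OF x']) simp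
  have "w ^ q \<in> pball 0" using w0 by (simp add: mem_pball_iff pval_power)
  then have "w ^ q * z \<in> pball (2 * (int q + int j))" using z by (rule pball_mult0)
  moreover have "of_nat q * x' * w ^ q = \<delta>"
    using w0(1) q_valuation(1) by (simp add: x'_def x_def)
  then have "(w * (1 + x')) ^ q - 1 - y = w ^ q * z"
    unfolding power_mult_distrib[of w "1 + x'" q] by (simp add: z_def \<delta>_def algebra_simps)
  ultimately have "(w * (1 + x')) ^ q - 1 - y \<in> pball (K + int (Suc j))"
    using q_valuation by (auto intro: pball_antimono simp: K_def)
  moreover have "w * (1 + x') - 1 \<in> pball (int q)"
    using pball_antimono[OF x', of "int q"] w w0 by (intro one_unit_mult) (auto simp: mem_pball_iff)
  ultimately show ?case by blast
qed

text \<open>Elements that are \<phi>-th powers up to 1 + p^q Z_p. By Euler's congruence their unit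
  part is 1 mod p^q whatever unit occurs in x, and the condition is first-order.\<close>

definition H :: "'p padic set" where
  "H = {s. s \<noteq> 0 \<and> (\<exists>x. x \<noteq> 0 \<and> s / x ^ \<phi> - 1 \<in> pball (int q))}"

lemma H_nonzero: "s \<in> H \<Longrightarrow> s \<noteq> 0"
  by (simp add: H_def)

text \<open>The bases x and x' of the two \<phi>-th powers have equal valuation too, so their
  quotient is a unit and its \<phi>-th power is 1 mod p^q.\<close>

lemma H_ratio:
  assumes "s \<in> H" "s' \<in> H" "pval s = pval s'"
  shows "s / s' - 1 \<in> pball (int q)"
proof -
  obtain x where x: "x \<noteq> 0" "s / x ^ \<phi> - 1 \<in> pball (int q)" using assms(1) by (auto simp: H_def)
  obtain x' where x': "x' \<noteq> 0" "s' / x' ^ \<phi> - 1 \<in> pball (int q)" using assms(2) by (auto simp: H_def)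
  have nz: "s \<noteq> 0" "s' \<noteq> 0" using assms H_nonzero by auto
  have v: "pval (s / x ^ \<phi>) = 0" "pval (s' / x' ^ \<phi>) = 0"
    using one_plus_pball(2)[OF x(2)] one_plus_pball(2)[OF x'(2)] q_pos by auto
  then have "int \<phi> * pval x = int \<phi> * pval x'"
    using assms(3) nz x(1) x'(1) by (simp add: pval_divide pval_power)
  then have "pval (x / x') = 0" using \<phi>_pos x(1) x'(1) by (simp add: pval_divide)
  then have xx: "(x / x') ^ \<phi> - 1 \<in> pball (int q)"
    unfolding \<phi>_def using x(1) x'(1) q_pos by (intro padic_euler) auto
  have "inverse (s' / x' ^ \<phi>) - 1 \<in> pball (int q)"
    using x' nz v by (intro one_unit_inverse) auto
  moreover have in0: "s / x ^ \<phi> \<in> pball 0" "inverse (s' / x' ^ \<phi>) \<in> pball 0"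
    using v nz x'(1) pval_inverse[of "s' / x' ^ \<phi>"] by (simp_all add: mem_pball_iff)
  ultimately have "s / x ^ \<phi> * inverse (s' / x' ^ \<phi>) - 1 \<in> pball (int q)"
    using x(2) by (intro one_unit_mult)
  then have "s / x ^ \<phi> * inverse (s' / x' ^ \<phi>) * (x / x') ^ \<phi> - 1 \<in> pball (int q)"
    by (rule one_unit_mult[OF _ xx pball_mult0[OF in0]])
  moreover have "s / x ^ \<phi> * inverse (s' / x' ^ \<phi>) * (x / x') ^ \<phi> = s / s'"
    using x(1) x'(1) by (simp add: power_divide)
  ultimately show ?thesis by simp
qed

lemma H_ex:
  assumes "w - 1 \<in> pball (int q)"
  shows "p powi (int \<phi> * k) * w \<in> H" "pval (p powi (int \<phi> * k) * w) = int \<phi> * k"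
proof -
  have w: "w \<noteq> 0" "pval w = 0" using one_plus_pball[OF assms] q_pos by auto
  have "p powi (int \<phi> * k) = (p powi k) ^ \<phi>" by (simp add: power_int_power' mult.commute)
  then have "p powi (int \<phi> * k) * w / (p powi k) ^ \<phi> - 1 \<in> pball (int q)"
    using assms by (simp add: power_int_not_zero)
  then show "p powi (int \<phi> * k) * w \<in> H"
    unfolding H_def using w by (auto simp: power_int_not_zero intro!: exI[of _ "p powi k"])
  show "pval (p powi (int \<phi> * k) * w) = int \<phi> * k"
    using w by (simp add: pval_mult power_int_not_zero)
qed

lemma dfn_H: "dfn (\<lambda>a. a i \<in> H)"
proof -
  have "dfn (\<lambda>a. \<exists>x. (\<lambda>b. \<not> b (Suc i) = 0 \<and> b i / b (Suc i) ^ \<phi> - 1 \<in> pball (int q)) (a(Suc i := x)))"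
    by (rule dfn_ex) (intro dfn_conj dfn_neg dfn_eq dfn_pball pw_diff pw_mult pw_inverse pw_power pw_var pw_0 pw_1
      | simp only: divide_inverse)+
  then have "dfn (\<lambda>a. \<not> a i = 0 \<and> (\<exists>x. x \<noteq> 0 \<and> a i / x ^ \<phi> - 1 \<in> pball (int q)))"
    by (intro dfn_conj dfn_neg dfn_eq pw_var pw_0) simp
  then show ?thesis by (simp add: H_def)
qed

text \<open>
  An element \<open>a i\<close> of valuation \<open>\<phi> * (\<kappa> ! i div h)\<close> carries the parameter \<open>\<kappa> ! i\<close>, given its
  class mod \<open>h = q * \<phi>\<close>. The congruence class of the unit part is fixed by the condition
  \<open>a i \<in> H\<close>, which replaces the choice of an angular component.
\<close>

definition carries :: "nat \<Rightarrow> int list \<Rightarrow> 'p assignment \<Rightarrow> bool" where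
  "carries m \<kappa> a \<longleftrightarrow> (\<forall>i<m. a i \<in> H \<and> pval (a i) = int \<phi> * (\<kappa> ! i div h))"

text \<open>Measured on q-th powers since the coordinate that exhibits a carrier in a point is
  p^(\<kappa> mod h) times its q-th power; congruence of points yields this and no more.\<close>

definition close :: "nat \<Rightarrow> int \<Rightarrow> 'p assignment \<Rightarrow> 'p assignment \<Rightarrow> bool" where
  "close m j a a' \<longleftrightarrow> (\<forall>i<m. a i ^ q / a' i ^ q - 1 \<in> pball j)"

definition agree :: "nat \<Rightarrow> 'p assignment \<Rightarrow> 'p assignment \<Rightarrow> bool" where
  "agree m a a' \<longleftrightarrow> (\<forall>i<m. a i = a' i)"

text \<open>Within one class mod h the corrective exponents of p are constant, so one formula serves
  the whole class.\<close>

definition cls :: "nat \<Rightarrow> (nat \<Rightarrow> int) \<Rightarrow> int list \<Rightarrow> bool" where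
  "cls m \<xi> \<kappa> \<longleftrightarrow> (\<forall>i<m. \<kappa> ! i mod h = \<xi> i)"

lemma carries_agree: "carries m \<kappa> a \<Longrightarrow> agree m a a' \<Longrightarrow> carries m \<kappa> a'"
  by (simp add: carries_def agree_def)

lemma close_mono: "close m j a a' \<Longrightarrow> i \<le> j \<Longrightarrow> close m i a a'"
  by (auto simp: close_def intro: pball_antimono)

text \<open>Carriers of one parameter lie in \<open>H\<close> with equal valuation, so their
  quotient is 1 mod p^q already and roots can be taken at the cost of v(q).\<close>

lemma close_ratio:
  assumes "carries m \<kappa> a" "carries m \<kappa> a'" "close m j a a'" "i < m"
  shows "a i / a' i - 1 \<in> pball (j - ev)" "a i / a' i \<noteq> 0" "pval (a i / a' i) = 0"
proof -
  have 1: "a i / a' i - 1 \<in> pball (int q)"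
    using assms by (intro H_ratio) (auto simp: carries_def)
  then show "a i / a' i \<noteq> 0" "pval (a i / a' i) = 0" using one_plus_pball[OF 1] q_pos by auto
  show "a i / a' i - 1 \<in> pball (j - ev)"
    using power_q(2)[OF 1, of j] assms(3,4) by (simp add: close_def power_divide)
qed

text \<open>Within a class mod h the dependence on \<kappa> must be expressible through the
  carriers, by one piecewise rational function.\<close>

definition unif :: "nat \<Rightarrow> int list set \<Rightarrow> (int list \<Rightarrow> 'p assignment \<Rightarrow> 'p padic) \<Rightarrow> bool" where
  "unif m M f \<longleftrightarrow> (\<forall>\<kappa> a a'. agree m a a' \<longrightarrow> f \<kappa> a = f \<kappa> a') \<and>
     (\<forall>\<xi>. \<exists>g. pw g \<and> (\<forall>\<kappa>\<in>M. cls m \<xi> \<kappa> \<longrightarrow> (\<forall>a. carries m \<kappa> a \<longrightarrow> f \<kappa> a = g a)))"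

lemma unif_agree: "unif m M f \<Longrightarrow> agree m a a' \<Longrightarrow> f \<kappa> a = f \<kappa> a'"
  by (simp add: unif_def)

lemma unifE:
  assumes "unif m M f"
  obtains g where "pw g" "\<And>\<kappa> a. \<kappa> \<in> M \<Longrightarrow> cls m \<xi> \<kappa> \<Longrightarrow> carries m \<kappa> a \<Longrightarrow> f \<kappa> a = g a"
proof -
  have "\<exists>g. pw g \<and> (\<forall>\<kappa>\<in>M. cls m \<xi> \<kappa> \<longrightarrow> (\<forall>a. carries m \<kappa> a \<longrightarrow> f \<kappa> a = g a))"
    using assms unfolding unif_def by simp
  then show ?thesis using that by blast
qed

lemma unif_const: "unif m M (\<lambda>_ _. of_nat n)"
  unfolding unif_def using pw_of_nat by blast

lemma unif_mult:
  assumes "unif m M f" "unif m M g"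
  shows "unif m M (\<lambda>\<kappa> a. f \<kappa> a * g \<kappa> a)"
  unfolding unif_def
proof (intro conjI allI impI)
  fix \<xi>
  obtain f' where f': "pw f'" "\<And>\<kappa> a. \<kappa> \<in> M \<Longrightarrow> cls m \<xi> \<kappa> \<Longrightarrow> carries m \<kappa> a \<Longrightarrow> f \<kappa> a = f' a"
    using unifE[OF assms(1)] by blast
  obtain g' where g': "pw g'" "\<And>\<kappa> a. \<kappa> \<in> M \<Longrightarrow> cls m \<xi> \<kappa> \<Longrightarrow> carries m \<kappa> a \<Longrightarrow> g \<kappa> a = g' a"
    using unifE[OF assms(2)] by blast
  show "\<exists>k. pw k \<and> (\<forall>\<kappa>\<in>M. cls m \<xi> \<kappa> \<longrightarrow> (\<forall>a. carries m \<kappa> a \<longrightarrow> f \<kappa> a * g \<kappa> a = k a))"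
    by (intro exI[of _ "\<lambda>a. f' a * g' a"] conjI pw_mult f'(1) g'(1)) (simp add: f'(2) g'(2))
qed (use assms in \<open>simp add: unif_def\<close>)

text \<open>An element of prescribed valuation that varies with the carriers in a 1-Lipschitz way.
  The Lipschitz condition is what allows points over two different carriers of the same \<kappa> to
  be compared.\<close>

definition lifts :: "nat \<Rightarrow> int list set \<Rightarrow> (int list \<Rightarrow> nat) \<Rightarrow> (int list \<Rightarrow> 'p assignment \<Rightarrow> 'p padic) \<Rightarrow> bool" where
  "lifts m M l \<theta> \<longleftrightarrow> unif m M \<theta> \<and>
     (\<forall>\<kappa>\<in>M. \<forall>a. carries m \<kappa> a \<longrightarrow> \<theta> \<kappa> a \<noteq> 0 \<and> pval (\<theta> \<kappa> a) = int (l \<kappa>)) \<and>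
     (\<forall>\<kappa>\<in>M. \<forall>a a' j. carries m \<kappa> a \<and> carries m \<kappa> a' \<and> close m j a a' \<longrightarrow> \<theta> \<kappa> a - \<theta> \<kappa> a' \<in> pball j)"

lemma liftsD:
  assumes "lifts m M l \<theta>"
  shows "unif m M \<theta>"
    "\<kappa> \<in> M \<Longrightarrow> carries m \<kappa> a \<Longrightarrow> \<theta> \<kappa> a \<noteq> 0"
    "\<kappa> \<in> M \<Longrightarrow> carries m \<kappa> a \<Longrightarrow> pval (\<theta> \<kappa> a) = int (l \<kappa>)"
    "\<kappa> \<in> M \<Longrightarrow> carries m \<kappa> a \<Longrightarrow> carries m \<kappa> a' \<Longrightarrow> close m j a a' \<Longrightarrow> \<theta> \<kappa> a - \<theta> \<kappa> a' \<in> pball j"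
    "\<kappa> \<in> M \<Longrightarrow> carries m \<kappa> a \<Longrightarrow> \<theta> \<kappa> a \<in> pball 0"
  using assms unfolding lifts_def mem_pball_iff by auto

lemma lifts_1: "lifts m M (\<lambda>_. 0) (\<lambda>_ _. 1)"
  using unif_const[of m M 1] by (simp add: lifts_def)

lemma lifts_mult:
  assumes "lifts m M k \<theta>" "lifts m M l \<psi>"
  shows "lifts m M (\<lambda>\<kappa>. k \<kappa> + l \<kappa>) (\<lambda>\<kappa> a. \<theta> \<kappa> a * \<psi> \<kappa> a)"
  unfolding lifts_def
proof (intro conjI ballI allI impI)
  note f = liftsD[OF assms(1)]
  note g = liftsD[OF assms(2)]
  show "unif m M (\<lambda>\<kappa> a. \<theta> \<kappa> a * \<psi> \<kappa> a)" by (rule unif_mult[OF f(1) g(1)])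
  fix \<kappa> a assume \<kappa>: "\<kappa> \<in> M"
  { assume a: "carries m \<kappa> a"
    show "\<theta> \<kappa> a * \<psi> \<kappa> a \<noteq> 0" using f(2)[OF \<kappa> a] g(2)[OF \<kappa> a] by simp
    show "pval (\<theta> \<kappa> a * \<psi> \<kappa> a) = int (k \<kappa> + l \<kappa>)"
      using f(2,3)[OF \<kappa> a] g(2,3)[OF \<kappa> a] by (simp add: pval_mult)
  }
  fix a' j assume aa: "carries m \<kappa> a \<and> carries m \<kappa> a' \<and> close m j a a'"
  have "\<theta> \<kappa> a * \<psi> \<kappa> a - \<theta> \<kappa> a' * \<psi> \<kappa> a' = \<theta> \<kappa> a * (\<psi> \<kappa> a - \<psi> \<kappa> a') + (\<theta> \<kappa> a - \<theta> \<kappa> a') * \<psi> \<kappa> a'"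
    by (simp add: algebra_simps)
  then show "\<theta> \<kappa> a * \<psi> \<kappa> a - \<theta> \<kappa> a' * \<psi> \<kappa> a' \<in> pball j"
    using pball_add[OF pball_mult0[OF f(5)[OF \<kappa>, of a] g(4)[OF \<kappa>, of a a' j]]
        pball_mult0'[OF f(4)[OF \<kappa>, of a a' j] g(5)[OF \<kappa>, of a']]] aa by simp
qed

text \<open>Valuations in the finite range from 0 to k - 1 can be tested one by one, so replacing
  the value by a power of p stays piecewise rational.\<close>

lemma pw_truncate:
  assumes "pw f"
  shows "pw (\<lambda>a. if f a \<noteq> 0 \<and> 0 \<le> pval (f a) \<and> pval (f a) < int k then p powi pval (f a) else f a)"
proof (induction k)
  case 0
  have "(\<lambda>a. if f a \<noteq> 0 \<and> 0 \<le> pval (f a) \<and> pval (f a) < int 0 then p powi pval (f a) else f a) = f"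
    by (rule ext) auto
  then show ?case using assms by simp
next
  case (Suc k)
  have eq: "(if f a \<noteq> 0 \<and> 0 \<le> pval (f a) \<and> pval (f a) < int (Suc k) then p powi pval (f a) else f a) =
     (if f a \<noteq> 0 \<and> pval (f a) = int k then p powi int k else
      if f a \<noteq> 0 \<and> 0 \<le> pval (f a) \<and> pval (f a) < int k then p powi pval (f a) else f a)" for a
    by auto
  show ?case unfolding eq
    by (rule pw.ite[OF dfn_pval_eq[OF assms] pw_powi[OF pw_of_nat] Suc])
qed

text \<open>
  For small values of the linear function the monomial has to be replaced by a constant: it varies
  by \<open>p ^ ev\<close> too much because \<open>close\<close> is a condition on \<open>q\<close>-th powers.
\<close>

lemma lifts_linear:
  fixes l :: "int list \<Rightarrow> nat" and \<alpha> :: "nat \<Rightarrow> rat"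
  assumes l: "\<And>\<kappa>. \<kappa> \<in> M \<Longrightarrow> of_nat (l \<kappa>) = (\<Sum>i<m. \<alpha> i * of_int (\<kappa> ! i)) + b"
    and n: "\<And>i. i < m \<Longrightarrow> \<alpha> i * of_nat q = of_int (n i)"
  obtains \<theta> where "lifts m M l \<theta>"
proof -
  \<comment> \<open>The exponent of p that corrects the valuation of the monomial to
    \<open>l \<kappa>\<close>.\<close>
  define B where "B \<kappa> = int (l \<kappa>) - (\<Sum>i<m. n i * (int \<phi> * (\<kappa> ! i div h)))" for \<kappa>
  define mon where "mon k a = p powi k * (\<Prod>i<m. a i powi n i)" for k and a :: "'p assignment"
  define \<theta> where "\<theta> \<kappa> a = (if l \<kappa> < q then p powi int (l \<kappa>) else mon (B \<kappa>) a)" for \<kappa> a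
  have mon: "mon (B \<kappa>) a \<noteq> 0" "pval (mon (B \<kappa>) a) = int (l \<kappa>)" if "carries m \<kappa> a" for \<kappa> a
  proof -
    have nz: "a i \<noteq> 0" if "i < m" for i using \<open>carries m \<kappa> a\<close> that H_nonzero by (auto simp: carries_def)
    then show "mon (B \<kappa>) a \<noteq> 0" by (auto simp: mon_def power_int_not_zero)
    have "pval (\<Prod>i<m. a i powi n i) = (\<Sum>i<m. pval (a i powi n i))"
      using nz by (intro pval_prod) auto
    also have "\<dots> = (\<Sum>i<m. n i * pval (a i))"
      using nz by (intro sum.cong) (auto simp: pval_powi)
    finally have "pval (mon (B \<kappa>) a) = B \<kappa> + (\<Sum>i<m. n i * pval (a i))"
      using nz by (simp add: mon_def pval_mult power_int_not_zero)
    also have "(\<Sum>i<m. n i * pval (a i)) = (\<Sum>i<m. n i * (int \<phi> * (\<kappa> ! i div h)))"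
      using that by (intro sum.cong) (auto simp: carries_def)
    finally show "pval (mon (B \<kappa>) a) = int (l \<kappa>)" by (simp add: B_def)
  qed
  \<comment> \<open>Write \<kappa>_i = h (\<kappa>_i div h) + \<xi>_i with h = q \<phi>. Since
    \<alpha>_i q = n_i, the first summand accounts exactly for the valuation of the monomial, and
    the rest depends on the class only.\<close>
  have B_const: "B \<kappa> = B \<kappa>'" if "\<kappa> \<in> M" "\<kappa>' \<in> M" "cls m \<xi> \<kappa>" "cls m \<xi> \<kappa>'" for \<kappa> \<kappa>' \<xi>
  proof -
    have "of_int (B \<kappa>) = (\<Sum>i<m. \<alpha> i * of_int (\<xi> i)) + b" if "\<kappa> \<in> M" "cls m \<xi> \<kappa>" for \<kappa>
    proof -
      have "(\<Sum>i<m. \<alpha> i * of_int (\<kappa> ! i)) =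
          (\<Sum>i<m. \<alpha> i * of_int (\<xi> i)) + (\<Sum>i<m. of_int (n i * (int \<phi> * (\<kappa> ! i div h))))"
        unfolding sum.distrib[symmetric]
      proof (rule sum.cong)
        fix i assume "i \<in> {..<m}"
        then have "\<kappa> ! i = h * (\<kappa> ! i div h) + \<xi> i"
          using that(2) mult_div_mod_eq[of h "\<kappa> ! i"] by (simp add: cls_def)
        then have "\<alpha> i * of_int (\<kappa> ! i) = \<alpha> i * of_int (h * (\<kappa> ! i div h) + \<xi> i)" by simp
        also have "\<dots> = \<alpha> i * of_int (\<xi> i) + (\<alpha> i * of_nat q) * of_int (int \<phi> * (\<kappa> ! i div h))"
          by (simp add: h_def algebra_simps)
        also have "\<alpha> i * of_nat q = of_int (n i)" using n \<open>i \<in> {..<m}\<close> by simp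
        finally show "\<alpha> i * of_int (\<kappa> ! i) = \<alpha> i * of_int (\<xi> i) + of_int (n i * (int \<phi> * (\<kappa> ! i div h)))"
          by simp
      qed simp
      then show ?thesis using l[OF that(1)] by (simp add: B_def)
    qed
    from this[OF that(1,3)] this[OF that(2,4)] show ?thesis by (metis of_int_eq_iff)
  qed
  have "lifts m M l \<theta>"
    unfolding lifts_def unif_def
  proof (intro conjI ballI allI impI)
    fix \<kappa> and a a' :: "'p assignment" assume "agree m a a'"
    then show "\<theta> \<kappa> a = \<theta> \<kappa> a'" by (auto simp: \<theta>_def mon_def agree_def)
  next
    fix \<xi>
    show "\<exists>g. pw g \<and> (\<forall>\<kappa>\<in>M. cls m \<xi> \<kappa> \<longrightarrow> (\<forall>a. carries m \<kappa> a \<longrightarrow> \<theta> \<kappa> a = g a))"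
    proof (cases "\<exists>\<kappa>\<in>M. cls m \<xi> \<kappa>")
      case True
      then obtain \<kappa>0 where k0: "\<kappa>0 \<in> M" "cls m \<xi> \<kappa>0" by blast
      let ?f = "mon (B \<kappa>0)"
      have "pw ?f" unfolding mon_def by (intro pw_mult pw_prod pw_powi pw_var pw_of_nat)
      moreover have "\<theta> \<kappa> a = (if ?f a \<noteq> 0 \<and> 0 \<le> pval (?f a) \<and> pval (?f a) < int q then p powi pval (?f a) else ?f a)"
        if "\<kappa> \<in> M" "cls m \<xi> \<kappa>" "carries m \<kappa> a" for \<kappa> a
        using mon[OF that(3)] B_const[OF that(1) k0(1) that(2) k0(2)] by (simp add: \<theta>_def)
      ultimately show ?thesis using pw_truncate[of ?f q] by blast
    qed (use pw_0 in blast)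
  next
    fix \<kappa> a assume "carries m \<kappa> a"
    then show "\<theta> \<kappa> a \<noteq> 0" "pval (\<theta> \<kappa> a) = int (l \<kappa>)"
      using mon pval_uniformizer[of "int (l \<kappa>)", where 'p='p] by (auto simp: \<theta>_def power_int_not_zero)
  next
    fix \<kappa> a a' j assume aa: "carries m \<kappa> a \<and> carries m \<kappa> a' \<and> close m j a a'"
    show "\<theta> \<kappa> a - \<theta> \<kappa> a' \<in> pball j"
    proof (cases "l \<kappa> < q")
      case False
      have nz: "a' i \<noteq> 0" if "i < m" for i using aa that H_nonzero by (auto simp: carries_def)
      have W: "(\<Prod>i<m. (a i / a' i) powi n i) - 1 \<in> pball (j - ev)"
        using close_ratio[of m \<kappa> a a' j] aa
        by (intro one_unit_prod) (auto simp: one_unit_powi pval_powi power_int_not_zero)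
      have "(\<Prod>i<m. a i powi n i) = (\<Prod>i<m. a' i powi n i) * (\<Prod>i<m. (a i / a' i) powi n i)"
        unfolding prod.distrib[symmetric]
        using nz by (intro prod.cong) (auto simp: power_int_divide_distrib power_int_not_zero)
      then have "mon (B \<kappa>) a - mon (B \<kappa>) a' = mon (B \<kappa>) a' * ((\<Prod>i<m. (a i / a' i) powi n i) - 1)"
        by (simp add: mon_def algebra_simps)
      \<comment> \<open>Here \<open>l \<kappa>\<close> is at least q > v(q), and this valuation
        absorbs the precision lost in \<open>close_ratio\<close>.\<close>
      moreover have "mon (B \<kappa>) a' \<in> pball ev"
        using mon[of \<kappa> a'] aa False q_valuation by (simp add: mem_pball_iff)
      ultimately have "mon (B \<kappa>) a - mon (B \<kappa>) a' \<in> pball (ev + (j - ev))"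
        using W pball_mult by metis
      then show ?thesis using False by (simp add: \<theta>_def)
    qed (simp add: \<theta>_def)
  qed
  then show ?thesis by (rule that)
qed

end

section \<open>Tame families of point sets\<close>

text \<open>Points of some \<open>Q_p\<close>^n are padded with zeros to infinite sequences.\<close>

type_synonym 'p point = "nat \<Rightarrow> 'p padic"

definition congr :: "int \<Rightarrow> 'p :: prime_card point \<Rightarrow> 'p point \<Rightarrow> bool" where
  "congr j x y \<longleftrightarrow> (\<forall>i. x i - y i \<in> pball j)"

text \<open>Interleaving joins two finitely supported sequences without fixing their lengths in
  advance.\<close>

definition comb :: "'p :: prime_card point \<Rightarrow> 'p point \<Rightarrow> 'p point" where
  "comb x y i = (if even i then x (i div 2) else y (i div 2))"

definition zero_from :: "nat \<Rightarrow> 'p :: prime_card point \<Rightarrow> bool" where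
  "zero_from n x \<longleftrightarrow> (\<forall>i\<ge>n. x i = 0)"

lemma congr_mono: "congr j x y \<Longrightarrow> i \<le> j \<Longrightarrow> congr i x y"
  by (auto simp: congr_def intro: pball_antimono)

lemma congr_comb: "congr j (comb x y) (comb x' y') \<longleftrightarrow> congr j x x' \<and> congr j y y'"
proof
  assume *: "congr j (comb x y) (comb x' y')"
  have "x i - x' i \<in> pball j" "y i - y' i \<in> pball j" for i
    using *[unfolded congr_def, rule_format, of "2 * i"] *[unfolded congr_def, rule_format, of "Suc (2 * i)"]
    by (simp_all add: comb_def)
  then show "congr j x x' \<and> congr j y y'" by (simp add: congr_def)
qed (auto simp: congr_def comb_def)

lemma congr_case_nat: "congr j (case_nat c x) (case_nat c' x') \<longleftrightarrow> c - c' \<in> pball j \<and> congr j x x'"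
  unfolding congr_def
proof
  assume *: "\<forall>i. case_nat c x i - case_nat c' x' i \<in> pball j"
  then show "c - c' \<in> pball j \<and> (\<forall>i. x i - x' i \<in> pball j)"
    using *[rule_format, of 0] *[rule_format, of "Suc i" for i] by simp
qed (auto split: nat.split)

lemma zero_from_mono: "zero_from n x \<Longrightarrow> n \<le> n' \<Longrightarrow> zero_from n' x"
  by (simp add: zero_from_def)

lemma zero_from_comb: "zero_from n x \<Longrightarrow> zero_from n' y \<Longrightarrow> zero_from (2 * (n + n')) (comb x y)"
  by (auto simp: zero_from_def comb_def)

lemma zero_from_case_nat: "zero_from n x \<Longrightarrow> zero_from (Suc n) (case_nat c x)"
  by (auto simp: zero_from_def split: nat.split)

context modulus
begin

text \<open>
  The entries of \<open>a'\<close> below \<open>m\<close> carry \<open>\<kappa>\<close>, the next \<open>d\<close> ones are free and give the dimension. One finite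
  set of pieces serves all \<open>\<kappa>\<close> in a residue class.
\<close>

definition pieces_ok :: "nat \<Rightarrow> (('p assignment \<Rightarrow> bool) \<times> ('p assignment \<Rightarrow> 'p point)) set \<Rightarrow> bool" where
  "pieces_ok n Ps \<longleftrightarrow> finite Ps \<and> (\<forall>D F. (D, F) \<in> Ps \<longrightarrow> dfn D \<and> (\<forall>i. pw (\<lambda>a. F a i)) \<and> (\<forall>a. zero_from n (F a)))"

definition pts :: "nat \<Rightarrow> nat \<Rightarrow> (('p assignment \<Rightarrow> bool) \<times> ('p assignment \<Rightarrow> 'p point)) set \<Rightarrow>
    'p assignment \<Rightarrow> 'p point set" where
  "pts m d Ps a = {F a' | D F a'. (D, F) \<in> Ps \<and> agree m a a' \<and> (\<forall>i\<ge>m + d. a' i = 0) \<and> D a'}"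

text \<open>Uniformity over a class mod h is essential: once the last parameter is quantified away,
  finitely many classes must account for all its values.\<close>

definition tame :: "nat \<Rightarrow> nat \<Rightarrow> int list set \<Rightarrow> (int list \<Rightarrow> 'p assignment \<Rightarrow> 'p point set) \<Rightarrow> bool" where
  "tame d m M X \<longleftrightarrow> (\<forall>\<xi>. \<exists>n Ps. pieces_ok n Ps \<and>
     (\<forall>\<kappa>\<in>M. cls m \<xi> \<kappa> \<longrightarrow> (\<forall>a. carries m \<kappa> a \<longrightarrow> X \<kappa> a = pts m d Ps a)))"

lemma tameE:
  assumes "tame d m M X"
  obtains n Ps where "pieces_ok n Ps"
    "\<And>\<kappa> a. \<kappa> \<in> M \<Longrightarrow> cls m \<xi> \<kappa> \<Longrightarrow> carries m \<kappa> a \<Longrightarrow> X \<kappa> a = pts m d Ps a"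
proof -
  have "\<exists>n Ps. pieces_ok n Ps \<and> (\<forall>\<kappa>\<in>M. cls m \<xi> \<kappa> \<longrightarrow> (\<forall>a. carries m \<kappa> a \<longrightarrow> X \<kappa> a = pts m d Ps a))"
    using assms unfolding tame_def by (rule spec)
  then show ?thesis using that by blast
qed

section \<open>Closure properties of tame families\<close>

lemma pieces_ok_mono: "pieces_ok n Ps \<Longrightarrow> n \<le> n' \<Longrightarrow> pieces_ok n' Ps"
  unfolding pieces_ok_def using zero_from_mono by blast

lemma pieces_ok_Un: "pieces_ok n Ps \<Longrightarrow> pieces_ok n Qs \<Longrightarrow> pieces_ok n (Ps \<union> Qs)"
  unfolding pieces_ok_def by blast

lemma pts_Un: "pts m d (Ps \<union> Qs) a = pts m d Ps a \<union> pts m d Qs a"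
  unfolding pts_def by blast

lemma tame_empty: "tame d m M (\<lambda>_ _. {})"
  unfolding tame_def
  by (intro allI exI[of _ 0] exI[of _ "{}"]) (simp add: pieces_ok_def pts_def)

lemma tame_Un:
  assumes "tame d m M X" "tame d m M Y"
  shows "tame d m M (\<lambda>\<kappa> a. X \<kappa> a \<union> Y \<kappa> a)"
  unfolding tame_def
proof
  fix \<xi>
  obtain n Ps where X: "pieces_ok n Ps"
    "\<And>\<kappa> a. \<kappa> \<in> M \<Longrightarrow> cls m \<xi> \<kappa> \<Longrightarrow> carries m \<kappa> a \<Longrightarrow> X \<kappa> a = pts m d Ps a"
    by (rule tameE[OF assms(1), of \<xi>]) blast
  obtain n' Qs where Y: "pieces_ok n' Qs"
    "\<And>\<kappa> a. \<kappa> \<in> M \<Longrightarrow> cls m \<xi> \<kappa> \<Longrightarrow> carries m \<kappa> a \<Longrightarrow> Y \<kappa> a = pts m d Qs a"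
    by (rule tameE[OF assms(2), of \<xi>]) blast
  have "pieces_ok (n + n') (Ps \<union> Qs)"
    by (intro pieces_ok_Un pieces_ok_mono[OF X(1)] pieces_ok_mono[OF Y(1)]) auto
  then show "\<exists>n Ps. pieces_ok n Ps \<and>
      (\<forall>\<kappa>\<in>M. cls m \<xi> \<kappa> \<longrightarrow> (\<forall>a. carries m \<kappa> a \<longrightarrow> X \<kappa> a \<union> Y \<kappa> a = pts m d Ps a))"
    by (intro exI[of _ "n + n'"] exI[of _ "Ps \<union> Qs"]) (simp add: X(2) Y(2) pts_Un)
qed

lemma tame_UN:
  assumes "finite I" "\<And>i. i \<in> I \<Longrightarrow> tame d m M (X i)"
  shows "tame d m M (\<lambda>\<kappa> a. \<Union>i\<in>I. X i \<kappa> a)"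
  using assms by (induction I rule: finite_induct) (simp_all add: tame_empty tame_Un)

text \<open>In each class the transformation is a recipe that turns every piecewise rational family
  of points into another one and keeps finite support bounded.\<close>

definition utrans :: "nat \<Rightarrow> int list set \<Rightarrow> (int list \<Rightarrow> 'p assignment \<Rightarrow> 'p point \<Rightarrow> 'p point) \<Rightarrow> bool" where
  "utrans m M \<Phi> \<longleftrightarrow> (\<forall>\<kappa> a a'. agree m a a' \<longrightarrow> \<Phi> \<kappa> a = \<Phi> \<kappa> a') \<and>
     (\<forall>\<xi>. \<exists>\<Psi>. (\<forall>F. (\<forall>i. pw (\<lambda>a. F a i)) \<longrightarrow> (\<forall>i. pw (\<lambda>a. \<Psi> a (F a) i))) \<and>
       (\<forall>n. \<exists>n'. \<forall>a x. zero_from n x \<longrightarrow> zero_from n' (\<Psi> a x)) \<and>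
       (\<forall>\<kappa>\<in>M. cls m \<xi> \<kappa> \<longrightarrow> (\<forall>a. carries m \<kappa> a \<longrightarrow> \<Phi> \<kappa> a = \<Psi> a)))"

lemma utransI:
  assumes "\<And>\<kappa> a a'. agree m a a' \<Longrightarrow> \<Phi> \<kappa> a = \<Phi> \<kappa> a'"
    "\<And>\<xi>. \<exists>\<Psi>. (\<forall>F. (\<forall>i. pw (\<lambda>a. F a i)) \<longrightarrow> (\<forall>i. pw (\<lambda>a. \<Psi> a (F a) i))) \<and>
       (\<forall>n. \<exists>n'. \<forall>a x. zero_from n x \<longrightarrow> zero_from n' (\<Psi> a x)) \<and>
       (\<forall>\<kappa>\<in>M. cls m \<xi> \<kappa> \<longrightarrow> (\<forall>a. carries m \<kappa> a \<longrightarrow> \<Phi> \<kappa> a = \<Psi> a))"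
  shows "utrans m M \<Phi>"
  using assms unfolding utrans_def by blast

lemma utransE:
  assumes "utrans m M \<Phi>"
  obtains \<Psi> where "\<And>F. (\<And>i. pw (\<lambda>a. F a i)) \<Longrightarrow> (\<And>i. pw (\<lambda>a. \<Psi> a (F a) i))"
    "\<And>n. \<exists>n'. \<forall>a x. zero_from n x \<longrightarrow> zero_from n' (\<Psi> a x)"
    "\<And>\<kappa> a. \<kappa> \<in> M \<Longrightarrow> cls m \<xi> \<kappa> \<Longrightarrow> carries m \<kappa> a \<Longrightarrow> \<Phi> \<kappa> a = \<Psi> a"
proof -
  have "\<exists>\<Psi>. (\<forall>F. (\<forall>i. pw (\<lambda>a. F a i)) \<longrightarrow> (\<forall>i. pw (\<lambda>a. \<Psi> a (F a) i))) \<and>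
       (\<forall>n. \<exists>n'. \<forall>a x. zero_from n x \<longrightarrow> zero_from n' (\<Psi> a x)) \<and>
       (\<forall>\<kappa>\<in>M. cls m \<xi> \<kappa> \<longrightarrow> (\<forall>a. carries m \<kappa> a \<longrightarrow> \<Phi> \<kappa> a = \<Psi> a))"
    using assms[unfolded utrans_def, THEN conjunct2, THEN spec, of \<xi>] .
  then obtain \<Psi> where "\<forall>F. (\<forall>i. pw (\<lambda>a. F a i)) \<longrightarrow> (\<forall>i. pw (\<lambda>a. \<Psi> a (F a) i))"
    "\<forall>n. \<exists>n'. \<forall>a x. zero_from n x \<longrightarrow> zero_from n' (\<Psi> a x)"
    "\<forall>\<kappa>\<in>M. cls m \<xi> \<kappa> \<longrightarrow> (\<forall>a. carries m \<kappa> a \<longrightarrow> \<Phi> \<kappa> a = \<Psi> a)" by (elim exE conjE)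
  then show ?thesis by (intro that[of \<Psi>]) simp_all
qed

lemma utrans_agree: "utrans m M \<Phi> \<Longrightarrow> agree m a a' \<Longrightarrow> \<Phi> \<kappa> a = \<Phi> \<kappa> a'"
  by (simp add: utrans_def)

lemma utrans_id: "utrans m M (\<lambda>_ _ x. x)"
  by (rule utransI) auto

lemma utrans_comb:
  assumes "utrans m M \<Phi>" "utrans m M \<Psi>"
  shows "utrans m M (\<lambda>\<kappa> a x. comb (\<Phi> \<kappa> a x) (\<Psi> \<kappa> a x))"
proof (rule utransI)
  show "(\<lambda>x. comb (\<Phi> \<kappa> a x) (\<Psi> \<kappa> a x)) = (\<lambda>x. comb (\<Phi> \<kappa> a' x) (\<Psi> \<kappa> a' x))" if "agree m a a'" for \<kappa> a a'
    using utrans_agree[OF assms(1) that] utrans_agree[OF assms(2) that] by simp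
  fix \<xi>
  obtain \<Phi>' where f: "\<And>F i. (\<And>i. pw (\<lambda>a. F a i)) \<Longrightarrow> pw (\<lambda>a. \<Phi>' a (F a) i)"
    "\<And>n. \<exists>n'. \<forall>a x. zero_from n x \<longrightarrow> zero_from n' (\<Phi>' a x)"
    "\<And>\<kappa> a. \<kappa> \<in> M \<Longrightarrow> cls m \<xi> \<kappa> \<Longrightarrow> carries m \<kappa> a \<Longrightarrow> \<Phi> \<kappa> a = \<Phi>' a"
    by (rule utransE[OF assms(1), of \<xi>]) blast
  obtain \<Psi>' where g: "\<And>F i. (\<And>i. pw (\<lambda>a. F a i)) \<Longrightarrow> pw (\<lambda>a. \<Psi>' a (F a) i)"
    "\<And>n. \<exists>n'. \<forall>a x. zero_from n x \<longrightarrow> zero_from n' (\<Psi>' a x)"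
    "\<And>\<kappa> a. \<kappa> \<in> M \<Longrightarrow> cls m \<xi> \<kappa> \<Longrightarrow> carries m \<kappa> a \<Longrightarrow> \<Psi> \<kappa> a = \<Psi>' a"
    by (rule utransE[OF assms(2), of \<xi>]) blast
  show "\<exists>\<Theta>. (\<forall>F. (\<forall>i. pw (\<lambda>a. F a i)) \<longrightarrow> (\<forall>i. pw (\<lambda>a. \<Theta> a (F a) i))) \<and>
       (\<forall>n. \<exists>n'. \<forall>a x. zero_from n x \<longrightarrow> zero_from n' (\<Theta> a x)) \<and>
       (\<forall>\<kappa>\<in>M. cls m \<xi> \<kappa> \<longrightarrow> (\<forall>a. carries m \<kappa> a \<longrightarrow> (\<lambda>x. comb (\<Phi> \<kappa> a x) (\<Psi> \<kappa> a x)) = \<Theta> a))"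
  proof (intro exI[of _ "\<lambda>a x. comb (\<Phi>' a x) (\<Psi>' a x)"] conjI allI impI ballI)
    fix F :: "'p assignment \<Rightarrow> 'p point" and i assume F: "\<forall>i. pw (\<lambda>a. F a i)"
    show "pw (\<lambda>a. comb (\<Phi>' a (F a)) (\<Psi>' a (F a)) i)"
      unfolding comb_def using f(1)[of F "i div 2"] g(1)[of F "i div 2"] F by (cases "even i") simp_all
  next
    fix n
    obtain n1 n2 where n: "\<forall>a x. zero_from n x \<longrightarrow> zero_from n1 (\<Phi>' a x)"
      "\<forall>a x. zero_from n x \<longrightarrow> zero_from n2 (\<Psi>' a x)" using f(2)[of n] g(2)[of n] by (elim exE)
    show "\<exists>n'. \<forall>a x. zero_from n x \<longrightarrow> zero_from n' (comb (\<Phi>' a x) (\<Psi>' a x))"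
      by (intro exI[of _ "2 * (n1 + n2)"] allI impI zero_from_comb) (use n in simp_all)
  qed (simp add: f(3) g(3))
qed

lemma utrans_case_nat:
  assumes "unif m M f" "utrans m M \<Phi>"
  shows "utrans m M (\<lambda>\<kappa> a x. case_nat (f \<kappa> a) (\<Phi> \<kappa> a x))"
proof (rule utransI)
  show "(\<lambda>x. case_nat (f \<kappa> a) (\<Phi> \<kappa> a x)) = (\<lambda>x. case_nat (f \<kappa> a') (\<Phi> \<kappa> a' x))" if "agree m a a'" for \<kappa> a a'
    using utrans_agree[OF assms(2) that] unif_agree[OF assms(1) that] by simp
  fix \<xi>
  obtain f' where f: "pw f'" "\<And>\<kappa> a. \<kappa> \<in> M \<Longrightarrow> cls m \<xi> \<kappa> \<Longrightarrow> carries m \<kappa> a \<Longrightarrow> f \<kappa> a = f' a"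
    by (rule unifE[OF assms(1), of \<xi>]) blast
  obtain \<Psi>' where g: "\<And>F i. (\<And>i. pw (\<lambda>a. F a i)) \<Longrightarrow> pw (\<lambda>a. \<Psi>' a (F a) i)"
    "\<And>n. \<exists>n'. \<forall>a x. zero_from n x \<longrightarrow> zero_from n' (\<Psi>' a x)"
    "\<And>\<kappa> a. \<kappa> \<in> M \<Longrightarrow> cls m \<xi> \<kappa> \<Longrightarrow> carries m \<kappa> a \<Longrightarrow> \<Phi> \<kappa> a = \<Psi>' a"
    by (rule utransE[OF assms(2), of \<xi>]) blast
  show "\<exists>\<Theta>. (\<forall>F. (\<forall>i. pw (\<lambda>a. F a i)) \<longrightarrow> (\<forall>i. pw (\<lambda>a. \<Theta> a (F a) i))) \<and>
       (\<forall>n. \<exists>n'. \<forall>a x. zero_from n x \<longrightarrow> zero_from n' (\<Theta> a x)) \<and>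
       (\<forall>\<kappa>\<in>M. cls m \<xi> \<kappa> \<longrightarrow> (\<forall>a. carries m \<kappa> a \<longrightarrow> (\<lambda>x. case_nat (f \<kappa> a) (\<Phi> \<kappa> a x)) = \<Theta> a))"
  proof (intro exI[of _ "\<lambda>a x. case_nat (f' a) (\<Psi>' a x)"] conjI allI impI ballI)
    fix F :: "'p assignment \<Rightarrow> 'p point" and i assume F: "\<forall>i. pw (\<lambda>a. F a i)"
    show "pw (\<lambda>a. case_nat (f' a) (\<Psi>' a (F a)) i)"
      using f(1) g(1)[of F "i - 1"] F by (cases i) simp_all
  next
    fix n
    obtain n2 where n: "\<forall>a x. zero_from n x \<longrightarrow> zero_from n2 (\<Psi>' a x)" using g(2)[of n] by (elim exE)
    show "\<exists>n'. \<forall>a x. zero_from n x \<longrightarrow> zero_from n' (case_nat (f' a) (\<Psi>' a x))"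
      by (intro exI[of _ "Suc n2"] allI impI zero_from_case_nat) (use n in simp)
  qed (simp add: f(2) g(3))
qed

lemma utrans_scale:
  assumes "unif m M f" "utrans m M \<Phi>"
  shows "utrans m M (\<lambda>\<kappa> a x i. f \<kappa> a * \<Phi> \<kappa> a x i)"
proof (rule utransI)
  show "(\<lambda>x i. f \<kappa> a * \<Phi> \<kappa> a x i) = (\<lambda>x i. f \<kappa> a' * \<Phi> \<kappa> a' x i)" if "agree m a a'" for \<kappa> a a'
    using utrans_agree[OF assms(2) that] unif_agree[OF assms(1) that] by simp
  fix \<xi>
  obtain f' where f: "pw f'" "\<And>\<kappa> a. \<kappa> \<in> M \<Longrightarrow> cls m \<xi> \<kappa> \<Longrightarrow> carries m \<kappa> a \<Longrightarrow> f \<kappa> a = f' a"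
    by (rule unifE[OF assms(1), of \<xi>]) blast
  obtain \<Psi>' where g: "\<And>F i. (\<And>i. pw (\<lambda>a. F a i)) \<Longrightarrow> pw (\<lambda>a. \<Psi>' a (F a) i)"
    "\<And>n. \<exists>n'. \<forall>a x. zero_from n x \<longrightarrow> zero_from n' (\<Psi>' a x)"
    "\<And>\<kappa> a. \<kappa> \<in> M \<Longrightarrow> cls m \<xi> \<kappa> \<Longrightarrow> carries m \<kappa> a \<Longrightarrow> \<Phi> \<kappa> a = \<Psi>' a"
    by (rule utransE[OF assms(2), of \<xi>]) blast
  show "\<exists>\<Theta>. (\<forall>F. (\<forall>i. pw (\<lambda>a. F a i)) \<longrightarrow> (\<forall>i. pw (\<lambda>a. \<Theta> a (F a) i))) \<and>
       (\<forall>n. \<exists>n'. \<forall>a x. zero_from n x \<longrightarrow> zero_from n' (\<Theta> a x)) \<and>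
       (\<forall>\<kappa>\<in>M. cls m \<xi> \<kappa> \<longrightarrow> (\<forall>a. carries m \<kappa> a \<longrightarrow> (\<lambda>x i. f \<kappa> a * \<Phi> \<kappa> a x i) = \<Theta> a))"
  proof (intro exI[of _ "\<lambda>a x i. f' a * \<Psi>' a x i"] conjI allI impI ballI)
    fix F :: "'p assignment \<Rightarrow> 'p point" and i assume F: "\<forall>i. pw (\<lambda>a. F a i)"
    show "pw (\<lambda>a. f' a * \<Psi>' a (F a) i)"
      using f(1) g(1)[of F i] F by (simp add: pw_mult)
  next
    fix n
    obtain n2 where n: "\<forall>a x. zero_from n x \<longrightarrow> zero_from n2 (\<Psi>' a x)" using g(2)[of n] by (elim exE)
    show "\<exists>n'. \<forall>a x. zero_from n x \<longrightarrow> zero_from n' (\<lambda>i. f' a * \<Psi>' a x i)"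
      by (intro exI[of _ n2]) (use n in \<open>simp add: zero_from_def\<close>)
  qed (simp add: f(2) g(3))
qed

lemma utrans_const:
  assumes "\<And>c. unif m M (\<lambda>\<kappa> a. x \<kappa> a c)" "\<And>\<kappa> a. zero_from n (x \<kappa> a)"
  shows "utrans m M (\<lambda>\<kappa> a _. x \<kappa> a)"
proof (rule utransI)
  show "(\<lambda>_ :: 'p point. x \<kappa> a) = (\<lambda>_. x \<kappa> a')" if "agree m a a'" for \<kappa> a a'
    using unif_agree[OF assms(1) that] by (auto simp: fun_eq_iff)
  fix \<xi>
  have "\<forall>c. \<exists>g. pw g \<and> (\<forall>\<kappa>\<in>M. cls m \<xi> \<kappa> \<longrightarrow> (\<forall>a. carries m \<kappa> a \<longrightarrow> x \<kappa> a c = g a))"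
    using assms(1) unfolding unif_def by blast
  then obtain g where g: "\<And>c. pw (g c)" "\<And>c \<kappa> a. \<kappa> \<in> M \<Longrightarrow> cls m \<xi> \<kappa> \<Longrightarrow> carries m \<kappa> a \<Longrightarrow> x \<kappa> a c = g c a"
    by (simp only: choice_iff) blast
  define G where "G a c = (if c < n then g c a else 0)" for a c
  have G: "x \<kappa> a = G a" if "\<kappa> \<in> M" "cls m \<xi> \<kappa>" "carries m \<kappa> a" for \<kappa> a
  proof
    fix c show "x \<kappa> a c = G a c"
      using g(2)[OF that] assms(2)[of \<kappa> a] by (auto simp: G_def zero_from_def)
  qed
  show "\<exists>\<Theta>. (\<forall>F. (\<forall>i. pw (\<lambda>a. F a i)) \<longrightarrow> (\<forall>i. pw (\<lambda>a. \<Theta> a (F a) i))) \<and>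
       (\<forall>n. \<exists>n'. \<forall>a x. zero_from n x \<longrightarrow> zero_from n' (\<Theta> a x)) \<and>
       (\<forall>\<kappa>\<in>M. cls m \<xi> \<kappa> \<longrightarrow> (\<forall>a. carries m \<kappa> a \<longrightarrow> (\<lambda>_. x \<kappa> a) = \<Theta> a))"
  proof (intro exI[of _ "\<lambda>a _. G a"] conjI allI impI ballI)
    show "pw (\<lambda>a. G a i)" for i
      unfolding G_def using g(1) pw_0 by (cases "i < n") simp_all
    show "\<exists>n'. \<forall>a x. zero_from k x \<longrightarrow> zero_from n' (G a)" for k
      by (intro exI[of _ n]) (simp add: zero_from_def G_def)
  qed (simp add: G)
qed

lemma tame_map:
  assumes X: "tame d m M X" and \<Phi>: "utrans m M \<Phi>"
  shows "tame d m M (\<lambda>\<kappa> a. \<Phi> \<kappa> a ` X \<kappa> a)"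
  unfolding tame_def
proof
  fix \<xi>
  obtain n Ps where Ps: "pieces_ok n Ps"
    "\<And>\<kappa> a. \<kappa> \<in> M \<Longrightarrow> cls m \<xi> \<kappa> \<Longrightarrow> carries m \<kappa> a \<Longrightarrow> X \<kappa> a = pts m d Ps a"
    by (rule tameE[OF X, of \<xi>]) blast
  obtain \<Psi> where \<Psi>: "\<And>F i. (\<And>i. pw (\<lambda>a. F a i)) \<Longrightarrow> pw (\<lambda>a. \<Psi> a (F a) i)"
    "\<And>n. \<exists>n'. \<forall>a x. zero_from n x \<longrightarrow> zero_from n' (\<Psi> a x)"
    "\<And>\<kappa> a. \<kappa> \<in> M \<Longrightarrow> cls m \<xi> \<kappa> \<Longrightarrow> carries m \<kappa> a \<Longrightarrow> \<Phi> \<kappa> a = \<Psi> a"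
    by (rule utransE[OF \<Phi>, of \<xi>]) blast
  obtain n' where n': "\<forall>a x. zero_from n x \<longrightarrow> zero_from n' (\<Psi> a x)" using \<Psi>(2) by blast
  define Qs where "Qs = (\<lambda>(D, F). (D, \<lambda>a. \<Psi> a (F a))) ` Ps"
  have "pieces_ok n' Qs"
    using Ps(1) \<Psi>(1) n' unfolding pieces_ok_def Qs_def by fastforce
  moreover have "\<Phi> \<kappa> a ` X \<kappa> a = pts m d Qs a" if \<kappa>: "\<kappa> \<in> M" "cls m \<xi> \<kappa>" "carries m \<kappa> a" for \<kappa> a
  proof -
    \<comment> \<open>The pieces evaluate the recipe at \<open>a'\<close>, which also holds the free
      entries; it agrees with \<open>a\<close> on the carriers, so the result is the same.\<close>
    have eq: "\<Phi> \<kappa> a = \<Psi> a'" if "agree m a a'" for a'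
      using \<Psi>(3)[OF \<kappa>(1,2) carries_agree[OF \<kappa>(3) that]] utrans_agree[OF \<Phi> that] by simp
    show ?thesis unfolding Ps(2)[OF \<kappa>]
    proof (intro subset_antisym subsetI)
      fix y assume "y \<in> \<Phi> \<kappa> a ` pts m d Ps a"
      then obtain D F a' where "(D, F) \<in> Ps" "agree m a a'" "\<forall>i\<ge>m + d. a' i = 0" "D a'" "y = \<Phi> \<kappa> a (F a')"
        unfolding pts_def by blast
      then show "y \<in> pts m d Qs a"
        unfolding pts_def Qs_def using eq[of a'] by (intro CollectI exI[of _ D] exI[of _ "\<lambda>a. \<Psi> a (F a)"] exI[of _ a']) force
    next
      fix y assume "y \<in> pts m d Qs a"
      then obtain D F a' where "(D, F) \<in> Ps" "agree m a a'" "\<forall>i\<ge>m + d. a' i = 0" "D a'" "y = \<Psi> a' (F a')"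
        unfolding pts_def Qs_def by auto
      then show "y \<in> \<Phi> \<kappa> a ` pts m d Ps a"
        unfolding pts_def using eq[of a'] by auto
    qed
  qed
  ultimately show "\<exists>n Ps. pieces_ok n Ps \<and> (\<forall>\<kappa>\<in>M. cls m \<xi> \<kappa> \<longrightarrow> (\<forall>a. carries m \<kappa> a \<longrightarrow> \<Phi> \<kappa> a ` X \<kappa> a = pts m d Ps a))"
    by blast
qed

lemma tame_zero: "tame d m M (\<lambda>_ _. {\<lambda>_. 0})"
  unfolding tame_def
proof
  fix \<xi>
  have "pts m d {(\<lambda>_. True, \<lambda>_ _. 0)} a = {\<lambda>_. 0}" for a
    unfolding pts_def agree_def by (auto intro!: exI[of _ "\<lambda>i. if i < m then a i else 0"])
  then show "\<exists>n Ps. pieces_ok n Ps \<and> (\<forall>\<kappa>\<in>M. cls m \<xi> \<kappa> \<longrightarrow> (\<forall>a. carries m \<kappa> a \<longrightarrow> {\<lambda>_. 0} = pts m d Ps a))"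
    by (intro exI[of _ 0] exI[of _ "{(\<lambda>_. True, \<lambda>_ _. 0)}"])
       (simp add: pieces_ok_def dfn_const pw_0 zero_from_def)
qed

text \<open>Hence every element of \<open>H\<close> carries exactly one parameter in each class mod
  h.\<close>

lemma H_val:
  assumes "s \<in> H"
  shows "\<exists>k. pval s = int \<phi> * k"
proof -
  obtain x where x: "x \<noteq> 0" "s / x ^ \<phi> - 1 \<in> pball (int q)" "s \<noteq> 0" using assms by (auto simp: H_def)
  then have "pval (s / x ^ \<phi>) = 0" using one_plus_pball(2)[OF x(2)] q_pos by simp
  then have "pval s = int \<phi> * pval x" using x by (simp add: pval_divide pval_power)
  then show ?thesis by blast
qed

lemma carries_Suc:
  assumes "length \<kappa> = m"
  shows "carries (Suc m) (\<kappa> @ [k]) a \<longleftrightarrow> carries m \<kappa> a \<and> a m \<in> H \<and> pval (a m) = int \<phi> * (k div h)"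
  using assms by (auto simp: carries_def less_Suc_eq nth_append)

lemma cls_Suc:
  assumes "length \<kappa> = m"
  shows "cls (Suc m) (\<xi>(m := \<eta>)) (\<kappa> @ [k]) \<longleftrightarrow> cls m \<xi> \<kappa> \<and> k mod h = \<eta>"
  using assms by (auto simp: cls_def less_Suc_eq nth_append)

text \<open>The carrier s of the last parameter becomes a free parameter, which raises the dimension
  by one. In the class of \<eta> mod h the parameter is recovered as k = \<eta> + q * v(s), so its
  domain N turns into a definable condition C on s; the h classes are united.\<close>

lemma tame_fiber:
  assumes Y: "tame d (Suc m) N Y" and len: "\<And>\<kappa>. \<kappa> \<in> M \<Longrightarrow> length \<kappa> = m"
    and N: "\<And>\<xi> \<eta>. 0 \<le> \<eta> \<Longrightarrow> \<eta> < h \<Longrightarrow> \<exists>C. dfn C \<and> (\<forall>\<kappa>\<in>M. cls m \<xi> \<kappa> \<longrightarrow> (\<forall>a. carries m \<kappa> a \<and> a m \<in> H \<longrightarrow>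
       (\<kappa> @ [\<eta> + int q * pval (a m)] \<in> N \<longleftrightarrow> C a)))"
  shows "tame (Suc d) m M (\<lambda>\<kappa> a. {x. \<exists>s k. \<kappa> @ [k] \<in> N \<and> carries (Suc m) (\<kappa> @ [k]) (a(m := s)) \<and>
     x \<in> Y (\<kappa> @ [k]) (a(m := s))})"
  unfolding tame_def
proof
  fix \<xi> :: "nat \<Rightarrow> int"
  have "\<exists>n Ps C. pieces_ok n Ps \<and> (\<forall>\<kappa>\<in>N. cls (Suc m) (\<xi>(m := \<eta>)) \<kappa> \<longrightarrow>
      (\<forall>a. carries (Suc m) \<kappa> a \<longrightarrow> Y \<kappa> a = pts (Suc m) d Ps a)) \<and> dfn C \<and>
      (\<forall>\<kappa>\<in>M. cls m \<xi> \<kappa> \<longrightarrow> (\<forall>a. carries m \<kappa> a \<and> a m \<in> H \<longrightarrow> (\<kappa> @ [\<eta> + int q * pval (a m)] \<in> N \<longleftrightarrow> C a)))"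
    if \<eta>: "\<eta> \<in> {0..<h}" for \<eta>
  proof -
    obtain C where C: "dfn C" "\<forall>\<kappa>\<in>M. cls m \<xi> \<kappa> \<longrightarrow> (\<forall>a. carries m \<kappa> a \<and> a m \<in> H \<longrightarrow>
       (\<kappa> @ [\<eta> + int q * pval (a m)] \<in> N \<longleftrightarrow> C a))" using N[of \<eta> \<xi>] \<eta> by auto
    obtain n Ps where Ps: "pieces_ok n Ps" "\<And>\<kappa> a. \<kappa> \<in> N \<Longrightarrow> cls (Suc m) (\<xi>(m := \<eta>)) \<kappa> \<Longrightarrow>
      carries (Suc m) \<kappa> a \<Longrightarrow> Y \<kappa> a = pts (Suc m) d Ps a"
      by (rule tameE[OF Y, of "\<xi>(m := \<eta>)"]) blast
    show ?thesis by (intro exI[of _ n] exI[of _ Ps] exI[of _ C]) (use C Ps in blast)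
  qed
  then have "\<forall>\<eta>\<in>{0..<h}. \<exists>n Ps C. pieces_ok n Ps \<and> (\<forall>\<kappa>\<in>N. cls (Suc m) (\<xi>(m := \<eta>)) \<kappa> \<longrightarrow>
      (\<forall>a. carries (Suc m) \<kappa> a \<longrightarrow> Y \<kappa> a = pts (Suc m) d Ps a)) \<and> dfn C \<and>
      (\<forall>\<kappa>\<in>M. cls m \<xi> \<kappa> \<longrightarrow> (\<forall>a. carries m \<kappa> a \<and> a m \<in> H \<longrightarrow> (\<kappa> @ [\<eta> + int q * pval (a m)] \<in> N \<longleftrightarrow> C a)))"
    by blast
  then obtain n Ps C where all: "\<forall>\<eta>\<in>{0..<h}. pieces_ok (n \<eta>) (Ps \<eta>) \<and> (\<forall>\<kappa>\<in>N. cls (Suc m) (\<xi>(m := \<eta>)) \<kappa> \<longrightarrow>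
      (\<forall>a. carries (Suc m) \<kappa> a \<longrightarrow> Y \<kappa> a = pts (Suc m) d (Ps \<eta>) a)) \<and> dfn (C \<eta>) \<and>
      (\<forall>\<kappa>\<in>M. cls m \<xi> \<kappa> \<longrightarrow> (\<forall>a. carries m \<kappa> a \<and> a m \<in> H \<longrightarrow> (\<kappa> @ [\<eta> + int q * pval (a m)] \<in> N \<longleftrightarrow> C \<eta> a)))"
    by (simp only: bchoice_iff) blast
  have ok: "pieces_ok (n \<eta>) (Ps \<eta>)" "dfn (C \<eta>)" if "\<eta> \<in> {0..<h}" for \<eta> using all that by blast+
  have Yeq: "Y \<kappa> a = pts (Suc m) d (Ps \<eta>) a" if "\<eta> \<in> {0..<h}" "\<kappa> \<in> N" "cls (Suc m) (\<xi>(m := \<eta>)) \<kappa>" "carries (Suc m) \<kappa> a" for \<eta> \<kappa> a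
    using all that by blast
  have Ceq: "\<kappa> @ [\<eta> + int q * pval (a m)] \<in> N \<longleftrightarrow> C \<eta> a" if "\<eta> \<in> {0..<h}" "\<kappa> \<in> M" "cls m \<xi> \<kappa>" "carries m \<kappa> a" "a m \<in> H" for \<eta> \<kappa> a
    using all that by blast
  \<comment> \<open>One copy of the pieces for each class, restricted to those s that carry a
    parameter in the domain.\<close>
  define Qs where "Qs = (\<Union>\<eta>\<in>{0..<h}. (\<lambda>(D, F). (\<lambda>a. a m \<in> H \<and> C \<eta> a \<and> D a, F)) ` Ps \<eta>)"
  have "pieces_ok (\<Sum>\<eta>\<in>{0..<h}. n \<eta>) Qs"
    unfolding pieces_ok_def
  proof (intro conjI allI impI)
    show "finite Qs" unfolding Qs_def using ok(1) by (auto simp: pieces_ok_def)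
    fix D F assume "(D, F) \<in> Qs"
    then obtain \<eta> D0 where \<eta>: "\<eta> \<in> {0..<h}" "(D0, F) \<in> Ps \<eta>" "D = (\<lambda>a. a m \<in> H \<and> C \<eta> a \<and> D0 a)"
      unfolding Qs_def by auto
    then have P: "dfn D0" "\<And>i. pw (\<lambda>a. F a i)" "\<And>a. zero_from (n \<eta>) (F a)"
      using ok(1)[OF \<eta>(1)] unfolding pieces_ok_def by auto
    show "dfn D" unfolding \<eta>(3) by (intro dfn_conj dfn_H ok(2) \<eta>(1) P(1))
    show "pw (\<lambda>a. F a i)" for i by (rule P(2))
    show "zero_from (\<Sum>\<eta>\<in>{0..<h}. n \<eta>) (F a)" for a
      using \<eta>(1) by (intro zero_from_mono[OF P(3)] member_le_sum) auto
  qed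
  moreover have "{x. \<exists>s k. \<kappa> @ [k] \<in> N \<and> carries (Suc m) (\<kappa> @ [k]) (a(m := s)) \<and> x \<in> Y (\<kappa> @ [k]) (a(m := s))} =
      pts m (Suc d) Qs a" (is "?X = _") if \<kappa>: "\<kappa> \<in> M" "cls m \<xi> \<kappa>" "carries m \<kappa> a" for \<kappa> a
  proof (intro subset_antisym subsetI)
    fix x assume "x \<in> ?X"
    then obtain s k where sk: "\<kappa> @ [k] \<in> N" "carries (Suc m) (\<kappa> @ [k]) (a(m := s))" "x \<in> Y (\<kappa> @ [k]) (a(m := s))" by blast
    define \<eta> where "\<eta> = k mod h"
    have \<eta>: "\<eta> \<in> {0..<h}" using h_pos by (simp add: \<eta>_def)
    have "cls (Suc m) (\<xi>(m := \<eta>)) (\<kappa> @ [k])" using cls_Suc[OF len[OF \<kappa>(1)]] \<kappa>(2) by (simp add: \<eta>_def)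
    then have "x \<in> pts (Suc m) d (Ps \<eta>) (a(m := s))" using Yeq[OF \<eta> sk(1) _ sk(2)] sk(3) by simp
    then obtain D F a' where a': "(D, F) \<in> Ps \<eta>" "agree (Suc m) (a(m := s)) a'" "\<forall>i\<ge>Suc m + d. a' i = 0" "D a'" "x = F a'"
      unfolding pts_def by blast
    have a'm: "a' m = s" "agree m a a'" using a'(2) by (auto simp: agree_def less_Suc_eq)
    have s: "s \<in> H" "pval s = int \<phi> * (k div h)" using sk(2) carries_Suc[OF len[OF \<kappa>(1)]] by auto
    have "\<eta> + int q * pval s = k" unfolding s(2) \<eta>_def by (simp add: h_def flip: mult.assoc)
    then have "C \<eta> a'" using Ceq[OF \<eta> \<kappa>(1,2) carries_agree[OF \<kappa>(3) a'm(2)]] a'm s(1) sk(1) by simp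
    then have "(\<lambda>a. a m \<in> H \<and> C \<eta> a \<and> D a) a'" using a'm(1) s(1) a'(4) by simp
    moreover have "(\<lambda>a. a m \<in> H \<and> C \<eta> a \<and> D a, F) \<in> Qs" unfolding Qs_def using \<eta> a'(1) by force
    ultimately show "x \<in> pts m (Suc d) Qs a" unfolding pts_def using a'm(2) a'(3,5) by auto
  next
    fix x assume "x \<in> pts m (Suc d) Qs a"
    then obtain D F a' where a': "(D, F) \<in> Qs" "agree m a a'" "\<forall>i\<ge>m + Suc d. a' i = 0" "D a'" "x = F a'"
      unfolding pts_def by blast
    then obtain \<eta> D0 where \<eta>: "\<eta> \<in> {0..<h}" "(D0, F) \<in> Ps \<eta>" "a' m \<in> H" "C \<eta> a'" "D0 a'"
      unfolding Qs_def by auto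
    obtain k where k: "pval (a' m) = int \<phi> * k" using H_val[OF \<eta>(3)] by blast
    define l where "l = \<eta> + h * k"
    have "l div h = k" "l mod h = \<eta>" using \<eta>(1) h_pos by (auto simp: l_def)
    moreover have "\<eta> + int q * pval (a' m) = l" by (simp add: l_def k h_def)
    ultimately have l: "l div h = k" "l mod h = \<eta>" "\<eta> + int q * pval (a' m) = l" by auto
    have lN: "\<kappa> @ [l] \<in> N" using Ceq[OF \<eta>(1) \<kappa>(1,2) carries_agree[OF \<kappa>(3) a'(2)] \<eta>(3)] \<eta>(4) l(3) by simp
    have c: "carries (Suc m) (\<kappa> @ [l]) (a(m := a' m))"
      using carries_Suc[OF len[OF \<kappa>(1)]] carries_agree[OF \<kappa>(3), of "a(m := a' m)"] \<eta>(3) k l(1) by (simp add: agree_def)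
    have "x \<in> pts (Suc m) d (Ps \<eta>) (a(m := a' m))"
      unfolding pts_def using \<eta>(2,5) a'(2,3,5) by (auto simp: agree_def less_Suc_eq)
    then have "x \<in> Y (\<kappa> @ [l]) (a(m := a' m))"
      using Yeq[OF \<eta>(1) lN _ c] cls_Suc[OF len[OF \<kappa>(1)]] \<kappa>(2) l(2) by simp
    then show "x \<in> ?X" using lN c by blast
  qed
  ultimately show "\<exists>n Ps. pieces_ok n Ps \<and> (\<forall>\<kappa>\<in>M. cls m \<xi> \<kappa> \<longrightarrow> (\<forall>a. carries m \<kappa> a \<longrightarrow>
      {x. \<exists>s k. \<kappa> @ [k] \<in> N \<and> carries (Suc m) (\<kappa> @ [k]) (a(m := s)) \<and> x \<in> Y (\<kappa> @ [k]) (a(m := s))} = pts m (Suc d) Ps a))"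
    by blast
qed

text \<open>The new last carrier is stepped over by renaming: variables from m on move up by
  one.\<close>

lemma tame_shift:
  assumes X: "tame d m M X" and N: "\<And>\<kappa>. \<kappa> \<in> N \<Longrightarrow> butlast \<kappa> \<in> M \<and> length \<kappa> = Suc m"
  shows "tame d (Suc m) N (\<lambda>\<kappa> a. X (butlast \<kappa>) a)"
  unfolding tame_def
proof
  fix \<xi>
  obtain n Ps where Ps: "pieces_ok n Ps"
    "\<And>\<kappa> a. \<kappa> \<in> M \<Longrightarrow> cls m \<xi> \<kappa> \<Longrightarrow> carries m \<kappa> a \<Longrightarrow> X \<kappa> a = pts m d Ps a"
    by (rule tameE[OF X, of \<xi>]) blast
  define f :: "nat \<Rightarrow> nat" where "f i = (if i < m then i else Suc i)" for i
  have f: "inj f" by (auto simp: inj_def f_def split: if_splits)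
  define Qs where "Qs = (\<lambda>(D, F). (\<lambda>a. D (\<lambda>i. a (f i)), \<lambda>a. F (\<lambda>i. a (f i)))) ` Ps"
  have "pieces_ok n Qs"
    unfolding pieces_ok_def
  proof (intro conjI allI impI)
    show "finite Qs" unfolding Qs_def using Ps(1) by (simp add: pieces_ok_def)
    fix D' F' assume "(D', F') \<in> Qs"
    then obtain D F where DF: "(D, F) \<in> Ps" "D' = (\<lambda>a. D (\<lambda>i. a (f i)))" "F' = (\<lambda>a. F (\<lambda>i. a (f i)))"
      unfolding Qs_def by auto
    then have "dfn D" "\<And>i. pw (\<lambda>a. F a i)" "\<And>a. zero_from n (F a)" using Ps(1) unfolding pieces_ok_def by auto
    then show "dfn D'" "\<And>i. pw (\<lambda>a. F' a i)" "\<And>a. zero_from n (F' a)"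
      unfolding DF(2,3) using dfn_rename[OF _ f] pw_rename[OF _ f] by auto
  qed
  moreover have "X (butlast \<kappa>) a = pts (Suc m) d Qs a" if \<kappa>: "\<kappa> \<in> N" "cls (Suc m) \<xi> \<kappa>" "carries (Suc m) \<kappa> a" for \<kappa> a
  proof -
    have len: "length \<kappa> = Suc m" "butlast \<kappa> \<in> M" using N \<kappa>(1) by auto
    have "cls m \<xi> (butlast \<kappa>)" "carries m (butlast \<kappa>) a"
      using \<kappa>(2,3) len(1) by (auto simp: cls_def carries_def nth_butlast)
    then have "X (butlast \<kappa>) a = pts m d Ps a" by (rule Ps(2)[OF len(2)])
    also have "\<dots> = pts (Suc m) d Qs a"
    proof (intro subset_antisym subsetI)
      fix x assume "x \<in> pts m d Ps a"
      then obtain D F b where b: "(D, F) \<in> Ps" "agree m a b" "\<forall>i\<ge>m + d. b i = 0" "D b" "x = F b" unfolding pts_def by blast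
      define b' where "b' i = (if i < m then b i else if i = m then a m else b (i - 1))" for i
      have "(\<lambda>i. b' (f i)) = b" by (auto simp: b'_def f_def)
      moreover have "agree (Suc m) a b'" using b(2) by (auto simp: agree_def b'_def less_Suc_eq)
      moreover have "\<forall>i\<ge>Suc m + d. b' i = 0" using b(3) by (auto simp: b'_def)
      moreover have "(\<lambda>a. D (\<lambda>i. a (f i)), \<lambda>a. F (\<lambda>i. a (f i))) \<in> Qs" unfolding Qs_def using b(1) by force
      ultimately show "x \<in> pts (Suc m) d Qs a" unfolding pts_def using b(4,5)
        by (intro CollectI exI[of _ "\<lambda>a. D (\<lambda>i. a (f i))"] exI[of _ "\<lambda>a. F (\<lambda>i. a (f i))"] exI[of _ b']) auto
    next
      fix x assume "x \<in> pts (Suc m) d Qs a"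
      then obtain D F b where b: "(D, F) \<in> Ps" "agree (Suc m) a b" "\<forall>i\<ge>Suc m + d. b i = 0"
        "D (\<lambda>i. b (f i))" "x = F (\<lambda>i. b (f i))" unfolding pts_def Qs_def by auto
      have "agree m a (\<lambda>i. b (f i))" using b(2) by (auto simp: agree_def f_def)
      moreover have "\<forall>i\<ge>m + d. b (f i) = 0" using b(3) by (auto simp: f_def)
      ultimately show "x \<in> pts m d Ps a" unfolding pts_def using b(1,4,5) by auto
    qed
    finally show ?thesis .
  qed
  ultimately show "\<exists>n Ps. pieces_ok n Ps \<and>
      (\<forall>\<kappa>\<in>N. cls (Suc m) \<xi> \<kappa> \<longrightarrow> (\<forall>a. carries (Suc m) \<kappa> a \<longrightarrow> X (butlast \<kappa>) a = pts (Suc m) d Ps a))" by blast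
qed

end

section \<open>Realizing trees\<close>

context modulus
begin

text \<open>
  \<open>X \<kappa> a\<close> is a set of points, each with the ray of \<open>T \<kappa>\<close> it stands for. The second condition says
  that two points agree mod \<open>p ^ j\<close> iff their rays agree up to depth \<open>j\<close>, even if the field
  elements that carry the parameters differ slightly.
\<close>

definition realizes :: "nat \<Rightarrow> nat \<Rightarrow> int list set \<Rightarrow> (int list \<Rightarrow> 'b rtree) \<Rightarrow>
    (int list \<Rightarrow> 'p assignment \<Rightarrow> ('p point \<times> (nat \<Rightarrow> 'b)) set) \<Rightarrow> bool" where
  "realizes d m M T X \<longleftrightarrow>
     (\<forall>\<kappa>\<in>M. \<forall>a x \<beta>. carries m \<kappa> a \<and> (x, \<beta>) \<in> X \<kappa> a \<longrightarrow> ray (T \<kappa>) \<beta> \<and> (\<forall>i. x i \<in> pball 0)) \<and>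
     (\<forall>\<kappa>\<in>M. \<forall>a a' x \<beta> x' \<beta>' j. carries m \<kappa> a \<and> carries m \<kappa> a' \<and> close m (int j) a a' \<and>
        (x, \<beta>) \<in> X \<kappa> a \<and> (x', \<beta>') \<in> X \<kappa> a' \<longrightarrow> (congr (int j) x x' \<longleftrightarrow> \<beta> j = \<beta>' j)) \<and>
     (\<forall>\<kappa>\<in>M. \<forall>a \<beta> j. carries m \<kappa> a \<and> ray (T \<kappa>) \<beta> \<longrightarrow> (\<exists>x \<beta>'. (x, \<beta>') \<in> X \<kappa> a \<and> \<beta>' j = \<beta> j)) \<and>
     tame d m M (\<lambda>\<kappa> a. fst ` X \<kappa> a)"

lemma realizesD:
  assumes "realizes d m M T X"
  shows "\<kappa> \<in> M \<Longrightarrow> carries m \<kappa> a \<Longrightarrow> (x, \<beta>) \<in> X \<kappa> a \<Longrightarrow> ray (T \<kappa>) \<beta>"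
    "\<kappa> \<in> M \<Longrightarrow> carries m \<kappa> a \<Longrightarrow> (x, \<beta>) \<in> X \<kappa> a \<Longrightarrow> x i \<in> pball 0"
    "\<kappa> \<in> M \<Longrightarrow> carries m \<kappa> a \<Longrightarrow> carries m \<kappa> a' \<Longrightarrow> close m (int j) a a' \<Longrightarrow>
      (x, \<beta>) \<in> X \<kappa> a \<Longrightarrow> (x', \<beta>') \<in> X \<kappa> a' \<Longrightarrow> congr (int j) x x' \<longleftrightarrow> \<beta> j = \<beta>' j"
    "\<kappa> \<in> M \<Longrightarrow> carries m \<kappa> a \<Longrightarrow> ray (T \<kappa>) \<gamma> \<Longrightarrow> \<exists>x \<beta>'. (x, \<beta>') \<in> X \<kappa> a \<and> \<beta>' j = \<gamma> j"
    "tame d m M (\<lambda>\<kappa> a. fst ` X \<kappa> a)"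
  using assms unfolding realizes_def by simp_all

lemma carries_butlast: "length \<kappa> = Suc m \<Longrightarrow> carries (Suc m) \<kappa> a \<Longrightarrow> carries m (butlast \<kappa>) a"
  by (simp add: carries_def nth_butlast)

lemma close_Suc: "close (Suc m) j a a' \<longleftrightarrow> close m j a a' \<and> a m ^ q / a' m ^ q - 1 \<in> pball j"
  by (auto simp: close_def less_Suc_eq)

text \<open>Lets side branches at joints, which depend on \<kappa> only, be treated like those on
  bones, which have the depth as an additional parameter.\<close>

lemma realizes_shift:
  assumes X: "realizes d m M T X" and N: "\<And>\<kappa>. \<kappa> \<in> N \<Longrightarrow> butlast \<kappa> \<in> M \<and> length \<kappa> = Suc m"
  shows "realizes d (Suc m) N (\<lambda>\<kappa>. T (butlast \<kappa>)) (\<lambda>\<kappa> a. X (butlast \<kappa>) a)"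
proof -
  note x = realizesD[OF X]
  have c: "carries m (butlast \<kappa>) a" if "\<kappa> \<in> N" "carries (Suc m) \<kappa> a" for \<kappa> a
    using N[OF that(1)] that(2) carries_butlast by blast
  show ?thesis
    unfolding realizes_def
  proof (intro conjI ballI allI impI)
    fix \<kappa> a y \<beta> assume \<kappa>: "\<kappa> \<in> N" and y: "carries (Suc m) \<kappa> a \<and> (y, \<beta>) \<in> X (butlast \<kappa>) a"
    then show "ray (T (butlast \<kappa>)) \<beta>" "\<And>i. y i \<in> pball 0" using x(1,2) c N by blast+
  next
    fix \<kappa> a a' y \<beta> y' \<beta>' j
    assume "\<kappa> \<in> N" "carries (Suc m) \<kappa> a \<and> carries (Suc m) \<kappa> a' \<and> close (Suc m) (int j) a a' \<and>
        (y, \<beta>) \<in> X (butlast \<kappa>) a \<and> (y', \<beta>') \<in> X (butlast \<kappa>) a'"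
    then show "congr (int j) y y' \<longleftrightarrow> \<beta> j = \<beta>' j" using x(3)[of "butlast \<kappa>" a a' j y \<beta> y' \<beta>'] c N by (simp add: close_Suc)
  next
    fix \<kappa> a \<beta> j assume "\<kappa> \<in> N" "carries (Suc m) \<kappa> a \<and> ray (T (butlast \<kappa>)) \<beta>"
    then show "\<exists>x \<beta>'. (x, \<beta>') \<in> X (butlast \<kappa>) a \<and> \<beta>' j = \<beta> j" using x(4) c N by blast
  next
    show "tame d (Suc m) N (\<lambda>\<kappa> a. fst ` X (butlast \<kappa>) a)" by (rule tame_shift[OF x(5) N])
  qed
qed

lemma ray_iso:
  assumes f: "bij_betw f (nodes T) (nodes T')" "\<forall>u\<in>nodes T. \<forall>v\<in>nodes T. (u, v) \<in> child_rel T \<longleftrightarrow> (f u, f v) \<in> child_rel T'"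
    and T: "tree_at T r D" and T': "tree_at T' r' D'" and \<beta>: "ray T \<beta>"
  shows "ray T' (\<lambda>i. f (\<beta> i))"
proof -
  have b: "\<beta> i \<in> nodes T" "(\<beta> i, \<beta> (Suc i)) \<in> child_rel T" "\<beta> 0 = r" for i
    using path_node(1)[OF T ray_path[OF \<beta>], of i i] \<beta> tree_at_root[OF T] by (auto simp: ray_def path_def)
  have fr: "f r \<in> nodes T'" using f(1) tree_atD(1)[OF T] by (auto simp: bij_betw_def)
  have "f r = r'"
  proof (rule ccontr)
    assume "f r \<noteq> r'"
    then obtain u' where u': "(u', f r) \<in> child_rel T'" using tree_atD(8)[OF T' fr] by blast
    then have "u' \<in> nodes T'" using tree_atD(3)[OF T'] by blast
    then obtain u where "u \<in> nodes T" "u' = f u" using f(1) by (auto simp: bij_betw_def)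
    then have "(u, r) \<in> child_rel T" using f(2) u' tree_atD(1)[OF T] by blast
    then show False using tree_atD(6)[OF T] by blast
  qed
  moreover have "(f (\<beta> i), f (\<beta> (Suc i))) \<in> child_rel T'" for i using f(2) b by blast
  ultimately show ?thesis
    using tree_at_root[OF T'] tree_atD(1)[OF T'] b(3) by (simp add: ray_def path_def)
qed

lemma ray_nonempty: "ray T \<beta> \<Longrightarrow> nodes T \<noteq> {}"
  unfolding ray_def path_def by blast

text \<open>Isomorphisms may be chosen separately for each \<kappa>, without uniformity: they change
  the rays and leave the points alone.\<close>

lemma realizes_iso:
  assumes X: "realizes d m M T' X" and iso: "\<And>\<kappa>. \<kappa> \<in> M \<Longrightarrow> T \<kappa> \<cong>\<^sub>T T' \<kappa>"
    and T: "\<And>\<kappa>. \<kappa> \<in> M \<Longrightarrow> rooted_tree (T \<kappa>)"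
    and T': "\<And>\<kappa>. \<kappa> \<in> M \<Longrightarrow> nodes (T' \<kappa>) \<noteq> {} \<Longrightarrow> \<exists>r D. tree_at (T' \<kappa>) r D"
  shows "\<exists>Y. realizes d m M T Y"
proof -
  note x = realizesD[OF X]
  have "\<forall>\<kappa>\<in>M. \<exists>f. bij_betw f (nodes (T \<kappa>)) (nodes (T' \<kappa>)) \<and>
     (\<forall>u\<in>nodes (T \<kappa>). \<forall>v\<in>nodes (T \<kappa>). (u, v) \<in> child_rel (T \<kappa>) \<longleftrightarrow> (f u, f v) \<in> child_rel (T' \<kappa>))"
    using iso unfolding tree_iso_def by blast
  then obtain f where f0: "\<forall>\<kappa>\<in>M. bij_betw (f \<kappa>) (nodes (T \<kappa>)) (nodes (T' \<kappa>)) \<and>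
     (\<forall>u\<in>nodes (T \<kappa>). \<forall>v\<in>nodes (T \<kappa>). (u, v) \<in> child_rel (T \<kappa>) \<longleftrightarrow> (f \<kappa> u, f \<kappa> v) \<in> child_rel (T' \<kappa>))"
    by (simp only: bchoice_iff) blast
  define g where "g \<kappa> = inv_into (nodes (T \<kappa>)) (f \<kappa>)" for \<kappa>
  have f: "bij_betw (f \<kappa>) (nodes (T \<kappa>)) (nodes (T' \<kappa>))"
    "\<forall>u\<in>nodes (T \<kappa>). \<forall>v\<in>nodes (T \<kappa>). (u, v) \<in> child_rel (T \<kappa>) \<longleftrightarrow> (f \<kappa> u, f \<kappa> v) \<in> child_rel (T' \<kappa>)" if "\<kappa> \<in> M" for \<kappa>
    using f0 that by blast+
  have g: "bij_betw (g \<kappa>) (nodes (T' \<kappa>)) (nodes (T \<kappa>))"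
    "\<forall>u\<in>nodes (T' \<kappa>). \<forall>v\<in>nodes (T' \<kappa>). (u, v) \<in> child_rel (T' \<kappa>) \<longleftrightarrow> (g \<kappa> u, g \<kappa> v) \<in> child_rel (T \<kappa>)"
    "\<And>u. u \<in> nodes (T \<kappa>) \<Longrightarrow> g \<kappa> (f \<kappa> u) = u" if "\<kappa> \<in> M" for \<kappa>
  proof -
    show g1: "bij_betw (g \<kappa>) (nodes (T' \<kappa>)) (nodes (T \<kappa>))" unfolding g_def by (rule bij_betw_inv_into[OF f(1)[OF that]])
    have fg: "f \<kappa> (g \<kappa> u) = u" "g \<kappa> u \<in> nodes (T \<kappa>)" if "u \<in> nodes (T' \<kappa>)" for u
      using bij_betw_inv_into_right[OF f(1)[OF \<open>\<kappa> \<in> M\<close>] that] bij_betwE[OF g1] that by (auto simp: g_def)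
    show "\<forall>u\<in>nodes (T' \<kappa>). \<forall>v\<in>nodes (T' \<kappa>). (u, v) \<in> child_rel (T' \<kappa>) \<longleftrightarrow> (g \<kappa> u, g \<kappa> v) \<in> child_rel (T \<kappa>)"
      using f(2)[OF that] fg by simp
    show "\<And>u. u \<in> nodes (T \<kappa>) \<Longrightarrow> g \<kappa> (f \<kappa> u) = u"
      unfolding g_def by (rule bij_betw_inv_into_left[OF f(1)[OF that]])
  qed
  have ne: "nodes (T \<kappa>) = {} \<longleftrightarrow> nodes (T' \<kappa>) = {}" if "\<kappa> \<in> M" for \<kappa>
    using f(1)[OF that] by (auto simp: bij_betw_def)
  have ray_f: "ray (T' \<kappa>) (\<lambda>i. f \<kappa> (\<beta> i))" if \<kappa>: "\<kappa> \<in> M" and b: "ray (T \<kappa>) \<beta>" for \<kappa> \<beta>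
  proof -
    have n: "nodes (T \<kappa>) \<noteq> {}" using ray_nonempty[OF b] .
    then obtain r D where t: "tree_at (T' \<kappa>) r D" using T'[OF \<kappa>] ne[OF \<kappa>] by blast
    show ?thesis using ray_iso[OF f[OF \<kappa>] rooted_tree_at[OF T[OF \<kappa>] n] t b] .
  qed
  have ray_g: "ray (T \<kappa>) (\<lambda>i. g \<kappa> (\<beta> i))" if \<kappa>: "\<kappa> \<in> M" and b: "ray (T' \<kappa>) \<beta>" for \<kappa> \<beta>
  proof -
    have n: "nodes (T' \<kappa>) \<noteq> {}" using ray_nonempty[OF b] .
    then obtain r D where t: "tree_at (T' \<kappa>) r D" using T'[OF \<kappa>] by blast
    have "nodes (T \<kappa>) \<noteq> {}" using n ne[OF \<kappa>] by simp
    then show ?thesis using ray_iso[OF g(1,2)[OF \<kappa>] t rooted_tree_at[OF T[OF \<kappa>]] b] by simp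
  qed
  have ray_node: "\<beta> i \<in> nodes (T' \<kappa>)" if \<kappa>: "\<kappa> \<in> M" and b: "ray (T' \<kappa>) \<beta>" for \<kappa> \<beta> i
  proof -
    obtain r D where t: "tree_at (T' \<kappa>) r D" using T'[OF \<kappa>] ray_nonempty[OF b] by blast
    show ?thesis using path_node(1)[OF t ray_path[OF b], of i i] by simp
  qed
  define Y where "Y \<kappa> a = (\<lambda>(x, \<beta>). (x, \<lambda>i. g \<kappa> (\<beta> i))) ` X \<kappa> a" for \<kappa> a
  have Y: "\<exists>\<beta>0. (y, \<beta>0) \<in> X \<kappa> a \<and> \<beta> = (\<lambda>i. g \<kappa> (\<beta>0 i))" if "(y, \<beta>) \<in> Y \<kappa> a" for y \<beta> \<kappa> a
    using that unfolding Y_def by auto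
  have "realizes d m M T Y"
    unfolding realizes_def
  proof (intro conjI ballI allI impI)
    fix \<kappa> a y \<beta> assume \<kappa>: "\<kappa> \<in> M" and y: "carries m \<kappa> a \<and> (y, \<beta>) \<in> Y \<kappa> a"
    then obtain \<beta>0 where "(y, \<beta>0) \<in> X \<kappa> a" "\<beta> = (\<lambda>i. g \<kappa> (\<beta>0 i))" using Y by blast
    then show "ray (T \<kappa>) \<beta>" "\<And>i. y i \<in> pball 0" using x(1,2)[OF \<kappa>] ray_g[OF \<kappa>] y by blast+
  next
    fix \<kappa> a a' y \<beta> y' \<beta>' j
    assume \<kappa>: "\<kappa> \<in> M" and y: "carries m \<kappa> a \<and> carries m \<kappa> a' \<and> close m (int j) a a' \<and> (y, \<beta>) \<in> Y \<kappa> a \<and> (y', \<beta>') \<in> Y \<kappa> a'"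
    then obtain \<beta>0 \<beta>1 where b: "(y, \<beta>0) \<in> X \<kappa> a" "\<beta> = (\<lambda>i. g \<kappa> (\<beta>0 i))" "(y', \<beta>1) \<in> X \<kappa> a'" "\<beta>' = (\<lambda>i. g \<kappa> (\<beta>1 i))"
      using Y by blast
    have "congr (int j) y y' \<longleftrightarrow> \<beta>0 j = \<beta>1 j" using x(3)[OF \<kappa>, of a a' j y \<beta>0 y' \<beta>1] y b by blast
    also have "\<dots> \<longleftrightarrow> g \<kappa> (\<beta>0 j) = g \<kappa> (\<beta>1 j)"
      using inj_on_eq_iff[OF bij_betw_imp_inj_on[OF g(1)[OF \<kappa>]], of "\<beta>0 j" "\<beta>1 j"]
        ray_node[OF \<kappa> x(1)[OF \<kappa>]] y b by blast
    finally show "congr (int j) y y' \<longleftrightarrow> \<beta> j = \<beta>' j" using b by simp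
  next
    fix \<kappa> a \<beta> j assume \<kappa>: "\<kappa> \<in> M" and b: "carries m \<kappa> a \<and> ray (T \<kappa>) \<beta>"
    then obtain y \<beta>' where y: "(y, \<beta>') \<in> X \<kappa> a" "\<beta>' j = f \<kappa> (\<beta> j)" using x(4)[OF \<kappa> _ ray_f[OF \<kappa>], of a \<beta> j] by blast
    have "\<beta> j \<in> nodes (T \<kappa>)"
      using path_node(1)[OF rooted_tree_at[OF T[OF \<kappa>]] ray_path, of \<beta> j j] b ray_nonempty by blast
    then have "g \<kappa> (\<beta>' j) = \<beta> j" using g(3)[OF \<kappa>] y(2) by simp
    moreover have "(y, \<lambda>i. g \<kappa> (\<beta>' i)) \<in> Y \<kappa> a" using y(1) unfolding Y_def by force
    ultimately show "\<exists>x \<beta>'. (x, \<beta>') \<in> Y \<kappa> a \<and> \<beta>' j = \<beta> j" by blast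
  next
    have "fst ` Y \<kappa> a = fst ` X \<kappa> a" for \<kappa> a
      unfolding Y_def image_image by (intro image_cong refl) auto
    then show "tame d m M (\<lambda>\<kappa> a. fst ` Y \<kappa> a)" using x(5) by simp
  qed
  then show ?thesis by blast
qed

end

text \<open>Mod p^j the coordinate of a label is nonzero iff its acquisition depth is below j, and a
  label present on both sides has congruent coordinates. So congruence compares the visible
  labels.\<close>

lemma congr_labels:
  fixes \<theta> \<theta>' :: "nat \<Rightarrow> 'p :: prime_card padic"
  assumes "\<And>c. c \<in> A \<union> A' \<Longrightarrow> \<theta> c - \<theta>' c \<in> pball j"
    "\<And>c. c \<in> A \<Longrightarrow> \<theta> c \<noteq> 0 \<and> pval (\<theta> c) = h c" "\<And>c. c \<in> A' \<Longrightarrow> \<theta>' c \<noteq> 0 \<and> pval (\<theta>' c) = h c"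
  shows "congr j (\<lambda>c. if c \<in> A then \<theta> c else 0) (\<lambda>c. if c \<in> A' then \<theta>' c else 0) \<longleftrightarrow>
    {c \<in> A. h c < j} = {c \<in> A'. h c < j}"
proof -
  have "(if c \<in> A then \<theta> c else 0) - (if c \<in> A' then \<theta>' c else 0) \<in> pball j \<longleftrightarrow>
      (c \<in> A \<and> h c < j \<longleftrightarrow> c \<in> A' \<and> h c < j)" for c
    using assms(1)[of c] assms(2)[of c] assms(3)[of c] by (auto simp: mem_pball_iff)
  then show ?thesis unfolding congr_def by auto
qed

lemma finite_tree_no_ray:
  assumes "tree_at T r D" "finite (nodes T)"
  shows "\<not> ray T \<alpha>"
proof
  assume r: "ray T \<alpha>"
  have "inj \<alpha>" using path_node(2)[OF assms(1) ray_path[OF r]] by (intro injI) (metis order.refl)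
  moreover have "range \<alpha> \<subseteq> nodes T" using path_node(1)[OF assms(1) ray_path[OF r]] by blast
  ultimately show False using assms(2) by (meson finite_subset infinite_UNIV_nat finite_imageD)
qed

subsection \<open>Side branches\<close>

text \<open>
  A point in the side branch at depth \<open>last \<kappa>\<close> is scaled by \<open>\<sigma> \<kappa> a\<close>, which has that valuation and
  is a monomial in the field element \<open>a m\<close> carrying \<open>last \<kappa>\<close>. The coordinate \<open>\<sigma> \<kappa> a\<close> itself
  determines \<open>\<tau> \<kappa> a\<close>, which together with the digit \<open>c\<close> gives the position in the factor
  \<open>T(Z_p)\<close>: so no parameter besides \<open>a m\<close> is needed for this factor.
\<close>

locale branching = modulus P q for P :: "'p :: prime_card itself" and q +
  fixes d m :: nat and N :: "int list set" and F :: "nat rtree" and rF DF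
    and U :: "nat \<Rightarrow> int list \<Rightarrow> nat rtree" and rU DU and E :: "nat \<Rightarrow> nat set" and \<alpha>
    and X :: "nat \<Rightarrow> int list \<Rightarrow> 'p assignment \<Rightarrow> ('p point \<times> (nat \<Rightarrow> nat)) set"
  assumes F: "labelled F rF DF E (\<lambda>c. DF c - 1)" "finite (nodes F)"
    and E: "\<And>l. l \<in> leaves F \<Longrightarrow> E l \<subseteq> nodes F"
    and \<alpha>: "\<And>l. l \<in> leaves F \<Longrightarrow> path F (\<alpha> l) (DF l) \<and> \<alpha> l (DF l) = l"
    and depth_le: "\<And>l. l \<in> leaves F \<Longrightarrow> DF l \<le> q"
    and N: "\<And>\<kappa>. \<kappa> \<in> N \<Longrightarrow> length \<kappa> = Suc m \<and> last \<kappa> \<ge> 0"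
    and U: "\<And>l \<kappa>. l \<in> leaves F \<Longrightarrow> \<kappa> \<in> N \<Longrightarrow> tree_at (U l \<kappa>) (rU l \<kappa>) (DU l \<kappa>)"
    and X: "\<And>l. l \<in> leaves F \<Longrightarrow> realizes d (Suc m) N (U l) (X l)"
begin

text \<open>The carrier has valuation \<phi> * (last \<kappa> div h) and h = q \<phi>, so the
  valuation of this monomial is \<open>last \<kappa>\<close>.\<close>

definition \<sigma> :: "int list \<Rightarrow> 'p assignment \<Rightarrow> 'p padic" where
  "\<sigma> \<kappa> a = p powi (last \<kappa> mod h) * a m ^ q"

text \<open>The deviation of the unit part of \<sigma> from 1. It lies in p^K Z_p and takes a dense
  set of values there as the carrier varies.\<close>

definition \<tau> :: "int list \<Rightarrow> 'p assignment \<Rightarrow> 'p padic" where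
  "\<tau> \<kappa> a = \<sigma> \<kappa> a / p powi last \<kappa> - 1"

text \<open>Records the path through F to the leaf: one coordinate for each node chosen on it, of
  valuation equal to the depth of its parent.\<close>

definition code :: "nat \<Rightarrow> 'p point" where
  "code l c = of_nat (if c \<in> E l then CARD('p) ^ (DF c - 1) else 0)"

text \<open>In this order: the scale, the leaf, the leading digits of the position in T(Z_p), the
  point of the attached tree. The factor p^(DF l) hides the last two until the path through F is
  complete.\<close>

definition point :: "nat \<Rightarrow> nat \<Rightarrow> int list \<Rightarrow> 'p assignment \<Rightarrow> 'p point \<Rightarrow> 'p point" where
  "point l c \<kappa> a x = case_nat (\<sigma> \<kappa> a) (comb (\<lambda>i. \<sigma> \<kappa> a * code l i)
     (case_nat (\<sigma> \<kappa> a * of_nat (CARD('p) ^ DF l * c)) (\<lambda>i. \<sigma> \<kappa> a * of_nat (CARD('p) ^ DF l) * x i)))"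

text \<open>The digit part c gives the position mod p^(K - DF l) and \<tau>, being divisible by p^K,
  the rest. Division by p^(DF l) accounts for the depth of the leaf, where T(Z_p) begins.\<close>

definition zp_pos :: "nat \<Rightarrow> nat \<Rightarrow> int list \<Rightarrow> 'p assignment \<Rightarrow> 'p padic" where
  "zp_pos l c \<kappa> a = of_nat c + \<tau> \<kappa> a / p powi int (DF l)"

definition branch_ray :: "nat \<Rightarrow> nat \<Rightarrow> int list \<Rightarrow> 'p assignment \<Rightarrow> (nat \<Rightarrow> nat) \<Rightarrow> nat \<Rightarrow> 'p branch_node" where
  "branch_ray l c \<kappa> a \<beta> = join_ray (\<alpha> l) (DF l) (\<lambda>k. ((k, padic_ball 1 [zp_pos l c \<kappa> a] k), \<beta> k))"

definition branch_points :: "int list \<Rightarrow> 'p assignment \<Rightarrow> ('p point \<times> (nat \<Rightarrow> 'p branch_node)) set" where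
  "branch_points \<kappa> a = {(point l c \<kappa> a x, branch_ray l c \<kappa> a \<beta>) | l c x \<beta>.
     l \<in> leaves F \<and> c < CARD('p) ^ nat (K - int (DF l)) \<and> (x, \<beta>) \<in> X l \<kappa> a}"

lemma FT: "tree_at F rF DF"
  using F(1) by (rule labelled_tree_at)

lemma leaves_nodes: "leaves F \<subseteq> nodes F"
  by (auto simp: leaves_def)

lemma depth_le_K: "l \<in> leaves F \<Longrightarrow> int (DF l) \<le> K"
  using depth_le[of l] q_valuation(2) by (simp add: K_def)

lemma last_nth: "\<kappa> \<in> N \<Longrightarrow> last \<kappa> = \<kappa> ! m"
  using N[of \<kappa>] by (subst last_conv_nth) auto

lemma \<sigma>_eq:
  assumes "\<kappa> \<in> N" "carries (Suc m) \<kappa> a"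
  shows "\<sigma> \<kappa> a = p powi last \<kappa> * (1 + \<tau> \<kappa> a)" "\<tau> \<kappa> a \<in> pball K" "\<sigma> \<kappa> a \<noteq> 0" "pval (\<sigma> \<kappa> a) = last \<kappa>"
proof -
  let ?k = "last \<kappa> div h"
  have a: "a m \<in> H" "pval (a m) = int \<phi> * ?k"
    using assms last_nth[OF assms(1)] by (auto simp: carries_def)
  have one: "(1 :: 'p padic) - 1 \<in> pball (int q)" by simp
  \<comment> \<open>Comparison with the standard element p^(\<phi> k) of \<open>H\<close>, whose
    q-th power is a pure power of p.\<close>
  have "a m / p powi (int \<phi> * ?k) - 1 \<in> pball (int q)"
    using H_ratio[OF a(1) H_ex(1)[OF one, of ?k]] a(2) H_ex(2)[OF one, of ?k] by simp
  then have w: "(a m / p powi (int \<phi> * ?k)) ^ q - 1 \<in> pball K" by (rule power_q(1))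
  have "last \<kappa> mod h + h * ?k = last \<kappa>" by simp
  then have "p powi last \<kappa> = p powi (last \<kappa> mod h) * p powi (h * ?k)"
    by (metis p_padic_nonzero power_int_add)
  also have "p powi (h * ?k) = (p powi (int \<phi> * ?k)) ^ q"
    by (simp add: power_int_power' h_def mult_ac)
  finally have "\<sigma> \<kappa> a / p powi last \<kappa> = (a m / p powi (int \<phi> * ?k)) ^ q"
    by (simp add: \<sigma>_def power_divide power_int_not_zero)
  then have "\<tau> \<kappa> a = (a m / p powi (int \<phi> * ?k)) ^ q - 1" by (simp add: \<tau>_def)
  with w show "\<tau> \<kappa> a \<in> pball K" by simp
  show "\<sigma> \<kappa> a = p powi last \<kappa> * (1 + \<tau> \<kappa> a)" by (simp add: \<tau>_def power_int_not_zero)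
  show "\<sigma> \<kappa> a \<noteq> 0" using H_nonzero[OF a(1)] by (simp add: \<sigma>_def power_int_not_zero)
  have "pval (\<sigma> \<kappa> a) = last \<kappa> mod h + int q * (int \<phi> * ?k)"
    using H_nonzero[OF a(1)] a(2) by (simp add: \<sigma>_def pval_mult pval_power power_int_not_zero)
  also have "\<dots> = last \<kappa> mod h + h * ?k" by (simp only: h_def mult.assoc)
  also have "\<dots> = last \<kappa>" by simp
  finally show "pval (\<sigma> \<kappa> a) = last \<kappa>" .
qed

lemma \<sigma>_in: "\<kappa> \<in> N \<Longrightarrow> carries (Suc m) \<kappa> a \<Longrightarrow> \<sigma> \<kappa> a \<in> pball (last \<kappa>)"
  using \<sigma>_eq(4) by (simp add: mem_pball_iff)

lemma \<sigma>_diff: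
  assumes "\<kappa> \<in> N" "carries (Suc m) \<kappa> a" "carries (Suc m) \<kappa> a'"
  shows "\<sigma> \<kappa> a - \<sigma> \<kappa> a' \<in> pball (last \<kappa> + i) \<longleftrightarrow> \<tau> \<kappa> a - \<tau> \<kappa> a' \<in> pball i"
proof -
  have "\<sigma> \<kappa> a - \<sigma> \<kappa> a' = p powi last \<kappa> * (\<tau> \<kappa> a - \<tau> \<kappa> a')"
    unfolding \<sigma>_eq(1)[OF assms(1,2)] \<sigma>_eq(1)[OF assms(1,3)] by (simp add: algebra_simps)
  then show ?thesis by (simp add: pball_mult_cancel power_int_not_zero)
qed

lemma \<tau>_diff:
  assumes "\<kappa> \<in> N" "carries (Suc m) \<kappa> a" "carries (Suc m) \<kappa> a'"
  shows "\<tau> \<kappa> a - \<tau> \<kappa> a' \<in> pball K"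
  by (intro pball_diff \<sigma>_eq(2) assms)

text \<open>Closeness of the last carriers is read off from the point itself, as \<sigma> contains
  \<open>a m\<close> as a q-th power. It makes the realizations of the attached trees
  comparable.\<close>

lemma close_last:
  assumes "\<kappa> \<in> N" "carries (Suc m) \<kappa> a" "carries (Suc m) \<kappa> a'"
    and close: "close m (int j) a a'" and \<tau>: "\<tau> \<kappa> a - \<tau> \<kappa> a' \<in> pball (int j)"
  shows "close (Suc m) (int j) a a'"
proof -
  note s = \<sigma>_eq[OF assms(1,2)] \<sigma>_eq[OF assms(1,3)]
  have "\<tau> \<kappa> a' \<in> pball 1" using pball_antimono[OF s(6)] q_pos q_valuation(2) by (simp add: K_def)
  then have u: "1 + \<tau> \<kappa> a' \<noteq> 0" "pval (1 + \<tau> \<kappa> a') = 0"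
    using one_plus_pball[of "1 + \<tau> \<kappa> a'" 1] by auto
  have "a m ^ q / a' m ^ q = \<sigma> \<kappa> a / \<sigma> \<kappa> a'" by (simp add: \<sigma>_def power_int_not_zero)
  also have "\<dots> = (1 + \<tau> \<kappa> a) / (1 + \<tau> \<kappa> a')" unfolding s(1,5) by (simp add: power_int_not_zero)
  finally have "a m ^ q / a' m ^ q - 1 = inverse (1 + \<tau> \<kappa> a') * (\<tau> \<kappa> a - \<tau> \<kappa> a')"
    using u(1) by (simp add: field_simps)
  moreover have "inverse (1 + \<tau> \<kappa> a') \<in> pball 0" using u by (simp add: mem_pball_iff pval_inverse)
  ultimately have "a m ^ q / a' m ^ q - 1 \<in> pball (int j)" using pball_mult0 \<tau> by simp
  then show ?thesis using close by (simp add: close_Suc)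
qed

lemma zp_pos_in:
  assumes "\<kappa> \<in> N" "carries (Suc m) \<kappa> a" "l \<in> leaves F"
  shows "zp_pos l c \<kappa> a \<in> pball 0"
proof -
  have "\<tau> \<kappa> a / p powi int (DF l) \<in> pball (K - int (DF l))"
    using \<sigma>_eq(2)[OF assms(1,2)] by (cases "\<tau> \<kappa> a = 0") (auto simp: mem_pball_iff pval_divide power_int_not_zero simp del: power_int_of_nat)
  then have "\<tau> \<kappa> a / p powi int (DF l) \<in> pball 0"
    using depth_le_K[OF assms(3)] by (auto intro: pball_antimono)
  then show ?thesis unfolding zp_pos_def by (intro pball_add) auto
qed

lemma tree_at_zp_prod:
  assumes "l \<in> leaves F" "\<kappa> \<in> N"
  shows "tree_at (tree_prod (zp_tree P) (U l \<kappa>)) ((0, padic_ball 1 [0] 0), rU l \<kappa>) (fst \<circ> fst)"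
  by (rule tree_at_prod[OF tree_at_zp U[OF assms]])

lemma tree_at_side_branch:
  assumes "\<kappa> \<in> N"
  shows "tree_at (side_branch P F U \<kappa>) (Inl rF) (case_sum DF (\<lambda>(v, u). DF v + (fst \<circ> fst) u))"
  unfolding side_branch_def by (rule tree_at_attach[OF FT leaves_nodes tree_at_zp_prod[OF _ assms]])

lemma branch_points_ray:
  assumes "\<kappa> \<in> N" "carries (Suc m) \<kappa> a" "(y, \<gamma>) \<in> branch_points \<kappa> a"
  shows "ray (side_branch P F U \<kappa>) \<gamma>"
proof -
  obtain l c x \<beta> where l: "l \<in> leaves F" "(x, \<beta>) \<in> X l \<kappa> a" and \<gamma>: "\<gamma> = branch_ray l c \<kappa> a \<beta>"
    using assms(3) unfolding branch_points_def by blast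
  let ?\<delta> = "\<lambda>k. ((k, padic_ball 1 [zp_pos l c \<kappa> a] k), \<beta> k)"
  have "fst \<circ> ?\<delta> = (\<lambda>k. (k, padic_ball 1 [zp_pos l c \<kappa> a] k))" "snd \<circ> ?\<delta> = \<beta>" by auto
  then have "ray (tree_prod (zp_tree P) (U l \<kappa>)) ?\<delta>"
    using ray_prod[OF tree_at_zp[of P] U[OF l(1) assms(1)], of ?\<delta>] ray_zp[OF zp_pos_in[OF assms(1,2) l(1)], of P c]
      realizesD(1)[OF X[OF l(1)] assms(1,2) l(2)] by simp
  then have "ray (attach F (leaves F) (\<lambda>w. tree_prod (zp_tree P) (U w \<kappa>))) (join_ray (\<alpha> l) (DF l) ?\<delta>)"
    using \<alpha>[OF l(1)] l(1)
    by (intro ray_join[OF FT leaves_nodes tree_at_zp_prod[OF _ assms(1)]]) auto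
  then show ?thesis unfolding \<gamma> branch_ray_def side_branch_def .
qed

lemma branch_points_val:
  assumes "\<kappa> \<in> N" "carries (Suc m) \<kappa> a" "(y, \<gamma>) \<in> branch_points \<kappa> a"
  shows "y i \<in> pball (last \<kappa>)" "y 0 \<noteq> 0" "pval (y 0) = last \<kappa>"
proof -
  obtain l c x \<beta> where l: "l \<in> leaves F" "(x, \<beta>) \<in> X l \<kappa> a" and y: "y = point l c \<kappa> a x"
    using assms(3) unfolding branch_points_def by blast
  note s = \<sigma>_in[OF assms(1,2)]
  have x: "x i \<in> pball 0" for i using realizesD(2)[OF X[OF l(1)] assms(1,2) l(2)] .
  have 1: "\<sigma> \<kappa> a * of_nat n \<in> pball (last \<kappa>)" for n by (rule pball_mult0'[OF s of_nat_in_pball_0])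
  have 2: "\<sigma> \<kappa> a * of_nat n * x i \<in> pball (last \<kappa>)" for n i by (rule pball_mult0'[OF 1 x])
  show "y i \<in> pball (last \<kappa>)"
    unfolding y point_def comb_def code_def using s 1 2 by (auto split: nat.split simp del: of_nat_mult of_nat_power)
  show "y 0 \<noteq> 0" "pval (y 0) = last \<kappa>" using \<sigma>_eq(3,4)[OF assms(1,2)] by (simp_all add: y point_def)
qed

lemma congr_point:
  "congr J (point l c \<kappa> a x) (point l' c' \<kappa> a' x') \<longleftrightarrow> \<sigma> \<kappa> a - \<sigma> \<kappa> a' \<in> pball J \<and>
    congr J (\<lambda>i. \<sigma> \<kappa> a * code l i) (\<lambda>i. \<sigma> \<kappa> a' * code l' i) \<and>
    \<sigma> \<kappa> a * of_nat (CARD('p) ^ DF l * c) - \<sigma> \<kappa> a' * of_nat (CARD('p) ^ DF l' * c') \<in> pball J \<and>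
    congr J (\<lambda>i. \<sigma> \<kappa> a * of_nat (CARD('p) ^ DF l) * x i) (\<lambda>i. \<sigma> \<kappa> a' * of_nat (CARD('p) ^ DF l') * x' i)"
  unfolding point_def congr_case_nat congr_comb by blast

text \<open>The labels of the path are seen through the factor \<sigma>, which shifts all
  acquisition depths by \<open>last \<kappa>\<close>.\<close>

lemma congr_code:
  assumes \<kappa>: "\<kappa> \<in> N" "carries (Suc m) \<kappa> a" "carries (Suc m) \<kappa> a'" and l: "l \<in> leaves F" "l' \<in> leaves F"
    and \<sigma>: "\<sigma> \<kappa> a - \<sigma> \<kappa> a' \<in> pball (last \<kappa> + int j)" and j: "j \<le> DF l" "j \<le> DF l'"
  shows "congr (last \<kappa> + int j) (\<lambda>i. \<sigma> \<kappa> a * code l i) (\<lambda>i. \<sigma> \<kappa> a' * code l' i) \<longleftrightarrow> \<alpha> l j = \<alpha> l' j"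
proof -
  let ?\<theta> = "\<lambda>a c. \<sigma> \<kappa> a * of_nat (CARD('p) ^ (DF c - 1))"
  have eq: "(\<lambda>i. \<sigma> \<kappa> a * code l i) = (\<lambda>i. if i \<in> E l then ?\<theta> a i else 0)" for a l
    by (auto simp: code_def)
  have "pval (of_nat (CARD('p) ^ n) :: 'p padic) = int n" for n using pval_uniformizer[of "int n", where 'p='p] by simp
  then have val: "?\<theta> a c \<noteq> 0 \<and> pval (?\<theta> a c) = last \<kappa> + int (DF c - 1)" if "carries (Suc m) \<kappa> a" for a c
    using \<sigma>_eq(3,4)[OF \<kappa>(1) that] by (simp add: pval_mult)
  have diff: "?\<theta> a c - ?\<theta> a' c \<in> pball (last \<kappa> + int j)" for c
    using pball_mult0'[OF \<sigma> of_nat_in_pball_0[of "CARD('p) ^ (DF c - 1)"]] by (simp add: left_diff_distrib)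
  have "congr (last \<kappa> + int j) (\<lambda>i. \<sigma> \<kappa> a * code l i) (\<lambda>i. \<sigma> \<kappa> a' * code l' i) \<longleftrightarrow>
     {c \<in> E l. last \<kappa> + int (DF c - 1) < last \<kappa> + int j} = {c \<in> E l'. last \<kappa> + int (DF c - 1) < last \<kappa> + int j}"
    unfolding eq by (rule congr_labels) (use val \<kappa> diff in auto)
  also have "\<dots> \<longleftrightarrow> {c \<in> E l. DF c - 1 < j} = {c \<in> E l'. DF c - 1 < j}" by simp
  also have "{c \<in> E l. DF c - 1 < j} = E (\<alpha> l j)"
    using labels_below[OF F(1), of "\<alpha> l" "DF l" j] \<alpha>[OF l(1)] j by simp
  also have "{c \<in> E l'. DF c - 1 < j} = E (\<alpha> l' j)"
    using labels_below[OF F(1), of "\<alpha> l'" "DF l'" j] \<alpha>[OF l(2)] j by simp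
  also have "E (\<alpha> l j) = E (\<alpha> l' j) \<longleftrightarrow> \<alpha> l j = \<alpha> l' j"
    by (rule labels_eq_iff[OF F(1) path_mono[OF conjunct1[OF \<alpha>[OF l(1)]] j(1)] path_mono[OF conjunct1[OF \<alpha>[OF l(2)]] j(2)]])
  finally show ?thesis .
qed

text \<open>A leaf has no child, so it cannot lie strictly inside the path to another leaf.\<close>

lemma leaf_paths_eq:
  assumes l: "l \<in> leaves F" "l' \<in> leaves F" and eq: "\<alpha> l (min (DF l) (DF l')) = \<alpha> l' (min (DF l) (DF l'))"
  shows "l = l'"
proof -
  have *: "l = l'" if l: "l \<in> leaves F" "l' \<in> leaves F" "DF l \<le> DF l'" "\<alpha> l (DF l) = \<alpha> l' (DF l)" for l l'
  proof (cases "DF l = DF l'")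
    case True
    then show ?thesis using \<alpha>[OF l(1)] \<alpha>[OF l(2)] l(4) by simp
  next
    case False
    then have "(\<alpha> l' (DF l), \<alpha> l' (Suc (DF l))) \<in> child_rel F" using \<alpha>[OF l(2)] l(3) by (auto simp: path_def)
    then have "(l, \<alpha> l' (Suc (DF l))) \<in> child_rel F" using l(4) \<alpha>[OF l(1)] by simp
    then show ?thesis using l(1) by (auto simp: leaves_def)
  qed
  show ?thesis
  proof (cases "DF l \<le> DF l'")
    case True
    then show ?thesis using *[OF l] eq by (simp add: min_def)
  next
    case False
    then show ?thesis using *[OF l(2,1)] eq by (simp add: min_def)
  qed
qed

text \<open>The coordinates \<sigma> and c together encode one position in Z_p. For j <= K - DF l
  the contribution of \<tau> is congruent automatically and c decides; beyond that the bounded range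
  of c forces c = c' and \<tau> decides. Congruence of \<sigma> also gives the closeness of carriers
  needed for the attached points.\<close>

lemma congr_same_leaf:
  assumes \<kappa>: "\<kappa> \<in> N" "carries (Suc m) \<kappa> a" "carries (Suc m) \<kappa> a'" and l: "l \<in> leaves F"
    and c: "c < CARD('p) ^ nat (K - int (DF l))" "c' < CARD('p) ^ nat (K - int (DF l))"
    and x: "(x, \<beta>) \<in> X l \<kappa> a" "(x', \<beta>') \<in> X l \<kappa> a'" and close: "close m (int j) a a'"
  shows "congr (last \<kappa> + int (DF l) + int j) (point l c \<kappa> a x) (point l c' \<kappa> a' x') \<longleftrightarrow>
    zp_pos l c \<kappa> a - zp_pos l c' \<kappa> a' \<in> pball (int j) \<and> \<beta> j = \<beta>' j"
proof -
  let ?J = "last \<kappa> + int (DF l) + int j"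
  let ?f = "DF l"
  let ?p = "of_nat (CARD('p) ^ ?f) :: 'p padic"
  define t where "t = \<tau> \<kappa> a - \<tau> \<kappa> a'"
  have t: "t \<in> pball K" unfolding t_def by (rule \<tau>_diff[OF \<kappa>])
  have pf: "?p \<noteq> 0" "pval ?p = int ?f" using pval_uniformizer[of "int ?f", where 'p='p] by simp_all
  have \<sigma>J: "\<sigma> \<kappa> a - \<sigma> \<kappa> a' \<in> pball ?J \<longleftrightarrow> t \<in> pball (int ?f + int j)"
    unfolding t_def using \<sigma>_diff[OF \<kappa>, of "int ?f + int j"] by (simp add: add.assoc)
  have fjK: "int ?f \<le> K" by (rule depth_le_K[OF l])
  have scaled: "\<sigma> \<kappa> a * ?p * z - \<sigma> \<kappa> a' * ?p * z' \<in> pball ?J \<longleftrightarrow> z - z' \<in> pball (int j)"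
    if "z \<in> pball 0" "\<sigma> \<kappa> a - \<sigma> \<kappa> a' \<in> pball ?J" for z z'
  proof -
    have e: "\<sigma> \<kappa> a * ?p * z - \<sigma> \<kappa> a' * ?p * z' = (\<sigma> \<kappa> a - \<sigma> \<kappa> a') * (?p * z) + \<sigma> \<kappa> a' * ?p * (z - z')"
      by (simp add: algebra_simps)
    have "(\<sigma> \<kappa> a - \<sigma> \<kappa> a') * (?p * z) \<in> pball ?J"
      by (rule pball_mult0'[OF that(2) pball_mult0[OF of_nat_in_pball_0 that(1)]])
    then have "\<sigma> \<kappa> a * ?p * z - \<sigma> \<kappa> a' * ?p * z' \<in> pball ?J \<longleftrightarrow> \<sigma> \<kappa> a' * ?p * (z - z') \<in> pball ?J"
      unfolding e using pball_add pball_diff by (metis add_diff_cancel_left')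
    also have "\<dots> \<longleftrightarrow> z - z' \<in> pball (?J - pval (\<sigma> \<kappa> a' * ?p))"
      using \<sigma>_eq(3)[OF \<kappa>(1,3)] pf by (intro pball_mult_cancel) simp
    also have "?J - pval (\<sigma> \<kappa> a' * ?p) = int j"
      using \<sigma>_eq(3,4)[OF \<kappa>(1,3)] pf by (simp add: pval_mult)
    finally show ?thesis .
  qed
  have zdiff: "zp_pos l c \<kappa> a - zp_pos l c' \<kappa> a' = (of_nat c - of_nat c') + t / ?p"
    by (simp add: zp_pos_def t_def diff_divide_distrib)
  have tp: "t / ?p \<in> pball i \<longleftrightarrow> t \<in> pball (int ?f + i)" for i
    using pball_mult_cancel[OF pf(1), of "t / ?p" "int ?f + i"] pf by simp
  have main: "t \<in> pball (int ?f + int j) \<and> (of_nat c - (of_nat c' :: 'p padic)) \<in> pball (int j) \<longleftrightarrow>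
      zp_pos l c \<kappa> a - zp_pos l c' \<kappa> a' \<in> pball (int j)"
  proof
    assume "t \<in> pball (int ?f + int j) \<and> (of_nat c - (of_nat c' :: 'p padic)) \<in> pball (int j)"
    then show "zp_pos l c \<kappa> a - zp_pos l c' \<kappa> a' \<in> pball (int j)" unfolding zdiff using tp by (intro pball_add) auto
  next
    assume z: "zp_pos l c \<kappa> a - zp_pos l c' \<kappa> a' \<in> pball (int j)"
    show "t \<in> pball (int ?f + int j) \<and> (of_nat c - (of_nat c' :: 'p padic)) \<in> pball (int j)"
    proof (cases "int j \<le> K - int ?f")
      case True
      then have tj: "t \<in> pball (int ?f + int j)" using t by (auto intro: pball_antimono)
      then have "t / ?p \<in> pball (int j)" using tp by simp
      from pball_diff[OF z this] show ?thesis unfolding zdiff using tj by simp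
    next
      case False
      have "t / ?p \<in> pball (K - int ?f)" using t tp by simp
      moreover have "zp_pos l c \<kappa> a - zp_pos l c' \<kappa> a' \<in> pball (K - int ?f)" using z False by (auto intro: pball_antimono)
      ultimately have "of_nat c - (of_nat c' :: 'p padic) \<in> pball (K - int ?f)"
        unfolding zdiff using pball_diff by (metis add_diff_cancel_right')
      then have "of_nat c - (of_nat c' :: 'p padic) \<in> pball (int (nat (K - int ?f)))" using fjK by simp
      then have "c = c'" using c unfolding of_nat_diff_in_pball by (simp add: cong_def)
      then show ?thesis using z tp unfolding zdiff by simp
    qed
  qed
  have cl: "close (Suc m) (int j) a a'" if "t \<in> pball (int ?f + int j)"
    using pball_antimono[OF that, of "int j"] close_last[OF \<kappa> close] by (simp add: t_def)
  have x0: "x i \<in> pball 0" for i using realizesD(2)[OF X[OF l] \<kappa>(1,2) x(1)] .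
  have "congr ?J (point l c \<kappa> a x) (point l c' \<kappa> a' x') \<longleftrightarrow>
      t \<in> pball (int ?f + int j) \<and> (of_nat c - (of_nat c' :: 'p padic)) \<in> pball (int j) \<and> congr (int j) x x'"
  proof (cases "t \<in> pball (int ?f + int j)")
    case True
    then have s: "\<sigma> \<kappa> a - \<sigma> \<kappa> a' \<in> pball ?J" using \<sigma>J by simp
    have "congr ?J (\<lambda>i. \<sigma> \<kappa> a * code l i) (\<lambda>i. \<sigma> \<kappa> a' * code l i)"
      unfolding congr_def code_def left_diff_distrib[symmetric] using pball_mult0'[OF s of_nat_in_pball_0] by blast
    moreover have "\<sigma> \<kappa> a * of_nat (CARD('p) ^ ?f * c) - \<sigma> \<kappa> a' * of_nat (CARD('p) ^ ?f * c') \<in> pball ?J \<longleftrightarrow>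
        of_nat c - (of_nat c' :: 'p padic) \<in> pball (int j)"
      using scaled[OF of_nat_in_pball_0 s, of c "of_nat c'"] by (simp add: mult.assoc)
    moreover have "congr ?J (\<lambda>i. \<sigma> \<kappa> a * ?p * x i) (\<lambda>i. \<sigma> \<kappa> a' * ?p * x' i) \<longleftrightarrow> congr (int j) x x'"
      unfolding congr_def using scaled[OF x0 s] by simp
    ultimately show ?thesis unfolding congr_point using s True by blast
  next
    case False
    then show ?thesis unfolding congr_point \<sigma>J by blast
  qed
  also have "\<dots> \<longleftrightarrow> zp_pos l c \<kappa> a - zp_pos l c' \<kappa> a' \<in> pball (int j) \<and> \<beta> j = \<beta>' j"
    using main cl realizesD(3)[OF X[OF l] \<kappa> _ x] by blast
  finally show ?thesis .
qed

lemma branch_points_congr: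
  assumes \<kappa>: "\<kappa> \<in> N" "carries (Suc m) \<kappa> a" "carries (Suc m) \<kappa> a'"
    and y: "(y, \<gamma>) \<in> branch_points \<kappa> a" "(y', \<gamma>') \<in> branch_points \<kappa> a'"
    and close: "close m (last \<kappa> + int j) a a'"
  shows "congr (last \<kappa> + int j) y y' \<longleftrightarrow> \<gamma> j = \<gamma>' j"
proof -
  obtain l c x \<beta> where l: "l \<in> leaves F" "c < CARD('p) ^ nat (K - int (DF l))" "(x, \<beta>) \<in> X l \<kappa> a"
    and y: "y = point l c \<kappa> a x" "\<gamma> = branch_ray l c \<kappa> a \<beta>"
    using y(1) unfolding branch_points_def by blast
  obtain l' c' x' \<beta>' where l': "l' \<in> leaves F" "c' < CARD('p) ^ nat (K - int (DF l'))" "(x', \<beta>') \<in> X l' \<kappa> a'"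
    and y': "y' = point l' c' \<kappa> a' x'" "\<gamma>' = branch_ray l' c' \<kappa> a' \<beta>'"
    using assms(5) unfolding branch_points_def by blast
  have last0: "last \<kappa> \<ge> 0" using N[OF \<kappa>(1)] by simp
  note pa = conjunct1[OF \<alpha>[OF l(1)]] conjunct1[OF \<alpha>[OF l'(1)]]
  \<comment> \<open>As long as both paths are in F, the digit coordinate and the attached point
    vanish at this precision and only the code is visible.\<close>
  have above: "congr (last \<kappa> + int i) y y' \<longleftrightarrow> \<alpha> l i = \<alpha> l' i" if i: "i \<le> DF l" "i \<le> DF l'" for i
  proof -
    have \<sigma>: "\<sigma> \<kappa> a - \<sigma> \<kappa> a' \<in> pball (last \<kappa> + int i)"
      unfolding \<sigma>_diff[OF \<kappa>] using \<tau>_diff[OF \<kappa>] depth_le_K[OF l(1)] i by (auto intro: pball_antimono)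
    have small: "\<sigma> \<kappa> b * (of_nat (CARD('p) ^ DF k * c)) \<in> pball (last \<kappa> + int i)"
      if "carries (Suc m) \<kappa> b" "i \<le> DF k" for b k c
    proof -
      have "(of_nat (CARD('p) ^ DF k) :: 'p padic) \<in> pball (int (DF k))"
        using pball_uniformizer[of "int (DF k)", where 'p='p] by simp
      then have "(of_nat (CARD('p) ^ DF k * c) :: 'p padic) \<in> pball (int i)"
        using that(2) by (auto simp del: of_nat_power intro: pball_antimono pball_mult0'[OF _ of_nat_in_pball_0])
      then show ?thesis by (rule pball_mult[OF \<sigma>_in[OF \<kappa>(1) that(1)]])
    qed
    have sx: "\<sigma> \<kappa> a * of_nat (CARD('p) ^ DF l) * x n \<in> pball (last \<kappa> + int i)" for n
      using pball_mult0'[OF small[OF \<kappa>(2) i(1), of 1] realizesD(2)[OF X[OF l(1)] \<kappa>(1,2) l(3)]] by simp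
    have sx': "\<sigma> \<kappa> a' * of_nat (CARD('p) ^ DF l') * x' n \<in> pball (last \<kappa> + int i)" for n
      using pball_mult0'[OF small[OF \<kappa>(3) i(2), of 1] realizesD(2)[OF X[OF l'(1)] \<kappa>(1,3) l'(3)]] by simp
    show ?thesis
      unfolding y(1) y'(1) congr_point congr_code[OF \<kappa> l(1) l'(1) \<sigma> i]
      using \<sigma> pball_diff[OF small[OF \<kappa>(2) i(1)] small[OF \<kappa>(3) i(2)]] pball_diff[OF sx sx'] by (simp add: congr_def)
  qed
  show ?thesis
  proof (cases "j \<le> DF l \<and> j \<le> DF l'")
    case True
    then show ?thesis using above[of j] unfolding y(2) y'(2) branch_ray_def join_ray_eq_iff[OF FT pa] by simp
  next
    case False
    show ?thesis
    proof (cases "l = l'")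
      case True
      define i where "i = j - DF l"
      have j: "j = DF l + i" "last \<kappa> + int j = last \<kappa> + int (DF l) + int i" using False True by (auto simp: i_def)
      have ji: "j - DF l = i" by (simp add: i_def)
      have "close m (int i) a a'" using close_mono[OF close, of "int i"] j last0 by simp
      then have "congr (last \<kappa> + int (DF l) + int i) y y' \<longleftrightarrow>
          zp_pos l c \<kappa> a - zp_pos l c' \<kappa> a' \<in> pball (int i) \<and> \<beta> i = \<beta>' i"
        unfolding y(1) y'(1) using congr_same_leaf[OF \<kappa>, of l c c' x \<beta> x' \<beta>' i] l l' True by simp
      moreover have "\<gamma> j = \<gamma>' j \<longleftrightarrow> zp_pos l c \<kappa> a - zp_pos l c' \<kappa> a' \<in> pball (int i) \<and> \<beta> i = \<beta>' i"
        unfolding y(2) y'(2) branch_ray_def join_ray_eq_iff[OF FT pa]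
        using False True ji by (simp add: zp_ball_eq_iff del: One_nat_def)
      ultimately show ?thesis unfolding j(2) by blast
    next
      case neq: False
      \<comment> \<open>Different leaves are told apart no later than at the smaller of their
        depths.\<close>
      have "\<not> congr (last \<kappa> + int j) y y'"
      proof
        assume "congr (last \<kappa> + int j) y y'"
        then have "congr (last \<kappa> + int (min (DF l) (DF l'))) y y'" by (rule congr_mono) (use False in auto)
        then have "\<alpha> l (min (DF l) (DF l')) = \<alpha> l' (min (DF l) (DF l'))" using above by simp
        then show False using leaf_paths_eq[OF l(1) l'(1)] neq by blast
      qed
      moreover have "\<gamma> j \<noteq> \<gamma>' j"
        unfolding y(2) y'(2) branch_ray_def join_ray_eq_iff[OF FT pa]
        using False neq \<alpha>[OF l(1)] \<alpha>[OF l'(1)] by auto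
      ultimately show ?thesis by blast
    qed
  qed
qed

lemma branch_points_dense:
  assumes \<kappa>: "\<kappa> \<in> N" "carries m \<kappa> a" and \<gamma>: "ray (side_branch P F U \<kappa>) \<gamma>"
  shows "\<exists>s y \<gamma>'. carries (Suc m) \<kappa> (a(m := s)) \<and> (y, \<gamma>') \<in> branch_points \<kappa> (a(m := s)) \<and> \<gamma>' j = \<gamma> j"
proof -
  note \<gamma>' = \<gamma>[unfolded side_branch_def]
  have tp: "\<And>v. v \<in> leaves F \<Longrightarrow> tree_at (tree_prod (zp_tree P) (U v \<kappa>)) ((0, padic_ball 1 [0] 0), rU v \<kappa>) (fst \<circ> fst)"
    by (rule tree_at_zp_prod[OF _ \<kappa>(1)])
  note cs = ray_attach_cases[OF FT leaves_nodes tp \<gamma>']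
  show ?thesis
  proof (rule cs, goal_cases)
    case (1 v)
    then show ?case .
  next
    case (2 \<beta>)
    then show ?case using finite_tree_no_ray[OF FT F(2)] by blast
  next
    case (3 \<beta> n \<delta>)
    define l where "l = \<beta> n"
    have l: "l \<in> leaves F" using 3(2) by (simp add: l_def)
    have n: "n = DF l" using path_node(2)[OF FT 3(1), of n] by (simp add: l_def)
    define k where "k = j - n"
    have \<delta>: "ray (zp_tree P) (fst \<circ> \<delta>)" "ray (U l \<kappa>) (snd \<circ> \<delta>)"
      using 3(3) ray_prod[OF tree_at_zp[of P] U[OF l \<kappa>(1)], of \<delta>] by (auto simp: l_def)
    have "fst (\<delta> k) \<in> nodes (zp_tree P)" "fst (fst (\<delta> k)) = k"
      using path_node[OF tree_at_zp ray_path[OF \<delta>(1)], of k k] by auto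
    then obtain t where t: "t \<in> pball 0" "fst (\<delta> k) = (k, padic_ball 1 [t] k)"
      unfolding zp_tree_simps by auto
    let ?f = "int (DF l)"
    have fK: "?f \<le> K" by (rule depth_le_K[OF l])
    \<comment> \<open>c agrees with the position t mod p^(K - f), where f is the depth of the leaf;
      the tail t - c, scaled by p^f, lies in p^K Z_p and is approximated by some w^q - 1.\<close>
    obtain c where c: "c < CARD('p) ^ nat (K - ?f)" "t - of_nat c \<in> pball (int (nat (K - ?f)))"
      using padic_residue[OF t(1)] by blast
    have "p powi ?f * (t - of_nat c) \<in> pball (?f + (K - ?f))"
      using pball_mult[OF pball_uniformizer[of ?f] c(2)] fK by simp
    then have "p powi ?f * (t - of_nat c) \<in> pball K" by simp
    from power_q_dense[OF this, of k] obtain w where w: "w - 1 \<in> pball (int q)"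
      "w ^ q - 1 - p powi ?f * (t - of_nat c) \<in> pball (K + int k)" by blast
    define s where "s = p powi (int \<phi> * (last \<kappa> div h)) * w"
    let ?a = "a(m := s)"
    have car: "carries (Suc m) \<kappa> ?a"
      using \<kappa>(2) H_ex[OF w(1), of "last \<kappa> div h"] last_nth[OF \<kappa>(1)] unfolding carries_def s_def by (auto simp: less_Suc_eq)
    have "\<tau> \<kappa> ?a = w ^ q - 1"
    proof -
      have "last \<kappa> mod h + h * (last \<kappa> div h) = last \<kappa>" by simp
      then have "p powi last \<kappa> = p powi (last \<kappa> mod h) * p powi (h * (last \<kappa> div h))"
        by (metis p_padic_nonzero power_int_add)
      also have "p powi (h * (last \<kappa> div h)) = (p powi (int \<phi> * (last \<kappa> div h))) ^ q"
        by (simp add: power_int_power' h_def mult_ac)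
      finally show ?thesis
        by (simp add: \<tau>_def \<sigma>_def s_def power_mult_distrib power_int_not_zero)
    qed
    then have "zp_pos l c \<kappa> ?a - t = (w ^ q - 1 - p powi ?f * (t - of_nat c)) / p powi ?f"
      by (simp add: zp_pos_def diff_divide_distrib power_int_not_zero del: power_int_of_nat)
    also have "\<dots> \<in> pball (K + int k - ?f)"
      using pball_mult_cancel[of "p powi ?f" "(w ^ q - 1 - p powi ?f * (t - of_nat c)) / p powi ?f" "K + int k"] w(2)
      by (simp add: power_int_not_zero del: power_int_of_nat)
    finally have z: "zp_pos l c \<kappa> ?a - t \<in> pball (int k)" using fK by (auto intro: pball_antimono)
    obtain x \<beta>' where x: "(x, \<beta>') \<in> X l \<kappa> ?a" "\<beta>' k = (snd \<circ> \<delta>) k"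
      using realizesD(4)[OF X[OF l] \<kappa>(1) car \<delta>(2), of k] by blast
    have mem: "(point l c \<kappa> ?a x, branch_ray l c \<kappa> ?a \<beta>') \<in> branch_points \<kappa> ?a"
      unfolding branch_points_def using l c(1) x(1) by blast
    have "path F \<beta> (DF l)" using 3(1) by (simp only: n)
    have "\<beta> (DF l) = l" unfolding n[symmetric] by (simp only: l_def)
    have "branch_ray l c \<kappa> ?a \<beta>' j = join_ray \<beta> n \<delta> j"
      unfolding branch_ray_def n join_ray_eq_iff[OF FT conjunct1[OF \<alpha>[OF l]] \<open>path F \<beta> (DF l)\<close>]
    proof (cases "j \<le> DF l")
      case True
      then have "\<alpha> l j = \<beta> j"
        using path_unique[OF FT conjunct1[OF \<alpha>[OF l]] \<open>path F \<beta> (DF l)\<close>] \<alpha>[OF l] \<open>\<beta> (DF l) = l\<close> by simp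
      then show "if j \<le> DF l \<and> j \<le> DF l then \<alpha> l j = \<beta> j
        else DF l = DF l \<and> \<alpha> l (DF l) = \<beta> (DF l) \<and>
          ((j - DF l, padic_ball 1 [zp_pos l c \<kappa> ?a] (j - DF l)), \<beta>' (j - DF l)) = \<delta> (j - DF l)" using True by simp
    next
      case False
      have "padic_ball 1 [zp_pos l c \<kappa> ?a] k = padic_ball 1 [t] k" using z by (simp add: zp_ball_eq_iff del: One_nat_def)
      then have "((k, padic_ball 1 [zp_pos l c \<kappa> ?a] k), \<beta>' k) = \<delta> k" using t(2) x(2) by (simp add: prod_eq_iff)
      then show "if j \<le> DF l \<and> j \<le> DF l then \<alpha> l j = \<beta> j
        else DF l = DF l \<and> \<alpha> l (DF l) = \<beta> (DF l) \<and>
          ((j - DF l, padic_ball 1 [zp_pos l c \<kappa> ?a] (j - DF l)), \<beta>' (j - DF l)) = \<delta> (j - DF l)"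
        using False \<alpha>[OF l] \<open>\<beta> (DF l) = l\<close> n by (simp add: k_def)
    qed
    then show ?case using car mem 3(4) by auto
  qed
qed

lemma unif_\<sigma>: "unif (Suc m) N \<sigma>"
  unfolding unif_def
proof (intro conjI allI impI)
  show "\<sigma> \<kappa> a = \<sigma> \<kappa> a'" if "agree (Suc m) a a'" for \<kappa> a a'
    using that by (simp add: \<sigma>_def agree_def)
  fix \<xi>
  have "\<forall>\<kappa>\<in>N. cls (Suc m) \<xi> \<kappa> \<longrightarrow> (\<forall>a. carries (Suc m) \<kappa> a \<longrightarrow> \<sigma> \<kappa> a = p powi (\<xi> m) * a m ^ q)"
    by (simp add: \<sigma>_def cls_def last_nth)
  moreover have "pw (\<lambda>a. p powi (\<xi> m) * a m ^ q)" by (intro pw_mult pw_powi pw_of_nat pw_power pw_var)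
  ultimately show "\<exists>g. pw g \<and> (\<forall>\<kappa>\<in>N. cls (Suc m) \<xi> \<kappa> \<longrightarrow> (\<forall>a. carries (Suc m) \<kappa> a \<longrightarrow> \<sigma> \<kappa> a = g a))" by blast
qed

lemma branch_points_tame: "tame d (Suc m) N (\<lambda>\<kappa> a. fst ` branch_points \<kappa> a)"
proof -
  obtain n where n: "\<And>c. c \<in> nodes F \<Longrightarrow> c < n"
    using F(2) finite_nat_set_iff_bounded by auto
  have "tame d (Suc m) N (\<lambda>\<kappa> a. point l c \<kappa> a ` (fst ` X l \<kappa> a))" if l: "l \<in> leaves F" for l c
  proof (rule tame_map[OF realizesD(5)[OF X[OF l]]])
    have "utrans (Suc m) N (\<lambda>\<kappa> a _ i. \<sigma> \<kappa> a * code l i)"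
    proof (rule utrans_const)
      show "unif (Suc m) N (\<lambda>\<kappa> a. \<sigma> \<kappa> a * code l i)" for i
        unfolding code_def by (rule unif_mult[OF unif_\<sigma> unif_const])
      show "zero_from n (\<lambda>i. \<sigma> \<kappa> a * code l i)" for \<kappa> a
        using n E[OF l] by (force simp: zero_from_def code_def)
    qed
    then show "utrans (Suc m) N (point l c)"
      unfolding point_def
      by (rule utrans_case_nat[OF unif_\<sigma> utrans_comb[OF _ utrans_case_nat[OF unif_mult[OF unif_\<sigma> unif_const]
            utrans_scale[OF unif_mult[OF unif_\<sigma> unif_const] utrans_id]]]])
  qed
  then have "tame d (Suc m) N (\<lambda>\<kappa> a. \<Union>l\<in>leaves F. \<Union>c\<in>{..<CARD('p) ^ nat (K - int (DF l))}. point l c \<kappa> a ` (fst ` X l \<kappa> a))"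
    using finite_subset[OF leaves_nodes F(2)] by (intro tame_UN) auto
  moreover have "fst ` branch_points \<kappa> a =
      (\<Union>l\<in>leaves F. \<Union>c\<in>{..<CARD('p) ^ nat (K - int (DF l))}. point l c \<kappa> a ` (fst ` X l \<kappa> a))" for \<kappa> a
    unfolding branch_points_def by force
  ultimately show ?thesis by simp
qed

end

subsection \<open>Skeletons with side branches\<close>

text \<open>The element \<open>\<theta> u\<close> lifts the depth of u, at which any bone below u is
  chosen. By \<open>infinite\<close> the virtual joints are the same for all \<kappa>.\<close>

locale skeleton_family = modulus P q for P :: "'p :: prime_card itself" and q +
  fixes m :: nat and M :: "int list set" and S :: "nat rtree" and rS DS
    and l :: "nat \<times> nat \<Rightarrow> int list \<Rightarrow> int extended" and jd :: "int list \<Rightarrow> nat \<Rightarrow> nat"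
    and E :: "nat \<Rightarrow> nat set" and par :: "nat \<Rightarrow> nat" and \<theta> :: "nat \<Rightarrow> int list \<Rightarrow> 'p assignment \<Rightarrow> 'p padic"
  assumes S: "tree_at S rS DS" "finite (nodes S)"
    and len: "\<And>\<kappa>. \<kappa> \<in> M \<Longrightarrow> length \<kappa> = m"
    and admissible: "\<And>\<kappa>. \<kappa> \<in> M \<Longrightarrow> admissible_lengths S (\<lambda>e. l e \<kappa>)"
    and jd: "\<And>\<kappa>. \<kappa> \<in> M \<Longrightarrow> joint_depths S rS (\<lambda>e. l e \<kappa>) (jd \<kappa>)"
    and E: "E rS = {}" "\<And>u v. (u, v) \<in> child_rel S \<Longrightarrow> E v = insert v (E u)"
      "\<And>v. v \<in> nodes S \<Longrightarrow> E v \<subseteq> {u \<in> nodes S. DS u \<le> DS v}"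
      "\<And>v u. v \<in> nodes S \<Longrightarrow> u \<in> E v \<Longrightarrow> DS u = DS v \<Longrightarrow> u = v"
      "\<And>v. v \<in> nodes S \<Longrightarrow> v \<noteq> rS \<Longrightarrow> v \<in> E v" "\<And>v. v \<in> nodes S \<Longrightarrow> rS \<notin> E v"
    and par: "\<And>u v. (u, v) \<in> child_rel S \<Longrightarrow> par v = u"
    and \<theta>: "\<And>u v. (u, v) \<in> child_rel S \<Longrightarrow> lifts m M (\<lambda>\<kappa>. jd \<kappa> u) (\<theta> u)"
    and infinite: "\<And>e \<kappa> \<kappa>'. e \<in> child_rel S \<Longrightarrow> \<kappa> \<in> M \<Longrightarrow> \<kappa>' \<in> M \<Longrightarrow> l e \<kappa> = \<infinity> \<Longrightarrow> l e \<kappa>' = \<infinity>"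
begin

abbreviation T0 :: "int list \<Rightarrow> skel_node rtree" where
  "T0 \<kappa> \<equiv> skeleton S (\<lambda>e. l e \<kappa>)"

definition acq :: "int list \<Rightarrow> nat \<Rightarrow> nat" where
  "acq \<kappa> c = jd \<kappa> (par c)"

text \<open>A label is encoded by the lift of its acquisition depth rather than by a power of p,
  because this depth varies with \<kappa> while the coordinate has to be piecewise rational in the
  carriers.\<close>

definition loc :: "nat set \<Rightarrow> int list \<Rightarrow> 'p assignment \<Rightarrow> 'p point" where
  "loc A \<kappa> a c = (if c \<in> A then \<theta> (par c) \<kappa> a else 0)"

definition infinite_bones :: "(nat \<times> nat) set" where
  "infinite_bones = {e \<in> child_rel S. \<forall>\<kappa>\<in>M. l e \<kappa> = \<infinity>}"

definition bone_ray :: "int list \<Rightarrow> nat \<times> nat \<Rightarrow> nat \<Rightarrow> skel_node" where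
  "bone_ray \<kappa> e = (SOME \<alpha>. ray (T0 \<kappa>) \<alpha> \<and> (\<forall>i. \<alpha> (jd \<kappa> (fst e) + i) = skel_pos (\<lambda>e. l e \<kappa>) e i))"

text \<open>The rays of the skeleton run down its infinite bones, so one point per bone is enough.
  The zero second half distinguishes them from points of side branches, where its first entry is
  nonzero.\<close>

definition bone_points :: "int list \<Rightarrow> 'p assignment \<Rightarrow> ('p point \<times> (nat \<Rightarrow> skel_node)) set" where
  "bone_points \<kappa> a = {(comb (loc (E (snd e)) \<kappa> a) (\<lambda>_. 0), bone_ray \<kappa> e) | e. e \<in> infinite_bones}"

lemma skel: "\<kappa> \<in> M \<Longrightarrow> skel S rS DS (\<lambda>e. l e \<kappa>) (jd \<kappa>)"
  using S(1) admissible jd by unfold_locales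

lemma finite_bones: "finite (child_rel S)"
  by (rule finite_subset[of _ "nodes S \<times> nodes S"]) (use S tree_atD(3,4)[OF S(1)] in auto)

lemma labelled: "\<kappa> \<in> M \<Longrightarrow> labelled (T0 \<kappa>) (Joint rS) (skel_depth (jd \<kappa>)) (skel_labels E) (acq \<kappa>)"
  by (rule skel.labelled_skeleton[OF skel E(1-5)]) (auto simp: acq_def par)

lemma T0: "\<kappa> \<in> M \<Longrightarrow> tree_at (T0 \<kappa>) (Joint rS) (skel_depth (jd \<kappa>))"
  by (rule labelled_tree_at[OF labelled])

lemma label_bone:
  assumes "c \<in> E w" "w \<in> nodes S"
  shows "(par c, c) \<in> child_rel S"
proof -
  have "c \<in> nodes S" "c \<noteq> rS" using E(3)[OF assms(2)] E(6)[OF assms(2)] assms(1) by auto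
  then obtain u where "(u, c) \<in> child_rel S" using tree_atD(8)[OF S(1)] by blast
  then show ?thesis using par by simp
qed

lemma loc_congr:
  assumes "\<kappa> \<in> M" "carries m \<kappa> a" "carries m \<kappa> a'" "close m (int j) a a'" "w \<in> nodes S" "w' \<in> nodes S"
  shows "congr (int j) (loc (E w) \<kappa> a) (loc (E w') \<kappa> a') \<longleftrightarrow> {c \<in> E w. acq \<kappa> c < j} = {c \<in> E w'. acq \<kappa> c < j}"
proof -
  have "congr (int j) (loc (E w) \<kappa> a) (loc (E w') \<kappa> a') \<longleftrightarrow>
      {c \<in> E w. int (acq \<kappa> c) < int j} = {c \<in> E w'. int (acq \<kappa> c) < int j}"
    unfolding loc_def
  proof (rule congr_labels)
    fix c assume "c \<in> E w \<union> E w'"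
    then have "(par c, c) \<in> child_rel S" using label_bone assms(5,6) by blast
    from liftsD(4)[OF \<theta>[OF this] assms(1-4)] show "\<theta> (par c) \<kappa> a - \<theta> (par c) \<kappa> a' \<in> pball (int j)" .
  next
    fix c assume "c \<in> E w"
    then have "(par c, c) \<in> child_rel S" using label_bone assms(5) by blast
    from liftsD(2,3)[OF \<theta>[OF this] assms(1,2)]
    show "\<theta> (par c) \<kappa> a \<noteq> 0 \<and> pval (\<theta> (par c) \<kappa> a) = int (acq \<kappa> c)" by (simp add: acq_def)
  next
    fix c assume "c \<in> E w'"
    then have "(par c, c) \<in> child_rel S" using label_bone assms(6) by blast
    from liftsD(2,3)[OF \<theta>[OF this] assms(1,3)]
    show "\<theta> (par c) \<kappa> a' \<noteq> 0 \<and> pval (\<theta> (par c) \<kappa> a') = int (acq \<kappa> c)" by (simp add: acq_def)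
  qed
  then show ?thesis by simp
qed

lemma loc_in:
  assumes "\<kappa> \<in> M" "carries m \<kappa> a" "w \<in> nodes S"
  shows "loc (E w) \<kappa> a i \<in> pball 0"
  using liftsD(5)[OF \<theta>[OF label_bone[OF _ assms(3)]] assms(1,2)] by (simp add: loc_def)

lemma utrans_loc:
  assumes "w \<in> nodes S"
  shows "utrans m M (\<lambda>\<kappa> a _. loc (E w) \<kappa> a)"
proof -
  obtain n where n: "\<And>c. c \<in> nodes S \<Longrightarrow> c < n"
    using S(2) finite_nat_set_iff_bounded by auto
  show ?thesis
  proof (rule utrans_const)
    show "unif m M (\<lambda>\<kappa> a. loc (E w) \<kappa> a c)" for c
    proof (cases "c \<in> E w")
      case True
      then show ?thesis using liftsD(1)[OF \<theta>[OF label_bone[OF True assms]]] by (simp add: loc_def)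
    next
      case False
      then show ?thesis using unif_const[of m M 0] by (simp add: loc_def)
    qed
    show "zero_from n (loc (E w) \<kappa> a)" for \<kappa> a
      unfolding zero_from_def loc_def using n E(3)[OF assms] by fastforce
  qed
qed

lemma bone_node: "e \<in> infinite_bones \<Longrightarrow> snd e \<in> nodes S"
  using tree_atD(4)[OF S(1), of "fst e" "snd e"] by (simp add: infinite_bones_def)

lemma bone_ray:
  assumes "\<kappa> \<in> M" "e \<in> infinite_bones"
  shows "ray (T0 \<kappa>) (bone_ray \<kappa> e)" "bone_ray \<kappa> e (jd \<kappa> (fst e) + i) = skel_pos (\<lambda>e. l e \<kappa>) e i"
proof -
  have "e \<in> child_rel S" "l e \<kappa> = \<infinity>" using assms by (auto simp: infinite_bones_def)
  then obtain \<alpha> where "ray (T0 \<kappa>) \<alpha>" "\<And>i. \<alpha> (jd \<kappa> (fst e) + i) = skel_pos (\<lambda>e. l e \<kappa>) e i"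
    by (rule skel.infinite_bone_ray[OF skel[OF assms(1)]]) blast
  then have "\<exists>\<alpha>. ray (T0 \<kappa>) \<alpha> \<and> (\<forall>i. \<alpha> (jd \<kappa> (fst e) + i) = skel_pos (\<lambda>e. l e \<kappa>) e i)" by blast
  from someI_ex[OF this] show "ray (T0 \<kappa>) (bone_ray \<kappa> e)" "bone_ray \<kappa> e (jd \<kappa> (fst e) + i) = skel_pos (\<lambda>e. l e \<kappa>) e i"
    unfolding bone_ray_def by blast+
qed

text \<open>Inside the bone the labels no longer change, so \<open>E (snd e)\<close> is the label
  set of any deeper node of the ray.\<close>

lemma bone_ray_labels:
  assumes "\<kappa> \<in> M" "e \<in> infinite_bones"
  shows "{c \<in> E (snd e). acq \<kappa> c < j} = skel_labels E (bone_ray \<kappa> e j)"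
proof -
  let ?n = "jd \<kappa> (fst e) + Suc j"
  have "skel_labels E (bone_ray \<kappa> e ?n) = E (snd e)"
    unfolding bone_ray(2)[OF assms] by (rule skel.pos_labels(1)[OF skel[OF assms(1)]]) simp
  then show ?thesis
    using labels_below[OF labelled[OF assms(1)] ray_path[OF bone_ray(1)[OF assms]], of j ?n] by simp
qed

text \<open>Stated against an arbitrary path with the right labels, so that it serves for two bones
  as well as for a bone and a side branch.\<close>

lemma bone_congr:
  assumes "\<kappa> \<in> M" "carries m \<kappa> a" "carries m \<kappa> a'" "close m (int j) a a'" "e \<in> infinite_bones" "w \<in> nodes S"
    "path (T0 \<kappa>) \<alpha> j" "{c \<in> E w. acq \<kappa> c < j} = skel_labels E (\<alpha> j)"
  shows "congr (int j) (loc (E (snd e)) \<kappa> a) (loc (E w) \<kappa> a') \<longleftrightarrow> bone_ray \<kappa> e j = \<alpha> j"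
  unfolding loc_congr[OF assms(1-4) bone_node[OF assms(5)] assms(6)] bone_ray_labels[OF assms(1,5)] assms(8)
  by (rule labels_eq_iff[OF labelled[OF assms(1)] ray_path[OF bone_ray(1)[OF assms(1,5)]] assms(7)])

lemma congr_zero_right: "congr j (\<lambda>_. 0) x \<longleftrightarrow> (\<forall>i. x i \<in> pball j)"
  by (simp add: congr_def)

lemma bone_points_congr:
  assumes "\<kappa> \<in> M" "carries m \<kappa> a" "carries m \<kappa> a'" "close m (int j) a a'"
    "(x, \<beta>) \<in> bone_points \<kappa> a" "(x', \<beta>') \<in> bone_points \<kappa> a'"
  shows "congr (int j) x x' \<longleftrightarrow> \<beta> j = \<beta>' j"
proof -
  obtain e where e: "e \<in> infinite_bones" "x = comb (loc (E (snd e)) \<kappa> a) (\<lambda>_. 0)" "\<beta> = bone_ray \<kappa> e"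
    using assms(5) unfolding bone_points_def by blast
  obtain e' where e': "e' \<in> infinite_bones" "x' = comb (loc (E (snd e')) \<kappa> a') (\<lambda>_. 0)" "\<beta>' = bone_ray \<kappa> e'"
    using assms(6) unfolding bone_points_def by blast
  show ?thesis
    unfolding e(2,3) e'(2,3) congr_comb
    using bone_congr[OF assms(1-4) e(1) bone_node[OF e'(1)] ray_path[OF bone_ray(1)[OF assms(1) e'(1)]]
        bone_ray_labels[OF assms(1) e'(1)]] by (simp add: congr_def)
qed

lemma bone_points_dense:
  assumes "\<kappa> \<in> M" "ray (T0 \<kappa>) \<beta>"
  shows "\<exists>x \<beta>'. (x, \<beta>') \<in> bone_points \<kappa> a \<and> \<beta>' j = \<beta> j"
proof -
  obtain e i where e: "e \<in> child_rel S" "l e \<kappa> = \<infinity>" "jd \<kappa> (fst e) + i \<ge> j"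
    "\<beta> (jd \<kappa> (fst e) + i) = skel_pos (\<lambda>e. l e \<kappa>) e i"
    by (rule skel.ray_in_infinite_bone[OF skel[OF assms(1)] S(2) assms(2), of j]) blast
  have eI: "e \<in> infinite_bones" using e(1,2) infinite[OF e(1) assms(1)] by (auto simp: infinite_bones_def)
  have "bone_ray \<kappa> e j = \<beta> j"
    using path_unique[OF T0[OF assms(1)] ray_path[OF bone_ray(1)[OF assms(1) eI]] ray_path[OF assms(2)] _ e(3)]
      e(4) bone_ray(2)[OF assms(1) eI] by simp
  then show ?thesis using eI unfolding bone_points_def by blast
qed

lemma bone_points_tame: "tame d m M (\<lambda>\<kappa> a. fst ` bone_points \<kappa> a)"
proof -
  have "tame d m M (\<lambda>\<kappa> a. \<Union>e\<in>infinite_bones. (\<lambda>x. comb (loc (E (snd e)) \<kappa> a) x) ` {\<lambda>_. 0})"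
  proof (rule tame_UN)
    show "finite infinite_bones" using finite_bones by (simp add: infinite_bones_def)
    show "tame d m M (\<lambda>\<kappa> a. (\<lambda>x. comb (loc (E (snd e)) \<kappa> a) x) ` {\<lambda>_. 0})" if "e \<in> infinite_bones" for e
      by (rule tame_map[OF tame_zero utrans_comb[OF utrans_loc[OF bone_node[OF that]] utrans_id]])
  qed
  moreover have "fst ` bone_points \<kappa> a = (\<Union>e\<in>infinite_bones. (\<lambda>x. comb (loc (E (snd e)) \<kappa> a) x) ` {\<lambda>_. 0})" for \<kappa> a
    unfolding bone_points_def by force
  ultimately show ?thesis by simp
qed

lemma bone_points_ray:
  assumes "\<kappa> \<in> M" "carries m \<kappa> a" "(x, \<beta>) \<in> bone_points \<kappa> a"
  shows "ray (T0 \<kappa>) \<beta>" "x i \<in> pball 0"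
proof -
  obtain e where e: "e \<in> infinite_bones" "x = comb (loc (E (snd e)) \<kappa> a) (\<lambda>_. 0)" "\<beta> = bone_ray \<kappa> e"
    using assms(3) unfolding bone_points_def by blast
  show "ray (T0 \<kappa>) \<beta>" using bone_ray(1)[OF assms(1) e(1)] e(3) by simp
  show "x i \<in> pball 0" using loc_in[OF assms(1,2) bone_node[OF e(1)]] by (simp add: e(2) comb_def)
qed

text \<open>Level 0: finitely many points, each determined by the carriers, so tameness holds with
  any number d of free entries.\<close>

lemma realizes_skeleton: "realizes d m M T0 bone_points"
  unfolding realizes_def
proof (intro conjI ballI allI impI)
  show "tame d m M (\<lambda>\<kappa> a. fst ` bone_points \<kappa> a)" by (rule bone_points_tame)
qed (use bone_points_ray bone_points_dense in \<open>blast+\<close> | (elim conjE, rule bone_points_congr, assumption+))+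

end

text \<open>In the application \<iota> is a joint, or a bone with a class mod \<rho>;
  \<open>w \<iota>\<close> is the joint whose labels the attachment nodes bear, and
  \<open>v \<iota> \<kappa> k\<close> is the attachment node at depth k. The assumptions on
  \<open>B\<close> are what \<open>branching\<close> provides.\<close>

locale branched_family = skeleton_family P q m M S rS DS l jd E par \<theta>
  for P :: "'p :: prime_card itself" and q m M S rS DS l jd E par \<theta> +
  fixes d :: nat and I :: "'i set" and N :: "'i \<Rightarrow> int list set" and w :: "'i \<Rightarrow> nat"
    and v :: "'i \<Rightarrow> int list \<Rightarrow> int \<Rightarrow> skel_node" and A :: "int list \<Rightarrow> skel_node \<Rightarrow> 'b rtree"
    and rA DA and B :: "'i \<Rightarrow> int list \<Rightarrow> 'p assignment \<Rightarrow> ('p point \<times> (nat \<Rightarrow> 'b)) set"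
  assumes I: "finite I" and w: "\<And>\<iota>. \<iota> \<in> I \<Longrightarrow> w \<iota> \<in> nodes S"
    and v: "\<And>\<iota> \<kappa> k. \<iota> \<in> I \<Longrightarrow> \<kappa> \<in> M \<Longrightarrow> \<kappa> @ [k] \<in> N \<iota> \<Longrightarrow> k \<ge> 0 \<and> v \<iota> \<kappa> k \<in> nodes (T0 \<kappa>) \<and>
        int (skel_depth (jd \<kappa>) (v \<iota> \<kappa> k)) = k \<and> skel_labels E (v \<iota> \<kappa> k) = E (w \<iota>)"
    and v_inj: "\<And>\<iota> \<iota>' \<kappa> k. \<iota> \<in> I \<Longrightarrow> \<iota>' \<in> I \<Longrightarrow> \<kappa> \<in> M \<Longrightarrow> \<kappa> @ [k] \<in> N \<iota> \<Longrightarrow> \<kappa> @ [k] \<in> N \<iota>' \<Longrightarrow>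
        v \<iota> \<kappa> k = v \<iota>' \<kappa> k \<Longrightarrow> \<iota> = \<iota>'"
    and v_surj: "\<And>\<kappa> u. \<kappa> \<in> M \<Longrightarrow> u \<in> nodes (T0 \<kappa>) \<Longrightarrow>
        \<exists>\<iota>\<in>I. \<exists>k. \<kappa> @ [k] \<in> N \<iota> \<and> v \<iota> \<kappa> k = u"
    and A: "\<And>\<kappa> u. \<kappa> \<in> M \<Longrightarrow> u \<in> nodes (T0 \<kappa>) \<Longrightarrow> tree_at (A \<kappa> u) (rA \<kappa> u) (DA \<kappa> u)"
    and N_dfn: "\<And>\<iota> \<xi> \<eta>. \<iota> \<in> I \<Longrightarrow> \<exists>C. dfn C \<and> (\<forall>\<kappa>\<in>M. cls m \<xi> \<kappa> \<longrightarrow> (\<forall>a. carries m \<kappa> a \<and> a m \<in> H \<longrightarrow>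
       (\<kappa> @ [\<eta> + int q * pval (a m)] \<in> N \<iota> \<longleftrightarrow> C a)))"
    and B_ray: "\<And>\<iota> \<kappa> k a y \<gamma>. \<iota> \<in> I \<Longrightarrow> \<kappa> \<in> M \<Longrightarrow> \<kappa> @ [k] \<in> N \<iota> \<Longrightarrow> carries (Suc m) (\<kappa> @ [k]) a \<Longrightarrow>
       (y, \<gamma>) \<in> B \<iota> (\<kappa> @ [k]) a \<Longrightarrow> ray (A \<kappa> (v \<iota> \<kappa> k)) \<gamma>"
    and B_val: "\<And>\<iota> \<kappa> k a y \<gamma>. \<iota> \<in> I \<Longrightarrow> \<kappa> \<in> M \<Longrightarrow> \<kappa> @ [k] \<in> N \<iota> \<Longrightarrow> carries (Suc m) (\<kappa> @ [k]) a \<Longrightarrow>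
       (y, \<gamma>) \<in> B \<iota> (\<kappa> @ [k]) a \<Longrightarrow> (\<forall>i. y i \<in> pball k) \<and> y 0 \<noteq> 0 \<and> pval (y 0) = k"
    and B_congr: "\<And>\<iota> \<kappa> k a a' y \<gamma> y' \<gamma>' j. \<iota> \<in> I \<Longrightarrow> \<kappa> \<in> M \<Longrightarrow> \<kappa> @ [k] \<in> N \<iota> \<Longrightarrow>
       carries (Suc m) (\<kappa> @ [k]) a \<Longrightarrow> carries (Suc m) (\<kappa> @ [k]) a' \<Longrightarrow>
       (y, \<gamma>) \<in> B \<iota> (\<kappa> @ [k]) a \<Longrightarrow> (y', \<gamma>') \<in> B \<iota> (\<kappa> @ [k]) a' \<Longrightarrow> close m (k + int j) a a' \<Longrightarrow>
       congr (k + int j) y y' \<longleftrightarrow> \<gamma> j = \<gamma>' j"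
    and B_dense: "\<And>\<iota> \<kappa> k a \<gamma> j. \<iota> \<in> I \<Longrightarrow> \<kappa> \<in> M \<Longrightarrow> \<kappa> @ [k] \<in> N \<iota> \<Longrightarrow> carries m \<kappa> a \<Longrightarrow>
       ray (A \<kappa> (v \<iota> \<kappa> k)) \<gamma> \<Longrightarrow>
       \<exists>s y \<gamma>'. carries (Suc m) (\<kappa> @ [k]) (a(m := s)) \<and> (y, \<gamma>') \<in> B \<iota> (\<kappa> @ [k]) (a(m := s)) \<and> \<gamma>' j = \<gamma> j"
    and B_tame: "\<And>\<iota>. \<iota> \<in> I \<Longrightarrow> tame d (Suc m) (N \<iota>) (\<lambda>\<kappa> a. fst ` B \<iota> \<kappa> a)"
begin

definition node_path :: "int list \<Rightarrow> skel_node \<Rightarrow> nat \<Rightarrow> skel_node" where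
  "node_path \<kappa> u = (SOME \<alpha>. path (T0 \<kappa>) \<alpha> (skel_depth (jd \<kappa>) u) \<and> \<alpha> (skel_depth (jd \<kappa>) u) = u)"

definition family_ray :: "'i \<Rightarrow> int list \<Rightarrow> int \<Rightarrow> (nat \<Rightarrow> 'b) \<Rightarrow> nat \<Rightarrow> skel_node + skel_node \<times> 'b" where
  "family_ray \<iota> \<kappa> k \<gamma> = join_ray (node_path \<kappa> (v \<iota> \<kappa> k)) (nat k) \<gamma>"

text \<open>Quantifying over the carrier s of the depth k makes it a free parameter, the one
  dimension that a level costs.\<close>

definition side_points :: "int list \<Rightarrow> 'p assignment \<Rightarrow> ('p point \<times> (nat \<Rightarrow> skel_node + skel_node \<times> 'b)) set" where
  "side_points \<kappa> a = {(comb (loc (E (w \<iota>)) \<kappa> a) y, family_ray \<iota> \<kappa> k \<gamma>) | \<iota> k s y \<gamma>. \<iota> \<in> I \<and> \<kappa> @ [k] \<in> N \<iota> \<and>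
     carries (Suc m) (\<kappa> @ [k]) (a(m := s)) \<and> (y, \<gamma>) \<in> B \<iota> (\<kappa> @ [k]) (a(m := s))}"

definition family_points :: "int list \<Rightarrow> 'p assignment \<Rightarrow> ('p point \<times> (nat \<Rightarrow> skel_node + skel_node \<times> 'b)) set" where
  "family_points \<kappa> a = (\<lambda>(x, \<beta>). (x, Inl \<circ> \<beta>)) ` bone_points \<kappa> a \<union> side_points \<kappa> a"

lemma node_path:
  assumes "\<kappa> \<in> M" "u \<in> nodes (T0 \<kappa>)"
  shows "path (T0 \<kappa>) (node_path \<kappa> u) (skel_depth (jd \<kappa>) u)" "node_path \<kappa> u (skel_depth (jd \<kappa>) u) = u"
proof -
  have "\<exists>\<alpha>. path (T0 \<kappa>) \<alpha> (skel_depth (jd \<kappa>) u) \<and> \<alpha> (skel_depth (jd \<kappa>) u) = u"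
    by (rule path_ex[OF T0[OF assms(1)] assms(2)]) blast
  from someI_ex[OF this] show "path (T0 \<kappa>) (node_path \<kappa> u) (skel_depth (jd \<kappa>) u)"
    "node_path \<kappa> u (skel_depth (jd \<kappa>) u) = u" unfolding node_path_def by blast+
qed

lemma side_pointsE:
  assumes \<kappa>: "\<kappa> \<in> M" and a: "carries m \<kappa> a" and x: "(x, \<beta>) \<in> side_points \<kappa> a"
  obtains \<iota> n s y \<gamma> \<alpha> where "\<iota> \<in> I" "\<kappa> @ [int n] \<in> N \<iota>" "carries (Suc m) (\<kappa> @ [int n]) (a(m := s))"
    "(y, \<gamma>) \<in> B \<iota> (\<kappa> @ [int n]) (a(m := s))" "x = comb (loc (E (w \<iota>)) \<kappa> a) y" "\<beta> = join_ray \<alpha> n \<gamma>"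
    "path (T0 \<kappa>) \<alpha> n" "\<alpha> n = v \<iota> \<kappa> (int n)" "\<alpha> n \<in> nodes (T0 \<kappa>)" "ray (A \<kappa> (\<alpha> n)) \<gamma>"
    "\<And>i. y i \<in> pball (int n)" "y 0 \<noteq> 0" "pval (y 0) = int n"
    "\<And>j. j \<le> n \<Longrightarrow> {c \<in> E (w \<iota>). acq \<kappa> c < j} = skel_labels E (\<alpha> j)"
proof -
  obtain \<iota> k s y \<gamma> where o: "\<iota> \<in> I" "\<kappa> @ [k] \<in> N \<iota>" "carries (Suc m) (\<kappa> @ [k]) (a(m := s))"
    "(y, \<gamma>) \<in> B \<iota> (\<kappa> @ [k]) (a(m := s))" "x = comb (loc (E (w \<iota>)) \<kappa> a) y" "\<beta> = family_ray \<iota> \<kappa> k \<gamma>"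
    using x unfolding side_points_def by blast
  have vv: "k \<ge> 0" "v \<iota> \<kappa> k \<in> nodes (T0 \<kappa>)" "int (skel_depth (jd \<kappa>) (v \<iota> \<kappa> k)) = k" "skel_labels E (v \<iota> \<kappa> k) = E (w \<iota>)"
    using v[OF o(1) \<kappa> o(2)] by auto
  define n where "n = nat k"
  have k: "k = int n" "skel_depth (jd \<kappa>) (v \<iota> \<kappa> k) = n" using vv(1,3) by (auto simp: n_def)
  note np = node_path[OF \<kappa> vv(2), unfolded k(2)]
  have lab: "{c \<in> E (w \<iota>). acq \<kappa> c < j} = skel_labels E (node_path \<kappa> (v \<iota> \<kappa> k) j)" if "j \<le> n" for j
    using labels_below[OF labelled[OF \<kappa>] np(1) that] np(2) vv(4) by simp
  show ?thesis
    by (rule that[of \<iota> n s y \<gamma> "node_path \<kappa> (v \<iota> \<kappa> k)"])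
       (use o vv np lab B_ray[OF o(1) \<kappa> o(2,3,4)] B_val[OF o(1) \<kappa> o(2,3,4)] in
         \<open>simp_all add: k(1) family_ray_def\<close>)
qed

text \<open>The valuation of \<open>y 0\<close> is the depth n at which the ray leaves the skeleton,
  so this depth shows mod p^j iff n < j. Up to there the labels decide, and beyond it the side
  branch at the common node.\<close>

lemma side_points_congr:
  assumes \<kappa>: "\<kappa> \<in> M" "carries m \<kappa> a" "carries m \<kappa> a'" "close m (int j) a a'"
    "(x, \<beta>) \<in> side_points \<kappa> a" "(x', \<beta>') \<in> side_points \<kappa> a'"
  shows "congr (int j) x x' \<longleftrightarrow> \<beta> j = \<beta>' j"
proof -
  from \<kappa>(1,2,5) obtain \<iota> n s y \<gamma> \<alpha> where 1: "\<iota> \<in> I" "\<kappa> @ [int n] \<in> N \<iota>" "carries (Suc m) (\<kappa> @ [int n]) (a(m := s))"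
    "(y, \<gamma>) \<in> B \<iota> (\<kappa> @ [int n]) (a(m := s))" "x = comb (loc (E (w \<iota>)) \<kappa> a) y" "\<beta> = join_ray \<alpha> n \<gamma>"
    "path (T0 \<kappa>) \<alpha> n" "\<alpha> n = v \<iota> \<kappa> (int n)" "\<alpha> n \<in> nodes (T0 \<kappa>)" "ray (A \<kappa> (\<alpha> n)) \<gamma>"
    "\<And>i. y i \<in> pball (int n)" "y 0 \<noteq> 0" "pval (y 0) = int n"
    "\<And>j. j \<le> n \<Longrightarrow> {c \<in> E (w \<iota>). acq \<kappa> c < j} = skel_labels E (\<alpha> j)" by (rule side_pointsE) blast
  from \<kappa>(1,3,6) obtain \<iota>' n' s' y' \<gamma>' \<alpha>' where 2: "\<iota>' \<in> I" "\<kappa> @ [int n'] \<in> N \<iota>'" "carries (Suc m) (\<kappa> @ [int n']) (a'(m := s'))"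
    "(y', \<gamma>') \<in> B \<iota>' (\<kappa> @ [int n']) (a'(m := s'))" "x' = comb (loc (E (w \<iota>')) \<kappa> a') y'" "\<beta>' = join_ray \<alpha>' n' \<gamma>'"
    "path (T0 \<kappa>) \<alpha>' n'" "\<alpha>' n' = v \<iota>' \<kappa> (int n')" "\<alpha>' n' \<in> nodes (T0 \<kappa>)" "ray (A \<kappa> (\<alpha>' n')) \<gamma>'"
    "\<And>i. y' i \<in> pball (int n')" "y' 0 \<noteq> 0" "pval (y' 0) = int n'"
    "\<And>j. j \<le> n' \<Longrightarrow> {c \<in> E (w \<iota>'). acq \<kappa> c < j} = skel_labels E (\<alpha>' j)" by (rule side_pointsE) blast
  have loc: "congr (int i) (loc (E (w \<iota>)) \<kappa> a) (loc (E (w \<iota>')) \<kappa> a') \<longleftrightarrow> \<alpha> i = \<alpha>' i"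
    if i: "i \<le> n" "i \<le> n'" "i \<le> j" for i
  proof -
    have "close m (int i) a a'" using close_mono[OF \<kappa>(4)] i by simp
    from loc_congr[OF \<kappa>(1-3) this w[OF 1(1)] w[OF 2(1)]] show ?thesis
      unfolding 1(14)[OF i(1)] 2(14)[OF i(2)]
      using labels_eq_iff[OF labelled[OF \<kappa>(1)] path_mono[OF 1(7) i(1)] path_mono[OF 2(7) i(2)]] by simp
  qed
  note jr = join_ray_eq_iff[OF T0[OF \<kappa>(1)] 1(7) 2(7)]
  consider "j \<le> n" "j \<le> n'" | "n < n'" "n < j" | "n' < n" "n' < j" | "n = n'" "n < j" by linarith
  then show ?thesis
  proof cases
    case c1: 1
    have "congr (int j) y y'"
      unfolding congr_def using pball_antimono[OF 1(11)] pball_antimono[OF 2(11)] c1 by (intro allI pball_diff) auto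
    then show ?thesis unfolding 1(5,6) 2(5,6) congr_comb jr using loc[OF c1] c1 by simp
  next
    case c2: 2
    have "\<not> congr (int j) y y'"
    proof
      assume "congr (int j) y y'"
      then have "y 0 - y' 0 \<in> pball (int n + 1)" using c2 unfolding congr_def by (auto intro: pball_antimono)
      moreover have "y' 0 \<in> pball (int n + 1)" using c2 by (intro pball_antimono[OF 2(11)]) simp
      ultimately have "y 0 - y' 0 + y' 0 \<in> pball (int n + 1)" by (rule pball_add)
      then show False using 1(12,13) by (simp add: mem_pball_iff)
    qed
    then show ?thesis unfolding 1(5,6) 2(5,6) congr_comb jr using c2 by simp
  next
    case 3
    have "\<not> congr (int j) y y'"
    proof
      assume "congr (int j) y y'"
      then have "y 0 - y' 0 \<in> pball (int n' + 1)" using 3 unfolding congr_def by (auto intro: pball_antimono)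
      moreover have "y 0 \<in> pball (int n' + 1)" using 3 by (intro pball_antimono[OF 1(11)]) simp
      ultimately have "y 0 - (y 0 - y' 0) \<in> pball (int n' + 1)" by (simp only: pball_diff)
      then show False using 2(12,13) by (simp add: mem_pball_iff)
    qed
    then show ?thesis unfolding 1(5,6) 2(5,6) congr_comb jr using 3 by simp
  next
    case 4
    show ?thesis
    proof (cases "\<alpha> n = \<alpha>' n")
      case True
      then have "v \<iota> \<kappa> (int n) = v \<iota>' \<kappa> (int n)" using 1(8) 2(8) 4 by simp
      then have \<iota>: "\<iota> = \<iota>'" using v_inj[OF 1(1) 2(1) \<kappa>(1) 1(2)] 2(2) 4 by simp
      have "congr (int j) (loc (E (w \<iota>)) \<kappa> a) (loc (E (w \<iota>')) \<kappa> a')"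
        using loc_congr[OF \<kappa>(1-4) w[OF 1(1)] w[OF 2(1)]] \<iota> by simp
      moreover have "congr (int n + int (j - n)) y y' \<longleftrightarrow> \<gamma> (j - n) = \<gamma>' (j - n)"
      proof (rule B_congr[OF 1(1) \<kappa>(1) 1(2,3) _ 1(4)])
        show "carries (Suc m) (\<kappa> @ [int n]) (a'(m := s'))" "(y', \<gamma>') \<in> B \<iota> (\<kappa> @ [int n]) (a'(m := s'))"
          using 2(3,4) \<iota> 4 by simp_all
        show "close m (int n + int (j - n)) (a(m := s)) (a'(m := s'))"
          using \<kappa>(4) 4 by (auto simp: close_def)
      qed
      ultimately show ?thesis unfolding 1(5,6) 2(5,6) congr_comb jr using 4 True by simp
    next
      case False
      have "\<not> congr (int j) (loc (E (w \<iota>)) \<kappa> a) (loc (E (w \<iota>')) \<kappa> a')"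
      proof
        assume "congr (int j) (loc (E (w \<iota>)) \<kappa> a) (loc (E (w \<iota>')) \<kappa> a')"
        then have "congr (int n) (loc (E (w \<iota>)) \<kappa> a) (loc (E (w \<iota>')) \<kappa> a')" by (rule congr_mono) (use 4 in simp)
        then show False using loc[of n] 4 False by simp
      qed
      then show ?thesis unfolding 1(5,6) 2(5,6) congr_comb jr using 4 False by simp
    qed
  qed
qed

text \<open>The second half of a bone point is 0, which is congruent to y exactly up to the depth
  where the other ray leaves the skeleton.\<close>

lemma bone_side_congr:
  assumes \<kappa>: "\<kappa> \<in> M" "carries m \<kappa> a" "carries m \<kappa> a'" "close m (int j) a a'"
    "(x, \<beta>) \<in> bone_points \<kappa> a" "(x', \<beta>') \<in> side_points \<kappa> a'"
  shows "congr (int j) x x' \<longleftrightarrow> Inl (\<beta> j) = \<beta>' j"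
proof -
  obtain e where e: "e \<in> infinite_bones" "x = comb (loc (E (snd e)) \<kappa> a) (\<lambda>_. 0)" "\<beta> = bone_ray \<kappa> e"
    using \<kappa>(5) unfolding bone_points_def by blast
  from \<kappa>(1,3,6) obtain \<iota> n s y \<gamma> \<alpha> where 1: "\<iota> \<in> I" "\<kappa> @ [int n] \<in> N \<iota>" "carries (Suc m) (\<kappa> @ [int n]) (a'(m := s))"
    "(y, \<gamma>) \<in> B \<iota> (\<kappa> @ [int n]) (a'(m := s))" "x' = comb (loc (E (w \<iota>)) \<kappa> a') y" "\<beta>' = join_ray \<alpha> n \<gamma>"
    "path (T0 \<kappa>) \<alpha> n" "\<alpha> n = v \<iota> \<kappa> (int n)" "\<alpha> n \<in> nodes (T0 \<kappa>)" "ray (A \<kappa> (\<alpha> n)) \<gamma>"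
    "\<And>i. y i \<in> pball (int n)" "y 0 \<noteq> 0" "pval (y 0) = int n"
    "\<And>j. j \<le> n \<Longrightarrow> {c \<in> E (w \<iota>). acq \<kappa> c < j} = skel_labels E (\<alpha> j)" by (rule side_pointsE) blast
  show ?thesis
  proof (cases "j \<le> n")
    case True
    have "y i \<in> pball (int j)" for i using pball_antimono[OF 1(11)] True by simp
    then show ?thesis
      unfolding e(2,3) 1(5,6) congr_comb congr_zero_right
      using bone_congr[OF \<kappa>(1-4) e(1) w[OF 1(1)] path_mono[OF 1(7) True] 1(14)[OF True]] True
      by (simp add: join_ray_def)
  next
    case False
    then have "y 0 \<notin> pball (int j)" using 1(12,13) by (simp add: mem_pball_iff)
    then show ?thesis unfolding e(2,3) 1(5,6) congr_comb congr_zero_right using False by (auto simp: join_ray_def)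
  qed
qed

lemma congr_sym: "congr j x y \<longleftrightarrow> congr j y x"
  by (simp add: congr_def pball_diff_commute)

lemma close_sym: "carries m \<kappa> a \<Longrightarrow> carries m \<kappa> a' \<Longrightarrow> close m (int j) a a' \<Longrightarrow> close m (int j) a' a"
proof -
  assume a: "carries m \<kappa> a" "carries m \<kappa> a'" and c: "close m (int j) a a'"
  have "a' i ^ q / a i ^ q - 1 \<in> pball (int j)" if "i < m" for i
  proof -
    have r: "a i / a' i \<noteq> 0" "pval (a i / a' i) = 0" using close_ratio[OF a c that] by auto
    have "(a i / a' i) ^ q - 1 \<in> pball (int j)" using c that by (simp add: close_def power_divide)
    then have "inverse ((a i / a' i) ^ q) - 1 \<in> pball (int j)"
      using r by (intro one_unit_inverse) (simp_all add: pval_power)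
    then show ?thesis by (simp add: power_divide)
  qed
  then show "close m (int j) a' a" by (simp add: close_def)
qed

text \<open>The step from d to d + 1. Tameness comes from \<open>tame_fiber\<close>, applied to the
  side branches of each index.\<close>

lemma realizes_attach: "realizes (Suc d) m M (\<lambda>\<kappa>. attach (T0 \<kappa>) (nodes (T0 \<kappa>)) (A \<kappa>)) family_points"
  unfolding realizes_def
proof (intro conjI ballI allI impI)
  fix \<kappa> a x \<beta> assume \<kappa>: "\<kappa> \<in> M" and "carries m \<kappa> a \<and> (x, \<beta>) \<in> family_points \<kappa> a"
  then have a: "carries m \<kappa> a" and "(x, \<beta>) \<in> family_points \<kappa> a" by auto
  then consider \<beta>0 where "(x, \<beta>0) \<in> bone_points \<kappa> a" "\<beta> = Inl \<circ> \<beta>0" | "(x, \<beta>) \<in> side_points \<kappa> a"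
    unfolding family_points_def by auto
  then have "ray (attach (T0 \<kappa>) (nodes (T0 \<kappa>)) (A \<kappa>)) \<beta> \<and> (\<forall>i. x i \<in> pball 0)"
  proof cases
    case 1
    then show ?thesis using ray_Inl[OF T0[OF \<kappa>] order.refl A[OF \<kappa>]] bone_points_ray[OF \<kappa> a 1(1)] by simp
  next
    case 2
    from \<kappa> a 2 obtain \<iota> n s y \<gamma> \<alpha> where 1: "\<iota> \<in> I" "x = comb (loc (E (w \<iota>)) \<kappa> a) y" "\<beta> = join_ray \<alpha> n \<gamma>"
      "path (T0 \<kappa>) \<alpha> n" "\<alpha> n \<in> nodes (T0 \<kappa>)" "ray (A \<kappa> (\<alpha> n)) \<gamma>" "\<And>i. y i \<in> pball (int n)" by (rule side_pointsE) blast
    have "y i \<in> pball 0" for i using pball_antimono[OF 1(7)] by simp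
    then show ?thesis
      using ray_join[where A = "A \<kappa>", OF T0[OF \<kappa>] order.refl A[OF \<kappa>] 1(4,5,6)] loc_in[OF \<kappa> a w[OF 1(1)]] unfolding 1(2,3)
      by (simp add: comb_def)
  qed
  then show "ray (attach (T0 \<kappa>) (nodes (T0 \<kappa>)) (A \<kappa>)) \<beta>" "\<And>i. x i \<in> pball 0" by auto
next
  fix \<kappa> a a' x \<beta> x' \<beta>' j
  assume \<kappa>: "\<kappa> \<in> M" and "carries m \<kappa> a \<and> carries m \<kappa> a' \<and> close m (int j) a a' \<and>
      (x, \<beta>) \<in> family_points \<kappa> a \<and> (x', \<beta>') \<in> family_points \<kappa> a'"
  then have a: "carries m \<kappa> a" "carries m \<kappa> a'" "close m (int j) a a'"
    and x: "(x, \<beta>) \<in> family_points \<kappa> a" and x': "(x', \<beta>') \<in> family_points \<kappa> a'" by auto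
  have a': "close m (int j) a' a" by (rule close_sym[OF a])
  from x consider \<beta>0 where "(x, \<beta>0) \<in> bone_points \<kappa> a" "\<beta> = Inl \<circ> \<beta>0" | "(x, \<beta>) \<in> side_points \<kappa> a"
    unfolding family_points_def by auto
  then show "congr (int j) x x' \<longleftrightarrow> \<beta> j = \<beta>' j"
  proof cases
    case 1
    from x' consider \<beta>0 where "(x', \<beta>0) \<in> bone_points \<kappa> a'" "\<beta>' = Inl \<circ> \<beta>0" | "(x', \<beta>') \<in> side_points \<kappa> a'"
      unfolding family_points_def by auto
    then show ?thesis
    proof cases
      case c1: 1
      then show ?thesis using bone_points_congr[OF \<kappa> a 1(1)] 1(2) by simp
    next
      case 2
      then show ?thesis using bone_side_congr[OF \<kappa> a 1(1)] 1(2) by simp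
    qed
  next
    case 2
    from x' consider \<beta>0 where "(x', \<beta>0) \<in> bone_points \<kappa> a'" "\<beta>' = Inl \<circ> \<beta>0" | "(x', \<beta>') \<in> side_points \<kappa> a'"
      unfolding family_points_def by auto
    then show ?thesis
    proof cases
      case 1
      have "congr (int j) x' x \<longleftrightarrow> Inl (\<beta>0 j) = \<beta> j" using bone_side_congr[OF \<kappa> a(2,1) a' 1(1) 2] .
      then show ?thesis using 1(2) congr_sym by auto
    next
      case c2: 2
      then show ?thesis using side_points_congr[OF \<kappa> a 2] by simp
    qed
  qed
next
  fix \<kappa> a \<beta> j assume \<kappa>: "\<kappa> \<in> M" and "carries m \<kappa> a \<and> ray (attach (T0 \<kappa>) (nodes (T0 \<kappa>)) (A \<kappa>)) \<beta>"
  then have a: "carries m \<kappa> a" and \<beta>: "ray (attach (T0 \<kappa>) (nodes (T0 \<kappa>)) (A \<kappa>)) \<beta>" by auto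
  note cs = ray_attach_cases[OF T0[OF \<kappa>] order.refl A[OF \<kappa>] \<beta>]
  show "\<exists>x \<beta>'. (x, \<beta>') \<in> family_points \<kappa> a \<and> \<beta>' j = \<beta> j"
  proof (rule cs, goal_cases)
    case (1 u)
    then show ?case .
  next
    case (2 \<alpha>)
    obtain x \<beta>' where "(x, \<beta>') \<in> bone_points \<kappa> a" "\<beta>' j = \<alpha> j" using bone_points_dense[OF \<kappa> 2(1)] by blast
    then have "(x, Inl \<circ> \<beta>') \<in> family_points \<kappa> a" "(Inl \<circ> \<beta>') j = \<beta> j"
      using 2(2) unfolding family_points_def by force+
    then show ?case by blast
  next
    case (3 \<alpha> n \<gamma>)
    obtain \<iota> k where \<iota>: "\<iota> \<in> I" "\<kappa> @ [k] \<in> N \<iota>" "v \<iota> \<kappa> k = \<alpha> n" using v_surj[OF \<kappa> 3(2)] by blast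
    have n: "skel_depth (jd \<kappa>) (\<alpha> n) = n" using path_node(2)[OF T0[OF \<kappa>] 3(1)] by simp
    have k: "k = int n" using v[OF \<iota>(1) \<kappa> \<iota>(2)] n \<iota>(3) by simp
    obtain s y \<gamma>' where y: "carries (Suc m) (\<kappa> @ [k]) (a(m := s))" "(y, \<gamma>') \<in> B \<iota> (\<kappa> @ [k]) (a(m := s))" "\<gamma>' (j - n) = \<gamma> (j - n)"
      using B_dense[OF \<iota>(1) \<kappa> \<iota>(2) a, of \<gamma> "j - n"] 3(3) \<iota>(3) by auto
    have mem: "(comb (loc (E (w \<iota>)) \<kappa> a) y, family_ray \<iota> \<kappa> k \<gamma>') \<in> family_points \<kappa> a"
      unfolding family_points_def side_points_def using \<iota>(1,2) y(1,2) by blast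
    note np = node_path[OF \<kappa> 3(2), unfolded n]
    have "family_ray \<iota> \<kappa> k \<gamma>' j = join_ray \<alpha> n \<gamma> j"
      unfolding family_ray_def \<iota>(3)[unfolded k] k nat_int join_ray_eq_iff[OF T0[OF \<kappa>] np(1) 3(1)]
      using path_unique[OF T0[OF \<kappa>] np(1) 3(1) np(2), of j] np(2) y(3) by simp
    then show ?case using mem 3(4) by auto
  qed
next
  have "tame (Suc d) m M (\<lambda>\<kappa> a. fst ` bone_points \<kappa> a \<union> (\<Union>\<iota>\<in>I. (\<lambda>y. comb (loc (E (w \<iota>)) \<kappa> a) y) ` {y. \<exists>s k. \<kappa> @ [k] \<in> N \<iota> \<and>
     carries (Suc m) (\<kappa> @ [k]) (a(m := s)) \<and> y \<in> fst ` B \<iota> (\<kappa> @ [k]) (a(m := s))}))"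
  proof (intro tame_Un tame_UN bone_points_tame I)
    fix \<iota> assume \<iota>: "\<iota> \<in> I"
    have "tame (Suc d) m M (\<lambda>\<kappa> a. {y. \<exists>s k. \<kappa> @ [k] \<in> N \<iota> \<and>
     carries (Suc m) (\<kappa> @ [k]) (a(m := s)) \<and> y \<in> fst ` B \<iota> (\<kappa> @ [k]) (a(m := s))})"
      by (rule tame_fiber[OF B_tame[OF \<iota>] len N_dfn[OF \<iota>]])
    from tame_map[OF this utrans_comb[OF utrans_loc[OF w[OF \<iota>]] utrans_id]]
    show "tame (Suc d) m M (\<lambda>\<kappa> a. (\<lambda>y. comb (loc (E (w \<iota>)) \<kappa> a) y) ` {y. \<exists>s k. \<kappa> @ [k] \<in> N \<iota> \<and>
     carries (Suc m) (\<kappa> @ [k]) (a(m := s)) \<and> y \<in> fst ` B \<iota> (\<kappa> @ [k]) (a(m := s))})" .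
  qed
  moreover have "fst ` family_points \<kappa> a = fst ` bone_points \<kappa> a \<union> (\<Union>\<iota>\<in>I. (\<lambda>y. comb (loc (E (w \<iota>)) \<kappa> a) y) ` {y. \<exists>s k. \<kappa> @ [k] \<in> N \<iota> \<and>
     carries (Suc m) (\<kappa> @ [k]) (a(m := s)) \<and> y \<in> fst ` B \<iota> (\<kappa> @ [k]) (a(m := s))})" (is "_ = ?R") for \<kappa> a
  proof (intro subset_antisym subsetI)
    fix x assume "x \<in> fst ` family_points \<kappa> a"
    then obtain \<beta> where "(x, \<beta>) \<in> family_points \<kappa> a" by auto
    then consider \<beta>0 where "(x, \<beta>0) \<in> bone_points \<kappa> a" | "(x, \<beta>) \<in> side_points \<kappa> a" unfolding family_points_def by auto
    then show "x \<in> ?R"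
    proof cases
      case 1
      then show ?thesis by force
    next
      case 2
      then obtain \<iota> k s y \<gamma> where "\<iota> \<in> I" "\<kappa> @ [k] \<in> N \<iota>" "carries (Suc m) (\<kappa> @ [k]) (a(m := s))"
        "(y, \<gamma>) \<in> B \<iota> (\<kappa> @ [k]) (a(m := s))" "x = comb (loc (E (w \<iota>)) \<kappa> a) y" unfolding side_points_def by blast
      then show ?thesis by force
    qed
  next
    fix x assume "x \<in> ?R"
    then consider \<beta>0 where "(x, \<beta>0) \<in> bone_points \<kappa> a" | \<iota> k s y \<gamma> where "\<iota> \<in> I" "\<kappa> @ [k] \<in> N \<iota>" "carries (Suc m) (\<kappa> @ [k]) (a(m := s))"
        "(y, \<gamma>) \<in> B \<iota> (\<kappa> @ [k]) (a(m := s))" "x = comb (loc (E (w \<iota>)) \<kappa> a) y" by fastforce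
    then have "\<exists>\<beta>. (x, \<beta>) \<in> family_points \<kappa> a"
    proof cases
      case 1
      then have "(x, Inl \<circ> \<beta>0) \<in> family_points \<kappa> a" unfolding family_points_def by force
      then show ?thesis by blast
    next
      case 2
      then show ?thesis unfolding family_points_def side_points_def by blast
    qed
    then show "x \<in> fst ` family_points \<kappa> a" by force
  qed
  ultimately show "tame (Suc d) m M (\<lambda>\<kappa> a. fst ` family_points \<kappa> a)" by simp
qed

end

subsection \<open>Level 0 data\<close>

text \<open>The way q is chosen: each part of a datum works for all multiples of some number, and
  finitely many such demands can be met together.\<close>

definition for_multiples :: "(nat \<Rightarrow> bool) \<Rightarrow> bool" where
  "for_multiples R \<longleftrightarrow> (\<exists>Q>0. \<forall>q>0. Q dvd q \<longrightarrow> R q)"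

lemma for_multiples_mono: "for_multiples R \<Longrightarrow> (\<And>q. q > 0 \<Longrightarrow> R q \<Longrightarrow> R' q) \<Longrightarrow> for_multiples R'"
  unfolding for_multiples_def by blast

lemma for_multiples_const: "c \<Longrightarrow> for_multiples (\<lambda>_. c)"
  unfolding for_multiples_def by auto

lemma for_multiples_conj:
  assumes "for_multiples R" "for_multiples R'"
  shows "for_multiples (\<lambda>q. R q \<and> R' q)"
proof -
  obtain Q Q' where "Q > 0" "\<forall>q>0. Q dvd q \<longrightarrow> R q" "Q' > 0" "\<forall>q>0. Q' dvd q \<longrightarrow> R' q"
    using assms unfolding for_multiples_def by blast
  then have "Q * Q' > 0" "\<forall>q>0. Q * Q' dvd q \<longrightarrow> R q \<and> R' q"
    using dvd_mult_left dvd_mult_right by auto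
  then show ?thesis unfolding for_multiples_def by blast
qed

lemma for_multiples_ball: "finite I \<Longrightarrow> (\<And>i. i \<in> I \<Longrightarrow> for_multiples (R i)) \<Longrightarrow> for_multiples (\<lambda>q. \<forall>i\<in>I. R i q)"
  by (induction I rule: finite_induct) (auto intro: for_multiples_const for_multiples_conj)

lemma for_multiples_dvd: "n > 0 \<Longrightarrow> for_multiples (\<lambda>q. n dvd q)"
  unfolding for_multiples_def by blast

lemma for_multiples_ge: "for_multiples (\<lambda>q. n \<le> q)"
  by (rule for_multiples_mono[OF for_multiples_dvd[of "Suc n"]]) (auto dest: dvd_imp_le)

definition bone_length :: "(nat \<times> nat \<Rightarrow> int list \<Rightarrow> int extended) \<Rightarrow> nat \<times> nat \<Rightarrow> int list \<Rightarrow> nat" where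
  "bone_length l e \<kappa> = (case l e \<kappa> of Fin k \<Rightarrow> nat k | _ \<Rightarrow> 0)"

text \<open>A linear function is infinite everywhere or nowhere, which is why the virtual joints do
  not vary with \<kappa>.\<close>

lemma level0_length_cases:
  assumes "level0_datum m M S l" "e \<in> child_rel S"
  obtains "\<And>\<kappa>. \<kappa> \<in> M \<Longrightarrow> l e \<kappa> = \<infinity>" |
    "\<And>\<kappa>. \<kappa> \<in> M \<Longrightarrow> bone_length l e \<kappa> > 0 \<and> l e \<kappa> = Fin (int (bone_length l e \<kappa>))"
proof -
  have lin: "linear_on m M (l e)" and pos: "\<And>\<kappa>. \<kappa> \<in> M \<Longrightarrow> 0 < l e \<kappa>"
    using assms unfolding level0_datum_def by blast+
  consider "\<And>\<kappa>. \<kappa> \<in> M \<Longrightarrow> l e \<kappa> = \<infinity>" | "\<And>\<kappa>. \<kappa> \<in> M \<Longrightarrow> \<exists>k. l e \<kappa> = Fin k"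
    using lin unfolding linear_on_def by blast
  then show ?thesis
  proof cases
    case 1
    then show ?thesis by (rule that(1))
  next
    case 2
    show ?thesis
    proof (rule that(2))
      fix \<kappa> assume \<kappa>: "\<kappa> \<in> M"
      then obtain k where "l e \<kappa> = Fin k" using 2 by blast
      with pos[OF \<kappa>] show "bone_length l e \<kappa> > 0 \<and> l e \<kappa> = Fin (int (bone_length l e \<kappa>))"
        by (auto simp: bone_length_def zero_extended_def)
    qed
  qed
qed

text \<open>If q is divisible by the denominators of the coefficients, all products \<alpha>_i q are
  integral; the constant term is absorbed by the exponent of p.\<close>

lemma bone_lifts:
  assumes D: "level0_datum m M S l" "e \<in> child_rel S"
  shows "for_multiples (\<lambda>q. (\<exists>\<kappa>\<in>M. l e \<kappa> \<noteq> \<infinity>) \<longrightarrow>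
    (\<exists>\<psi> :: int list \<Rightarrow> 'p :: prime_card assignment \<Rightarrow> 'p padic. modulus.lifts q m M (bone_length l e) \<psi>))"
proof (cases "\<exists>\<kappa>\<in>M. l e \<kappa> \<noteq> \<infinity>")
  case True
  have pos: "\<And>\<kappa>. \<kappa> \<in> M \<Longrightarrow> l e \<kappa> = Fin (int (bone_length l e \<kappa>))"
    by (rule level0_length_cases[OF D]) (use True in auto)
  have "linear_on m M (l e)" using D unfolding level0_datum_def by blast
  then obtain \<alpha> :: "nat \<Rightarrow> rat" and b where
    lin: "\<forall>\<kappa>\<in>M. \<exists>k. l e \<kappa> = Fin k \<and> of_int k = (\<Sum>i<m. \<alpha> i * of_int (\<kappa> ! i)) + b"
    using True unfolding linear_on_def by blast
  have eq: "of_nat (bone_length l e \<kappa>) = (\<Sum>i<m. \<alpha> i * of_int (\<kappa> ! i)) + b" if \<kappa>: "\<kappa> \<in> M" for \<kappa>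
  proof -
    obtain k where k: "l e \<kappa> = Fin k" "of_int k = (\<Sum>i<m. \<alpha> i * of_int (\<kappa> ! i)) + b" using lin \<kappa> by blast
    have "k = int (bone_length l e \<kappa>)" using k(1) pos[OF \<kappa>] by simp
    then show ?thesis using k(2) by simp
  qed
  have "for_multiples (\<lambda>q. \<forall>i\<in>{..<m}. nat (snd (quotient_of (\<alpha> i))) dvd q)"
    by (rule for_multiples_ball[OF _ for_multiples_dvd]) (simp_all add: quotient_of_denom_pos')
  then show ?thesis
  proof (rule for_multiples_mono, intro impI)
    fix q :: nat assume q: "q > 0" and dv: "\<forall>i\<in>{..<m}. nat (snd (quotient_of (\<alpha> i))) dvd q"
    have "\<alpha> i * of_nat q = of_int (fst (quotient_of (\<alpha> i)) * int (q div nat (snd (quotient_of (\<alpha> i)))))"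
      if i: "i < m" for i
    proof -
      define n d where "n = fst (quotient_of (\<alpha> i))" and "d = snd (quotient_of (\<alpha> i))"
      have nd: "\<alpha> i = of_int n / of_int d" by (rule quotient_of_div) (simp add: n_def d_def)
      have d: "d > 0" by (simp add: d_def quotient_of_denom_pos')
      obtain c where c: "q = nat d * c" using dv i by (auto simp: d_def)
      have "of_nat q = (of_int d * of_nat c :: rat)" using d by (simp add: c)
      moreover have "q div nat d = c" using d by (simp add: c)
      ultimately have "\<alpha> i * of_nat q = of_int (n * int (q div nat d))" using d by (simp add: nd)
      then show ?thesis by (simp only: n_def d_def)
    qed
    note int = this
    obtain \<psi> :: "int list \<Rightarrow> 'p assignment \<Rightarrow> 'p padic" where "modulus.lifts q m M (bone_length l e) \<psi>"
      by (rule modulus.lifts_linear[OF modulus.intro[OF q], where M = M and m = m and l = "bone_length l e" and \<alpha> = \<alpha> and b = b,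
          OF eq int]) auto
    then show "\<exists>\<psi> :: int list \<Rightarrow> 'p assignment \<Rightarrow> 'p padic. modulus.lifts q m M (bone_length l e) \<psi>" by blast
  qed
qed (auto simp: for_multiples_def)

definition realizable :: "'p :: prime_card itself \<Rightarrow> nat \<Rightarrow> nat \<Rightarrow> nat \<Rightarrow> int list set \<Rightarrow> (int list \<Rightarrow> 'b rtree) \<Rightarrow> bool" where
  "realizable P q d m M T \<longleftrightarrow>
     (\<exists>X :: int list \<Rightarrow> 'p assignment \<Rightarrow> ('p point \<times> (nat \<Rightarrow> 'b)) set. modulus.realizes q d m M T X)"

context modulus
begin

lemma realizableI: "realizes d m M T X \<Longrightarrow> realizable P q d m M T"
  unfolding realizable_def by (rule exI[where x = X])

lemma lifts_cong:
  assumes "lifts m M l \<theta>" "\<And>\<kappa>. \<kappa> \<in> M \<Longrightarrow> l' \<kappa> = l \<kappa>"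
  shows "lifts m M l' \<theta>"
  using assms unfolding lifts_def by simp

text \<open>The depth of a real joint is the sum of the lengths of the bones above it, so the
  product of their lifts is a lift of the depth.\<close>

lemma skeleton_data:
  assumes len: "\<And>\<kappa>. \<kappa> \<in> M \<Longrightarrow> length \<kappa> = m" and D: "level0_datum m M S l"
    and M: "M \<noteq> {}" and ne: "nodes S \<noteq> {}"
    and lift: "\<And>e. e \<in> child_rel S \<Longrightarrow> \<exists>\<kappa>\<in>M. l e \<kappa> \<noteq> \<infinity> \<Longrightarrow>
      \<exists>\<psi> :: int list \<Rightarrow> 'p assignment \<Rightarrow> 'p padic. lifts m M (bone_length l e) \<psi>"
  obtains jd E par and \<theta> :: "nat \<Rightarrow> int list \<Rightarrow> 'p assignment \<Rightarrow> 'p padic" where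
    "skeleton_family q m M S (tree_root S) (depth S) l jd E par \<theta>"
    "\<And>w \<kappa>. \<kappa> \<in> M \<Longrightarrow> w \<in> real_joints S (\<lambda>e. l e \<kappa>) \<Longrightarrow> lifts m M (\<lambda>\<kappa>. jd \<kappa> w) (\<theta> w)"
proof -
  let ?r = "tree_root S"
  have S: "tree_at S ?r (depth S)" "finite (nodes S)"
    using D rooted_tree_at ne unfolding level0_datum_def by blast+
  have leaf: "snd e \<in> leaves S" if "e \<in> child_rel S" "\<kappa> \<in> M" "l e \<kappa> = \<infinity>" for e \<kappa>
    using D that unfolding level0_datum_def by blast
  have adm: "admissible_lengths S (\<lambda>e. l e \<kappa>)" if \<kappa>: "\<kappa> \<in> M" for \<kappa>
    unfolding admissible_lengths_def
  proof (intro allI impI)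
    fix u v assume uv: "(u, v) \<in> child_rel S"
    show "l (u, v) \<kappa> = \<infinity> \<and> v \<in> leaves S \<or> (\<exists>k>0. l (u, v) \<kappa> = Fin (int k))"
      by (rule level0_length_cases[OF D uv]) (use leaf[OF uv \<kappa>] \<kappa> in auto)
  qed
  have inf: "l e \<kappa>' = \<infinity>" if "e \<in> child_rel S" "\<kappa> \<in> M" "\<kappa>' \<in> M" "l e \<kappa> = \<infinity>" for e \<kappa> \<kappa>'
    by (rule level0_length_cases[OF D that(1)]) (use that in fastforce)+
  have "\<forall>\<kappa>. \<exists>jd. joint_depths S ?r (\<lambda>e. l e \<kappa>) jd"
    using joint_depths_ex[OF S(1)] by blast
  then obtain jd where jd: "\<And>\<kappa>. joint_depths S ?r (\<lambda>e. l e \<kappa>) (jd \<kappa>)"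
    by (simp only: choice_iff) blast
  obtain E where E: "E ?r = {}" "\<And>u v. (u, v) \<in> child_rel S \<Longrightarrow> E v = insert v (E u)"
    "\<And>v. v \<in> nodes S \<Longrightarrow> E v \<subseteq> {u \<in> nodes S. depth S u \<le> depth S v}"
    "\<And>v u. v \<in> nodes S \<Longrightarrow> u \<in> E v \<Longrightarrow> depth S u = depth S v \<Longrightarrow> u = v"
    "\<And>v. v \<in> nodes S \<Longrightarrow> v \<noteq> ?r \<Longrightarrow> v \<in> E v" "\<And>v. v \<in> nodes S \<Longrightarrow> ?r \<notin> E v"
    by (rule ancestor_labels[OF S(1)]) blast
  define par where "par v = (THE u. (u, v) \<in> child_rel S)" for v
  have par: "par v = u" if "(u, v) \<in> child_rel S" for u v
    unfolding par_def using that tree_atD(7)[OF S(1)] by blast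
  define \<psi> where "\<psi> e = (SOME \<psi> :: int list \<Rightarrow> 'p assignment \<Rightarrow> 'p padic. lifts m M (bone_length l e) \<psi>)" for e
  have \<psi>: "lifts m M (bone_length l e) (\<psi> e)" if "e \<in> child_rel S" "\<exists>\<kappa>\<in>M. l e \<kappa> \<noteq> \<infinity>" for e
    unfolding \<psi>_def by (rule someI_ex[OF lift[OF that]])
  \<comment> \<open>Below an infinite bone the value is arbitrary; such a bone ends in a leaf of S,
    so no further joint inherits it.\<close>
  obtain \<theta> where \<theta>: "\<theta> ?r = (\<lambda>_ _. 1)" "\<And>u v. (u, v) \<in> child_rel S \<Longrightarrow> \<theta> v = (\<lambda>\<kappa> a. \<theta> u \<kappa> a * \<psi> (u, v) \<kappa> a)"
    by (rule tree_recursion[OF S(1), of "\<lambda>_ _. 1" "\<lambda>u v f \<kappa> a. f \<kappa> a * \<psi> (u, v) \<kappa> a"]) blast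
  have lifts: "lifts m M (\<lambda>\<kappa>. jd \<kappa> w) (\<theta> w)"
    if "w \<in> nodes S" "\<And>u. (u, w) \<in> child_rel S \<Longrightarrow> \<exists>\<kappa>\<in>M. l (u, w) \<kappa> \<noteq> \<infinity>" for w
    using that
  proof (induction "depth S w" arbitrary: w)
    case 0
    then have "w = ?r" using tree_atD(9)[OF S(1)] by simp
    moreover have "jd \<kappa> ?r = 0" for \<kappa> using jd by (simp add: joint_depths_def)
    ultimately show ?case using lifts_1 by (simp add: \<theta>(1))
  next
    case (Suc n)
    then have "w \<noteq> ?r" using tree_atD(2)[OF S(1)] by auto
    then obtain u where u: "(u, w) \<in> child_rel S" using tree_atD(8)[OF S(1)] Suc.prems(1) by blast
    have un: "u \<in> nodes S" "depth S w = Suc (depth S u)" using tree_atD(3,5)[OF S(1) u] by auto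
    have "u \<notin> leaves S" using u by (auto simp: leaves_def)
    then have "\<exists>\<kappa>\<in>M. l (t, u) \<kappa> \<noteq> \<infinity>" if "(t, u) \<in> child_rel S" for t
      using M leaf[OF that] by force
    then have IH: "lifts m M (\<lambda>\<kappa>. jd \<kappa> u) (\<theta> u)" using Suc.hyps un by simp
    have fin: "\<exists>\<kappa>\<in>M. l (u, w) \<kappa> \<noteq> \<infinity>" by (rule Suc.prems(2)[OF u])
    have "jd \<kappa> w = jd \<kappa> u + bone_length l (u, w) \<kappa>" if \<kappa>: "\<kappa> \<in> M" for \<kappa>
    proof -
      have "l (u, w) \<kappa> = Fin (int (bone_length l (u, w) \<kappa>))"
        by (rule level0_length_cases[OF D u]) (use fin \<kappa> in auto)
      then show ?thesis using jd[of \<kappa>] u unfolding joint_depths_def by blast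
    qed
    then show ?case
      unfolding \<theta>(2)[OF u] by (rule lifts_cong[OF lifts_mult[OF IH \<psi>[OF u fin]]])
  qed
  show ?thesis
  proof (rule that)
    show "skeleton_family q m M S ?r (depth S) l jd E par \<theta>"
    proof
      show "lifts m M (\<lambda>\<kappa>. jd \<kappa> u) (\<theta> u)" if uv: "(u, v) \<in> child_rel S" for u v
      proof (rule lifts)
        show "u \<in> nodes S" using tree_atD(3)[OF S(1) uv] .
        have "u \<notin> leaves S" using uv by (auto simp: leaves_def)
        then show "\<exists>\<kappa>\<in>M. l (t, u) \<kappa> \<noteq> \<infinity>" if "(t, u) \<in> child_rel S" for t
          using M leaf[OF that] by force
      qed
    qed (fact S len adm E par inf | rule jd)+
    show "lifts m M (\<lambda>\<kappa>. jd \<kappa> w) (\<theta> w)" if "\<kappa> \<in> M" "w \<in> real_joints S (\<lambda>e. l e \<kappa>)" for w \<kappa>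
      by (rule lifts) (use that in \<open>auto simp: real_joints_def\<close>)
  qed
qed

lemma realizes_no_rays:
  assumes "\<And>\<kappa>. \<kappa> \<in> M \<Longrightarrow> nodes (T \<kappa>) = {}"
  shows "realizes d m M T (\<lambda>_ _. {})"
  unfolding realizes_def using assms ray_nonempty tame_empty by force

lemma realizable_level0:
  assumes len: "\<And>\<kappa>. \<kappa> \<in> M \<Longrightarrow> length \<kappa> = m" and D: "level0_datum m M S l"
    and lift: "\<And>e. e \<in> child_rel S \<Longrightarrow> \<exists>\<kappa>\<in>M. l e \<kappa> \<noteq> \<infinity> \<Longrightarrow>
      \<exists>\<psi> :: int list \<Rightarrow> 'p assignment \<Rightarrow> 'p padic. lifts m M (bone_length l e) \<psi>"
  shows "realizable P q d m M (\<lambda>\<kappa>. skeleton S (\<lambda>e. l e \<kappa>)) \<and>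
    (\<forall>\<kappa>\<in>M. nodes (skeleton S (\<lambda>e. l e \<kappa>)) \<noteq> {} \<longrightarrow> (\<exists>r D. tree_at (skeleton S (\<lambda>e. l e \<kappa>)) r D))"
\<comment> \<open>The locale for skeletons presupposes a root, so an empty S is treated
  apart.\<close>
proof (cases "M = {} \<or> nodes S = {}")
  case True
  have "child_rel S \<subseteq> nodes S \<times> nodes S" using D unfolding level0_datum_def rooted_tree_def by blast
  then have e: "nodes (skeleton S (\<lambda>e. l e \<kappa>)) = {}" if "\<kappa> \<in> M" for \<kappa>
    using True that by (auto simp: skeleton_simps real_joints_def)
  have "realizes d m M (\<lambda>\<kappa>. skeleton S (\<lambda>e. l e \<kappa>)) (\<lambda>_ _. {})" by (rule realizes_no_rays[OF e])
  then have "realizable P q d m M (\<lambda>\<kappa>. skeleton S (\<lambda>e. l e \<kappa>))" by (rule realizableI)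
  then show ?thesis using e by simp
next
  case False
  then have ne: "M \<noteq> {}" "nodes S \<noteq> {}" by auto
  obtain jd E par and \<theta> :: "nat \<Rightarrow> int list \<Rightarrow> 'p assignment \<Rightarrow> 'p padic" where
    "skeleton_family q m M S (tree_root S) (depth S) l jd E par \<theta>"
    by (rule skeleton_data[OF len D ne lift]) blast
  then interpret sf: skeleton_family P q m M S "tree_root S" "depth S" l jd E par \<theta> .
  have "realizable P q d m M (\<lambda>\<kappa>. skeleton S (\<lambda>e. l e \<kappa>))"
    by (rule realizableI[OF sf.realizes_skeleton])
  then show ?thesis using sf.T0 by blast
qed

end

subsection \<open>Families of side branches\<close>

text \<open>The bound on the depth of leaves is a further condition on q: positions in T(Z_p)
  contain \<tau>, which is divisible by p^K, divided by p to that depth and have to be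
  integral.\<close>

definition realizable_branch :: "'p :: prime_card itself \<Rightarrow> nat \<Rightarrow> nat \<Rightarrow> nat \<Rightarrow> int list set \<Rightarrow> nat rtree \<Rightarrow>
    (nat \<Rightarrow> int list \<Rightarrow> nat rtree) \<Rightarrow> bool" where
  "realizable_branch P q d m N F U \<longleftrightarrow> rooted_tree F \<and> finite (nodes F) \<and> nodes F \<noteq> {} \<and>
     (\<forall>w\<in>leaves F. depth F w \<le> q \<and> (\<forall>\<kappa>\<in>N. rooted_tree (U w \<kappa>) \<and> nodes (U w \<kappa>) \<noteq> {}) \<and> realizable P q d m N (U w))"

context modulus
begin

lemma realizable_branch_shift:
  assumes "realizable_branch P q d m M F U" "\<And>\<kappa>. \<kappa> \<in> N \<Longrightarrow> butlast \<kappa> \<in> M \<and> length \<kappa> = Suc m"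
  shows "realizable_branch P q d (Suc m) N F (\<lambda>w \<kappa>. U w (butlast \<kappa>))"
proof -
  have "realizable P q d (Suc m) N (\<lambda>\<kappa>. U w (butlast \<kappa>))" if "realizable P q d m M (U w)" for w
    using that realizes_shift[OF _ assms(2)] unfolding realizable_def by blast
  then show ?thesis using assms unfolding realizable_branch_def by blast
qed

text \<open>The facts about \<open>branching\<close> that \<open>branched_family\<close> assumes,
  packed into one predicate so that a realization can be chosen for each index.\<close>

definition branch_realized :: "nat \<Rightarrow> nat \<Rightarrow> int list set \<Rightarrow> (int list \<Rightarrow> 'b rtree) \<Rightarrow>
    (int list \<Rightarrow> 'p assignment \<Rightarrow> ('p point \<times> (nat \<Rightarrow> 'b)) set) \<Rightarrow> bool" where
  "branch_realized d m N T B \<longleftrightarrow> tame d (Suc m) N (\<lambda>\<kappa> a. fst ` B \<kappa> a) \<and>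
     (\<forall>\<kappa>\<in>N. tree_at (T \<kappa>) (tree_root (T \<kappa>)) (depth (T \<kappa>))) \<and>
     (\<forall>\<kappa>\<in>N. \<forall>a y \<gamma>. carries (Suc m) \<kappa> a \<and> (y, \<gamma>) \<in> B \<kappa> a \<longrightarrow>
        ray (T \<kappa>) \<gamma> \<and> (\<forall>i. y i \<in> pball (last \<kappa>)) \<and> y 0 \<noteq> 0 \<and> pval (y 0) = last \<kappa>) \<and>
     (\<forall>\<kappa>\<in>N. \<forall>a a' y \<gamma> y' \<gamma>' j. carries (Suc m) \<kappa> a \<and> carries (Suc m) \<kappa> a' \<and> (y, \<gamma>) \<in> B \<kappa> a \<and> (y', \<gamma>') \<in> B \<kappa> a' \<and>
        close m (last \<kappa> + int j) a a' \<longrightarrow> (congr (last \<kappa> + int j) y y' \<longleftrightarrow> \<gamma> j = \<gamma>' j)) \<and>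
     (\<forall>\<kappa>\<in>N. \<forall>a \<gamma> j. carries m \<kappa> a \<and> ray (T \<kappa>) \<gamma> \<longrightarrow>
        (\<exists>s y \<gamma>'. carries (Suc m) \<kappa> (a(m := s)) \<and> (y, \<gamma>') \<in> B \<kappa> (a(m := s)) \<and> \<gamma>' j = \<gamma> j))"

lemma tree_at_canonical: "tree_at T r D \<Longrightarrow> tree_at T (tree_root T) (depth T)"
proof -
  assume T: "tree_at T r D"
  show ?thesis
    using T tree_at_depth[OF T] tree_atD(3,4)[OF T] unfolding tree_at_root[OF T] tree_at_def by auto
qed

lemma branch_realized_ex:
  assumes side: "realizable_branch P q d (Suc m) N F U"
    and N: "\<And>\<kappa>. \<kappa> \<in> N \<Longrightarrow> length \<kappa> = Suc m \<and> last \<kappa> \<ge> 0"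
  shows "\<exists>B. branch_realized d m N (side_branch P F U) B"
proof -
  have F: "rooted_tree F" "finite (nodes F)" "nodes F \<noteq> {}" and
    w: "\<And>w. w \<in> leaves F \<Longrightarrow> depth F w \<le> q"
      "\<And>w \<kappa>. w \<in> leaves F \<Longrightarrow> \<kappa> \<in> N \<Longrightarrow> rooted_tree (U w \<kappa>) \<and> nodes (U w \<kappa>) \<noteq> {}"
      "\<And>w. w \<in> leaves F \<Longrightarrow> realizable P q d (Suc m) N (U w)"
    using side unfolding realizable_branch_def by auto
  note FT = rooted_tree_at[OF F(1,3)]
  obtain E where E: "labelled F (tree_root F) (depth F) E (\<lambda>c. depth F c - 1)" "\<And>v. v \<in> nodes F \<Longrightarrow> E v \<subseteq> nodes F"
    by (rule labelled_self[OF FT]) blast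
  have "\<forall>w\<in>nodes F. \<exists>\<alpha>. path F \<alpha> (depth F w) \<and> \<alpha> (depth F w) = w"
    using path_ex[OF FT] by blast
  then obtain \<alpha> where \<alpha>: "\<forall>w\<in>nodes F. path F (\<alpha> w) (depth F w) \<and> \<alpha> w (depth F w) = w"
    by (simp only: bchoice_iff) blast
  have "\<forall>w\<in>leaves F. \<exists>X :: int list \<Rightarrow> 'p assignment \<Rightarrow> ('p point \<times> (nat \<Rightarrow> nat)) set. realizes d (Suc m) N (U w) X"
    using w(3) unfolding realizable_def by blast
  then obtain X :: "nat \<Rightarrow> int list \<Rightarrow> 'p assignment \<Rightarrow> ('p point \<times> (nat \<Rightarrow> nat)) set"
    where X: "\<forall>w\<in>leaves F. realizes d (Suc m) N (U w) (X w)"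
    by (simp only: bchoice_iff) blast
  interpret br: branching P q d m N F "tree_root F" "depth F" U "\<lambda>w \<kappa>. tree_root (U w \<kappa>)" "\<lambda>w \<kappa>. depth (U w \<kappa>)" E \<alpha> X
  proof
    show "tree_at (U l \<kappa>) (tree_root (U l \<kappa>)) (depth (U l \<kappa>))" if "l \<in> leaves F" "\<kappa> \<in> N" for l \<kappa>
      using w(2)[OF that] rooted_tree_at by blast
  qed (use E F(2) \<alpha> w(1) N X in \<open>auto simp: leaves_def\<close>)
  have "branch_realized d m N (side_branch P F U) br.branch_points"
    unfolding branch_realized_def
  proof (intro conjI ballI allI impI; (elim conjE)?)
    show "tree_at (side_branch P F U \<kappa>) (tree_root (side_branch P F U \<kappa>)) (depth (side_branch P F U \<kappa>))"
      if "\<kappa> \<in> N" for \<kappa>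
      by (rule tree_at_canonical[OF br.tree_at_side_branch[OF that]])
  qed (fact br.branch_points_tame | rule br.branch_points_ray br.branch_points_val br.branch_points_congr
      br.branch_points_dense; assumption)+
  then show ?thesis by blast
qed

end

subsection \<open>Trees of level d + 1\<close>

context modulus
begin

lemma carries_append: "length \<kappa> = m \<Longrightarrow> carries m (\<kappa> @ [k]) a \<longleftrightarrow> carries m \<kappa> a"
  by (simp add: carries_def nth_append)

lemma realizable_branched:
  fixes F :: "nat \<Rightarrow> nat rtree" and U V G
  assumes len: "\<And>\<kappa>. \<kappa> \<in> M \<Longrightarrow> length \<kappa> = m" and D: "level0_datum m M S l"
    and lift: "\<And>e. e \<in> child_rel S \<Longrightarrow> \<exists>\<kappa>\<in>M. l e \<kappa> \<noteq> \<infinity> \<Longrightarrow>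
      \<exists>\<psi> :: int list \<Rightarrow> 'p assignment \<Rightarrow> 'p padic. lifts m M (bone_length l e) \<psi>"
    and \<rho>: "\<rho> > 0" "\<rho> dvd int q"
    and joints: "\<And>w \<kappa>. \<kappa> \<in> M \<Longrightarrow> w \<in> real_joints S (\<lambda>e. l e \<kappa>) \<Longrightarrow> realizable_branch P q d m M (F w) (U w)"
    and bones: "\<And>e \<xi>. e \<in> child_rel S \<Longrightarrow> \<xi> \<in> {0..<\<rho>} \<Longrightarrow>
      realizable_branch P q d (Suc m) (bone_params M \<rho> S l e \<xi>) (G e \<xi>) (V e \<xi>)"
  defines "T \<equiv> branched_tree \<rho> S l (\<lambda>w. side_branch P (F w) (U w)) (\<lambda>e \<xi>. side_branch P (G e \<xi>) (V e \<xi>))"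
  shows "realizable P q (Suc d) m M T \<and> (\<forall>\<kappa>\<in>M. nodes (T \<kappa>) \<noteq> {} \<longrightarrow> (\<exists>r D. tree_at (T \<kappa>) r D))"
proof (cases "M = {} \<or> nodes S = {}")
  case True
  have "child_rel S \<subseteq> nodes S \<times> nodes S" using D unfolding level0_datum_def rooted_tree_def by blast
  then have "nodes (skeleton S (\<lambda>e. l e \<kappa>)) = {}" if "\<kappa> \<in> M" for \<kappa>
    using True that by (auto simp: skeleton_simps real_joints_def)
  then have e: "nodes (T \<kappa>) = {}" if "\<kappa> \<in> M" for \<kappa>
    using that by (simp add: T_def branched_tree_def attach_def Let_def)
  have "realizes (Suc d) m M T (\<lambda>_ _. {})" by (rule realizes_no_rays[OF e])
  then have "realizable P q (Suc d) m M T" by (rule realizableI)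
  then show ?thesis using e by simp
next
  case False
  then obtain \<kappa>0 where \<kappa>0: "\<kappa>0 \<in> M" by blast
  have ne: "M \<noteq> {}" "nodes S \<noteq> {}" using False by auto
  obtain jd E par and \<theta> :: "nat \<Rightarrow> int list \<Rightarrow> 'p assignment \<Rightarrow> 'p padic" where
    sf: "skeleton_family q m M S (tree_root S) (depth S) l jd E par \<theta>"
    and lifts: "\<And>w \<kappa>. \<kappa> \<in> M \<Longrightarrow> w \<in> real_joints S (\<lambda>e. l e \<kappa>) \<Longrightarrow> lifts m M (\<lambda>\<kappa>. jd \<kappa> w) (\<theta> w)"
    by (rule skeleton_data[OF len D ne lift]) (assumption | erule that, blast)+
  interpret sf: skeleton_family P q m M S "tree_root S" "depth S" l jd E par \<theta> by (rule sf)
  define J where "J = real_joints S (\<lambda>e. l e \<kappa>0)"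
  have J: "real_joints S (\<lambda>e. l e \<kappa>) = J" if "\<kappa> \<in> M" for \<kappa>
    using sf.infinite[OF _ \<kappa>0 that] sf.infinite[OF _ that \<kappa>0] unfolding J_def real_joints_def by blast
  have JS: "J \<subseteq> nodes S" by (auto simp: J_def real_joints_def)
  \<comment> \<open>Two forms of membership: by depths of joints, which can be lifted and hence
    defined, and by the length of the bone, which matches the nodes of the skeleton.\<close>
  have bp: "\<kappa> @ [k] \<in> bone_params M \<rho> S l e \<xi> \<longleftrightarrow>
      k mod \<rho> = \<xi> \<and> int (jd \<kappa> (fst e)) < k \<and> (l e \<kappa> = \<infinity> \<or> snd e \<in> J \<and> k < int (jd \<kappa> (snd e)))"
    "\<kappa> @ [k] \<in> bone_params M \<rho> S l e \<xi> \<longleftrightarrow>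
      k mod \<rho> = \<xi> \<and> int (jd \<kappa> (fst e)) < k \<and> Fin (k - int (jd \<kappa> (fst e))) < l e \<kappa>"
    if \<kappa>: "\<kappa> \<in> M" and e: "e \<in> child_rel S" for \<kappa> k e \<xi>
  proof -
    note sk = sf.skel[OF \<kappa>]
    have up: "joint_depth S (\<lambda>e. l e \<kappa>) (fst e) = Fin (int (jd \<kappa> (fst e)))"
      unfolding skel.joint_depth_eq[OF sk] using skel.real_upper[OF sk e] by simp
    have 1: "\<kappa> @ [k] \<in> bone_params M \<rho> S l e \<xi> \<longleftrightarrow>
        k mod \<rho> = \<xi> \<and> int (jd \<kappa> (fst e)) < k \<and> Fin k < joint_depth S (\<lambda>e. l e \<kappa>) (snd e)"
      using \<kappa> by (auto simp: bone_params_def up)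
    have 2: "(Fin k < joint_depth S (\<lambda>e. l e \<kappa>) (snd e) \<longleftrightarrow> l e \<kappa> = \<infinity> \<or> snd e \<in> J \<and> k < int (jd \<kappa> (snd e))) \<and>
      (Fin k < joint_depth S (\<lambda>e. l e \<kappa>) (snd e) \<longleftrightarrow> Fin (k - int (jd \<kappa> (fst e))) < l e \<kappa>)"
    proof (rule skel.length_cases[OF sk e])
      assume inf: "l e \<kappa> = \<infinity>"
      then have "snd e \<notin> real_joints S (\<lambda>e. l e \<kappa>)" using e by (cases e) (auto simp: real_joints_def)
      then show ?thesis using inf by (simp add: skel.joint_depth_eq[OF sk])
    next
      fix n assume n: "l e \<kappa> = Fin (int n)"
      then have "snd e \<in> real_joints S (\<lambda>e. l e \<kappa>)" by (intro skel.real_lower[OF sk e]) simp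
      then show ?thesis using n skel.jd_bone[OF sk e n] J[OF \<kappa>] by (auto simp: skel.joint_depth_eq[OF sk])
    qed
    show "\<kappa> @ [k] \<in> bone_params M \<rho> S l e \<xi> \<longleftrightarrow>
      k mod \<rho> = \<xi> \<and> int (jd \<kappa> (fst e)) < k \<and> (l e \<kappa> = \<infinity> \<or> snd e \<in> J \<and> k < int (jd \<kappa> (snd e)))"
    "\<kappa> @ [k] \<in> bone_params M \<rho> S l e \<xi> \<longleftrightarrow>
      k mod \<rho> = \<xi> \<and> int (jd \<kappa> (fst e)) < k \<and> Fin (k - int (jd \<kappa> (fst e))) < l e \<kappa>"
      unfolding 1 using 2 by blast+
  qed
  define I :: "(nat + (nat \<times> nat) \<times> int) set" where "I = Inl ` J \<union> Inr ` (child_rel S \<times> {0..<\<rho>})"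
  \<comment> \<open>At a joint the additional parameter is forced to be its depth, so joints and
    bones become families of one kind.\<close>
  define N where "N = case_sum (\<lambda>w. (\<lambda>\<kappa>. \<kappa> @ [int (jd \<kappa> w)]) ` M) (\<lambda>(e, \<xi>). bone_params M \<rho> S l e \<xi>)"
  define w :: "nat + (nat \<times> nat) \<times> int \<Rightarrow> nat" where "w = case_sum id (\<lambda>(e, _). snd e)"
  define v :: "nat + (nat \<times> nat) \<times> int \<Rightarrow> int list \<Rightarrow> int \<Rightarrow> skel_node" where
    "v \<iota> \<kappa> k = (case \<iota> of Inl w \<Rightarrow> Joint w | Inr (e, _) \<Rightarrow> Inner e (nat k - jd \<kappa> (fst e)))" for \<iota> \<kappa> k
  define A where "A \<kappa> u = (case u of Joint w \<Rightarrow> side_branch P (F w) (U w) \<kappa>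
     | Inner e i \<Rightarrow> (let \<mu> = int (depth (skeleton S (\<lambda>e. l e \<kappa>)) u) in side_branch P (G e (\<mu> mod \<rho>)) (V e (\<mu> mod \<rho>)) (\<kappa> @ [\<mu>])))" for \<kappa> u
  define TT where "TT = case_sum (\<lambda>w. side_branch P (F w) (\<lambda>x \<kappa>. U w x (butlast \<kappa>))) (\<lambda>(e, \<xi>). side_branch P (G e \<xi>) (V e \<xi>))"
  have IE: "\<iota> \<in> I \<Longrightarrow> (\<And>x. \<iota> = Inl x \<Longrightarrow> x \<in> J \<Longrightarrow> R) \<Longrightarrow>
      (\<And>e \<xi>. \<iota> = Inr (e, \<xi>) \<Longrightarrow> e \<in> child_rel S \<Longrightarrow> \<xi> \<in> {0..<\<rho>} \<Longrightarrow> R) \<Longrightarrow> R" for \<iota> R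
    unfolding I_def by blast
  have NJ: "\<kappa> @ [k] \<in> N (Inl x) \<longleftrightarrow> k = int (jd \<kappa> x)" if "\<kappa> \<in> M" for \<kappa> k x
    using that by (auto simp: N_def)
  have node: "k \<ge> 0 \<and> v \<iota> \<kappa> k \<in> nodes (sf.T0 \<kappa>) \<and> int (skel_depth (jd \<kappa>) (v \<iota> \<kappa> k)) = k \<and>
      skel_labels E (v \<iota> \<kappa> k) = E (w \<iota>)" if \<iota>: "\<iota> \<in> I" and \<kappa>: "\<kappa> \<in> M" "\<kappa> @ [k] \<in> N \<iota>" for \<iota> \<kappa> k
  proof (rule IE[OF \<iota>])
    fix x assume "\<iota> = Inl x" "x \<in> J"
    then show ?thesis
      using NJ[OF \<kappa>(1)] \<kappa>(2) J[OF \<kappa>(1)] by (auto simp: v_def w_def skeleton_simps skel_depth_def skel_labels_def)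
  next
    fix e \<xi> assume e: "\<iota> = Inr (e, \<xi>)" "e \<in> child_rel S"
    have "k mod \<rho> = \<xi>" and k: "int (jd \<kappa> (fst e)) < k" "Fin (k - int (jd \<kappa> (fst e))) < l e \<kappa>"
      using \<kappa>(2) bp(2)[OF \<kappa>(1) e(2)] by (auto simp: N_def e(1))
    define i where "i = nat k - jd \<kappa> (fst e)"
    have i: "k - int (jd \<kappa> (fst e)) = int i" "i > 0" using k(1) by (auto simp: i_def)
    then have "Inner e i \<in> nodes (sf.T0 \<kappa>)" using e(2) k(2) by (cases e) (auto simp: skeleton_simps)
    then show ?thesis using i k(1) by (simp add: v_def w_def e(1) skel_depth_def skel_labels_def flip: i_def)
  qed
  have N_form: "\<exists>\<kappa>\<in>M. \<exists>k\<ge>0. \<kappa>' = \<kappa> @ [k]" if \<iota>: "\<iota> \<in> I" and \<kappa>': "\<kappa>' \<in> N \<iota>" for \<iota> \<kappa>'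
  proof -
    have "\<exists>\<kappa>\<in>M. \<exists>k. \<kappa>' = \<kappa> @ [k]" using \<iota>
      by (rule IE) (use \<kappa>' in \<open>auto simp: N_def bone_params_def\<close>)
    then show ?thesis using node[OF \<iota>] \<kappa>' by blast
  qed
  have N_last: "length \<kappa>' = Suc m \<and> last \<kappa>' \<ge> 0" "butlast \<kappa>' \<in> M \<and> length \<kappa>' = Suc m" if "\<iota> \<in> I" "\<kappa>' \<in> N \<iota>" for \<iota> \<kappa>'
    using N_form[OF that] len by auto
  have "\<exists>B. branch_realized d m (N \<iota>) (TT \<iota>) B" if \<iota>: "\<iota> \<in> I" for \<iota>
  proof (rule IE[OF \<iota>])
    fix x assume x: "\<iota> = Inl x" "x \<in> J"
    have "realizable_branch P q d m M (F x) (U x)" using joints[OF \<kappa>0] x(2) by (simp add: J_def)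
    from realizable_branch_shift[OF this N_last(2)[OF \<iota>]] N_last(1)[OF \<iota>]
    show ?thesis unfolding x(1) by (simp only: TT_def sum.case) (rule branch_realized_ex)
  next
    fix e \<xi> assume e: "\<iota> = Inr (e, \<xi>)" "e \<in> child_rel S" "\<xi> \<in> {0..<\<rho>}"
    have "realizable_branch P q d (Suc m) (N \<iota>) (G e \<xi>) (V e \<xi>)" using bones[OF e(2,3)] by (simp add: N_def e(1))
    from branch_realized_ex[OF this N_last(1)[OF \<iota>]]
    show ?thesis by (simp add: TT_def e(1))
  qed
  then have "\<forall>\<iota>\<in>I. \<exists>B. branch_realized d m (N \<iota>) (TT \<iota>) B" by blast
  then obtain B where B: "\<forall>\<iota>\<in>I. branch_realized d m (N \<iota>) (TT \<iota>) (B \<iota>)" by (simp only: bchoice_iff) blast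
  have TTA: "TT \<iota> (\<kappa> @ [k]) = A \<kappa> (v \<iota> \<kappa> k)" if \<iota>: "\<iota> \<in> I" and \<kappa>: "\<kappa> \<in> M" "\<kappa> @ [k] \<in> N \<iota>" for \<iota> \<kappa> k
  proof (rule IE[OF \<iota>])
    fix x assume "\<iota> = Inl x"
    then show ?thesis by (simp add: TT_def A_def v_def side_branch_def)
  next
    fix e \<xi> assume e: "\<iota> = Inr (e, \<xi>)" "e \<in> child_rel S"
    have \<xi>: "k mod \<rho> = \<xi>" using \<kappa>(2) bp(1)[OF \<kappa>(1) e(2)] by (simp add: N_def e(1))
    have "int (depth (sf.T0 \<kappa>) (v \<iota> \<kappa> k)) = k" using node[OF \<iota> \<kappa>] tree_at_depth[OF sf.T0[OF \<kappa>(1)]] by simp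
    then show ?thesis using \<xi> by (simp add: TT_def A_def v_def e(1))
  qed
  have surj: "\<exists>\<iota>\<in>I. \<exists>k. \<kappa> @ [k] \<in> N \<iota> \<and> v \<iota> \<kappa> k = u" if \<kappa>: "\<kappa> \<in> M" and u: "u \<in> nodes (sf.T0 \<kappa>)" for \<kappa> u
  proof (cases u)
    case (Joint x)
    then have "x \<in> J" using u J[OF \<kappa>] by (auto simp: skeleton_simps)
    then show ?thesis using NJ[OF \<kappa>] by (intro bexI[of _ "Inl x"] exI[of _ "int (jd \<kappa> x)"]) (auto simp: v_def Joint I_def)
  next
    case (Inner e i)
    then have e: "e \<in> child_rel S" "0 < i" "Fin (int i) < l e \<kappa>" using u by (auto simp: skeleton_simps)
    let ?k = "int (jd \<kappa> (fst e) + i)"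
    have "\<kappa> @ [?k] \<in> N (Inr (e, ?k mod \<rho>))" using e bp(2)[OF \<kappa> e(1)] by (simp add: N_def)
    moreover have "Inr (e, ?k mod \<rho>) \<in> I" using e(1) \<rho>(1) unfolding I_def by simp
    moreover have "v (Inr (e, ?k mod \<rho>)) \<kappa> ?k = u" using nat_int[of "jd \<kappa> (fst e) + i"] by (simp add: v_def Inner del: of_nat_add nat_int)
    ultimately show ?thesis by blast
  qed
  have Atree: "tree_at (A \<kappa> u) (tree_root (A \<kappa> u)) (depth (A \<kappa> u))" if \<kappa>: "\<kappa> \<in> M" and u: "u \<in> nodes (sf.T0 \<kappa>)" for \<kappa> u
  proof -
    obtain \<iota> k where i: "\<iota> \<in> I" "\<kappa> @ [k] \<in> N \<iota>" "v \<iota> \<kappa> k = u" using surj[OF \<kappa> u] by blast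
    have "branch_realized d m (N \<iota>) (TT \<iota>) (B \<iota>)" using B i(1) by blast
    then show ?thesis using i(2) TTA[OF i(1) \<kappa> i(2)] unfolding branch_realized_def i(3) by metis
  qed
  have N_dfn: "\<exists>C. dfn C \<and> (\<forall>\<kappa>\<in>M. cls m \<xi> \<kappa> \<longrightarrow> (\<forall>a. carries m \<kappa> a \<and> a m \<in> H \<longrightarrow>
       (\<kappa> @ [\<eta> + int q * pval (a m)] \<in> N \<iota> \<longleftrightarrow> C a)))" if \<iota>: "\<iota> \<in> I" for \<iota> \<xi> \<eta>
  proof -
    \<comment> \<open>In the class of \<eta> the depth represented by a carrier is the valuation of
      \<open>s a\<close>, so membership in N becomes a comparison with lifted depths of
      joints.\<close>
    define s where "s a = p powi \<eta> * a m ^ q" for a :: "'p assignment"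
    have s: "pw s" unfolding s_def by (intro pw_mult pw_powi pw_of_nat pw_power pw_var)
    have sv: "s a \<noteq> 0" "pval (s a) = \<eta> + int q * pval (a m)" if "a m \<in> H" for a
      using H_nonzero[of "a m", OF that] pval_uniformizer[of \<eta>, where 'p = 'p] by (simp_all add: s_def pval_mult pval_power)
    have rep: "\<exists>g. pw g \<and> (\<forall>\<kappa> a. \<kappa> \<in> M \<and> cls m \<xi> \<kappa> \<and> carries m \<kappa> a \<longrightarrow> g a \<noteq> 0 \<and> pval (g a) = int (jd \<kappa> x))"
      if x: "x \<in> J" for x
    proof -
      have l: "lifts m M (\<lambda>\<kappa>. jd \<kappa> x) (\<theta> x)" using lifts[OF \<kappa>0] x by (simp add: J_def)
      obtain g where "pw g" "\<And>\<kappa> a. \<kappa> \<in> M \<Longrightarrow> cls m \<xi> \<kappa> \<Longrightarrow> carries m \<kappa> a \<Longrightarrow> \<theta> x \<kappa> a = g a"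
        by (rule unifE[OF liftsD(1)[OF l], of \<xi>]) blast
      then show ?thesis using liftsD(2,3)[OF l] by (intro exI[of _ g]) force
    qed
    show ?thesis
    proof (rule IE[OF \<iota>])
      fix x assume x: "\<iota> = Inl x" "x \<in> J"
      obtain g where g: "pw g" "\<forall>\<kappa> a. \<kappa> \<in> M \<and> cls m \<xi> \<kappa> \<and> carries m \<kappa> a \<longrightarrow> g a \<noteq> 0 \<and> pval (g a) = int (jd \<kappa> x)"
        using rep[OF x(2)] by blast
      \<comment> \<open>Equality of valuations, written as failure of both strict
        inequalities.\<close>
      let ?C = "\<lambda>a. \<not> (s a \<noteq> 0 \<and> (g a = 0 \<or> pval (s a) < pval (g a))) \<and> \<not> (g a \<noteq> 0 \<and> (s a = 0 \<or> pval (g a) < pval (s a)))"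
      have "dfn ?C" by (intro dfn_conj dfn_neg[OF dfn_val_less] s g(1))
      moreover have "\<kappa> @ [\<eta> + int q * pval (a m)] \<in> N \<iota> \<longleftrightarrow> ?C a"
        if "\<kappa> \<in> M" "cls m \<xi> \<kappa>" "carries m \<kappa> a" "a m \<in> H" for \<kappa> a
      proof -
        have "g a \<noteq> 0 \<and> pval (g a) = int (jd \<kappa> x)" using g(2) that by blast
        then show ?thesis using sv[of a, OF that(4)] NJ[OF that(1)] unfolding x(1) by auto
      qed
      ultimately show ?thesis by blast
    next
      fix e \<xi>' assume e: "\<iota> = Inr (e, \<xi>')" "e \<in> child_rel S"
      have "fst e \<in> J" using skel.real_upper[OF sf.skel[OF \<kappa>0] e(2)] by (simp add: J_def)
      then obtain g where g: "pw g" "\<forall>\<kappa> a. \<kappa> \<in> M \<and> cls m \<xi> \<kappa> \<and> carries m \<kappa> a \<longrightarrow> g a \<noteq> 0 \<and> pval (g a) = int (jd \<kappa> (fst e))"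
        using rep by blast
      \<comment> \<open>As \<rho> divides q, the residue mod \<rho> depends on \<eta> alone, and the
        congruence condition is constant on the class.\<close>
      have md: "(\<eta> + int q * k) mod \<rho> = \<eta> mod \<rho>" for k
        using \<rho>(2) by (auto simp: mod_eq_dvd_iff)
      show ?thesis
      proof (cases "snd e \<in> J")
        case False
        have inf: "l e \<kappa> = \<infinity>" if "\<kappa> \<in> M" for \<kappa>
          using skel.real_lower[OF sf.skel[OF that] e(2)] J[OF that] False by auto
        let ?C = "\<lambda>a. (\<eta> mod \<rho> = \<xi>') \<and> (g a \<noteq> 0 \<and> (s a = 0 \<or> pval (g a) < pval (s a)))"
        have "dfn ?C" by (rule dfn_conj[OF dfn_const dfn_val_less[OF g(1) s]])
        moreover have "\<kappa> @ [\<eta> + int q * pval (a m)] \<in> N \<iota> \<longleftrightarrow> ?C a"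
          if "\<kappa> \<in> M" "cls m \<xi> \<kappa>" "carries m \<kappa> a" "a m \<in> H" for \<kappa> a
        proof -
          have "g a \<noteq> 0 \<and> pval (g a) = int (jd \<kappa> (fst e))" using g(2) that by blast
          then show ?thesis using sv[of a, OF that(4)] inf[OF that(1)] by (simp add: N_def e(1) bp(1)[OF that(1) e(2)] md)
        qed
        ultimately show ?thesis by blast
      next
        case True
        then obtain g' where g': "pw g'" "\<forall>\<kappa> a. \<kappa> \<in> M \<and> cls m \<xi> \<kappa> \<and> carries m \<kappa> a \<longrightarrow> g' a \<noteq> 0 \<and> pval (g' a) = int (jd \<kappa> (snd e))"
          using rep by blast
        have fin: "l e \<kappa> \<noteq> \<infinity>" if "\<kappa> \<in> M" for \<kappa>
          using True J[OF that] e(2) by (cases e) (auto simp: real_joints_def)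
        let ?C = "\<lambda>a. (\<eta> mod \<rho> = \<xi>') \<and> (g a \<noteq> 0 \<and> (s a = 0 \<or> pval (g a) < pval (s a))) \<and>
          (s a \<noteq> 0 \<and> (g' a = 0 \<or> pval (s a) < pval (g' a)))"
        have "dfn ?C" by (rule dfn_conj[OF dfn_const dfn_conj[OF dfn_val_less[OF g(1) s] dfn_val_less[OF s g'(1)]]])
        moreover have "\<kappa> @ [\<eta> + int q * pval (a m)] \<in> N \<iota> \<longleftrightarrow> ?C a"
          if "\<kappa> \<in> M" "cls m \<xi> \<kappa>" "carries m \<kappa> a" "a m \<in> H" for \<kappa> a
        proof -
          have "g a \<noteq> 0 \<and> pval (g a) = int (jd \<kappa> (fst e))" "g' a \<noteq> 0 \<and> pval (g' a) = int (jd \<kappa> (snd e))"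
            using g(2) g'(2) that by blast+
          then show ?thesis using sv[of a, OF that(4)] fin[OF that(1)] True by (simp add: N_def e(1) bp(1)[OF that(1) e(2)] md)
        qed
        ultimately show ?thesis by blast
      qed
    qed
  qed
  interpret bf: branched_family P q m M S "tree_root S" "depth S" l jd E par \<theta> d I N w v A
    "\<lambda>\<kappa> u. tree_root (A \<kappa> u)" "\<lambda>\<kappa> u. depth (A \<kappa> u)" B
  proof
    have "finite J" using sf.S(2) JS finite_subset by blast
    then show "finite I" using sf.finite_bones by (simp add: I_def)
    show "w \<iota> \<in> nodes S" if "\<iota> \<in> I" for \<iota>
      using that by (rule IE) (use JS tree_atD(4)[OF sf.S(1)] in \<open>auto simp: w_def\<close>)
    show "\<iota> = \<iota>'" if "\<iota> \<in> I" "\<iota>' \<in> I" "\<kappa> \<in> M" "\<kappa> @ [k] \<in> N \<iota>" "\<kappa> @ [k] \<in> N \<iota>'" "v \<iota> \<kappa> k = v \<iota>' \<kappa> k" for \<iota> \<iota>' \<kappa> k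
      using that(1)
    proof (rule IE)
      fix x assume "\<iota> = Inl x"
      with that(2) show ?thesis by (rule_tac IE[of \<iota>']) (use that(6) in \<open>auto simp: v_def\<close>)
    next
      fix e \<xi> assume e: "\<iota> = Inr (e, \<xi>)" "e \<in> child_rel S"
      with that(2) show ?thesis
        by (rule_tac IE[of \<iota>']) (use that(4-6) bp(1)[OF that(3)] in \<open>auto simp: v_def N_def\<close>)
    qed
  next
    fix \<iota> \<kappa> k assume i: "\<iota> \<in> I" "\<kappa> \<in> M" "\<kappa> @ [k] \<in> N \<iota>"
    have br: "branch_realized d m (N \<iota>) (TT \<iota>) (B \<iota>)" using B i(1) by blast
    note br' = br[unfolded branch_realized_def, THEN conjunct2, THEN conjunct2]
    show "ray (A \<kappa> (v \<iota> \<kappa> k)) \<gamma>" "(\<forall>i. y i \<in> pball k) \<and> y 0 \<noteq> 0 \<and> pval (y 0) = k"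
      if "carries (Suc m) (\<kappa> @ [k]) a" "(y, \<gamma>) \<in> B \<iota> (\<kappa> @ [k]) a" for a y \<gamma>
      using bspec[OF conjunct1[OF br'] i(3)] that unfolding TTA[OF i] by auto
    show "congr (k + int j) y y' \<longleftrightarrow> \<gamma> j = \<gamma>' j"
      if "carries (Suc m) (\<kappa> @ [k]) a" "carries (Suc m) (\<kappa> @ [k]) a'"
       "(y, \<gamma>) \<in> B \<iota> (\<kappa> @ [k]) a" "(y', \<gamma>') \<in> B \<iota> (\<kappa> @ [k]) a'" "close m (k + int j) a a'" for a a' y \<gamma> y' \<gamma>' j
      using bspec[OF conjunct1[OF conjunct2[OF br']] i(3), rule_format, of a a' y \<gamma> y' \<gamma>' j] that by simp
    show "\<exists>s y \<gamma>'. carries (Suc m) (\<kappa> @ [k]) (a(m := s)) \<and> (y, \<gamma>') \<in> B \<iota> (\<kappa> @ [k]) (a(m := s)) \<and> \<gamma>' j = \<gamma> j"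
      if "carries m \<kappa> a" "ray (A \<kappa> (v \<iota> \<kappa> k)) \<gamma>" for a \<gamma> j
      using bspec[OF conjunct2[OF conjunct2[OF br']] i(3), rule_format, of a \<gamma> j] that carries_append[OF len[OF i(2)]]
      unfolding TTA[OF i] by simp
  next
    show "tame d (Suc m) (N \<iota>) (\<lambda>\<kappa> a. fst ` B \<iota> \<kappa> a)" if "\<iota> \<in> I" for \<iota>
      using B that unfolding branch_realized_def by blast
  qed (fact node surj Atree N_dfn)+
  have T: "T \<kappa> = attach (sf.T0 \<kappa>) (nodes (sf.T0 \<kappa>)) (A \<kappa>)" for \<kappa>
    unfolding T_def branched_tree_def A_def Let_def by (rule refl)
  have "realizable P q (Suc d) m M T"
    using realizableI[OF bf.realizes_attach] unfolding T[abs_def] by simp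
  moreover have "\<exists>r D. tree_at (T \<kappa>) r D" if "\<kappa> \<in> M" for \<kappa>
    unfolding T using tree_at_attach[where A = "A \<kappa>", OF sf.T0[OF that] order.refl Atree[OF that]] by blast
  ultimately show ?thesis by blast
qed

end

section \<open>Dimension of parametrized sets\<close>

text \<open>Gaussian elimination: an equation with a nonzero coefficient is solved for that unknown,
  which is substituted into the other equations.\<close>

lemma homogeneous_system:
  fixes M :: "'j \<Rightarrow> 'b \<Rightarrow> 'k :: field"
  assumes "finite B" "finite J" "card B < card J"
  shows "\<exists>c. (\<exists>j\<in>J. c j \<noteq> 0) \<and> (\<forall>b\<in>B. (\<Sum>j\<in>J. c j * M j b) = 0)"
  using assms
proof (induction B arbitrary: J M rule: finite_induct)
  case empty
  then have "J \<noteq> {}" by auto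
  then show ?case by (intro exI[of _ "\<lambda>_. 1"]) auto
next
  case (insert b B)
  show ?case
  proof (cases "\<forall>j\<in>J. M j b = 0")
    case True
    have "card B < card J" using insert.hyps insert.prems by simp
    from insert.IH[OF insert.prems(1) this, of M] show ?thesis using True by auto
  next
    case False
    then obtain j0 where j0: "j0 \<in> J" "M j0 b \<noteq> 0" by blast
    define J' where "J' = J - {j0}"
    have J': "finite J'" "card B < card J'" "j0 \<notin> J'" "J = insert j0 J'"
      using insert.prems insert.hyps j0(1) by (auto simp: J'_def card_Diff_singleton)
    define M' where "M' j b' = M j b' - M j b / M j0 b * M j0 b'" for j b'
    obtain c where c: "\<exists>j\<in>J'. c j \<noteq> 0" "\<forall>b'\<in>B. (\<Sum>j\<in>J'. c j * M' j b') = 0"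
      using insert.IH[OF J'(1,2), of M'] by blast
    define s where "s = - (\<Sum>j\<in>J'. c j * (M j b / M j0 b))"
    define c' where "c' = c(j0 := s)"
    have sum: "(\<Sum>j\<in>J. c' j * M j b') = s * M j0 b' + (\<Sum>j\<in>J'. c j * M j b')" for b'
    proof -
      have "(\<Sum>j\<in>J. c' j * M j b') = c' j0 * M j0 b' + (\<Sum>j\<in>J'. c' j * M j b')"
        unfolding J'(4) using J'(1,3) by simp
      moreover have "(\<Sum>j\<in>J'. c' j * M j b') = (\<Sum>j\<in>J'. c j * M j b')"
        using J'(3) by (intro sum.cong) (auto simp: c'_def)
      ultimately show ?thesis by (simp add: c'_def)
    qed
    have "(\<Sum>j\<in>J. c' j * M j b) = 0"
      unfolding sum s_def using j0(2) by (simp add: sum_distrib_right mult.assoc)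
    moreover have "(\<Sum>j\<in>J. c' j * M j b') = 0" if "b' \<in> B" for b'
    proof -
      have "(\<Sum>j\<in>J. c' j * M j b') = (\<Sum>j\<in>J'. c j * M' j b')"
        unfolding sum s_def M'_def
        by (simp add: right_diff_distrib sum_subtractf sum_distrib_right mult.assoc)
      then show ?thesis using c(2) that by simp
    qed
    moreover have "\<exists>j\<in>J. c' j \<noteq> 0"
      using c(1) J'(3,4) by (auto simp: c'_def)
    ultimately show ?thesis by (intro exI[of _ c']) auto
  qed
qed

subsection \<open>Algebraic independence along chains of irreducible sets\<close>

text \<open>Degree at most N in each of k variables; \<open>PiE\<close> makes the exponent functions
  extensional, so that they can be counted.\<close>

definition exponents :: "nat \<Rightarrow> nat \<Rightarrow> (nat \<Rightarrow> nat) set" where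
  "exponents k N = PiE {..<k} (\<lambda>_. {..N})"

lemma finite_exponents [simp]: "finite (exponents k N)"
  unfolding exponents_def by (intro finite_PiE) auto

lemma card_exponents: "card (exponents k N) = Suc N ^ k"
  unfolding exponents_def by (simp add: card_PiE)

lemma sum_exponents_Suc:
  "(\<Sum>e\<in>exponents (Suc k) N. F e) = (\<Sum>i\<le>N. \<Sum>e\<in>exponents k N. F (e(k := i)))"
proof -
  have "exponents (Suc k) N = (\<lambda>(i, e). e(k := i)) ` ({..N} \<times> exponents k N)"
    unfolding exponents_def lessThan_Suc by (rule PiE_insert_eq)
  moreover have "inj_on (\<lambda>(i, e). e(k := i)) ({..N} \<times> exponents k N)"
    unfolding exponents_def by (rule inj_combinator) simp
  ultimately have "(\<Sum>e\<in>exponents (Suc k) N. F e) = (\<Sum>(i, e)\<in>{..N} \<times> exponents k N. F (e(k := i)))"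
    by (simp only: sum.reindex) (simp add: comp_def case_prod_beta)
  then show ?thesis by (simp add: sum.cartesian_product)
qed

lemma polynomial_functions_power: "f \<in> polynomial_functions n \<Longrightarrow> (\<lambda>x. f x ^ i) \<in> polynomial_functions n"
  by (induction i) (auto intro: polynomial_functions.intros)

lemma polynomial_functions_sum:
  "(\<And>i. i \<in> A \<Longrightarrow> f i \<in> polynomial_functions n) \<Longrightarrow> (\<lambda>x. \<Sum>i\<in>A. f i x) \<in> polynomial_functions n"
  by (induction A rule: infinite_finite_induct) (auto intro: polynomial_functions.intros)

lemma polynomial_functions_prod:
  "(\<And>i. i \<in> A \<Longrightarrow> f i \<in> polynomial_functions n) \<Longrightarrow> (\<lambda>x. \<Prod>i\<in>A. f i x) \<in> polynomial_functions n"
  by (induction A rule: infinite_finite_induct) (auto intro: polynomial_functions.intros)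

lemma zariski_closed_zeros:
  assumes "zariski_closed n Z" "f \<in> polynomial_functions n"
  shows "zariski_closed n {x \<in> Z. f x = 0}"
proof -
  obtain Q where "Q \<subseteq> polynomial_functions n" "Z = {x. length x = n \<and> (\<forall>f\<in>Q. f x = 0)}"
    using assms(1) unfolding zariski_closed_def by blast
  then show ?thesis
    unfolding zariski_closed_def using assms(2) by (intro exI[of _ "insert f Q"]) auto
qed

text \<open>The zero sets of the two factors are closed and cover Z, so one of them is all of
  Z.\<close>

lemma zariski_irreducible_mult:
  assumes "zariski_irreducible n Z" "f \<in> polynomial_functions n" "g \<in> polynomial_functions n"
    "\<forall>x\<in>Z. f x * g x = 0" "\<not> (\<forall>x\<in>Z. f x = 0)"
  shows "\<forall>x\<in>Z. g x = 0"
proof -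
  have Z: "zariski_closed n Z" using assms(1) by (simp add: zariski_irreducible_def)
  have "Z = {x \<in> Z. f x = 0} \<union> {x \<in> Z. g x = 0}" using assms(4) by auto
  then have "Z = {x \<in> Z. f x = 0} \<or> Z = {x \<in> Z. g x = 0}"
    using assms(1) zariski_closed_zeros[OF Z assms(2)] zariski_closed_zeros[OF Z assms(3)]
    unfolding zariski_irreducible_def by blast
  then show ?thesis using assms(5) by blast
qed

definition alg_independent_on :: "'k :: field list set \<Rightarrow> nat \<Rightarrow> (nat \<Rightarrow> 'k list \<Rightarrow> 'k) \<Rightarrow> bool" where
  "alg_independent_on Z k f \<longleftrightarrow> (\<forall>N c. (\<forall>x\<in>Z. (\<Sum>e\<in>exponents k N. c e * (\<Prod>l<k. f l x ^ e l)) = 0) \<longrightarrow>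
     (\<forall>e\<in>exponents k N. c e = 0))"

text \<open>A function g that vanishes on Z k but not on Z (k + 1) is independent of functions
  independent on Z k: in a relation the lowest power of g is cancelled by irreducibility, and on Z k
  only its coefficient survives.\<close>

lemma chain_alg_independent:
  assumes "\<forall>i\<le>k. zariski_irreducible n (Z i)" "\<forall>i<k. Z i \<subset> Z (Suc i)"
  shows "\<exists>f. (\<forall>l<k. f l \<in> polynomial_functions n) \<and> alg_independent_on (Z k) k f"
  using assms
proof (induction k)
  case 0
  have "Z 0 \<noteq> {}" using 0 by (simp add: zariski_irreducible_def)
  then show ?case by (auto simp: alg_independent_on_def exponents_def)
next
  case (Suc k)
  then obtain f where f: "\<forall>l<k. f l \<in> polynomial_functions n" "alg_independent_on (Z k) k f" by auto
  have irr: "zariski_irreducible n (Z (Suc k))" "zariski_irreducible n (Z k)" and sub: "Z k \<subset> Z (Suc k)"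
    using Suc.prems by auto
  obtain x0 where x0: "x0 \<in> Z (Suc k)" "x0 \<notin> Z k" using sub by blast
  have cl: "zariski_closed n (Z (Suc k))" "zariski_closed n (Z k)"
    using irr by (simp_all add: zariski_irreducible_def)
  obtain Q where Q: "Q \<subseteq> polynomial_functions n" "Z k = {x. length x = n \<and> (\<forall>f\<in>Q. f x = 0)}"
    using cl(2) unfolding zariski_closed_def by (elim exE conjE)
  have "length x0 = n" using cl(1) x0(1) unfolding zariski_closed_def by auto
  then obtain g where g: "g \<in> polynomial_functions n" "g x0 \<noteq> 0" "\<forall>x\<in>Z k. g x = 0"
    using Q x0(2) by auto
  have g_nz: "\<not> (\<forall>x\<in>Z (Suc k). g x ^ i = 0)" for i using g(2) x0(1) by auto
  define f' where "f' = f(k := g)"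
  have "alg_independent_on (Z (Suc k)) (Suc k) f'"
    unfolding alg_independent_on_def
  proof (intro allI impI)
    fix N c assume zero: "\<forall>x\<in>Z (Suc k). (\<Sum>e\<in>exponents (Suc k) N. c e * (\<Prod>l<Suc k. f' l x ^ e l)) = 0"
    define R where "R i x = (\<Sum>e\<in>exponents k N. c (e(k := i)) * (\<Prod>l<k. f l x ^ e l))" for i x
    have R_poly: "R i \<in> polynomial_functions n" for i
      unfolding R_def
      by (intro polynomial_functions_sum polynomial_functions.mult polynomial_functions.const
          polynomial_functions_prod polynomial_functions_power) (use f(1) in auto)
    have sum_R: "(\<Sum>i\<le>N. R i x * g x ^ i) = 0" if "x \<in> Z (Suc k)" for x
    proof -
      have "(\<Prod>l<Suc k. f' l x ^ (e(k := i)) l) = (\<Prod>l<k. f l x ^ e l) * g x ^ i" for e i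
      proof -
        have "(\<Prod>l<k. f' l x ^ (e(k := i)) l) = (\<Prod>l<k. f l x ^ e l)"
          by (intro prod.cong) (auto simp: f'_def)
        then show ?thesis by (simp add: f'_def)
      qed
      then have "(\<Sum>e\<in>exponents (Suc k) N. c e * (\<Prod>l<Suc k. f' l x ^ e l)) = (\<Sum>i\<le>N. R i x * g x ^ i)"
        unfolding sum_exponents_Suc R_def sum_distrib_right by (simp add: mult.assoc)
      then show ?thesis using zero that by simp
    qed
    have R_zero: "\<forall>e\<in>exponents k N. c (e(k := i)) = 0" if "i \<le> N" for i
      using that
    proof (induction i rule: less_induct)
      case (less i)
      define S where "S x = (\<Sum>i'\<in>{i..N}. R i' x * g x ^ (i' - i))" for x
      have S_poly: "S \<in> polynomial_functions n"
        unfolding S_def by (intro polynomial_functions_sum polynomial_functions.mult R_poly polynomial_functions_power g(1))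
      have "g x ^ i * S x = 0" if "x \<in> Z (Suc k)" for x
      proof -
        have "R i' x = 0" if "i' < i" for i'
        proof -
          have "i' \<le> N" using that less.prems by simp
          note z = less.IH[OF that this]
          show ?thesis unfolding R_def
          proof (rule sum.neutral, rule ballI)
            fix e assume "e \<in> exponents k N"
            with z have "c (e(k := i')) = 0" by (rule bspec)
            then show "c (e(k := i')) * (\<Prod>l<k. f l x ^ e l) = 0" by (simp only: mult_zero_left)
          qed
        qed
        then have "(\<Sum>i'\<le>N. R i' x * g x ^ i') = (\<Sum>i'\<in>{i..N}. R i' x * g x ^ i')"
          by (intro sum.mono_neutral_right) auto
        also have "\<dots> = g x ^ i * S x"
          unfolding S_def sum_distrib_left by (intro sum.cong) (auto simp flip: power_add simp: mult.left_commute)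
        finally show ?thesis using sum_R[OF that] by simp
      qed
      then have "\<forall>x\<in>Z (Suc k). S x = 0"
        using zariski_irreducible_mult[OF irr(1) polynomial_functions_power[OF g(1)] S_poly _ g_nz] by blast
      moreover have "S x = R i x" if "x \<in> Z k" for x
      proof -
        have "S x = (\<Sum>i'\<in>{i}. R i' x * g x ^ (i' - i))"
          unfolding S_def using g(3) that less.prems by (intro sum.mono_neutral_right) auto
        then show ?thesis by simp
      qed
      ultimately have "\<forall>x\<in>Z k. R i x = 0" using sub by fastforce
      then show ?case using f(2) unfolding alg_independent_on_def R_def by (elim allE[of _ N] allE[of _ "\<lambda>e. c (e(k := i))"]) (simp del: fun_upd_apply)
    qed
    have "exponents (Suc k) N = (\<lambda>(i, e). e(k := i)) ` ({..N} \<times> exponents k N)"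
      unfolding exponents_def lessThan_Suc by (rule PiE_insert_eq)
    then show "\<forall>e\<in>exponents (Suc k) N. c e = 0" using R_zero by (auto simp del: fun_upd_apply)
  qed
  moreover have "\<forall>l<Suc k. f' l \<in> polynomial_functions n"
    using f(1) g(1) by (auto simp: f'_def less_Suc_eq)
  ultimately show ?case by blast
qed

subsection \<open>Functions of bounded degree\<close>

definition mono_fun :: "nat \<Rightarrow> (nat \<Rightarrow> nat) \<Rightarrow> (nat \<Rightarrow> 'k :: field) \<Rightarrow> 'k" where
  "mono_fun d e a = (\<Prod>i<d. a i ^ e i)"

text \<open>Polynomial functions of degree at most N in each of d variables, built up by monomials
  so that coefficients can be read off.\<close>

inductive_set bdeg :: "nat \<Rightarrow> nat \<Rightarrow> ((nat \<Rightarrow> 'k :: field) \<Rightarrow> 'k) set" for d N where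
  zero: "(\<lambda>_. 0) \<in> bdeg d N"
| add: "(\<forall>i<d. e i \<le> N) \<Longrightarrow> f \<in> bdeg d N \<Longrightarrow> (\<lambda>a. c * mono_fun d e a + f a) \<in> bdeg d N"

lemma bdeg_mono: "f \<in> bdeg d N \<Longrightarrow> N \<le> N' \<Longrightarrow> f \<in> bdeg d N'"
  by (induction rule: bdeg.induct) (auto intro!: bdeg.zero bdeg.add intro: order.trans)

lemma bdeg_add: "f \<in> bdeg d N \<Longrightarrow> g \<in> bdeg d N \<Longrightarrow> (\<lambda>a. f a + g a) \<in> bdeg d N"
proof (induction rule: bdeg.induct)
  case (add e f c)
  then show ?case using bdeg.add[of d e N "\<lambda>a. f a + g a" c] by (simp add: add.assoc)
qed simp

lemma bdeg_monomial: "(\<forall>i<d. e i \<le> N) \<Longrightarrow> (\<lambda>a. c * mono_fun d e a) \<in> bdeg d N"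
  using bdeg.add[OF _ bdeg.zero, of d e N c] by simp

lemma bdeg_const: "(\<lambda>_. c) \<in> bdeg d N"
  using bdeg_monomial[of d "\<lambda>_. 0" N c] by (simp add: mono_fun_def)

lemma bdeg_var: "i < d \<Longrightarrow> (\<lambda>a. a i) \<in> bdeg d 1"
proof -
  assume i: "i < d"
  have eq: "(\<lambda>a :: nat \<Rightarrow> 'a. 1 * mono_fun d (\<lambda>j. if j = i then 1 else 0) a) = (\<lambda>a. a i)"
  proof
    fix a :: "nat \<Rightarrow> 'a"
    have "mono_fun d (\<lambda>j. if j = i then 1 else 0) a = (\<Prod>j<d. if j = i then a j else 1)"
      unfolding mono_fun_def by (intro prod.cong) auto
    then show "1 * mono_fun d (\<lambda>j. if j = i then 1 else 0) a = a i" using i by simp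
  qed
  have "(\<lambda>a :: nat \<Rightarrow> 'a. 1 * mono_fun d (\<lambda>j. if j = i then 1 else 0) a) \<in> bdeg d 1"
    by (rule bdeg_monomial) simp
  then show ?thesis unfolding eq .
qed

lemma bdeg_mult: "f \<in> bdeg d N \<Longrightarrow> g \<in> bdeg d N' \<Longrightarrow> (\<lambda>a. f a * g a) \<in> bdeg d (N + N')"
proof (induction rule: bdeg.induct)
  case zero
  show ?case by (simp add: bdeg.zero)
next
  case (add e f c)
  have "(\<lambda>a. c * mono_fun d e a * g a) \<in> bdeg d (N + N')"
    using add.prems
  proof (induction rule: bdeg.induct)
    case zero
    show ?case by (simp add: bdeg.zero)
  next
    case (add e' g c')
    have "mono_fun d e a * mono_fun d e' a = mono_fun d (\<lambda>i. e i + e' i) a" for a :: "nat \<Rightarrow> 'a"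
      by (simp add: mono_fun_def power_add prod.distrib)
    then have "c * mono_fun d e a * (c' * mono_fun d e' a + g a) =
        c * c' * mono_fun d (\<lambda>i. e i + e' i) a + c * mono_fun d e a * g a" for a
      by (simp add: algebra_simps)
    then show ?case
      using add \<open>\<forall>i<d. e i \<le> N\<close> bdeg.add[of d "\<lambda>i. e i + e' i" "N + N'"] by (simp add: add_mono)
  qed
  then show ?case using bdeg_add add.IH[OF add.prems] by (simp add: distrib_right)
qed

lemma bdeg_power: "f \<in> bdeg d N \<Longrightarrow> (\<lambda>a. f a ^ i) \<in> bdeg d (i * N)"
  by (induction i) (auto simp: bdeg_const intro: bdeg_mult)

lemma bdeg_prod:
  assumes "finite A" "\<And>i. i \<in> A \<Longrightarrow> f i \<in> bdeg d N"
  shows "(\<lambda>a. \<Prod>i\<in>A. f i a) \<in> bdeg d (card A * N)"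
  using assms by (induction A rule: finite_induct) (auto simp: bdeg_const intro: bdeg_mult)

lemma bdeg_coeffs:
  assumes "f \<in> bdeg d N"
  shows "\<exists>c. \<forall>a. f a = (\<Sum>e\<in>exponents d N. c e * mono_fun d e a)"
  using assms
proof (induction rule: bdeg.induct)
  case zero
  show ?case by (intro exI[of _ "\<lambda>_. 0"]) simp
next
  case (add e f c)
  then obtain c' where c': "\<forall>a. f a = (\<Sum>e\<in>exponents d N. c' e * mono_fun d e a)" by blast
  \<comment> \<open>Exponents from d on are forgotten, which gives an extensional function with the
    same monomial.\<close>
  define e0 where "e0 = restrict e {..<d}"
  have e0: "e0 \<in> exponents d N" "mono_fun d e0 a = mono_fun d e a" for a :: "nat \<Rightarrow> 'a"
    using add.hyps(1) by (auto simp: e0_def exponents_def mono_fun_def)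
  have "(\<Sum>e\<in>exponents d N. (if e = e0 then c else 0) * mono_fun d e a) = c * mono_fun d e a" for a
    using e0 by (subst sum.cong[OF refl, of _ _ "\<lambda>e. if e = e0 then c * mono_fun d e a else 0"]) auto
  then have "c * mono_fun d e a + f a = (\<Sum>e\<in>exponents d N. ((if e = e0 then c else 0) + c' e) * mono_fun d e a)" for a
    using c' by (simp add: distrib_right sum.distrib)
  then show ?case by (intro exI[of _ "\<lambda>e. (if e = e0 then c else 0) + c' e"] allI)
qed

text \<open>Passage to the algebraic closure, over which dimension is defined; variables from d on
  are 0 and drop out.\<close>

lemma bdeg_term:
  assumes "trm t"
  obtains N g where "g \<in> bdeg d N"
    "\<And>a :: 'p :: prime_card assignment. (\<forall>k\<ge>d. a k = 0) \<Longrightarrow> to_ac (t a) = g (\<lambda>i. to_ac (a i))"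
proof -
  have "\<exists>N. \<exists>g\<in>bdeg d N. \<forall>a :: 'p assignment. (\<forall>k\<ge>d. a k = 0) \<longrightarrow> to_ac (eval_field a s) = g (\<lambda>i. to_ac (a i))" for s
  proof (induction s)
    case (FVar i)
    show ?case
    proof (cases "i < d")
      case True
      then show ?thesis by (intro exI[of _ 1] bexI[OF _ bdeg_var]) auto
    next
      case False
      then show ?thesis by (intro exI[of _ 1] bexI[OF _ bdeg_const[of 0]]) auto
    qed
  next
    case FZero
    show ?case by (intro exI[of _ 1] bexI[OF _ bdeg_const[of 0]]) auto
  next
    case FOne
    show ?case by (intro exI[of _ 1] bexI[OF _ bdeg_const[of 1]]) auto
  next
    case (FAdd s t)
    then obtain N g N' g' where g: "g \<in> bdeg d N" "g' \<in> bdeg d N'"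
      "\<forall>a :: 'p assignment. (\<forall>k\<ge>d. a k = 0) \<longrightarrow> to_ac (eval_field a s) = g (\<lambda>i. to_ac (a i))"
      "\<forall>a :: 'p assignment. (\<forall>k\<ge>d. a k = 0) \<longrightarrow> to_ac (eval_field a t) = g' (\<lambda>i. to_ac (a i))" by blast
    have "(\<lambda>a. g a + g' a) \<in> bdeg d (N + N')"
      by (rule bdeg_add[OF bdeg_mono[OF g(1)] bdeg_mono[OF g(2)]]) auto
    then show ?case using g(3,4) by (intro exI bexI[of _ "\<lambda>a. g a + g' a"]) auto
  next
    case (FNeg s)
    then obtain N g where g: "g \<in> bdeg d N"
      "\<forall>a :: 'p assignment. (\<forall>k\<ge>d. a k = 0) \<longrightarrow> to_ac (eval_field a s) = g (\<lambda>i. to_ac (a i))" by blast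
    have "(\<lambda>a. (- 1) * g a) \<in> bdeg d (0 + N)" by (rule bdeg_mult[OF bdeg_const g(1)])
    then show ?case using g(2) by (intro exI bexI[of _ "\<lambda>a. (- 1) * g a"]) auto
  next
    case (FMult s t)
    then obtain N g N' g' where g: "g \<in> bdeg d N" "g' \<in> bdeg d N'"
      "\<forall>a :: 'p assignment. (\<forall>k\<ge>d. a k = 0) \<longrightarrow> to_ac (eval_field a s) = g (\<lambda>i. to_ac (a i))"
      "\<forall>a :: 'p assignment. (\<forall>k\<ge>d. a k = 0) \<longrightarrow> to_ac (eval_field a t) = g' (\<lambda>i. to_ac (a i))" by blast
    have "(\<lambda>a. g a * g' a) \<in> bdeg d (N + N')" by (rule bdeg_mult[OF g(1,2)])
    then show ?case using g(3,4) by (intro exI bexI[of _ "\<lambda>a. g a * g' a"]) auto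
  qed
  moreover obtain s where s: "\<And>a :: 'p assignment. eval_field a s = t a" using assms by (rule trmE) blast
  ultimately obtain N g where g: "g \<in> bdeg d N"
    "\<forall>a :: 'p assignment. (\<forall>k\<ge>d. a k = 0) \<longrightarrow> to_ac (eval_field a s) = g (\<lambda>i. to_ac (a i))" by blast
  show ?thesis by (rule that[OF g(1)]) (use g(2) s in auto)
qed

text \<open>A polynomial in the quotients \<open>f j / g j\<close> becomes a polynomial in the parameters after
  multiplication with a power of the product \<open>Q\<close> of the denominators.\<close>

lemma bdeg_polynomial_function:
  fixes f g :: "nat \<Rightarrow> (nat \<Rightarrow> 'k :: field) \<Rightarrow> 'k"
  assumes "u \<in> polynomial_functions n" and fg: "\<And>j. j < n \<Longrightarrow> f j \<in> bdeg d N0 \<and> g j \<in> bdeg d N0"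
  defines "Q \<equiv> \<lambda>a. \<Prod>j<n. g j a"
  shows "\<exists>m N. \<exists>w\<in>bdeg d N. \<forall>a. Q a \<noteq> 0 \<longrightarrow> u (map (\<lambda>j. f j a / g j a) [0..<n]) * Q a ^ m = w a"
proof -
  let ?x = "\<lambda>a. map (\<lambda>j. f j a / g j a) [0..<n]"
  have Q: "Q \<in> bdeg d (n * N0)"
    using bdeg_prod[of "{..<n}" g d N0] fg by (simp add: Q_def)
  show ?thesis using assms(1)
  proof (induction rule: polynomial_functions.induct)
    case (const c)
    show ?case by (rule exI[of _ 0], rule exI[of _ 0], rule bexI[OF _ bdeg_const[of c]]) simp
  next
    case (coord i)
    define Q' where "Q' a = (\<Prod>j\<in>{..<n} - {i}. g j a)" for a
    have "Q' \<in> bdeg d (card ({..<n} - {i}) * N0)"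
      unfolding Q'_def using fg by (intro bdeg_prod) auto
    then have "(\<lambda>a. f i a * Q' a) \<in> bdeg d (N0 + card ({..<n} - {i}) * N0)"
      using fg coord by (intro bdeg_mult) auto
    moreover have "?x a ! i * Q a ^ 1 = f i a * Q' a" if "Q a \<noteq> 0" for a
    proof -
      have "Q a = g i a * Q' a" unfolding Q_def Q'_def using coord by (intro prod.remove) auto
      then show ?thesis using coord that by simp
    qed
    ultimately show ?case
      by (intro exI[of _ 1] exI[of _ "N0 + card ({..<n} - {i}) * N0"] bexI[of _ "\<lambda>a. f i a * Q' a"]) auto
  next
    case (add u v)
    then obtain m N w m' N' w' where w: "w \<in> bdeg d N" "\<forall>a. Q a \<noteq> 0 \<longrightarrow> u (?x a) * Q a ^ m = w a"
      and w': "w' \<in> bdeg d N'" "\<forall>a. Q a \<noteq> 0 \<longrightarrow> v (?x a) * Q a ^ m' = w' a" by blast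
    have "(\<lambda>a. w a * Q a ^ m' + w' a * Q a ^ m) \<in> bdeg d (N + m' * (n * N0) + (N' + m * (n * N0)))"
      by (intro bdeg_add bdeg_mono[OF bdeg_mult[OF w(1) bdeg_power[OF Q]]]
          bdeg_mono[OF bdeg_mult[OF w'(1) bdeg_power[OF Q]]]) auto
    moreover have "(u (?x a) + v (?x a)) * Q a ^ (m + m') = w a * Q a ^ m' + w' a * Q a ^ m" if "Q a \<noteq> 0" for a
      by (simp add: power_add algebra_simps flip: w(2)[rule_format, OF that] w'(2)[rule_format, OF that])
    ultimately show ?case
      by (intro exI[of _ "m + m'"] exI bexI[of _ "\<lambda>a. w a * Q a ^ m' + w' a * Q a ^ m"]) auto
  next
    case (mult u v)
    then obtain m N w m' N' w' where w: "w \<in> bdeg d N" "\<forall>a. Q a \<noteq> 0 \<longrightarrow> u (?x a) * Q a ^ m = w a"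
      and w': "w' \<in> bdeg d N'" "\<forall>a. Q a \<noteq> 0 \<longrightarrow> v (?x a) * Q a ^ m' = w' a" by blast
    have "(\<lambda>a. w a * w' a) \<in> bdeg d (N + N')" by (rule bdeg_mult[OF w(1) w'(1)])
    moreover have "(u (?x a) * v (?x a)) * Q a ^ (m + m') = w a * w' a" if "Q a \<noteq> 0" for a
      by (simp add: power_add algebra_simps flip: w(2)[rule_format, OF that] w'(2)[rule_format, OF that])
    ultimately show ?case
      by (intro exI[of _ "m + m'"] exI[of _ "N + N'"] bexI[of _ "\<lambda>a. w a * w' a"]) auto
  qed
qed

text \<open>The point is uniformity in N: one denominator Q^(m N) clears all monomials of degree at
  most N, and the degree that results is linear in N.\<close>

lemma bdeg_monomials_in_polynomials:
  fixes f g :: "nat \<Rightarrow> (nat \<Rightarrow> 'k :: field) \<Rightarrow> 'k"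
  assumes u: "\<And>l. l < k \<Longrightarrow> u l \<in> polynomial_functions n"
    and fg: "\<And>j. j < n \<Longrightarrow> f j \<in> bdeg d N0 \<and> g j \<in> bdeg d N0"
  defines "Q \<equiv> \<lambda>a. \<Prod>j<n. g j a"
  shows "\<exists>m C. \<forall>N. \<forall>e\<in>exponents k N. \<exists>w\<in>bdeg d (C * N). \<forall>a. Q a \<noteq> 0 \<longrightarrow>
     (\<Prod>l<k. u l (map (\<lambda>j. f j a / g j a) [0..<n]) ^ e l) * Q a ^ (m * N) = w a"
proof -
  let ?x = "\<lambda>a. map (\<lambda>j. f j a / g j a) [0..<n]"
  have Q: "Q \<in> bdeg d (n * N0)"
    using bdeg_prod[of "{..<n}" g d N0] fg by (simp add: Q_def)
  have "\<forall>l\<in>{..<k}. \<exists>m N w. w \<in> bdeg d N \<and> (\<forall>a. Q a \<noteq> 0 \<longrightarrow> u l (?x a) * Q a ^ m = w a)"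
  proof
    fix l assume "l \<in> {..<k}"
    then have "u l \<in> polynomial_functions n" using u by simp
    then have "\<exists>m N. \<exists>w\<in>bdeg d N. \<forall>a. (\<Prod>j<n. g j a) \<noteq> 0 \<longrightarrow> u l (?x a) * (\<Prod>j<n. g j a) ^ m = w a"
      by (rule bdeg_polynomial_function) (rule fg)
    then show "\<exists>m N w. w \<in> bdeg d N \<and> (\<forall>a. Q a \<noteq> 0 \<longrightarrow> u l (?x a) * Q a ^ m = w a)" unfolding Q_def by blast
  qed
  then obtain m N w where w: "\<forall>l\<in>{..<k}. w l \<in> bdeg d (N l) \<and> (\<forall>a. Q a \<noteq> 0 \<longrightarrow> u l (?x a) * Q a ^ m l = w l a)"
    by (simp only: bchoice_iff) blast
  define C where "C l = N l + m l * (n * N0)" for l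
  show ?thesis
  proof (rule exI[of _ "\<Sum>l<k. m l"], rule exI[of _ "\<Sum>l<k. C l"], intro allI ballI)
    fix D e assume e: "e \<in> exponents k D"
    have eD: "e l \<le> D" if "l < k" for l using e that by (auto simp: exponents_def PiE_iff)
    \<comment> \<open>The second factor pads every monomial to the same power of Q.\<close>
    define v where "v l a = w l a ^ e l * (Q a ^ m l) ^ (D - e l)" for l a
    have v: "v l \<in> bdeg d (D * C l)" if "l < k" for l
    proof -
      have "v l \<in> bdeg d (e l * N l + (D - e l) * (m l * (n * N0)))"
        unfolding v_def using w that Q by (intro bdeg_mult bdeg_power) auto
      moreover have "e l * N l + (D - e l) * (m l * (n * N0)) \<le> D * C l"
        unfolding C_def distrib_left using eD[OF that] by (intro add_mono mult_right_mono) auto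
      ultimately show ?thesis by (rule bdeg_mono)
    qed
    have "(\<lambda>a. \<Prod>l<i. v l a) \<in> bdeg d ((\<Sum>l<i. C l) * D)" if "i \<le> k" for i
      using that
    proof (induction i)
      case 0
      show ?case by (simp add: bdeg_const)
    next
      case (Suc i)
      then have "(\<lambda>a. (\<Prod>l<i. v l a) * v i a) \<in> bdeg d ((\<Sum>l<i. C l) * D + D * C i)"
        by (intro bdeg_mult v) auto
      then show ?case by (simp add: algebra_simps)
    qed
    then have "(\<lambda>a. \<Prod>l<k. v l a) \<in> bdeg d ((\<Sum>l<k. C l) * D)" by simp
    moreover have "(\<Prod>l<k. u l (?x a) ^ e l) * Q a ^ ((\<Sum>l<k. m l) * D) = (\<Prod>l<k. v l a)" if "Q a \<noteq> 0" for a
    proof -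
      have "v l a = u l (?x a) ^ e l * Q a ^ (m l * D)" if "l < k" for l
      proof -
        have "w l a = u l (?x a) * Q a ^ m l" using w that \<open>Q a \<noteq> 0\<close> by simp
        then have "v l a = u l (?x a) ^ e l * ((Q a ^ m l) ^ e l * (Q a ^ m l) ^ (D - e l))"
          by (simp add: v_def power_mult_distrib)
        also have "(Q a ^ m l) ^ e l * (Q a ^ m l) ^ (D - e l) = Q a ^ (m l * D)"
          using eD[OF that] by (simp flip: power_add power_mult distrib_left)
        finally show ?thesis .
      qed
      then have "(\<Prod>l<k. v l a) = (\<Prod>l<k. u l (?x a) ^ e l * Q a ^ (m l * D))" by (intro prod.cong) auto
      also have "\<dots> = (\<Prod>l<k. u l (?x a) ^ e l) * Q a ^ (\<Sum>l<k. m l * D)"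
        by (simp add: prod.distrib power_sum)
      finally show ?thesis by (simp add: sum_distrib_right)
    qed
    ultimately show "\<exists>w\<in>bdeg d ((\<Sum>l<k. C l) * D). \<forall>a. Q a \<noteq> 0 \<longrightarrow>
        (\<Prod>l<k. u l (?x a) ^ e l) * Q a ^ ((\<Sum>l<k. m l) * D) = w a" by (intro bexI[of _ "\<lambda>a. \<Prod>l<k. v l a"]) auto
  qed
qed

text \<open>A chain of length d + 1 gives d + 1 independent functions, with (N + 1)^(d+1) monomials.
  On each of finitely many pieces these pull back, up to a denominator, to combinations of (C N +
  1)^d monomials in the parameters. For large N a nontrivial combination vanishes on X, hence on its
  closure, against independence.\<close>

theorem dim_le_parametrized:
  fixes X :: "'p :: prime_card padic list set"
    and I :: "(nat \<Rightarrow> ('p assignment \<Rightarrow> 'p padic) \<times> ('p assignment \<Rightarrow> 'p padic)) set"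
  assumes I: "finite I" "\<And>R j. R \<in> I \<Longrightarrow> j < n \<Longrightarrow> trm (fst (R j)) \<and> trm (snd (R j))"
    and X: "\<And>x. x \<in> X \<Longrightarrow> \<exists>R\<in>I. \<exists>a. (\<forall>i\<ge>d. a i = 0) \<and> (\<forall>j<n. snd (R j) a \<noteq> 0) \<and>
        x = map (\<lambda>j. fst (R j) a / snd (R j) a) [0..<n]"
  shows "dim_le n X d"
  unfolding dim_le_def alg_dim_le_def
proof (intro allI impI, elim conjE)
  fix k and Z :: "nat \<Rightarrow> 'p padic alg_closure list set"
  assume Z1: "\<forall>i\<le>k. zariski_irreducible n (Z i) \<and> Z i \<subseteq> zariski_closed n hull map to_ac ` X"
    and Z2: "\<forall>i<k. Z i \<subset> Z (Suc i)"
  show "k \<le> d"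
  proof (rule ccontr)
    assume "\<not> k \<le> d"
    then have k: "Suc d \<le> k" by simp
    let ?k = "Suc d"
    have "\<exists>f. (\<forall>l<?k. f l \<in> polynomial_functions n) \<and> alg_independent_on (Z ?k) ?k f"
      using Z1 Z2 k by (intro chain_alg_independent) auto
    then obtain u where u: "\<And>l. l < ?k \<Longrightarrow> u l \<in> polynomial_functions n" and ind: "alg_independent_on (Z ?k) ?k u" by auto
    \<comment> \<open>Collects the choices for one piece R: numerators and denominators over the
      algebraic closure, and constants m and C that are good for all N at once.\<close>
    define A where "A R fg m C \<longleftrightarrow> (\<forall>j<n. \<forall>a. (\<forall>i\<ge>d. a i = 0) \<longrightarrow>
          to_ac (fst (R j) a) = fst (fg j) (\<lambda>i. to_ac (a i)) \<and> to_ac (snd (R j) a) = snd (fg j) (\<lambda>i. to_ac (a i))) \<and>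
        (\<forall>N. \<forall>e\<in>exponents ?k N. \<exists>w\<in>bdeg d (C * N). \<forall>a. (\<Prod>j<n. snd (fg j) a) \<noteq> 0 \<longrightarrow>
          (\<Prod>l<?k. u l (map (\<lambda>j. fst (fg j) a / snd (fg j) a) [0..<n]) ^ e l) * (\<Prod>j<n. snd (fg j) a) ^ (m * N) = w a)"
      for R :: "nat \<Rightarrow> ('p assignment \<Rightarrow> 'p padic) \<times> ('p assignment \<Rightarrow> 'p padic)"
        and fg :: "nat \<Rightarrow> ((nat \<Rightarrow> 'p padic alg_closure) \<Rightarrow> 'p padic alg_closure) \<times> ((nat \<Rightarrow> 'p padic alg_closure) \<Rightarrow> 'p padic alg_closure)"
        and m C :: nat
    have "\<exists>fg m C. A R fg m C" if R: "R \<in> I" for R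
    proof -
      have "\<forall>j\<in>{..<n}. \<exists>N fg. fst fg \<in> bdeg d N \<and> snd fg \<in> bdeg d N \<and> (\<forall>a. (\<forall>i\<ge>d. a i = 0) \<longrightarrow>
          to_ac (fst (R j) a) = fst fg (\<lambda>i. to_ac (a i)) \<and> to_ac (snd (R j) a) = snd fg (\<lambda>i. to_ac (a i)))"
      proof
        fix j assume "j \<in> {..<n}"
        then have t: "trm (fst (R j))" "trm (snd (R j))" using I(2)[OF R] by auto
        obtain N f where f: "f \<in> bdeg d N" "\<And>a. (\<forall>i\<ge>d. a i = 0) \<Longrightarrow> to_ac (fst (R j) a) = f (\<lambda>i. to_ac (a i))"
          by (rule bdeg_term[OF t(1), of d]) blast
        obtain N' g where g: "g \<in> bdeg d N'" "\<And>a. (\<forall>i\<ge>d. a i = 0) \<Longrightarrow> to_ac (snd (R j) a) = g (\<lambda>i. to_ac (a i))"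
          by (rule bdeg_term[OF t(2), of d]) blast
        show "\<exists>N fg. fst fg \<in> bdeg d N \<and> snd fg \<in> bdeg d N \<and> (\<forall>a. (\<forall>i\<ge>d. a i = 0) \<longrightarrow>
          to_ac (fst (R j) a) = fst fg (\<lambda>i. to_ac (a i)) \<and> to_ac (snd (R j) a) = snd fg (\<lambda>i. to_ac (a i)))"
          using bdeg_mono[OF f(1), of "N + N'"] bdeg_mono[OF g(1), of "N + N'"] f(2) g(2)
          by (intro exI[of _ "N + N'"] exI[of _ "(f, g)"]) simp
      qed
      then obtain N fg where fg: "\<forall>j\<in>{..<n}. fst (fg j) \<in> bdeg d (N j) \<and> snd (fg j) \<in> bdeg d (N j) \<and> (\<forall>a. (\<forall>i\<ge>d. a i = 0) \<longrightarrow>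
          to_ac (fst (R j) a) = fst (fg j) (\<lambda>i. to_ac (a i)) \<and> to_ac (snd (R j) a) = snd (fg j) (\<lambda>i. to_ac (a i)))"
        by (simp only: bchoice_iff) blast
      have "fst (fg j) \<in> bdeg d (\<Sum>j<n. N j) \<and> snd (fg j) \<in> bdeg d (\<Sum>j<n. N j)" if "j < n" for j
      proof -
        have "N j \<le> (\<Sum>j<n. N j)" using that by (intro member_le_sum) auto
        then show ?thesis using fg that bdeg_mono by blast
      qed
      from bdeg_monomials_in_polynomials[of ?k u n "\<lambda>j. fst (fg j)" d _ "\<lambda>j. snd (fg j)", OF u this]
      obtain m C where "\<forall>N. \<forall>e\<in>exponents ?k N. \<exists>w\<in>bdeg d (C * N). \<forall>a. (\<Prod>j<n. snd (fg j) a) \<noteq> 0 \<longrightarrow>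
          (\<Prod>l<?k. u l (map (\<lambda>j. fst (fg j) a / snd (fg j) a) [0..<n]) ^ e l) * (\<Prod>j<n. snd (fg j) a) ^ (m * N) = w a"
        by blast
      then have "A R fg m C" unfolding A_def using fg by simp
      then show ?thesis by blast
    qed
    then have "\<forall>R\<in>I. \<exists>fg m C. A R fg m C" by blast
    then obtain fg m C where fgmC0: "\<forall>R\<in>I. A R (fg R) (m R) (C R)" by (simp only: bchoice_iff) blast
    have fgmC: "to_ac (fst (R j) a) = fst (fg R j) (\<lambda>i. to_ac (a i))" "to_ac (snd (R j) a) = snd (fg R j) (\<lambda>i. to_ac (a i))"
      if "R \<in> I" "j < n" "\<forall>i\<ge>d. a i = 0" for R j a
      using fgmC0 that unfolding A_def by simp_all
    have fgmC': "\<exists>w\<in>bdeg d (C R * N). \<forall>a. (\<Prod>j<n. snd (fg R j) a) \<noteq> 0 \<longrightarrow>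
          (\<Prod>l<?k. u l (map (\<lambda>j. fst (fg R j) a / snd (fg R j) a) [0..<n]) ^ e l) * (\<Prod>j<n. snd (fg R j) a) ^ (m R * N) = w a"
      if "R \<in> I" "e \<in> exponents ?k N" for R e N
    proof -
      have "A R (fg R) (m R) (C R)" using fgmC0 that(1) by (rule bspec)
      then show ?thesis unfolding A_def using that(2) by blast
    qed
    define C' where "C' = (\<Sum>R\<in>I. C R)"
    have C': "C R \<le> C'" if "R \<in> I" for R unfolding C'_def using that I(1) by (intro member_le_sum) auto
    \<comment> \<open>Chosen such that card I * (C' N + 1)^d <= card I * ((C' + 1) (N + 1))^d = N (N
      + 1)^d < (N + 1)^(d+1).\<close>
    define N where "N = card I * Suc C' ^ d"
    define J where "J = exponents ?k N"
    define Q where "Q R a = (\<Prod>j<n. snd (fg R j) a)" for R a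
    define y where "y R a = map (\<lambda>j. fst (fg R j) a / snd (fg R j) a) [0..<n]" for R a
    have "\<exists>c. \<forall>a. Q R a \<noteq> 0 \<longrightarrow>
        (\<Prod>l<?k. u l (y R a) ^ e l) * Q R a ^ (m R * N) = (\<Sum>b\<in>exponents d (C' * N). c b * mono_fun d b a)"
      if RI: "R \<in> I" and eJ: "e \<in> J" for R e
    proof -
      obtain w where w: "w \<in> bdeg d (C R * N)" "\<forall>a. Q R a \<noteq> 0 \<longrightarrow> (\<Prod>l<?k. u l (y R a) ^ e l) * Q R a ^ (m R * N) = w a"
        using fgmC'[OF RI, of e N] eJ unfolding J_def Q_def y_def by blast
      have "w \<in> bdeg d (C' * N)" using C'[OF RI] by (intro bdeg_mono[OF w(1)]) simp
      from bdeg_coeffs[OF this] obtain c where "\<forall>a. w a = (\<Sum>b\<in>exponents d (C' * N). c b * mono_fun d b a)" by blast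
      with w(2) show ?thesis by (intro exI[of _ c]) simp
    qed
    then have "\<forall>z\<in>I \<times> J. \<exists>c. \<forall>a. Q (fst z) a \<noteq> 0 \<longrightarrow>
        (\<Prod>l<?k. u l (y (fst z) a) ^ (snd z) l) * Q (fst z) a ^ (m (fst z) * N) = (\<Sum>b\<in>exponents d (C' * N). c b * mono_fun d b a)"
      by auto
    then obtain c where c: "\<forall>z\<in>I \<times> J. \<forall>a. Q (fst z) a \<noteq> 0 \<longrightarrow>
        (\<Prod>l<?k. u l (y (fst z) a) ^ (snd z) l) * Q (fst z) a ^ (m (fst z) * N) = (\<Sum>b\<in>exponents d (C' * N). c z b * mono_fun d b a)"
      by (simp only: bchoice_iff) blast
    have "card (I \<times> exponents d (C' * N)) < card J"
    proof -
      have "card (I \<times> exponents d (C' * N)) = card I * Suc (C' * N) ^ d"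
        by (simp add: card_cartesian_product card_exponents)
      also have "\<dots> \<le> card I * (Suc C' * Suc N) ^ d"
        by (intro mult_left_mono power_mono) auto
      also have "\<dots> = N * Suc N ^ d" by (simp only: N_def power_mult_distrib mult.assoc)
      also have "\<dots> < Suc N * Suc N ^ d" by simp
      also have "\<dots> = card J" by (simp add: J_def card_exponents)
      finally show ?thesis .
    qed
    from homogeneous_system[of "I \<times> exponents d (C' * N)" J "\<lambda>e z. c (fst z, e) (snd z)", OF _ _ this]
    obtain s where s: "\<exists>e\<in>J. s e \<noteq> 0" "\<forall>z\<in>I \<times> exponents d (C' * N). (\<Sum>e\<in>J. s e * c (fst z, e) (snd z)) = 0"
      using I(1) by (auto simp: J_def)
    define F where "F x = (\<Sum>e\<in>J. s e * (\<Prod>l<?k. u l x ^ e l))" for x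
    have F_poly: "F \<in> polynomial_functions n"
      unfolding F_def by (intro polynomial_functions_sum polynomial_functions.mult polynomial_functions.const
          polynomial_functions_prod polynomial_functions_power u) auto
    have F_zero: "F (map to_ac x) = 0" if xX: "x \<in> X" for x
    proof -
      obtain R a where R: "R \<in> I" and a: "\<forall>i\<ge>d. a i = 0" "\<forall>j<n. snd (R j) a \<noteq> 0"
        and x: "x = map (\<lambda>j. fst (R j) a / snd (R j) a) [0..<n]" using X[OF xX] by blast
      let ?a = "\<lambda>i. to_ac (a i)"
      have fgR: "to_ac (fst (R j) a) = fst (fg R j) ?a" "to_ac (snd (R j) a) = snd (fg R j) ?a" if "j < n" for j
        using fgmC[OF R that a(1)] .
      have xy: "map to_ac x = y R ?a" unfolding x y_def using fgR by (auto simp: to_ac_divide)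
      have "snd (fg R j) ?a \<noteq> 0" if "j < n" for j
        using fgR(2)[OF that] a(2) that by (metis to_ac_0 to_ac_eq_iff)
      then have Q0: "Q R ?a \<noteq> 0" by (simp add: Q_def)
      have "F (y R ?a) * Q R ?a ^ (m R * N) = (\<Sum>e\<in>J. s e * ((\<Prod>l<?k. u l (y R ?a) ^ e l) * Q R ?a ^ (m R * N)))"
        unfolding F_def sum_distrib_right by (simp add: mult.assoc)
      also have "\<dots> = (\<Sum>e\<in>J. s e * (\<Sum>b\<in>exponents d (C' * N). c (R, e) b * mono_fun d b ?a))"
      proof (rule sum.cong[OF refl])
        fix e assume "e \<in> J"
        then show "s e * ((\<Prod>l<?k. u l (y R ?a) ^ e l) * Q R ?a ^ (m R * N)) =
            s e * (\<Sum>b\<in>exponents d (C' * N). c (R, e) b * mono_fun d b ?a)"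
          using c[rule_format, of "(R, e)" ?a] R Q0 by simp
      qed
      also have "\<dots> = (\<Sum>b\<in>exponents d (C' * N). (\<Sum>e\<in>J. s e * c (R, e) b) * mono_fun d b ?a)"
        unfolding sum_distrib_left sum_distrib_right by (subst sum.swap) (simp add: mult.assoc)
      also have "\<dots> = 0"
      proof (rule sum.neutral, rule ballI)
        fix b assume "b \<in> exponents d (C' * N)"
        then have "(\<Sum>e\<in>J. s e * c (R, e) b) = 0" using s(2)[rule_format, of "(R, b)"] R by simp
        then show "(\<Sum>e\<in>J. s e * c (R, e) b) * mono_fun d b ?a = 0" by simp
      qed
      finally show ?thesis using Q0 xy by simp
    qed
    define V where "V = {x. length x = n \<and> F x = 0}"
    have "zariski_closed n V"
      unfolding zariski_closed_def V_def using F_poly by (intro exI[of _ "{F}"]) auto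
    moreover have "map to_ac ` X \<subseteq> V"
    proof
      fix z assume "z \<in> map to_ac ` X"
      then obtain x where x: "x \<in> X" "z = map to_ac x" by blast
      moreover have "length x = n" using X[OF x(1)] by auto
      ultimately show "z \<in> V" using F_zero by (simp add: V_def)
    qed
    ultimately have "zariski_closed n hull map to_ac ` X \<subseteq> V" by (intro hull_minimal)
    then have "\<forall>x\<in>Z ?k. F x = 0" using Z1 k unfolding V_def by blast
    then have "\<forall>e\<in>J. s e = 0" using ind unfolding alg_independent_on_def F_def J_def by blast
    then show False using s(1) by blast
  qed
qed

subsection \<open>All levels\<close>

lemma definable_group_length: "definable_group P m M \<Longrightarrow> \<kappa> \<in> M \<Longrightarrow> length \<kappa> = m"
  unfolding definable_group_def definable_def by auto

lemma level_on_rooted: "level_on P d m M T \<Longrightarrow> definable_group P m M \<and> (\<forall>\<kappa>\<in>M. rooted_tree (T \<kappa>))"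
  by (cases d) simp_all

lemma (in modulus) realizable_iso:
  assumes "realizable P q d m M T'" "\<And>\<kappa>. \<kappa> \<in> M \<Longrightarrow> nodes (T' \<kappa>) \<noteq> {} \<Longrightarrow> \<exists>r D. tree_at (T' \<kappa>) r D"
    and "\<And>\<kappa>. \<kappa> \<in> M \<Longrightarrow> T \<kappa> \<cong>\<^sub>T T' \<kappa>" "\<And>\<kappa>. \<kappa> \<in> M \<Longrightarrow> rooted_tree (T \<kappa>)"
  shows "realizable P q d m M T"
proof -
  obtain X where "realizes d m M T' X" using assms(1) unfolding realizable_def by (elim exE)
  from realizes_iso[OF this assms(3,4,2)] show ?thesis unfolding realizable_def by simp
qed

text \<open>Besides the demands of the trees at the leaves, q must be at least the depth of each
  leaf of F.\<close>

lemma side_branch_multiples: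
  assumes side: "side_branch_datum N (level_on P d m N) F U"
    and IH: "\<And>T. level_on P d m N T \<Longrightarrow> for_multiples (\<lambda>q. realizable P q d m N T)"
  shows "for_multiples (\<lambda>q. realizable_branch P q d m N F U)"
proof -
  have F: "rooted_tree F" "finite (nodes F)" "nodes F \<noteq> {}"
    and U: "\<And>w. w \<in> leaves F \<Longrightarrow> level_on P d m N (U w) \<and> (\<forall>\<kappa>\<in>N. nodes (U w \<kappa>) \<noteq> {})"
    using side unfolding side_branch_datum_def by blast+
  have "finite (leaves F)" by (rule finite_subset[OF _ F(2)]) (auto simp: leaves_def)
  then have "for_multiples (\<lambda>q. \<forall>w\<in>leaves F. depth F w \<le> q \<and> realizable P q d m N (U w))"
    by (rule for_multiples_ball) (intro for_multiples_conj for_multiples_ge IH, use U in blast)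
  then show ?thesis
    by (rule for_multiples_mono) (use F U level_on_rooted in \<open>unfold realizable_branch_def, blast\<close>)
qed

lemma bones_lift:
  assumes "level0_datum m M S l"
  shows "for_multiples (\<lambda>q. \<forall>e\<in>child_rel S. (\<exists>\<kappa>\<in>M. l e \<kappa> \<noteq> \<infinity>) \<longrightarrow>
    (\<exists>\<psi> :: int list \<Rightarrow> 'p :: prime_card assignment \<Rightarrow> 'p padic. modulus.lifts q m M (bone_length l e) \<psi>))"
proof (rule for_multiples_ball[OF _ bone_lifts[OF assms]])
  have "child_rel S \<subseteq> nodes S \<times> nodes S" "finite (nodes S)"
    using assms unfolding level0_datum_def rooted_tree_def by blast+
  then show "finite (child_rel S)" using finite_subset by blast
qed

text \<open>Induction for all parameter sets at once, as side branches on bones have one parameter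
  more. Joints, bones, classes and leaves are finite in number, so the demands on q can be
  combined.\<close>

theorem level_realizable: "level_on P d m M T \<Longrightarrow> for_multiples (\<lambda>q. realizable P q d m M T)"
  for P :: "'p :: prime_card itself"
proof (induction d arbitrary: m M T)
  case 0
  then obtain S l where D: "level0_datum m M S l" and iso: "\<And>\<kappa>. \<kappa> \<in> M \<Longrightarrow> T \<kappa> \<cong>\<^sub>T skeleton S (\<lambda>e. l e \<kappa>)"
    by auto
  note T = level_on_rooted[OF 0]
  note len = definable_group_length[OF conjunct1[OF T]]
  from bones_lift[OF D] show ?case
  proof (rule for_multiples_mono)
    fix q :: nat assume q: "q > 0" and lift: "\<forall>e\<in>child_rel S. (\<exists>\<kappa>\<in>M. l e \<kappa> \<noteq> \<infinity>) \<longrightarrow>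
      (\<exists>\<psi> :: int list \<Rightarrow> 'p assignment \<Rightarrow> 'p padic. modulus.lifts q m M (bone_length l e) \<psi>)"
    interpret modulus P q by standard (rule q)
    have *: "realizable P q 0 m M (\<lambda>\<kappa>. skeleton S (\<lambda>e. l e \<kappa>)) \<and>
      (\<forall>\<kappa>\<in>M. nodes (skeleton S (\<lambda>e. l e \<kappa>)) \<noteq> {} \<longrightarrow> (\<exists>r D. tree_at (skeleton S (\<lambda>e. l e \<kappa>)) r D))"
      by (rule realizable_level0[OF len D lift[rule_format]]) auto
    then show "realizable P q 0 m M T"
      by (intro realizable_iso[OF conjunct1[OF *] _ iso]) (use T in blast)+
  qed
next
  case (Suc d)
  note T = level_on_rooted[OF Suc.prems]
  note len = definable_group_length[OF conjunct1[OF T]]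
  from Suc.prems obtain \<rho> S l F U G V where \<rho>: "\<rho> > 0" and D: "level0_datum m M S l"
    and joints: "\<forall>w\<in>(\<Union>\<kappa>\<in>M. real_joints S (\<lambda>e. l e \<kappa>)). side_branch_datum M (level_on P d m M) (F w) (U w)"
    and bones: "\<forall>e\<in>child_rel S. \<forall>\<xi>\<in>{0..<\<rho>}. side_branch_datum (bone_params M \<rho> S l e \<xi>)
             (level_on P d (Suc m) (bone_params M \<rho> S l e \<xi>)) (G e \<xi>) (V e \<xi>)"
    and iso: "\<forall>\<kappa>\<in>M. T \<kappa> \<cong>\<^sub>T branched_tree \<rho> S l
           (\<lambda>w. side_branch P (F w) (U w)) (\<lambda>e \<xi>. side_branch P (G e \<xi>) (V e \<xi>)) \<kappa>"
    unfolding level_on.simps by (elim exE conjE)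
  have fin: "child_rel S \<subseteq> nodes S \<times> nodes S" "finite (nodes S)"
    using D unfolding level0_datum_def rooted_tree_def by blast+
  let ?J = "\<Union>\<kappa>\<in>M. real_joints S (\<lambda>e. l e \<kappa>)"
  have "finite ?J" by (rule finite_subset[OF _ fin(2)]) (auto simp: real_joints_def)
  moreover have "for_multiples (\<lambda>q. realizable_branch P q d m M (F w) (U w))" if "w \<in> ?J" for w
    by (rule side_branch_multiples[OF _ Suc.IH]) (use joints that in blast)
  ultimately have J: "for_multiples (\<lambda>q. \<forall>w\<in>?J. realizable_branch P q d m M (F w) (U w))"
    by (rule for_multiples_ball)
  have B: "for_multiples (\<lambda>q. \<forall>e\<in>child_rel S. \<forall>\<xi>\<in>{0..<\<rho>}.
      realizable_branch P q d (Suc m) (bone_params M \<rho> S l e \<xi>) (G e \<xi>) (V e \<xi>))"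
  proof (intro for_multiples_ball)
    show "finite (child_rel S)" using fin finite_subset by blast
    show "for_multiples (\<lambda>q. realizable_branch P q d (Suc m) (bone_params M \<rho> S l e \<xi>) (G e \<xi>) (V e \<xi>))"
      if "e \<in> child_rel S" "\<xi> \<in> {0..<\<rho>}" for e \<xi>
      by (rule side_branch_multiples[OF _ Suc.IH]) (use bones that in blast)
  qed simp
  have "nat \<rho> > 0" using \<rho> by simp
  from for_multiples_conj[OF bones_lift[where 'p = 'p, OF D] for_multiples_conj[OF for_multiples_dvd[OF this] for_multiples_conj[OF J B]]]
  show ?case
  proof (rule for_multiples_mono, elim conjE)
    fix q :: nat assume q: "q > 0" and lift: "\<forall>e\<in>child_rel S. (\<exists>\<kappa>\<in>M. l e \<kappa> \<noteq> \<infinity>) \<longrightarrow>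
        (\<exists>\<psi> :: int list \<Rightarrow> 'p assignment \<Rightarrow> 'p padic. modulus.lifts q m M (bone_length l e) \<psi>)"
      and \<rho>q: "nat \<rho> dvd q"
      and J: "\<forall>w\<in>?J. realizable_branch P q d m M (F w) (U w)"
      and B: "\<forall>e\<in>child_rel S. \<forall>\<xi>\<in>{0..<\<rho>}. realizable_branch P q d (Suc m) (bone_params M \<rho> S l e \<xi>) (G e \<xi>) (V e \<xi>)"
    interpret modulus P q by standard (rule q)
    have "\<rho> dvd int q" using \<rho> \<rho>q int_dvd_int_iff[of "nat \<rho>" q] by simp
    note * = realizable_branched[OF len D lift[rule_format] \<rho> this, of d F U G V]
    have *: "realizable P q (Suc d) m M (branched_tree \<rho> S l (\<lambda>w. side_branch P (F w) (U w)) (\<lambda>e \<xi>. side_branch P (G e \<xi>) (V e \<xi>))) \<and>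
      (\<forall>\<kappa>\<in>M. nodes (branched_tree \<rho> S l (\<lambda>w. side_branch P (F w) (U w)) (\<lambda>e \<xi>. side_branch P (G e \<xi>) (V e \<xi>)) \<kappa>) \<noteq> {} \<longrightarrow>
       (\<exists>r D. tree_at (branched_tree \<rho> S l (\<lambda>w. side_branch P (F w) (U w)) (\<lambda>e \<xi>. side_branch P (G e \<xi>) (V e \<xi>)) \<kappa>) r D))"
      by (rule *) (use J B in blast)+
    show "realizable P q (Suc d) m M T"
      by (rule realizable_iso[OF conjunct1[OF *]]) (use * T iso in blast)+
  qed
qed

lemma points_of_realization:
  fixes T :: "'a rtree" and X :: "int list \<Rightarrow> 'p :: prime_card assignment \<Rightarrow> ('p point \<times> (nat \<Rightarrow> 'a)) set"
  assumes q: "q > 0" and X: "modulus.realizes q d 0 {[]} (\<lambda>_. T) X"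
    and T: "rooted_tree T" "leaves T = {}"
  shows "\<exists>n (Z :: 'p padic list set). definable_field n Z \<and> dim_le n Z d \<and> ball_tree n Z \<cong>\<^sub>T T"
proof -
  interpret modulus "TYPE('p)" q by standard (rule q)
  \<comment> \<open>The empty tuple is carried by every assignment, so the zero assignment may be
    fixed; the set is then described by the d free entries alone.\<close>
  define a0 :: "'p assignment" where "a0 = (\<lambda>_. 0)"
  have triv: "carries 0 [] a0" "close 0 j a0 a0" "cls 0 \<xi> []" for j \<xi>
    by (simp_all add: carries_def close_def cls_def)
  note x = realizesD[OF X]
  obtain n Ps where Ps: "pieces_ok n Ps" and eq: "\<And>\<kappa> a. \<kappa> \<in> {[]} \<Longrightarrow> cls 0 (\<lambda>_. 0) \<kappa> \<Longrightarrow> carries 0 \<kappa> a \<Longrightarrow> fst ` X \<kappa> a = pts 0 d Ps a"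
    by (rule tameE[OF x(5), of "\<lambda>_. 0"]) blast
  have P: "finite Ps" "\<And>D F. (D, F) \<in> Ps \<Longrightarrow> dfn D" "\<And>D F i. (D, F) \<in> Ps \<Longrightarrow> pw (\<lambda>a. F a i)"
    "\<And>D F a. (D, F) \<in> Ps \<Longrightarrow> zero_from n (F a)"
    using Ps unfolding pieces_ok_def by blast+
  have pts: "fst ` X [] a0 = {F a | D F a. (D, F) \<in> Ps \<and> (\<forall>k\<ge>d. a k = 0) \<and> D a}"
    using eq[of "[]" a0] triv by (auto simp: pts_def agree_def)
  define Y where "Y = (\<lambda>(x, \<beta>). (map x [0..<n], \<beta>)) ` X [] a0"
  have YE: "\<exists>y. (y, \<beta>) \<in> X [] a0 \<and> z = map y [0..<n]" if "(z, \<beta>) \<in> Y" for z \<beta>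
    using that by (auto simp: Y_def)
  have Z: "fst ` Y = {map (snd i a) [0..<n] | i a. i \<in> Ps \<and> (\<forall>k\<ge>d. a k = 0) \<and> fst i a}"
  proof -
    have "fst ` Y = (\<lambda>x. map x [0..<n]) ` fst ` X [] a0" unfolding Y_def by force
    also have "\<dots> = {map (snd i a) [0..<n] | i a. i \<in> Ps \<and> (\<forall>k\<ge>d. a k = 0) \<and> fst i a}" (is "_ = ?R")
      unfolding pts
    proof (intro subset_antisym subsetI)
      fix z assume "z \<in> (\<lambda>x. map x [0..<n]) ` {F a | D F a. (D, F) \<in> Ps \<and> (\<forall>k\<ge>d. a k = 0) \<and> D a}"
      then obtain D F a where "(D, F) \<in> Ps" "\<forall>k\<ge>d. a k = 0" "D a" "z = map (F a) [0..<n]" by blast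
      then show "z \<in> ?R" by (intro CollectI, rule_tac exI[of _ "(D, F)"], rule_tac exI[of _ a]) simp
    next
      fix z assume "z \<in> ?R"
      then obtain i a where i: "i \<in> Ps" "\<forall>k\<ge>d. a k = 0" "fst i a" "z = map (snd i a) [0..<n]" by blast
      moreover have "(fst i, snd i) \<in> Ps" using i(1) by simp
      ultimately show "z \<in> (\<lambda>x. map x [0..<n]) ` {F a | D F a. (D, F) \<in> Ps \<and> (\<forall>k\<ge>d. a k = 0) \<and> D a}" by blast
    qed
    finally show ?thesis .
  qed
  have "definable_field n (fst ` Y)"
    unfolding Z by (rule definable_field_image) (use P in auto)
  moreover have "dim_le n (fst ` Y) d"
  proof -
    \<comment> \<open>A finite set of candidate quotients for each coordinate; an element of
      \<open>I\<close> below picks one candidate per coordinate.\<close>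
    define R where "R f = (SOME R. finite R \<and> (\<forall>(n, d)\<in>R. trm n \<and> trm d) \<and> (\<forall>a. \<exists>(n, d)\<in>R. d a \<noteq> 0 \<and> f a = n a / d a))"
      for f :: "'p assignment \<Rightarrow> 'p padic"
    have R: "finite (R f) \<and> (\<forall>(n, d)\<in>R f. trm n \<and> trm d) \<and> (\<forall>a. \<exists>(n, d)\<in>R f. d a \<noteq> 0 \<and> f a = n a / d a)" if "pw f" for f
      unfolding R_def by (rule someI_ex[OF pw_rational_cases[OF that]])
    define I where "I = (\<Union>i\<in>Ps. PiE {..<n} (\<lambda>j. R (\<lambda>a. snd i a j)))"
    have pwi: "pw (\<lambda>a. snd i a j)" if "i \<in> Ps" for i j using P(3)[of "fst i" "snd i"] that by simp
    show ?thesis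
    proof (rule dim_le_parametrized[of I])
      show "finite I" unfolding I_def using P(1) R[OF pwi] by (intro finite_UN_I finite_PiE) auto
      show "trm (fst (r j)) \<and> trm (snd (r j))" if r: "r \<in> I" "j < n" for r j
      proof -
        obtain i where i: "i \<in> Ps" "r \<in> PiE {..<n} (\<lambda>j. R (\<lambda>a. snd i a j))" using r(1) unfolding I_def by blast
        have "r j \<in> R (\<lambda>a. snd i a j)" using PiE_mem[OF i(2)] r(2) by simp
        then show ?thesis using bspec[OF conjunct1[OF conjunct2[OF R[OF pwi[OF i(1)]]]]] by (simp add: case_prod_beta)
      qed
      fix z assume "z \<in> fst ` Y"
      then obtain i a where i: "i \<in> Ps" "\<forall>k\<ge>d. a k = 0" "z = map (snd i a) [0..<n]" unfolding Z by blast
      have "\<forall>j. \<exists>r. r \<in> R (\<lambda>a. snd i a j) \<and> snd r a \<noteq> 0 \<and> snd i a j = fst r a / snd r a"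
      proof
        fix j
        have "\<exists>r\<in>R (\<lambda>a. snd i a j). snd r a \<noteq> 0 \<and> snd i a j = fst r a / snd r a"
          using spec[OF conjunct2[OF conjunct2[OF R[OF pwi[OF i(1), of j]]]], of a] by (simp add: case_prod_beta)
        then show "\<exists>r. r \<in> R (\<lambda>a. snd i a j) \<and> snd r a \<noteq> 0 \<and> snd i a j = fst r a / snd r a" by blast
      qed
      then obtain r where r: "\<And>j. r j \<in> R (\<lambda>a. snd i a j) \<and> snd (r j) a \<noteq> 0 \<and> snd i a j = fst (r j) a / snd (r j) a"
        by (simp only: choice_iff) blast
      have "restrict r {..<n} \<in> I" unfolding I_def using r i(1) by auto
      moreover have "(\<forall>j<n. snd (restrict r {..<n} j) a \<noteq> 0) \<and>
          z = map (\<lambda>j. fst (restrict r {..<n} j) a / snd (restrict r {..<n} j) a) [0..<n]"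
        using r by (simp add: i(3))
      ultimately show "\<exists>r\<in>I. \<exists>a. (\<forall>i\<ge>d. a i = 0) \<and> (\<forall>j<n. snd (r j) a \<noteq> 0) \<and>
          z = map (\<lambda>j. fst (r j) a / snd (r j) a) [0..<n]"
        using i(2) by blast
    qed
  qed
  moreover have "ball_tree n (fst ` Y) \<cong>\<^sub>T T"
  proof (rule ball_tree_iso[OF T(1)])
    fix z \<beta> assume "(z, \<beta>) \<in> Y"
    then obtain y where y: "(y, \<beta>) \<in> X [] a0" "z = map y [0..<n]" using YE by blast
    have "y i \<in> padic_integers" for i using x(2)[OF _ triv(1) y(1)] by (simp add: pball_0)
    then show "length z = n \<and> set z \<subseteq> padic_integers \<and> ray T \<beta>"
      using x(1)[OF _ triv(1) y(1)] by (auto simp: y(2))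
  next
    fix z \<beta> z' \<beta>' j assume "(z, \<beta>) \<in> Y" "(z', \<beta>') \<in> Y"
    then obtain y y' where y: "(y, \<beta>) \<in> X [] a0" "z = map y [0..<n]" "(y', \<beta>') \<in> X [] a0" "z' = map y' [0..<n]"
      using YE by blast
    have "y \<in> fst ` X [] a0" "y' \<in> fst ` X [] a0" using y by force+
    then have "zero_from n y" "zero_from n y'" using P(4) unfolding pts by blast+
    \<comment> \<open>Cutting off at n loses nothing, since both sequences vanish from there
      on.\<close>
    then have "(\<forall>i<n. z ! i - z' ! i \<in> pball (int j)) \<longleftrightarrow> congr (int j) y y'"
      unfolding congr_def zero_from_def by (auto simp: y) (metis diff_zero not_less zero_in_pball)
    also have "\<dots> \<longleftrightarrow> \<beta> j = \<beta>' j" by (rule x(3)[OF _ triv(1,1,2) y(1,3)]) simp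
    finally show "(\<forall>i<n. z ! i - z' ! i \<in> pball (int j)) \<longleftrightarrow> \<beta> j = \<beta>' j" .
  next
    fix v assume v: "v \<in> nodes T"
    then have "nodes T \<noteq> {}" by blast
    note t = rooted_tree_at[OF T(1) this]
    obtain \<gamma> where \<gamma>: "ray T \<gamma>" "\<gamma> (depth T v) = v" by (rule leafless_ray[OF t T(2) v])
    obtain y \<beta> where "(y, \<beta>) \<in> X [] a0" "\<beta> (depth T v) = \<gamma> (depth T v)"
      using x(4)[OF _ triv(1) \<gamma>(1), of "depth T v"] by blast
    then show "\<exists>(z, \<beta>)\<in>Y. \<exists>j. \<beta> j = v" using \<gamma>(2) unfolding Y_def by force
  qed
  ultimately show ?thesis by blast
qed

theorem theorem1p2:
  fixes d :: nat and T :: "'a rtree"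
  assumes "tree_of_level TYPE('p :: prime_card) d T"
    and "leaves T = {}"
  shows "\<exists>n (X :: 'p padic list set). definable_field n X \<and> dim_le n X d \<and> ball_tree n X \<cong>\<^sub>T T"
proof -
  obtain T' where T: "rooted_tree T" and T': "level_on TYPE('p) d 0 {[]} T'" "T \<cong>\<^sub>T T' []"
    using assms(1) unfolding tree_of_level_def by blast
  from level_realizable[OF T'(1)] obtain q where q: "q > 0" "\<forall>q'>0. q dvd q' \<longrightarrow> realizable TYPE('p) q' d 0 {[]} T'"
    unfolding for_multiples_def by (elim exE conjE)
  have r: "realizable TYPE('p) q d 0 {[]} T'" using q by simp
  interpret modulus "TYPE('p)" q by standard (rule q(1))
  have "realizable TYPE('p) q d 0 {[]} (\<lambda>_. T)"
    by (rule realizable_iso[OF r]) (use T T' level_on_rooted[OF T'(1)] rooted_tree_at in auto)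
  then obtain X :: "int list \<Rightarrow> 'p assignment \<Rightarrow> ('p point \<times> (nat \<Rightarrow> 'a)) set"
    where "realizes d 0 {[]} (\<lambda>_. T) X" unfolding realizable_def by (elim exE)
  then show ?thesis by (rule points_of_realization[OF q(1) _ T assms(2)])
qed

end
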